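(* There exist three positive numerical constants $c,c',c''$ such that the following holds. Let $\mathbf X$ be the adjacency matrix of a stochastic block model as described in the context, with true partition $G=(G_1,\dots,G_K)$ and connection matrix $P$, and let $L$ be such that $|P|_\infty\le L$ and $1/m\le L\le 1/\log(n)$. Let $\alpha\in[K/n,1]$ satisfy $$\frac1m\le\alpha\le\alpha(L):=\frac{K^3}{n}e^{4nL},$$ set $s^2=\Delta^2/L$, and suppose that $s^2\ge c''\,n/m$. Let $\widehat B\in\operatorname{argmax}_{B\in\mathcal C_\alpha}\langle\mathbf X\mathbf X^T,B\rangle$ and let $\widehat G$ be the partition derived from any $7$-approximate $K$-medoids on the rows of $\widehat B$. Then, with probability at least $1-c/n^2$, $$err(\widehat G,G)\le e^{-c's^2}.$$
   Context: Model (stochastic block model). There is an unknown partition $G=(G_1,\dots,G_K)$ of $\{1,\dots,n\}$ into $K$ nonempty groups and a symmetric matrix $P\in[0,1]^{K\times K}$. The adjacency matrix $\mathbf X\in\{0,1\}^{n\times n}$ is symmetric with zero diagonal, its entries below the diagonal are independent, and $\mathbb E[\mathbf X_{ab}]=P_{jk}$ for $a\in G_k$, $b\in G_j$, $a\ne b$. Write $m_k=|G_k|$, $m=\min_km_k$, $|P|_\infty=\max_{j,k}P_{jk}$, and $$\Delta^2=\min_{j\ne k}\Delta_{jk}^2,\qquad\Delta_{jk}^2=\sum_{\ell=1}^Km_\ell(P_{k\ell}-P_{j\ell})^2.$$ For $K/n\le\alpha\le1$, $\mathcal C_\alpha$ is the set of symmetric positive semi-definite $B\in\mathbb R^{n\times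 n}$ with $\operatorname{Tr}(B)=K$, $B\mathbf 1=\mathbf 1$ ($\mathbf 1$ the all-ones vector) and $0\le B_{ab}\le\alpha$ for all $a,b$. $\langle A,B\rangle=\sum_{a,b}A_{ab}B_{ab}$; $|M|_1$ is the sum of the absolute values of the entries of $M$. $7$-approximate $K$-medoids. Let $\mathcal A_K$ be the set of matrices $A\in\{0,1\}^{n\times K}$ with $A_{ik}=1$ if $i\in G'_k$ and $0$ otherwise, for some partition $(G'_1,\dots,G'_K)$ of $\{1,\dots,n\}$ into $K$ nonempty groups. A $7$-approximate $K$-medoids on the rows of $\widehat B$ is a pair $(\widehat A,\widehat M)$ with $\widehat A\in\mathcal A_K$, $\widehat M\in\mathbb R^{K\times n}$, every row of $\widehat M$ being a row of $\widehat B$, and $|\widehat A\widehat M-\widehat B|_1\le7\min|AM-\widehat B|_1$, the minimum being over $A\in\mathcal A_K$ and $M\in\mathbb R^{K\times n}$ all of whose rows are rows of $\widehat B$. The derived partition is $\widehat G_k=\{i:\widehat A_{ik}=1\}$, $k=1,\dots,K$. Misclassification proportion: $err(\widehat G,G)=\min_{\pi}\frac1{2n}\sum_{k=1}^K|G_k\bigtriangleup\widehat G_{\pi(k)}|$, the minimum being over permutations $\pi$ of $\{1,\dots,K\}$ and $\bigtriangleup$ denoting symmetric difference. *)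

theory Defs
  imports
    "HOL-Probability.Probability"
    "HOL-Combinatorics.Permutations"
    "Jordan_Normal_Form.Matrix"
begin

(* Matrix and vector notation is that of Jordan_Normal_Form. *)
unbundle no vec_syntax
unbundle no inner_syntax

text \<open>Throughout, nodes are \<open>0, \<dots>, n - 1\<close> and groups are \<open>0, \<dots>, K - 1\<close>;
  only the values \<open>G k\<close> with \<open>k < K\<close> matter.\<close>

definition is_partition :: "nat \<Rightarrow> nat \<Rightarrow> (nat \<Rightarrow> nat set) \<Rightarrow> bool" where
  "is_partition n K G \<longleftrightarrow>
     (\<Union>k<K. G k) = {..<n} \<and> disjoint_family_on G {..<K} \<and> (\<forall>k<K. G k \<noteq> {})"

text \<open>\<open>Q\<close> is the law of the adjacency matrix; being the law of a finitely valued random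
  matrix it is a \<open>pmf\<close>.\<close>

definition stochastic_block_model ::
  "nat \<Rightarrow> nat \<Rightarrow> (nat \<Rightarrow> nat set) \<Rightarrow> real mat \<Rightarrow> real mat pmf \<Rightarrow> bool" where
  "stochastic_block_model n K G P Q \<longleftrightarrow>
     1 \<le> K \<and> is_partition n K G \<and>
     P \<in> carrier_mat K K \<and> transpose_mat P = P \<and>
     (\<forall>j<K. \<forall>k<K. 0 \<le> P $$ (j, k) \<and> P $$ (j, k) \<le> 1) \<and>
     (\<forall>X \<in> set_pmf Q. X \<in> carrier_mat n n \<and> transpose_mat X = X \<and>
        (\<forall>a<n. X $$ (a, a) = 0) \<and> (\<forall>a<n. \<forall>b<n. X $$ (a, b) \<in> {0, 1})) \<and>
     prob_space.indep_vars (measure_pmf Q) (\<lambda>_. borel) (\<lambda>(a, b) X. X $$ (a, b))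
       {(a, b). b < a \<and> a < n} \<and>
     (\<forall>j<K. \<forall>k<K. \<forall>a \<in> G k. \<forall>b \<in> G j. a \<noteq> b \<longrightarrow>
        measure_pmf.expectation Q (\<lambda>X. X $$ (a, b)) = P $$ (j, k))"

definition min_size :: "nat \<Rightarrow> (nat \<Rightarrow> nat set) \<Rightarrow> nat" where
  "min_size K G = (MIN k\<in>{..<K}. card (G k))"

definition max_entry :: "nat \<Rightarrow> real mat \<Rightarrow> real" where
  "max_entry K P = Max {P $$ (j, k) | j k. j < K \<and> k < K}"

definition separation_sq :: "nat \<Rightarrow> (nat \<Rightarrow> nat set) \<Rightarrow> real mat \<Rightarrow> nat \<Rightarrow> nat \<Rightarrow> real" where
  "separation_sq K G P j k = (\<Sum>l<K. real (card (G l)) * (P $$ (k, l) - P $$ (j, l))\<^sup>2)"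

text \<open>For \<open>K = 1\<close> the minimum is over the empty set and its value is unspecified; then the
  only partition is the trivial one and every misclassification proportion is \<open>0\<close>.\<close>

definition min_separation_sq :: "nat \<Rightarrow> (nat \<Rightarrow> nat set) \<Rightarrow> real mat \<Rightarrow> real" where
  "min_separation_sq K G P = Min {separation_sq K G P j k | j k. j < K \<and> k < K \<and> j \<noteq> k}"

definition mat_inner :: "nat \<Rightarrow> real mat \<Rightarrow> real mat \<Rightarrow> real" where
  "mat_inner n A B = (\<Sum>a<n. \<Sum>b<n. A $$ (a, b) * B $$ (a, b))"

definition l1_norm :: "real mat \<Rightarrow> real" where
  "l1_norm M = (\<Sum>i<dim_row M. \<Sum>j<dim_col M. \<bar>M $$ (i, j)\<bar>)"

definition pos_semidef :: "nat \<Rightarrow> real mat \<Rightarrow> bool" where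
  "pos_semidef n B \<longleftrightarrow> (\<forall>v \<in> carrier_vec n. 0 \<le> v \<bullet> (B *\<^sub>v v))"

definition ones_vec :: "nat \<Rightarrow> real vec" where
  "ones_vec n = vec n (\<lambda>_. 1)"

definition C_set :: "nat \<Rightarrow> nat \<Rightarrow> real \<Rightarrow> real mat set" where
  "C_set n K \<alpha> = {B \<in> carrier_mat n n.
     transpose_mat B = B \<and> pos_semidef n B \<and>
     (\<Sum>a<n. B $$ (a, a)) = real K \<and>
     B *\<^sub>v ones_vec n = ones_vec n \<and>
     (\<forall>a<n. \<forall>b<n. 0 \<le> B $$ (a, b) \<and> B $$ (a, b) \<le> \<alpha>)}"

definition membership_mats :: "nat \<Rightarrow> nat \<Rightarrow> real mat set" where
  "membership_mats n K =
     {mat n K (\<lambda>(i, k). if i \<in> G' k then 1 else 0) | G'. is_partition n K G'}"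

definition row_selections :: "nat \<Rightarrow> nat \<Rightarrow> real mat \<Rightarrow> real mat set" where
  "row_selections n K B = {M \<in> carrier_mat K n. \<forall>k<K. \<exists>i<n. row M k = row B i}"

definition approx_medoids ::
  "real \<Rightarrow> nat \<Rightarrow> nat \<Rightarrow> real mat \<Rightarrow> real mat \<Rightarrow> real mat \<Rightarrow> bool" where
  "approx_medoids \<rho> n K B A' M' \<longleftrightarrow>
     A' \<in> membership_mats n K \<and> M' \<in> row_selections n K B \<and>
     l1_norm (A' * M' - B) \<le>
       \<rho> * Min {l1_norm (A * M - B) | A M. A \<in> membership_mats n K \<and> M \<in> row_selections n K B}"

lemma finite_membership_mats: "finite (membership_mats n K)"
proof -
  have "membership_mats n K \<subseteq>
      (\<lambda>S. mat n K (\<lambda>ik. if ik \<in> S then 1 else 0)) ` Pow ({..<n} \<times> {..<K})"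
  proof
    fix A assume "A \<in> membership_mats n K"
    then obtain G' where "A = mat n K (\<lambda>(i, k). if i \<in> G' k then 1 else 0)"
      by (auto simp: membership_mats_def)
    then have "A = mat n K (\<lambda>ik. if ik \<in> {(i, k). i < n \<and> k < K \<and> i \<in> G' k} then 1 else 0)"
      by (auto intro!: eq_matI)
    then show "A \<in> (\<lambda>S. mat n K (\<lambda>ik. if ik \<in> S then 1 else 0)) ` Pow ({..<n} \<times> {..<K})"
      by (rule image_eqI) auto
  qed
  then show ?thesis
    by (rule finite_subset) auto
qed

lemma finite_row_selections: "finite (row_selections n K B)"
proof -
  have "row_selections n K B \<subseteq>
      mat_of_rows n ` {rs. set rs \<subseteq> row B ` {..<n} \<and> length rs = K}"
  proof
    fix M assume M: "M \<in> row_selections n K B"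
    then have "M = mat_of_rows n (rows M)"
      by (auto simp: row_selections_def)
    moreover have "set (rows M) \<subseteq> row B ` {..<n}" "length (rows M) = K"
      using M by (auto simp: row_selections_def rows_def)
    ultimately show "M \<in> mat_of_rows n ` {rs. set rs \<subseteq> row B ` {..<n} \<and> length rs = K}"
      by blast
  qed
  then show ?thesis
    by (rule finite_subset) (auto intro: finite_lists_length_eq)
qed

lemma finite_medoid_costs:
  "finite {l1_norm (A * M - B) | A M. A \<in> membership_mats n K \<and> M \<in> row_selections n K B}"
proof -
  have "{l1_norm (A * M - B) | A M. A \<in> membership_mats n K \<and> M \<in> row_selections n K B} =
      (\<lambda>(A, M). l1_norm (A * M - B)) ` (membership_mats n K \<times> row_selections n K B)"
    by auto
  then show ?thesis
    by (simp add: finite_membership_mats finite_row_selections)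
qed

definition derived_partition :: "nat \<Rightarrow> real mat \<Rightarrow> nat \<Rightarrow> nat set" where
  "derived_partition n A k = {i. i < n \<and> A $$ (i, k) = 1}"

definition misclass_error :: "nat \<Rightarrow> nat \<Rightarrow> (nat \<Rightarrow> nat set) \<Rightarrow> (nat \<Rightarrow> nat set) \<Rightarrow> real" where
  "misclass_error n K G' G =
     (MIN \<pi>\<in>{\<pi>. \<pi> permutes {..<K}}.
        1 / (2 * real n) * (\<Sum>k<K. real (card (sym_diff (G k) (G' (\<pi> k))))))"

end

theory Submission
  imports Defs
begin

text \<open>Let \<open>Bst\<close> be the normalised membership matrix of the true partition. It is feasible, so the
  optimality of \<open>B\<close> gives \<open>\<langle>XX\<^sup>T, Bst - B\<rangle> \<le> 0\<close>. Around the mean of \<open>X\<close> this inner product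
  splits into a signal, at least \<open>\<Delta>\<^sup>2\<close> times the mass \<open>off\<close> that \<open>B\<close> puts outside the diagonal blocks,
  a linear noise term and a quadratic noise term. The linear term is controlled row by row, its
  positive part being exponentially small in \<open>s\<^sup>2\<close> for all but few rows. In the quadratic term the
  component \<open>(I - Bst) B (I - Bst)\<close> of \<open>B\<close> is positive semidefinite with trace at most of the order of
  \<open>off / m\<close>, which is paired with the operator norm \<open>O(\<surd>(nL))\<close> of the noise restricted to nodes of
  moderate degree (Feige and Ofek's light and heavy pairs argument); the nodes of large degree
  contribute at most \<open>\<alpha> n exp (-7 n L)\<close>, which the assumption \<open>\<alpha> \<le> \<alpha>(L)\<close> makes negligible. The
  remaining component averages the noise over a group, and the rows where this average is large are
  again exponentially few. Hence \<open>off\<close> is at most \<open>n exp (-c s\<^sup>2)\<close>; this bounds the \<open>l\<^sub>1\<close> distance of \<open>B\<close>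
  to \<open>Bst\<close>, and since two rows of \<open>Bst\<close> from different groups are at \<open>l\<^sub>1\<close> distance 2, approximate medoids
  can only misclassify the few rows at distance at least 1 from their own row of \<open>Bst\<close>.\<close>

text \<open>The obstacle is sparsity: \<open>d = n L\<close> may be far below ln n, so degrees do
  not concentrate and single rows fail with non-negligible probability. Only the number of failing
  rows can be controlled, and doing so with probability 1 - O(n^-2) needs joint bounds for up to
  order ln n rows at once. For the quadratic term these rows share edges; conditioning on part of
  the edges makes the chaos linear, at the price of a cap on the number of neighbours in the chosen
  set of rows. Once s2 exceeds a multiple of ln n, a union bound shows that no row fails. Two
  relations tie the parameters together: s2 \<le> d, as the entries of P lie in [0, L], and K \<le>
  n / m \<le> s2, so that powers of K and of n / m disappear in exponentials of s2. The exponent is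
  halved twice: \<open>rate\<close> / 8 for the proportion of failing rows, \<open>rate\<close> / 16
  for \<open>off\<close>, where the bad rows enter under a square root, and \<open>rate\<close> / 32
  after the polynomial factors are absorbed. Probabilities are finite weighted sums over edge sets;
  the law of the matrix enters only at the end.\<close>

section \<open>Expectations over independent Bernoulli variables\<close>

definition bern :: "'e set \<Rightarrow> ('e \<Rightarrow> real) \<Rightarrow> ('e set \<Rightarrow> real) \<Rightarrow> real" where
  "bern I p F = (\<Sum>A\<in>Pow I. ((\<Prod>e\<in>A. p e) * (\<Prod>e\<in>I-A. 1 - p e)) * F A)"

lemma bern_cong: "(\<And>A. A \<subseteq> I \<Longrightarrow> F A = F' A) \<Longrightarrow> bern I p F = bern I p F'"
  unfolding bern_def by (rule sum.cong) auto

lemma bern_sum: "bern I p (\<lambda>A. \<Sum>j\<in>J. F j A) = (\<Sum>j\<in>J. bern I p (F j))"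
  unfolding bern_def sum_distrib_left by (rule sum.swap)

lemma bern_add: "bern I p (\<lambda>A. F A + F' A) = bern I p F + bern I p F'"
  unfolding bern_def by (simp add: distrib_left sum.distrib)

lemma bern_cmult: "bern I p (\<lambda>A. c * F A) = c * bern I p F"
  unfolding bern_def by (simp add: sum_distrib_left mult_ac)

lemma bern_mono:
  assumes "\<And>e. e \<in> I \<Longrightarrow> 0 \<le> p e \<and> p e \<le> 1" "\<And>A. A \<subseteq> I \<Longrightarrow> F A \<le> F' A"
  shows "bern I p F \<le> bern I p F'"
  unfolding bern_def
  by (intro sum_mono mult_left_mono mult_nonneg_nonneg prod_nonneg) (use assms in auto)

text \<open>Multiplying out the product over e gives one summand per subset of \<open>I\<close>.
  This is where independence enters; the moment generating functions below reduce to it.\<close>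

lemma bern_prod:
  assumes "finite I"
  shows "bern I p (\<lambda>A. (\<Prod>e\<in>A. h1 e) * (\<Prod>e\<in>I-A. h0 e)) = (\<Prod>e\<in>I. p e * h1 e + (1 - p e) * h0 e)"
  unfolding bern_def using assms by (simp add: prod_add prod.distrib mult_ac)

lemma bern_const: "finite I \<Longrightarrow> bern I p (\<lambda>A. c) = c"
  using bern_prod[of I p "\<lambda>_. 1" "\<lambda>_. 1"] bern_cmult[of I p c "\<lambda>_. 1"] by simp

text \<open>Fubini: the weight of a subset factorises over the two disjoint parts. It allows one
  block of edges to be integrated out while the others are fixed.\<close>

lemma bern_union:
  assumes "finite I0" "finite I1" "I0 \<inter> I1 = {}"
  shows "bern (I0 \<union> I1) p F = bern I1 p (\<lambda>B. bern I0 p (\<lambda>A. F (A \<union> B)))"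
proof -
  have bij: "bij_betw (\<lambda>(B, A). A \<union> B) (Pow I1 \<times> Pow I0) (Pow (I0 \<union> I1))"
    by (rule bij_betw_byWitness[where f' = "\<lambda>C. (C \<inter> I1, C \<inter> I0)"]) (use assms in auto)
  have w: "(\<Prod>e\<in>A \<union> B. p e) * (\<Prod>e\<in>I0 \<union> I1 - (A \<union> B). 1 - p e) =
      ((\<Prod>e\<in>B. p e) * (\<Prod>e\<in>I1 - B. 1 - p e)) * ((\<Prod>e\<in>A. p e) * (\<Prod>e\<in>I0 - A. 1 - p e))"
    if "B \<subseteq> I1" "A \<subseteq> I0" for A B
  proof -
    have "I0 \<union> I1 - (A \<union> B) = (I0 - A) \<union> (I1 - B)" using that assms by auto
    moreover have "(\<Prod>e\<in>A \<union> B. p e) = (\<Prod>e\<in>A. p e) * (\<Prod>e\<in>B. p e)"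
      by (rule prod.union_disjoint) (use that assms finite_subset in auto)
    moreover have "(\<Prod>e\<in>(I0 - A) \<union> (I1 - B). 1 - p e) = (\<Prod>e\<in>I0 - A. 1 - p e) * (\<Prod>e\<in>I1 - B. 1 - p e)"
      by (rule prod.union_disjoint) (use that assms in auto)
    ultimately show ?thesis by (simp add: mult_ac)
  qed
  show ?thesis
    unfolding bern_def
    by (subst sum.reindex_bij_betw[OF bij, symmetric])
      (auto simp: sum.cartesian_product sum_distrib_left w mult_ac intro!: sum.cong)
qed

lemma exp_le_1_plus_sq:
  fixes x :: real assumes "\<bar>x\<bar> \<le> 1" shows "exp x \<le> 1 + x + x\<^sup>2"
proof (cases "x \<ge> 0")
  case True then show ?thesis using exp_bound[of x] assms by auto
next
  case False
  define y where "y = - x"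
  have y: "0 \<le> y" "y \<le> 1" using False assms by (auto simp: y_def)
  \<comment> \<open>The claim exp (- y) \<le> 1 - y + y^2 is multiplied by exp y; already the
    quadratic Taylor polynomial of exp y suffices.\<close>
  have "1 \<le> (1 - y + y\<^sup>2) * (1 + y + y\<^sup>2 / 2)"
  proof -
    have "(1 - y + y\<^sup>2) * (1 + y + y\<^sup>2 / 2) = 1 + y\<^sup>2 / 2 + y^3 / 2 + y^4 / 2"
      by (simp add: field_simps power2_eq_square power3_eq_cube power4_eq_xxxx)
    then show ?thesis using y by simp
  qed
  also have "\<dots> \<le> (1 - y + y\<^sup>2) * exp y"
  proof (rule mult_left_mono)
    show "1 + y + y\<^sup>2 / 2 \<le> exp y" using exp_lower_Taylor_quadratic[of y] y by simp
    show "0 \<le> 1 - y + y\<^sup>2" using y by simp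
  qed
  finally have "exp (- y) \<le> 1 - y + y\<^sup>2" 
    by (simp add: exp_minus field_simps)
  then show ?thesis by (simp add: y_def)
qed

text \<open>For |c| \<le> 1 the bound exp c \<le> 1 + c + c^2 cancels the mean, so that an edge
  contributes at most p c^2 to the logarithm of the moment. The exponent therefore carries the
  sparsity \<open>L\<close>; in exchange every later multiplier has to keep the coefficients below
  1.\<close>

lemma bern_exp_centered:
  assumes "finite J" "\<And>e. e \<in> J \<Longrightarrow> 0 \<le> p e \<and> p e \<le> 1 \<and> p e \<le> L" "\<And>e. e \<in> J \<Longrightarrow> \<bar>c e\<bar> \<le> 1"
  shows "bern J p (\<lambda>A. exp (\<Sum>e\<in>J. c e * (of_bool (e \<in> A) - p e))) \<le> exp (L * (\<Sum>e\<in>J. (c e)\<^sup>2))"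
proof -
  have "bern J p (\<lambda>A. exp (\<Sum>e\<in>J. c e * (of_bool (e \<in> A) - p e))) =
     bern J p (\<lambda>A. (\<Prod>e\<in>A. exp (c e * (1 - p e))) * (\<Prod>e\<in>J-A. exp (- c e * p e)))"
  proof (rule bern_cong)
    fix A assume A: "A \<subseteq> J"
    have "(\<Sum>e\<in>J. c e * (of_bool (e \<in> A) - p e)) = (\<Sum>e\<in>A. c e * (of_bool (e \<in> A) - p e)) + (\<Sum>e\<in>J-A. c e * (of_bool (e \<in> A) - p e))"
      using sum.subset_diff[OF A assms(1), of "\<lambda>e. c e * (of_bool (e \<in> A) - p e)"] by simp
    also have "\<dots> = (\<Sum>e\<in>A. c e * (1 - p e)) + (\<Sum>e\<in>J-A. - c e * p e)"
      by (intro arg_cong2[of _ _ _ _ "(+)"] sum.cong) auto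
    finally show "exp (\<Sum>e\<in>J. c e * (of_bool (e \<in> A) - p e)) = (\<Prod>e\<in>A. exp (c e * (1 - p e))) * (\<Prod>e\<in>J-A. exp (- c e * p e))"
      using assms(1) A by (simp add: exp_add exp_sum finite_subset)
  qed
  also have "\<dots> = (\<Prod>e\<in>J. p e * exp (c e * (1 - p e)) + (1 - p e) * exp (- c e * p e))"
    by (rule bern_prod[OF assms(1)])
  also have "\<dots> \<le> (\<Prod>e\<in>J. exp (L * (c e)\<^sup>2))"
  proof (rule prod_mono)
    fix e assume e: "e \<in> J"
    have "p e * exp (c e * (1 - p e)) + (1 - p e) * exp (- c e * p e) = exp (- c e * p e) * (1 + p e * (exp (c e) - 1))"
      by (simp add: algebra_simps exp_diff exp_minus field_simps)
    also have "\<dots> \<le> exp (- c e * p e) * exp (p e * (exp (c e) - 1))"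
      by (intro mult_left_mono) auto
    also have "\<dots> \<le> exp (- c e * p e) * exp (p e * (c e + (c e)\<^sup>2))"
      using assms(2,3)[OF e] exp_le_1_plus_sq[of "c e"] by (intro mult_left_mono) (auto intro!: mult_left_mono)
    also have "\<dots> = exp (p e * (c e)\<^sup>2)" by (simp add: exp_add[symmetric] algebra_simps)
    also have "\<dots> \<le> exp (L * (c e)\<^sup>2)" using assms(2)[OF e] by (auto intro!: mult_right_mono)
    finally show "0 \<le> p e * exp (c e * (1 - p e)) + (1 - p e) * exp (- c e * p e) \<and>
      p e * exp (c e * (1 - p e)) + (1 - p e) * exp (- c e * p e) \<le> exp (L * (c e)\<^sup>2)"
      using assms(2)[OF e] by auto
  qed
  also have "\<dots> = exp (L * (\<Sum>e\<in>J. (c e)\<^sup>2))" using assms(1) by (simp add: exp_sum sum_distrib_left)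
  finally show ?thesis .
qed

text \<open>Poisson-type bound, without centring and without a restriction on the size of c. It
  serves discrepancies and neighbour counts, where the multiplier may be large.\<close>

lemma bern_exp_pos:
  assumes "finite J" "\<And>e. e \<in> J \<Longrightarrow> 0 \<le> p e \<and> p e \<le> 1 \<and> p e \<le> L" "\<And>e. e \<in> J \<Longrightarrow> 0 \<le> c e"
  shows "bern J p (\<lambda>A. exp (\<Sum>e\<in>J. c e * of_bool (e \<in> A))) \<le> exp (L * (\<Sum>e\<in>J. exp (c e) - 1))"
proof -
  have "bern J p (\<lambda>A. exp (\<Sum>e\<in>J. c e * of_bool (e \<in> A))) =
     bern J p (\<lambda>A. (\<Prod>e\<in>A. exp (c e)) * (\<Prod>e\<in>J-A. 1))"
  proof (rule bern_cong)
    fix A assume A: "A \<subseteq> J"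
    have "(\<Sum>e\<in>J. c e * of_bool (e \<in> A)) = (\<Sum>e\<in>A. c e)"
      using A assms(1) by (simp add: sum.inter_restrict[symmetric] Int_absorb1 of_bool_def if_distrib cong: if_cong)
    then show "exp (\<Sum>e\<in>J. c e * of_bool (e \<in> A)) = (\<Prod>e\<in>A. exp (c e)) * (\<Prod>e\<in>J-A. 1)"
      using assms(1) A by (simp add: exp_sum finite_subset)
  qed
  also have "\<dots> = (\<Prod>e\<in>J. p e * exp (c e) + (1 - p e) * 1)"
    by (rule bern_prod[OF assms(1)])
  also have "\<dots> \<le> (\<Prod>e\<in>J. exp (L * (exp (c e) - 1)))"
  proof (rule prod_mono)
    fix e assume e: "e \<in> J"
    have "p e * exp (c e) + (1 - p e) * 1 = 1 + p e * (exp (c e) - 1)" by (simp add: algebra_simps)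
    also have "\<dots> \<le> exp (p e * (exp (c e) - 1))" by simp
    also have "\<dots> \<le> exp (L * (exp (c e) - 1))" using assms(2,3)[OF e] by (auto intro!: mult_right_mono)
    finally show "0 \<le> p e * exp (c e) + (1 - p e) * 1 \<and> p e * exp (c e) + (1 - p e) * 1 \<le> exp (L * (exp (c e) - 1))"
      using assms(2)[OF e] by auto
  qed
  also have "\<dots> = exp (L * (\<Sum>e\<in>J. exp (c e) - 1))" using assms(1) by (simp add: exp_sum sum_distrib_left)
  finally show ?thesis .
qed

text \<open>Conditionally on the part of the random set outside \<open>J\<close>, the coefficients are constants.\<close>
lemma bern_exp_conditional:
  assumes "finite I" "J \<subseteq> I" "\<And>e. e \<in> I \<Longrightarrow> 0 \<le> p e \<and> p e \<le> 1 \<and> p e \<le> L"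
    and "\<And>A e. A \<subseteq> I \<Longrightarrow> e \<in> J \<Longrightarrow> c e (A - J) = c e A" "\<And>A. A \<subseteq> I \<Longrightarrow> \<Phi> (A - J) = \<Phi> A"
    and "\<And>A e. A \<subseteq> I \<Longrightarrow> e \<in> J \<Longrightarrow> \<Phi> A \<Longrightarrow> \<bar>c e A\<bar> \<le> 1"
  shows "bern I p (\<lambda>A. of_bool (\<Phi> A) * exp (\<Sum>e\<in>J. c e A * (of_bool (e \<in> A) - p e)))
    \<le> bern I p (\<lambda>A. of_bool (\<Phi> A) * exp (L * (\<Sum>e\<in>J. (c e A)\<^sup>2)))"
proof -
  have fin: "finite J" "finite (I - J)" using assms finite_subset by auto
  have I: "I = J \<union> (I - J)" using assms by auto
  have AB: "c e (A \<union> B) = c e B" "\<Phi> (A \<union> B) = \<Phi> B" if "A \<subseteq> J" "B \<subseteq> I - J" "e \<in> J" for A B e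
  proof -
    have "A \<union> B - J = B - J" "A \<union> B \<subseteq> I" "B \<subseteq> I" using that assms by auto
    then show "c e (A \<union> B) = c e B" "\<Phi> (A \<union> B) = \<Phi> B" 
      using assms(4)[of "A \<union> B" e] assms(4)[of B e] assms(5)[of "A \<union> B"] assms(5)[of B] that by auto
  qed
  have AB2: "\<Phi> (A \<union> B) = \<Phi> B" if "A \<subseteq> J" "B \<subseteq> I - J" for A B
  proof -
    have "A \<union> B - J = B - J" "A \<union> B \<subseteq> I" "B \<subseteq> I" using that assms by auto
    then show "\<Phi> (A \<union> B) = \<Phi> B" 
      using assms(5)[of "A \<union> B"] assms(5)[of B] that by auto
  qed
  have "bern (J \<union> (I - J)) p (\<lambda>A. of_bool (\<Phi> A) * exp (\<Sum>e\<in>J. c e A * (of_bool (e \<in> A) - p e)))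
    = bern (I - J) p (\<lambda>B. of_bool (\<Phi> B) * bern J p (\<lambda>A. exp (\<Sum>e\<in>J. c e B * (of_bool (e \<in> A) - p e))))"
    unfolding bern_union[OF fin Diff_disjoint]
  proof (rule bern_cong)
    fix B assume B: "B \<subseteq> I - J"
    show "bern J p (\<lambda>A. of_bool (\<Phi> (A \<union> B)) * exp (\<Sum>e\<in>J. c e (A \<union> B) * (of_bool (e \<in> A \<union> B) - p e)))
      = of_bool (\<Phi> B) * bern J p (\<lambda>A. exp (\<Sum>e\<in>J. c e B * (of_bool (e \<in> A) - p e)))"
      unfolding bern_cmult[symmetric]
    proof (rule bern_cong)
      fix A assume A: "A \<subseteq> J"
      have "(\<Sum>e\<in>J. c e (A \<union> B) * (of_bool (e \<in> A \<union> B) - p e)) = (\<Sum>e\<in>J. c e B * (of_bool (e \<in> A) - p e))"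
        by (rule sum.cong) (use AB[OF A B] B in auto)
      then show "of_bool (\<Phi> (A \<union> B)) * exp (\<Sum>e\<in>J. c e (A \<union> B) * (of_bool (e \<in> A \<union> B) - p e))
        = of_bool (\<Phi> B) * exp (\<Sum>e\<in>J. c e B * (of_bool (e \<in> A) - p e))" using AB2[OF A B] by simp
    qed
  qed
  also have "\<dots> \<le> bern (I - J) p (\<lambda>B. bern J p (\<lambda>A. of_bool (\<Phi> (A \<union> B)) * exp (L * (\<Sum>e\<in>J. (c e (A \<union> B))\<^sup>2))))"
  proof (rule bern_mono)
    show "\<And>e. e \<in> I - J \<Longrightarrow> 0 \<le> p e \<and> p e \<le> 1" using assms by auto
    fix B assume B: "B \<subseteq> I - J"
    have "bern J p (\<lambda>A. of_bool (\<Phi> (A \<union> B)) * exp (L * (\<Sum>e\<in>J. (c e (A \<union> B))\<^sup>2)))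
      = bern J p (\<lambda>A. of_bool (\<Phi> B) * exp (L * (\<Sum>e\<in>J. (c e B)\<^sup>2)))"
      by (rule bern_cong) (use AB[OF _ B] AB2[OF _ B] in auto)
    also have "\<dots> = of_bool (\<Phi> B) * exp (L * (\<Sum>e\<in>J. (c e B)\<^sup>2))" by (rule bern_const[OF fin(1)])
    moreover have "bern J p (\<lambda>A. exp (\<Sum>e\<in>J. c e B * (of_bool (e \<in> A) - p e))) \<le> exp (L * (\<Sum>e\<in>J. (c e B)\<^sup>2))" if "\<Phi> B"
      by (rule bern_exp_centered[OF fin(1)]) (use assms(2,3) assms(6)[of B] B that in auto)
    ultimately show "of_bool (\<Phi> B) * bern J p (\<lambda>A. exp (\<Sum>e\<in>J. c e B * (of_bool (e \<in> A) - p e)))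
      \<le> bern J p (\<lambda>A. of_bool (\<Phi> (A \<union> B)) * exp (L * (\<Sum>e\<in>J. (c e (A \<union> B))\<^sup>2)))" by auto
  qed
  also have "\<dots> = bern (J \<union> (I - J)) p (\<lambda>A. of_bool (\<Phi> A) * exp (L * (\<Sum>e\<in>J. (c e A)\<^sup>2)))"
    unfolding bern_union[OF fin Diff_disjoint] ..
  finally show ?thesis using I by simp
qed

subsection \<open>Probabilities\<close>

definition bprob :: "'e set \<Rightarrow> ('e \<Rightarrow> real) \<Rightarrow> ('e set \<Rightarrow> bool) \<Rightarrow> real" where
  "bprob I p \<Phi> = bern I p (\<lambda>A. of_bool (\<Phi> A))"

context
  fixes I :: "'e set" and p :: "'e \<Rightarrow> real"
  assumes I: "finite I" and p: "\<forall>e\<in>I. 0 \<le> p e \<and> p e \<le> 1"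
begin

lemma bprob_mono: "(\<And>A. A \<subseteq> I \<Longrightarrow> \<Phi> A \<Longrightarrow> \<Psi> A) \<Longrightarrow> bprob I p \<Phi> \<le> bprob I p \<Psi>"
  unfolding bprob_def by (rule bern_mono) (use p in auto)

lemma bprob_or: "bprob I p (\<lambda>A. \<Phi> A \<or> \<Psi> A) \<le> bprob I p \<Phi> + bprob I p \<Psi>"
  unfolding bprob_def bern_add[symmetric] by (rule bern_mono) (use p in auto)

lemma bprob_Ex:
  assumes "finite J" shows "bprob I p (\<lambda>A. \<exists>j\<in>J. \<Phi> j A) \<le> (\<Sum>j\<in>J. bprob I p (\<Phi> j))"
  unfolding bprob_def bern_sum[symmetric]
proof (rule bern_mono)
  fix A assume "A \<subseteq> I"
  show "of_bool (\<exists>j\<in>J. \<Phi> j A) \<le> (\<Sum>j\<in>J. of_bool (\<Phi> j A) :: real)"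
  proof (cases "\<exists>j\<in>J. \<Phi> j A")
    case True
    then obtain j where "j \<in> J" "\<Phi> j A" by auto
    then show ?thesis using member_le_sum[of j J "\<lambda>j. of_bool (\<Phi> j A) :: real"] assms by auto
  qed (simp add: sum_nonneg)
qed (use p in auto)

text \<open>The event \<Phi> stays inside the moment, because some moments below are bounded only
  under a cap on neighbour counts.\<close>

lemma bprob_exp_Markov:
  assumes "bern I p (\<lambda>A. of_bool (\<Phi> A) * exp (Y A)) \<le> b"
  shows "bprob I p (\<lambda>A. \<Phi> A \<and> Y A \<ge> y) \<le> b * exp (- y)"
proof -
  have "bprob I p (\<lambda>A. \<Phi> A \<and> Y A \<ge> y) \<le> bern I p (\<lambda>A. exp (- y) * (of_bool (\<Phi> A) * exp (Y A)))"
    unfolding bprob_def by (rule bern_mono) (use p in \<open>auto simp: exp_add[symmetric]\<close>)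
  also have "\<dots> \<le> b * exp (- y)" unfolding bern_cmult using assms by (simp add: mult.commute)
  finally show ?thesis .
qed

lemma bprob_exp_Markov':
  assumes "bern I p (\<lambda>A. exp (Y A)) \<le> b"
  shows "bprob I p (\<lambda>A. Y A \<ge> y) \<le> b * exp (- y)"
  using bprob_exp_Markov[of "\<lambda>_. True" Y b y] assms by simp

text \<open>Bad events of different rows are dependent, so binomial moments replace tail bounds for
  independent sums: if at least t events occur, at least \<open>t choose r\<close> of the r-subsets
  are entirely bad. A bound on the joint probability of r events is then enough, and the ratio of
  the two binomial coefficients is at most (N / (t - r + 1))^r for N events.\<close>

lemma bprob_many_bad:
  assumes "finite N" "\<And>S. S \<subseteq> N \<Longrightarrow> card S = r \<Longrightarrow> bprob I p (\<lambda>A. \<forall>b\<in>S. bad b A) \<le> q"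
    and "r \<le> t" "1 \<le> r" and "0 \<le> q"
  shows "bprob I p (\<lambda>A. t \<le> card {b\<in>N. bad b A}) \<le> q * (real (card N) / (real t - real r + 1)) ^ r"
proof -
  have "real (t choose r) * bprob I p (\<lambda>A. t \<le> card {b\<in>N. bad b A})
     \<le> (\<Sum>S\<in>{S. S \<subseteq> N \<and> card S = r}. bprob I p (\<lambda>A. \<forall>b\<in>S. bad b A))"
    unfolding bprob_def bern_sum[symmetric] bern_cmult[symmetric]
  proof (rule bern_mono)
    fix A assume "A \<subseteq> I"
    have "real (t choose r) \<le> (\<Sum>S\<in>{S. S \<subseteq> N \<and> card S = r}. of_bool (\<forall>b\<in>S. bad b A))" if t: "t \<le> card {b\<in>N. bad b A}"
    proof -
      have "real (t choose r) \<le> real (card {b\<in>N. bad b A} choose r)" using t by (auto intro: binomial_right_mono)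
      also have "\<dots> = real (card {S. S \<subseteq> {b\<in>N. bad b A} \<and> card S = r})"
        using assms(1) by (subst n_subsets) auto
      also have "{S. S \<subseteq> {b\<in>N. bad b A} \<and> card S = r} = {S\<in>{S. S \<subseteq> N \<and> card S = r}. \<forall>b\<in>S. bad b A}" by auto
      also have "real (card \<dots>) = (\<Sum>S\<in>{S. S \<subseteq> N \<and> card S = r}. of_bool (\<forall>b\<in>S. bad b A))"
        using assms(1) by (simp add: sum.inter_filter[symmetric] of_bool_def)
      finally show ?thesis .
    qed
    then show "real (t choose r) * of_bool (t \<le> card {b\<in>N. bad b A}) \<le> (\<Sum>S\<in>{S. S \<subseteq> N \<and> card S = r}. of_bool (\<forall>b\<in>S. bad b A))"
      by (auto simp: sum_nonneg)
  qed (use p in auto)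
  also have "\<dots> \<le> (\<Sum>S\<in>{S. S \<subseteq> N \<and> card S = r}. q)"
    by (rule sum_mono) (use assms in auto)
  also have "\<dots> = real (card N choose r) * q" using assms(1) by (simp add: n_subsets)
  finally have 1: "real (t choose r) * bprob I p (\<lambda>A. t \<le> card {b\<in>N. bad b A}) \<le> real (card N choose r) * q" .
  have pos: "0 < real (t choose r)" using assms by (simp add: zero_less_binomial)
  have 2: "real (card N choose r) \<le> (real (card N) / (real t - real r + 1)) ^ r * real (t choose r)"
  proof -
    have a: "real (card N choose r) * fact r \<le> real (card N) ^ r"
      using binomial_fact_pow[of "card N" r, THEN of_nat_mono, where ?'a = real] by simp
    have "real (t choose r) * fact r = (\<Prod>i<r. real t - real i)"
      by (simp add: binomial_gbinomial gbinomial_prod_rev atLeast0LessThan)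
    also have "\<dots> \<ge> (real t - real r + 1) ^ r"
      using prod_mono[of "{..<r}" "\<lambda>_. real t - real r + 1" "\<lambda>i. real t - real i"] assms(3) by auto
    finally have b: "(real t - real r + 1) ^ r \<le> real (t choose r) * fact r" .
    have pp: "0 < (real t - real r + 1) ^ r" using assms(3) by simp
    have "real (card N choose r) * fact r * (real t - real r + 1) ^ r \<le> real (card N) ^ r * (real (t choose r) * fact r)"
      by (rule mult_mono[OF a b]) (use pp in auto)
    then have "real (card N choose r) * (real t - real r + 1) ^ r \<le> real (card N) ^ r * real (t choose r)"
      by simp
    then show ?thesis using pp by (simp add: power_divide field_simps)
  qed
  have "real (t choose r) * bprob I p (\<lambda>A. t \<le> card {b\<in>N. bad b A}) \<le> real (t choose r) * (q * (real (card N) / (real t - real r + 1)) ^ r)"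
    using 1 mult_right_mono[OF 2 assms(5)] by (simp add: mult_ac)
  then show ?thesis using pos by simp
qed

end

section \<open>Random graphs with independent edges\<close>

text \<open>Unordered pairs are coded with the larger node first, which is the index set of the
  independent entries in the model. Graphs are subsets of \<open>pairs n\<close>.\<close>

definition pairs :: "nat \<Rightarrow> (nat \<times> nat) set" where
  "pairs n = {(a, b). b < a \<and> a < n}"

definition adj :: "(nat \<times> nat) set \<Rightarrow> nat \<Rightarrow> nat \<Rightarrow> real" where
  "adj A a b = of_bool ((max a b, min a b) \<in> A)"

lemma finite_pairs [simp]: "finite (pairs n)"
  by (rule finite_subset[of _ "{..<n} \<times> {..<n}"]) (auto simp: pairs_def)

lemma adj_sym: "adj A a b = adj A b a"
  by (simp add: adj_def max.commute min.commute)

lemma adj_nonneg [simp]: "0 \<le> adj A a b" and adj_le_1 [simp]: "adj A a b \<le> 1"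
  by (auto simp: adj_def)

lemma adj_pairs:
  "(a, b) \<in> pairs n \<Longrightarrow> adj A a b = of_bool ((a, b) \<in> A)"
  "(a, b) \<in> pairs n \<Longrightarrow> adj A b a = of_bool ((a, b) \<in> A)"
  by (auto simp: adj_def pairs_def max_def min_def)

lemma adj_diag: "A \<subseteq> pairs n \<Longrightarrow> adj A a a = 0"
  by (auto simp: adj_def pairs_def)

lemma sum_pairs:
  fixes f :: "nat \<Rightarrow> nat \<Rightarrow> real"
  shows "(\<Sum>a<n. \<Sum>b<n. f a b) = (\<Sum>a<n. f a a) + (\<Sum>(a, b)\<in>pairs n. f a b + f b a)"
proof -
  have 1: "(\<Sum>(a, b)\<in>pairs n. f b a) = (\<Sum>(a, b)\<in>{(a, b). a < b \<and> b < n}. f a b)"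
    by (rule sum.reindex_bij_witness[where i = prod.swap and j = prod.swap]) (auto simp: pairs_def)
  have 2: "(\<Sum>a<n. f a a) = (\<Sum>(a, b)\<in>{(a, b). a = b \<and> b < n}. f a b)"
    by (rule sum.reindex_bij_witness[where j = "\<lambda>a. (a, a)" and i = fst]) auto
  have fin: "finite {(a, b). a < b \<and> b < n}" "finite {(a, b). a = b \<and> b < n}"
    by (rule finite_subset[of _ "{..<n} \<times> {..<n}"], auto)+
  have "{..<n} \<times> {..<n} = {(a, b). a = b \<and> b < n} \<union> (pairs n \<union> {(a, b). a < b \<and> b < n})"
    by (auto simp: pairs_def)
  then have "(\<Sum>a<n. \<Sum>b<n. f a b) = (\<Sum>(a, b)\<in>{(a, b). a = b \<and> b < n} \<union> (pairs n \<union> {(a, b). a < b \<and> b < n}). f a b)"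
    by (simp add: sum.cartesian_product)
  also have "\<dots> = (\<Sum>(a, b)\<in>{(a, b). a = b \<and> b < n}. f a b) + ((\<Sum>(a, b)\<in>pairs n. f a b) + (\<Sum>(a, b)\<in>{(a, b). a < b \<and> b < n}. f a b))"
  proof -
    have d: "{(a, b). a = b \<and> b < n} \<inter> (pairs n \<union> {(a, b). a < b \<and> b < n}) = {}" "pairs n \<inter> {(a, b). a < b \<and> b < n} = {}"
      by (auto simp: pairs_def)
    show ?thesis
      using sum.union_disjoint[OF fin(2) _ d(1), of "case_prod f"] sum.union_disjoint[OF _ fin(1) d(2), of "case_prod f"] fin by simp
  qed
  finally show ?thesis unfolding 1[symmetric] 2[symmetric]
    by (simp add: sum.distrib case_prod_unfold)
qed

section \<open>Union bounds over node sets\<close>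

text \<open>Upper bound for the logarithm of \<open>n choose s\<close>: the price of a union bound
  over the node sets of size s.\<close>

definition set_entropy :: "nat \<Rightarrow> nat \<Rightarrow> real" where
  "set_entropy n s = real s * (1 + ln (real n / real s))"

text \<open>The derivative ln (n / s) is nonnegative up to n; the inequality ln (t / s) \<le> t / s
  - 1 gives this without calculus. It lets the entropy of the smaller of two sets be charged to the
  larger.\<close>

lemma set_entropy_mono:
  assumes "1 \<le> s" "s \<le> t" "t \<le> n" shows "set_entropy n s \<le> set_entropy n t"
proof -
  have pos: "0 < real s" "0 < real t" "0 < real n" using assms by auto
  have "ln (real t / real s) \<le> real t / real s - 1" using pos by (intro ln_le_minus_one) auto
  then have "real s * (ln (real t) - ln (real s)) \<le> real s * (real t / real s - 1)"
    using pos by (intro mult_left_mono) (auto simp: ln_div)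
  then have 1: "real s * (ln (real t) - ln (real s)) \<le> real t - real s" using pos by (simp add: right_diff_distrib)
  have 2: "(real t - real s) * ln (real t) \<le> (real t - real s) * ln (real n)"
    using assms pos by (intro mult_left_mono) auto
  show ?thesis using 1 2 pos by (simp add: set_entropy_def ln_div algebra_simps)
qed

lemma set_entropy_ge:
  assumes "1 \<le> s" "s \<le> n" shows "1 + ln (real n) \<le> set_entropy n s"
  using set_entropy_mono[of 1 s n] assms by (simp add: set_entropy_def)

lemma exp_minus_set_entropy_le:
  assumes "1 \<le> s" "s \<le> n" shows "exp (- real k * set_entropy n s) \<le> 1 / real n ^ k"
proof -
  have n: "0 < real n" using assms by auto
  have "exp (- real k * set_entropy n s) \<le> exp (- real k * ln (real n))"
    using set_entropy_ge[OF assms] by (auto intro!: mult_left_mono)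
  also have "\<dots> = 1 / real n ^ k" using n by (simp add: exp_minus exp_of_nat_mult field_simps)
  finally show ?thesis .
qed

lemma binomial_le_exp_set_entropy:
  assumes "1 \<le> s" "s \<le> n" shows "real (n choose s) \<le> exp (set_entropy n s)"
proof -
  \<comment> \<open>With this weight (1 + x)^n \<le> exp s, while x^(-s) = (n / s)^s.\<close>
  define x where "x = real s / real n"
  have x: "0 < x" using assms by (simp add: x_def)
  have "real (n choose s) * x ^ s \<le> (\<Sum>k\<le>n. real (n choose k) * x ^ k * 1 ^ (n - k))"
    using member_le_sum[of s "{..n}" "\<lambda>k. real (n choose k) * x ^ k * 1 ^ (n - k)"] assms x by simp
  also have "\<dots> = (x + 1) ^ n" by (simp add: binomial_ring)
  also have "\<dots> \<le> exp x ^ n" using x exp_ge_add_one_self[of x] by (intro power_mono) (auto simp: add.commute)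
  also have "\<dots> = exp (real s)" using assms by (simp add: exp_of_nat_mult[symmetric] x_def)
  finally have "real (n choose s) \<le> exp (real s) * (1 / x) ^ s" using x by (simp add: power_divide field_simps)
  also have "(1 / x) ^ s = exp (real s * ln (real n / real s))"
    using assms by (simp add: x_def exp_of_nat_mult)
  finally show ?thesis by (simp add: set_entropy_def exp_add[symmetric] distrib_left)
qed

text \<open>Grouped by cardinality, the sets of each size contribute at most 1.\<close>

lemma sum_subsets_exp_set_entropy:
  "(\<Sum>S\<in>Pow {..<n} - {{}}. exp (- set_entropy n (card S))) \<le> real n"
proof -
  have "(\<Sum>S\<in>Pow {..<n} - {{}}. exp (- set_entropy n (card S))) 
    = (\<Sum>s\<in>{1..n}. \<Sum>S\<in>{S \<in> Pow {..<n} - {{}}. card S = s}. exp (- set_entropy n (card S)))"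
  proof (rule sum.group[symmetric])
    show "card ` (Pow {..<n} - {{}}) \<subseteq> {1..n}"
      using card_mono[of "{..<n}"] by (fastforce simp: Suc_le_eq card_gt_0_iff finite_subset)
  qed auto
  also have "\<dots> = (\<Sum>s\<in>{1..n}. real (n choose s) * exp (- set_entropy n s))"
  proof (rule sum.cong[OF refl])
    fix s assume s: "s \<in> {1..n}"
    have "{S \<in> Pow {..<n} - {{}}. card S = s} = {S. S \<subseteq> {..<n} \<and> card S = s}" using s by auto
    then show "(\<Sum>S\<in>{S \<in> Pow {..<n} - {{}}. card S = s}. exp (- set_entropy n (card S))) = real (n choose s) * exp (- set_entropy n s)"
      by (simp add: n_subsets)
  qed
  also have "\<dots> \<le> (\<Sum>s\<in>{1..n}. 1)"
  proof (rule sum_mono)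
    fix s assume "s \<in> {1..n}"
    then show "real (n choose s) * exp (- set_entropy n s) \<le> 1"
      using binomial_le_exp_set_entropy[of s n] by (simp add: exp_minus field_simps)
  qed
  finally show ?thesis by simp
qed

section \<open>Exponential moments of linear forms in the edges\<close>

locale random_graph =
  fixes n :: nat and M :: "nat \<Rightarrow> nat \<Rightarrow> real" and L :: real
  assumes n_pos: "0 < n"
    and M_nonneg: "a < n \<Longrightarrow> b < n \<Longrightarrow> 0 \<le> M a b"
    and M_le_L: "a < n \<Longrightarrow> b < n \<Longrightarrow> M a b \<le> L"
    and M_le_1: "a < n \<Longrightarrow> b < n \<Longrightarrow> M a b \<le> 1"
    and M_sym: "a < n \<Longrightarrow> b < n \<Longrightarrow> M a b = M b a"
    and L_pos: "0 < L"
begin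

abbreviation EE :: "((nat \<times> nat) set \<Rightarrow> real) \<Rightarrow> real" where
  "EE \<equiv> bern (pairs n) (case_prod M)"

abbreviation PP :: "((nat \<times> nat) set \<Rightarrow> bool) \<Rightarrow> real" where
  "PP \<equiv> bprob (pairs n) (case_prod M)"

text \<open>Centred adjacency matrix with zero diagonal. Exponential moments are computed for
  \<open>E\<close>, whereas the algebra uses \<open>W\<close> below, from which the mean is
  subtracted on the diagonal too.\<close>

definition E :: "(nat \<times> nat) set \<Rightarrow> nat \<Rightarrow> nat \<Rightarrow> real" where
  "E A a b = (if a = b then 0 else adj A a b - M a b)"

text \<open>Upper bound for all expected degrees.\<close>

definition d :: real where "d = real n * L"

definition deg :: "(nat \<times> nat) set \<Rightarrow> nat \<Rightarrow> real" where
  "deg A a = (\<Sum>b<n. adj A a b)"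

lemma d_pos: "0 < d" using n_pos L_pos by (simp add: d_def)

lemma case_M:
  "e \<in> pairs n \<Longrightarrow> 0 \<le> case_prod M e \<and> case_prod M e \<le> 1"
  "e \<in> pairs n \<Longrightarrow> 0 \<le> case_prod M e \<and> case_prod M e \<le> 1 \<and> case_prod M e \<le> L"
  using M_nonneg M_le_1 M_le_L by (auto simp: pairs_def)

lemma case_M': "\<forall>e\<in>pairs n. 0 \<le> case_prod M e \<and> case_prod M e \<le> 1"
  using case_M by blast

lemmas PP_mono = bprob_mono[OF finite_pairs case_M']
lemmas PP_or = bprob_or[OF finite_pairs case_M']
lemmas PP_Ex = bprob_Ex[OF finite_pairs case_M']
lemmas PP_Markov = bprob_exp_Markov[OF finite_pairs case_M']
lemmas PP_Markov' = bprob_exp_Markov'[OF finite_pairs case_M']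
lemmas PP_many_bad = bprob_many_bad[OF finite_pairs case_M']

lemma EE_mono: "(\<And>A. A \<subseteq> pairs n \<Longrightarrow> F A \<le> F' A) \<Longrightarrow> EE F \<le> EE F'"
  by (rule bern_mono[OF case_M(1)])

lemma E_pairs: "(a, b) \<in> pairs n \<Longrightarrow> E A a b = of_bool ((a, b) \<in> A) - M a b"
  "(a, b) \<in> pairs n \<Longrightarrow> E A b a = of_bool ((a, b) \<in> A) - M a b"
  using adj_pairs[of a b n A] adj_sym[of A a b] M_sym[of a b] by (auto simp: E_def pairs_def)

lemma
  assumes "a < n" "b < n"
  shows abs_E_le: "\<bar>E A a b\<bar> \<le> adj A a b + L" and abs_E_le_1: "\<bar>E A a b\<bar> \<le> 1"
  using M_nonneg[OF assms] M_le_L[OF assms] M_le_1[OF assms] adj_nonneg[of A a b] adj_le_1[of A a b] L_pos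
  unfolding E_def by (cases "a = b"; simp del: adj_nonneg adj_le_1 add: abs_le_iff; linarith)+

lemma sum_E:
  fixes q :: "nat \<Rightarrow> nat \<Rightarrow> real"
  shows "(\<Sum>a<n. \<Sum>b<n. q a b * E A a b) = 
    (\<Sum>e\<in>pairs n. (case e of (a, b) \<Rightarrow> q a b + q b a) * (of_bool (e \<in> A) - case_prod M e))"
  unfolding sum_pairs
  by (simp add: E_def[of A a a for a]) (intro sum.cong, auto simp: E_pairs algebra_simps)

lemma sum_sq_pairs:
  fixes q :: "nat \<Rightarrow> nat \<Rightarrow> real"
  shows "(\<Sum>e\<in>pairs n. (case e of (a, b) \<Rightarrow> q a b + q b a)\<^sup>2) \<le> 2 * (\<Sum>a<n. \<Sum>b<n. (q a b)\<^sup>2)"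
proof -
  have "(\<Sum>e\<in>pairs n. (case e of (a, b) \<Rightarrow> q a b + q b a)\<^sup>2) \<le> (\<Sum>e\<in>pairs n. case e of (a, b) \<Rightarrow> 2 * (q a b)\<^sup>2 + 2 * (q b a)\<^sup>2)"
  proof (rule sum_mono)
    fix e assume "e \<in> pairs n"
    have "(x + y)\<^sup>2 \<le> 2 * x\<^sup>2 + 2 * y\<^sup>2" for x y :: real
      using sum_squares_ge_zero[of "x - y" 0] by (simp add: power2_eq_square algebra_simps)
    then show "(case e of (a, b) \<Rightarrow> q a b + q b a)\<^sup>2 \<le> (case e of (a, b) \<Rightarrow> 2 * (q a b)\<^sup>2 + 2 * (q b a)\<^sup>2)"
      by (cases e) auto
  qed
  also have "\<dots> \<le> (\<Sum>a<n. \<Sum>b<n. 2 * (q a b)\<^sup>2)" unfolding sum_pairs by (simp add: sum_nonneg)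
  finally show ?thesis by (simp add: sum_distrib_left)
qed

text \<open>An edge collects the two coefficients q a b and q b a; hence the bound 1/2 on each of
  them and the factor 2 in the exponent.\<close>

lemma EE_exp_centered:
  assumes "\<And>a b. a < n \<Longrightarrow> b < n \<Longrightarrow> \<bar>q a b\<bar> \<le> 1/2"
  shows "EE (\<lambda>A. exp (\<Sum>a<n. \<Sum>b<n. q a b * E A a b)) \<le> exp (2 * L * (\<Sum>a<n. \<Sum>b<n. (q a b)\<^sup>2))"
proof -
  have "EE (\<lambda>A. exp (\<Sum>a<n. \<Sum>b<n. q a b * E A a b)) \<le> exp (L * (\<Sum>e\<in>pairs n. (case e of (a, b) \<Rightarrow> q a b + q b a)\<^sup>2))"
    unfolding sum_E
  proof (rule bern_exp_centered)
    fix e assume "e \<in> pairs n"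
    then show "\<bar>case e of (a, b) \<Rightarrow> q a b + q b a\<bar> \<le> 1"
      using assms[of "fst e" "snd e"] assms[of "snd e" "fst e"] by (cases e) (auto simp: pairs_def)
  qed (use case_M in auto)
  also have "\<dots> \<le> exp (2 * L * (\<Sum>a<n. \<Sum>b<n. (q a b)\<^sup>2))"
    using mult_left_mono[OF sum_sq_pairs[of q], of L] L_pos by (simp add: mult_ac)
  finally show ?thesis .
qed

text \<open>By exp (x + y) \<le> (exp (2 x) + exp (2 y)) / 2 the two coefficients of an edge are
  separated and the sum over edges becomes half a sum over ordered pairs.\<close>

lemma EE_exp_pos:
  assumes "\<And>a b. a < n \<Longrightarrow> b < n \<Longrightarrow> 0 \<le> q a b"
  shows "EE (\<lambda>A. exp (\<Sum>a<n. \<Sum>b<n. q a b * adj A a b)) \<le> exp (L / 2 * (\<Sum>a<n. \<Sum>b<n. exp (2 * q a b) - 1))"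
proof -
  have eq: "(\<Sum>a<n. \<Sum>b<n. q a b * adj A a b) = (\<Sum>e\<in>pairs n. (case e of (a, b) \<Rightarrow> q a b + q b a) * of_bool (e \<in> A))" 
    if "A \<subseteq> pairs n" for A
    unfolding sum_pairs adj_diag[OF that] mult_zero_right sum.neutral_const add_0
    by (rule sum.cong) (auto simp: adj_pairs algebra_simps)
  have "EE (\<lambda>A. exp (\<Sum>a<n. \<Sum>b<n. q a b * adj A a b)) = EE (\<lambda>A. exp (\<Sum>e\<in>pairs n. (case e of (a, b) \<Rightarrow> q a b + q b a) * of_bool (e \<in> A)))"
    by (rule bern_cong) (simp add: eq)
  also have "\<dots> \<le> exp (L * (\<Sum>e\<in>pairs n. exp (case e of (a, b) \<Rightarrow> q a b + q b a) - 1))"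
    by (rule bern_exp_pos[OF finite_pairs case_M(2)]) (use assms in \<open>auto simp: pairs_def\<close>)
  also have "\<dots> \<le> exp (L * (\<Sum>e\<in>pairs n. case e of (a, b) \<Rightarrow> (exp (2 * q a b) - 1) / 2 + (exp (2 * q b a) - 1) / 2))"
  proof -
    have "exp (x + y) - 1 \<le> (exp (2 * x) - 1) / 2 + (exp (2 * y) - 1) / 2" for x y :: real
    proof -
      have "exp (2 * x) = exp x * exp x" "exp (2 * y) = exp y * exp y" by (simp_all add: exp_add[symmetric])
      then show ?thesis
        using sum_squares_ge_zero[of "exp x - exp y" 0] by (simp add: exp_add field_simps)
    qed
    then show ?thesis using L_pos by (auto intro!: mult_left_mono sum_mono)
  qed
  also have "\<dots> \<le> exp (L * (\<Sum>a<n. \<Sum>b<n. (exp (2 * q a b) - 1) / 2))"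
    unfolding sum_pairs using L_pos assms by (auto intro!: mult_left_mono sum_nonneg)
  also have "\<dots> = exp (L / 2 * (\<Sum>a<n. \<Sum>b<n. exp (2 * q a b) - 1))"
    by (simp add: sum_distrib_left sum_divide_distrib[symmetric] sum_subtractf)
  finally show ?thesis .
qed

section \<open>Degrees and discrepancy\<close>

definition edges_between :: "(nat \<times> nat) set \<Rightarrow> nat set \<Rightarrow> nat set \<Rightarrow> real" where
  "edges_between A S T = (\<Sum>a\<in>S. \<Sum>b\<in>T. adj A a b)"

lemma edges_between_sym: "edges_between A S T = edges_between A T S"
  unfolding edges_between_def by (subst sum.swap) (simp add: adj_sym)

text \<open>S and T may overlap, and \<open>edges_between\<close> then counts an edge inside the
  intersection twice; the factor 1/2 in front of f accounts for this.\<close>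

lemma EE_exp_edges:
  assumes "S \<subseteq> {..<n}" "T \<subseteq> {..<n}" "0 \<le> f"
  shows "EE (\<lambda>A. exp (f / 2 * edges_between A S T)) \<le> exp (L / 2 * (real (card S) * real (card T)) * (exp f - 1))"
proof -
  have S: "{..<n} \<inter> S = S" "{..<n} \<inter> T = T" using assms by auto
  have 1: "(\<Sum>a<n. \<Sum>b<n. (of_bool (a \<in> S) * of_bool (b \<in> T)) * F a b) = (\<Sum>a\<in>S. \<Sum>b\<in>T. F a b)" for F :: "nat \<Rightarrow> nat \<Rightarrow> real"
  proof -
    have "(\<Sum>a<n. \<Sum>b<n. (of_bool (a \<in> S) * of_bool (b \<in> T)) * F a b) = (\<Sum>a\<in>S. \<Sum>b<n. (of_bool (a \<in> S) * of_bool (b \<in> T)) * F a b)"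
      by (rule sum.mono_neutral_right) (use assms in auto)
    also have "\<dots> = (\<Sum>a\<in>S. \<Sum>b\<in>T. (of_bool (a \<in> S) * of_bool (b \<in> T)) * F a b)"
      by (intro sum.cong refl sum.mono_neutral_right) (use assms in auto)
    also have "\<dots> = (\<Sum>a\<in>S. \<Sum>b\<in>T. F a b)"
      by (intro sum.cong refl) auto
    finally show ?thesis .
  qed
  define q where "q = (\<lambda>a b. f / 2 * (of_bool (a \<in> S) * of_bool (b \<in> T)))"
  have "EE (\<lambda>A. exp (\<Sum>a<n. \<Sum>b<n. q a b * adj A a b)) \<le> exp (L / 2 * (\<Sum>a<n. \<Sum>b<n. exp (2 * q a b) - 1))"
    by (rule EE_exp_pos) (use assms in \<open>auto simp: q_def\<close>)
  also have "(\<Sum>a<n. \<Sum>b<n. exp (2 * q a b) - 1) = (\<Sum>a<n. \<Sum>b<n. (of_bool (a \<in> S) * of_bool (b \<in> T)) * (exp f - 1))"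
    by (intro sum.cong) (auto simp: q_def)
  also have "\<dots> = (real (card S) * real (card T)) * (exp f - 1)" unfolding 1 by simp
  also have "(\<lambda>A. exp (\<Sum>a<n. \<Sum>b<n. q a b * adj A a b)) = (\<lambda>A. exp (f / 2 * edges_between A S T))"
  proof
    fix A
    have "(\<Sum>a<n. \<Sum>b<n. q a b * adj A a b) = f / 2 * (\<Sum>a<n. \<Sum>b<n. (of_bool (a \<in> S) * of_bool (b \<in> T)) * adj A a b)"
      by (simp only: q_def sum_distrib_left mult.assoc)
    then show "exp (\<Sum>a<n. \<Sum>b<n. q a b * adj A a b) = exp (f / 2 * edges_between A S T)"
      unfolding 1 edges_between_def by simp
  qed
  finally show ?thesis by (simp add: mult_ac)
qed

text \<open>When \<open>d\<close> is far below ln n, single degrees need not be of order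
  \<open>d\<close>. The total degree of a node set is, up to its entropy, and this suffices to count
  the nodes of a given large degree.\<close>

definition degree_regular :: "(nat \<times> nat) set \<Rightarrow> bool" where
  "degree_regular A \<longleftrightarrow> (\<forall>S. S \<subseteq> {..<n} \<and> S \<noteq> {} \<longrightarrow>
     (\<Sum>a\<in>S. deg A a) \<le> 2 * d * real (card S) + 10 * set_entropy n (card S))"

lemma card_bounds: "S \<subseteq> {..<n} \<Longrightarrow> S \<noteq> {} \<Longrightarrow> 1 \<le> card S \<and> card S \<le> n"
  using card_mono[of "{..<n}" S] by (auto simp: Suc_le_eq card_gt_0_iff finite_subset)

text \<open>Chernoff bound with multiplier 1, where exp 1 - 1 \<le> 2. Of the 5 entropies gained,
  one pays for the choice of the set and four give n^-4; the sum over all sets costs a factor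
  n.\<close>

lemma PP_not_degree_regular: "PP (\<lambda>A. \<not> degree_regular A) \<le> 1 / (real n)\<^sup>2"
proof -
  have one: "PP (\<lambda>A. 1 / 2 * edges_between A S {..<n} \<ge> d * real (card S) + 5 * set_entropy n (card S))
     \<le> exp (- 5 * set_entropy n (card S))" if S: "S \<subseteq> {..<n}" for S
  proof -
    have e: "exp 1 - 1 \<le> (2::real)" using exp_le by simp
    have "PP (\<lambda>A. 1 / 2 * edges_between A S {..<n} \<ge> d * real (card S) + 5 * set_entropy n (card S)) \<le>
      exp (L / 2 * (real (card S) * real (card {..<n})) * (exp 1 - 1)) * exp (- (d * real (card S) + 5 * set_entropy n (card S)))"
      by (rule PP_Markov'[OF EE_exp_edges]) (use S in auto)
    also have "\<dots> \<le> exp (d * real (card S)) * exp (- (d * real (card S) + 5 * set_entropy n (card S)))"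
      using mult_left_mono[OF e, of "L / 2 * (real (card S) * real n)"] L_pos
      by (intro mult_right_mono) (auto simp: d_def mult_ac)
    also have "\<dots> = exp (- 5 * set_entropy n (card S))" by (simp add: exp_add[symmetric])
    finally show ?thesis .
  qed
  have "PP (\<lambda>A. \<not> degree_regular A) \<le> PP (\<lambda>A. \<exists>S\<in>Pow {..<n} - {{}}. 
     1 / 2 * edges_between A S {..<n} \<ge> d * real (card S) + 5 * set_entropy n (card S))"
  proof (rule PP_mono)
    fix A assume "\<not> degree_regular A"
    then obtain S where "S \<in> Pow {..<n} - {{}}" "(\<Sum>a\<in>S. deg A a) > 2 * d * real (card S) + 10 * set_entropy n (card S)"
      unfolding degree_regular_def by (auto simp: not_le)
    then show "\<exists>S\<in>Pow {..<n} - {{}}. 1 / 2 * edges_between A S {..<n} \<ge> d * real (card S) + 5 * set_entropy n (card S)"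
      by (intro bexI[of _ S]) (auto simp: deg_def edges_between_def)
  qed
  also have "\<dots> \<le> (\<Sum>S\<in>Pow {..<n} - {{}}. PP (\<lambda>A. 1 / 2 * edges_between A S {..<n} \<ge> d * real (card S) + 5 * set_entropy n (card S)))"
    by (rule PP_Ex) auto
  also have "\<dots> \<le> (\<Sum>S\<in>Pow {..<n} - {{}}. exp (- set_entropy n (card S)) * (1 / real n ^ 4))"
  proof (rule sum_mono)
    fix S assume S: "S \<in> Pow {..<n} - {{}}"
    have "exp (- 5 * set_entropy n (card S)) = exp (- set_entropy n (card S)) * exp (- real 4 * set_entropy n (card S))"
      by (simp add: exp_add[symmetric])
    also have "\<dots> \<le> exp (- set_entropy n (card S)) * (1 / real n ^ 4)"
      using card_bounds[of S] S by (intro mult_left_mono exp_minus_set_entropy_le) auto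
    finally show "PP (\<lambda>A. 1 / 2 * edges_between A S {..<n} \<ge> d * real (card S) + 5 * set_entropy n (card S))
       \<le> exp (- set_entropy n (card S)) * (1 / real n ^ 4)" using one[of S] S by auto
  qed
  also have "\<dots> \<le> real n * (1 / real n ^ 4)"
    unfolding sum_distrib_right[symmetric] by (intro mult_right_mono sum_subsets_exp_set_entropy) auto
  also have "\<dots> \<le> 1 / (real n)\<^sup>2" using n_pos by (simp add: field_simps power2_eq_square power4_eq_xxxx)
  finally show ?thesis .
qed

text \<open>The discrepancy property of Feige and Ofek with the Chernoff multiplier l kept free:
  choosing l according to the two sets recovers the usual alternative between few edges and an
  entropy bound. Integer values up to n keep the union bound finite, at the cost of a factor
  n.\<close>

definition discrepancy_bounded :: "(nat \<times> nat) set \<Rightarrow> bool" where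
  "discrepancy_bounded A \<longleftrightarrow> (\<forall>S T l. S \<subseteq> {..<n} \<and> S \<noteq> {} \<and> T \<subseteq> {..<n} \<and> card S \<le> card T \<and> l \<in> {1..n} \<longrightarrow>
     real l * edges_between A S T \<le> 2 * (exp (real l) * L * real (card S) * real (card T) + 7 * set_entropy n (card T)))"

lemma PP_not_discrepancy_bounded: "PP (\<lambda>A. \<not> discrepancy_bounded A) \<le> 1 / (real n)\<^sup>2"
proof -
  define J where "J = {(l, S, T). l \<in> {1..n} \<and> S \<in> Pow {..<n} - {{}} \<and> T \<in> Pow {..<n} - {{}} \<and> card S \<le> card T}"
  have J: "J \<subseteq> {1..n} \<times> (Pow {..<n} - {{}}) \<times> (Pow {..<n} - {{}})" by (auto simp: J_def)
  have finJ: "finite J" by (rule finite_subset[OF J]) auto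
  define ev where "ev = (\<lambda>(l, S, T) A. real l / 2 * edges_between A S T \<ge> exp (real l) * L * real (card S) * real (card T) + 7 * set_entropy n (card T))"
  have "PP (\<lambda>A. \<not> discrepancy_bounded A) \<le> PP (\<lambda>A. \<exists>j\<in>J. ev j A)"
  proof (rule PP_mono)
    fix A assume "\<not> discrepancy_bounded A"
    then obtain S T l where h: "S \<subseteq> {..<n}" "S \<noteq> {}" "T \<subseteq> {..<n}" "card S \<le> card T" "l \<in> {1..n}"
      "real l * edges_between A S T > 2 * (exp (real l) * L * real (card S) * real (card T) + 7 * set_entropy n (card T))"
      unfolding discrepancy_bounded_def by (meson not_le)
    have "T \<noteq> {}" using h card_bounds[of S] by auto
    then have "(l, S, T) \<in> J" using h by (auto simp: J_def)
    moreover have "ev (l, S, T) A" using h by (simp add: ev_def)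
    ultimately show "\<exists>j\<in>J. ev j A" by blast
  qed
  also have "\<dots> \<le> (\<Sum>j\<in>J. PP (ev j))" by (rule PP_Ex[OF finJ])
  also have "\<dots> \<le> (\<Sum>(l, S, T)\<in>J. exp (- set_entropy n (card S)) * exp (- set_entropy n (card T)) * (1 / real n ^ 5))"
  proof (rule sum_mono)
    fix j assume j: "j \<in> J"
    obtain l S T where jj: "j = (l, S, T)" by (cases j)
    have h: "S \<subseteq> {..<n}" "T \<subseteq> {..<n}" "S \<noteq> {}" "T \<noteq> {}" "card S \<le> card T" using j by (auto simp: jj J_def)
    let ?st = "real (card S) * real (card T)"
    have "PP (ev j) \<le> exp (L / 2 * ?st * (exp (real l) - 1)) * exp (- (exp (real l) * L * real (card S) * real (card T) + 7 * set_entropy n (card T)))"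
      unfolding jj ev_def prod.case by (rule PP_Markov'[OF EE_exp_edges]) (use h in auto)
    also have "\<dots> \<le> exp (exp (real l) * L * ?st) * exp (- (exp (real l) * L * ?st + 7 * set_entropy n (card T)))"
    proof -
      have "L / 2 * ?st * (exp (real l) - 1) \<le> L * ?st * exp (real l)"
        using L_pos by (intro mult_mono) auto
      then show ?thesis by (intro mult_mono) (auto simp: mult_ac)
    qed
    \<comment> \<open>The 7 entropies split as 1 + 1 + 5: one each for the sums over T and, by
      monotonicity, over the smaller set S, and five for n^-5, since the sums over l, S and T each
      cost a factor n.\<close>
    also have "\<dots> = exp (- set_entropy n (card T)) * exp (- set_entropy n (card T)) * exp (- real 5 * set_entropy n (card T))"
      by (simp add: exp_add[symmetric])
    also have "\<dots> \<le> exp (- set_entropy n (card S)) * exp (- set_entropy n (card T)) * (1 / real n ^ 5)"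
      using set_entropy_mono[of "card S" "card T" n] h card_bounds[of S] card_bounds[of T]
      by (intro mult_mono exp_minus_set_entropy_le) auto
    finally show "PP (ev j) \<le> (case j of (l, S, T) \<Rightarrow> exp (- set_entropy n (card S)) * exp (- set_entropy n (card T)) * (1 / real n ^ 5))"
      by (simp add: jj)
  qed
  also have "\<dots> \<le> (\<Sum>(l, S, T)\<in>{1..n} \<times> (Pow {..<n} - {{}}) \<times> (Pow {..<n} - {{}}). 
     exp (- set_entropy n (card S)) * exp (- set_entropy n (card T)) * (1 / real n ^ 5))"
    by (rule sum_mono2[OF _ J]) auto
  also have "\<dots> = real n * ((\<Sum>S\<in>Pow {..<n} - {{}}. exp (- set_entropy n (card S))) * ((\<Sum>T\<in>Pow {..<n} - {{}}. exp (- set_entropy n (card T))) * (1 / real n ^ 5)))"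
    by (simp add: sum.cartesian_product[symmetric] sum_distrib_left sum_distrib_right mult_ac)
  also have "\<dots> \<le> real n * (real n * (real n * (1 / real n ^ 5)))"
    by (intro mult_left_mono mult_mono sum_subsets_exp_set_entropy mult_right_mono sum_nonneg mult_nonneg_nonneg) auto
  also have "\<dots> = 1 / (real n)\<^sup>2" using n_pos by (simp add: field_simps power2_eq_square numeral_eq_Suc)
  finally show ?thesis .
qed

end

section \<open>The spectral norm of a sparse random graph\<close>

text \<open>The subtracted term carries the induction: passing to N + 1 adds 2 exp (- (N + 1)^2),
  which is at most the gain 2 (1/2)^(N + 1).\<close>

lemma sum_exp_minus_sq_le: "(\<Sum>j\<in>{- int N..int N}. exp (- (real_of_int j)\<^sup>2)) \<le> 3 - 2 * (1 / 2) ^ N"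
proof (induction N)
  case (Suc N)
  have "{- int (Suc N)..int (Suc N)} = insert (- int (Suc N)) (insert (int (Suc N)) {- int N..int N})" by auto
  then have "(\<Sum>j\<in>{- int (Suc N)..int (Suc N)}. exp (- (real_of_int j)\<^sup>2)) 
    = 2 * exp (- (real (Suc N))\<^sup>2) + (\<Sum>j\<in>{- int N..int N}. exp (- (real_of_int j)\<^sup>2))" by (simp add: power2_eq_square algebra_simps)
  moreover have "exp (- (real (Suc N))\<^sup>2) \<le> (1 / 2) ^ Suc N"
  proof -
    have "exp (- (real (Suc N))\<^sup>2) \<le> exp (- (real (Suc N)))"
      by (simp add: power2_eq_square algebra_simps)
    also have "\<dots> = exp (-1) ^ Suc N" unfolding exp_of_nat_mult[symmetric] by simp
    also have "\<dots> \<le> (1 / 2) ^ Suc N"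
    proof (rule power_mono)
      show "exp (-1) \<le> (1/2 :: real)" using exp_ge_add_one_self[of "1::real"] by (simp add: exp_minus field_simps)
    qed auto
    finally show ?thesis .
  qed
  ultimately show ?case using Suc by simp
qed simp

lemma sum_exp_half_le:
  assumes "finite I" "\<And>i. i \<in> I \<Longrightarrow> real i \<le> z"
  shows "(\<Sum>i\<in>I. exp (- (z - real i) / 2)) \<le> 3"
proof (cases "I = {}")
  case False
  define N where "N = Max I"
  have N: "N \<in> I" "\<And>i. i \<in> I \<Longrightarrow> i \<le> N" using assms False by (auto simp: N_def)
  define r :: real where "r = exp (- 1 / 2)"
  have r: "0 < r" "r \<le> 2 / 3"
    using exp_ge_add_one_self[of "1/2 :: real"] by (auto simp: r_def exp_minus field_simps)
  have "(\<Sum>i\<in>I. exp (- (z - real i) / 2)) \<le> (\<Sum>i\<in>I. r ^ (N - i))"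
  proof (rule sum_mono)
    fix i assume i: "i \<in> I"
    have "exp (- (z - real i) / 2) \<le> exp (real (N - i) * (- 1 / 2))"
      using assms(2)[OF N(1)] N(2)[OF i] by (simp add: of_nat_diff field_simps)
    then show "exp (- (z - real i) / 2) \<le> r ^ (N - i)" by (simp only: exp_of_nat_mult r_def)
  qed
  also have "\<dots> \<le> (\<Sum>i\<in>{..N}. r ^ (N - i))"
    by (rule sum_mono2) (use N r in auto)
  also have "\<dots> = (\<Sum>i\<le>N. r ^ i)" by (rule sum.nat_diff_reindex[of "\<lambda>i. r ^ i" "Suc N", unfolded lessThan_Suc_atMost, simplified])
  also have "\<dots> \<le> 1 / (1 - r)"
  proof -
    have "(1 - r) * (\<Sum>i\<le>N. r ^ i) \<le> 1" unfolding sum_gp_basic using r by simp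
    then show ?thesis using r by (simp add: pos_le_divide_eq mult.commute)
  qed
  also have "\<dots> \<le> 3" using r by (simp add: field_simps)
  finally show ?thesis .
qed simp

lemma sum_exp_minus_le:
  "finite I \<Longrightarrow> (\<Sum>j\<in>I. exp (- real j)) \<le> 3"
proof (cases "I = {}")
  assume fin: "finite I"
  case False
  have "(\<Sum>j\<in>I. exp (- real j)) \<le> (\<Sum>j\<in>{..Max I}. exp (- real j))"
    by (rule sum_mono2) (use fin in auto)
  also have "\<dots> = (\<Sum>j\<in>{..Max I}. exp (- real (Max I - j)))"
    by (rule sum.reindex_bij_witness[where i = "\<lambda>j. Max I - j" and j = "\<lambda>j. Max I - j"]) auto
  also have "\<dots> \<le> (\<Sum>j\<in>{..Max I}. exp (- (real (Max I) - real j) / 2))"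
    by (rule sum_mono) (auto simp: of_nat_diff)
  also have "\<dots> \<le> 3" by (rule sum_exp_half_le) auto
  finally show ?thesis .
qed simp

section \<open>A lattice net of the unit ball and the light pairs\<close>

context random_graph
begin

text \<open>After division by 4 sqrt n these are the points of the unit ball on a grid of mesh 1 /
  (4 sqrt n). The box only makes the set visibly finite; it follows from the norm
  constraint.\<close>

definition lattice :: "(nat \<Rightarrow> int) set" where
  "lattice = {k \<in> PiE {..<n} (\<lambda>_. {- int (16 * n)..int (16 * n)}). (\<Sum>a<n. (real_of_int (k a))\<^sup>2) \<le> 16 * real n}"

definition lat_vec :: "(nat \<Rightarrow> int) \<Rightarrow> nat \<Rightarrow> real" where
  "lat_vec k a = real_of_int (k a) / (4 * sqrt (real n))"

lemma finite_lattice: "finite lattice"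
  by (rule finite_subset[of _ "PiE {..<n} (\<lambda>_. {- int (16 * n)..int (16 * n)})"]) (auto simp: lattice_def intro!: finite_PiE)

text \<open>On the lattice exp (16 n) times the product of all exp (- k_a^2) is at least 1. Without
  the norm constraint the sum of these products is the n-th power of a theta sum, which is at most 3
  \<le> exp 2.\<close>

lemma card_lattice: "real (card lattice) \<le> exp (18 * real n)"
proof -
  let ?P = "PiE {..<n} (\<lambda>_. {- int (16 * n)..int (16 * n)})"
  have "real (card lattice) = (\<Sum>k\<in>lattice. 1)" by simp
  also have "\<dots> \<le> (\<Sum>k\<in>lattice. exp (16 * real n) * (\<Prod>a<n. exp (- (real_of_int (k a))\<^sup>2)))"
  proof (rule sum_mono)
    fix k assume "k \<in> lattice"
    then have "0 \<le> 16 * real n + (\<Sum>a<n. - (real_of_int (k a))\<^sup>2)" by (simp add: lattice_def sum_negf)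
    then have "1 \<le> exp (16 * real n + (\<Sum>a<n. - (real_of_int (k a))\<^sup>2))" by simp
    then show "1 \<le> exp (16 * real n) * (\<Prod>a<n. exp (- (real_of_int (k a))\<^sup>2))"
      by (simp add: exp_add exp_sum)
  qed
  also have "\<dots> \<le> (\<Sum>k\<in>?P. exp (16 * real n) * (\<Prod>a<n. exp (- (real_of_int (k a))\<^sup>2)))"
    by (rule sum_mono2) (auto simp: lattice_def prod_nonneg intro!: finite_PiE)
  also have "\<dots> = exp (16 * real n) * (\<Prod>a<n. \<Sum>j\<in>{- int (16 * n)..int (16 * n)}. exp (- (real_of_int j)\<^sup>2))"
    by (subst prod_sum_PiE) (auto simp: sum_distrib_left)
  also have "\<dots> \<le> exp (16 * real n) * (\<Prod>a<n. exp 2)"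
  proof -
    have "(\<Sum>j\<in>{- int (16 * n)..int (16 * n)}. exp (- (real_of_int j)\<^sup>2)) \<le> 3"
      using sum_exp_minus_sq_le[of "16 * n"] zero_le_power[of "1/2::real" "16 * n"] by linarith
    also have "(3::real) \<le> exp 2" using exp_ge_add_one_self[of "2::real"] by simp
    finally show ?thesis by (intro mult_left_mono prod_mono) (auto intro!: sum_nonneg)
  qed
  also have "\<dots> = exp (18 * real n)" by (simp add: exp_of_nat_mult[symmetric] exp_add[symmetric] mult_ac)
  finally show ?thesis .
qed

text \<open>Below the cut sqrt d / n the coefficients stay at most 1/2 after scaling by n / (2 sqrt
  d), so a Bernstein bound is strong enough for a union over the net. Larger products are left to
  the discrepancy property.\<close>

definition light :: "real \<Rightarrow> real" where
  "light z = (if \<bar>z\<bar> \<le> sqrt d / real n then z else 0)"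

definition light_bounded :: "(nat \<times> nat) set \<Rightarrow> bool" where
  "light_bounded A \<longleftrightarrow> (\<forall>k\<in>lattice. \<forall>k'\<in>lattice.
     \<bar>\<Sum>a<n. \<Sum>b<n. light (lat_vec k a * lat_vec k' b) * E A a b\<bar> \<le> 80 * sqrt d)"

lemma sum_sq_lat_vec: "k \<in> lattice \<Longrightarrow> (\<Sum>a<n. (lat_vec k a)\<^sup>2) \<le> 1"
  using n_pos by (simp add: lat_vec_def lattice_def power_divide power_mult_distrib sum_divide_distrib[symmetric])

lemma PP_not_light_bounded: "PP (\<lambda>A. \<not> light_bounded A) \<le> 2 / (real n)\<^sup>2"
proof -
  \<comment> \<open>The multiplier is the largest one that keeps the coefficients at most 1/2. It
    turns the threshold 80 sqrt d into 40 n, against at most exp (36 n) pairs of lattice points and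
    a variance cost exp (n / 2). The sign \<sigma> removes the absolute value.\<close>
  define ev where "ev = (\<lambda>(k, k', \<sigma>) A. real n / (2 * sqrt d) * \<sigma> * (\<Sum>a<n. \<Sum>b<n. light (lat_vec k a * lat_vec k' b) * E A a b) \<ge> 40 * real n)"
  let ?J = "lattice \<times> lattice \<times> {1, -1 :: real}"
  have sd: "0 < sqrt d" using d_pos by simp
  have "PP (\<lambda>A. \<not> light_bounded A) \<le> PP (\<lambda>A. \<exists>j\<in>?J. ev j A)"
  proof (rule PP_mono)
    fix A assume "\<not> light_bounded A"
    then obtain k k' where k: "k \<in> lattice" "k' \<in> lattice" 
      and gt: "\<bar>\<Sum>a<n. \<Sum>b<n. light (lat_vec k a * lat_vec k' b) * E A a b\<bar> > 80 * sqrt d" (is "\<bar>?s\<bar> > _")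
      unfolding light_bounded_def by (auto simp: not_le)
    define \<sigma> :: real where "\<sigma> = (if ?s \<ge> 0 then 1 else -1)"
    have "\<sigma> * ?s = \<bar>?s\<bar>" by (simp add: \<sigma>_def)
    then have "80 * sqrt d \<le> \<sigma> * ?s" using gt by simp
    then have "real n / (2 * sqrt d) * (80 * sqrt d) \<le> real n / (2 * sqrt d) * (\<sigma> * ?s)"
      using sd by (intro mult_left_mono) auto
    then have "ev (k, k', \<sigma>) A" using sd d_pos by (simp add: ev_def mult.assoc)
    then show "\<exists>j\<in>?J. ev j A" using k by (auto simp: \<sigma>_def split: if_splits)
  qed
  also have "\<dots> \<le> (\<Sum>j\<in>?J. PP (ev j))" by (rule PP_Ex) (use finite_lattice in auto)
  also have "\<dots> \<le> (\<Sum>j\<in>?J. exp (real n / 2) * exp (- (40 * real n)))"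
  proof (rule sum_mono)
    fix j assume "j \<in> ?J"
    then obtain k k' \<sigma> where j: "j = (k, k', \<sigma>)" and k: "k \<in> lattice" "k' \<in> lattice" and \<sigma>: "\<sigma> = 1 \<or> \<sigma> = -1" by auto
    define q where "q = (\<lambda>a b. real n / (2 * sqrt d) * \<sigma> * light (lat_vec k a * lat_vec k' b))"
    have \<sigma>2: "\<sigma>\<^sup>2 = 1" "\<bar>\<sigma>\<bar> = 1" using \<sigma> by auto
    have "EE (\<lambda>A. exp (\<Sum>a<n. \<Sum>b<n. q a b * E A a b)) \<le> exp (2 * L * (\<Sum>a<n. \<Sum>b<n. (q a b)\<^sup>2))"
    proof (rule EE_exp_centered)
      fix a b
      have "\<bar>light (lat_vec k a * lat_vec k' b)\<bar> \<le> sqrt d / real n" using sd by (simp add: light_def)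
      then have "\<bar>q a b\<bar> \<le> real n / (2 * sqrt d) * (sqrt d / real n)"
        unfolding q_def abs_mult \<sigma>2 using sd by (intro mult_mono) auto
      then show "\<bar>q a b\<bar> \<le> 1 / 2" using sd d_pos n_pos by simp
    qed
    also have "2 * L * (\<Sum>a<n. \<Sum>b<n. (q a b)\<^sup>2) \<le> 2 * L * (\<Sum>a<n. \<Sum>b<n. (real n / (2 * sqrt d))\<^sup>2 * ((lat_vec k a)\<^sup>2 * (lat_vec k' b)\<^sup>2))"
      using L_pos by (intro mult_left_mono sum_mono) (auto simp: q_def light_def power_mult_distrib power_divide \<sigma>2)
    also have "\<dots> = 2 * L * (real n / (2 * sqrt d))\<^sup>2 * ((\<Sum>a<n. (lat_vec k a)\<^sup>2) * (\<Sum>b<n. (lat_vec k' b)\<^sup>2))"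
      by (simp only: sum_product sum_distrib_left[symmetric] mult.assoc)
    also have "\<dots> \<le> 2 * L * (real n / (2 * sqrt d))\<^sup>2 * (1 * 1)"
      using L_pos k by (intro mult_left_mono mult_mono sum_sq_lat_vec) (auto intro!: sum_nonneg)
    also have "\<dots> = real n / 2" using n_pos L_pos by (simp add: d_def power_divide power_mult_distrib field_simps power2_eq_square)
    finally have b: "EE (\<lambda>A. exp (\<Sum>a<n. \<Sum>b<n. q a b * E A a b)) \<le> exp (real n / 2)" by simp
    have eq: "(\<Sum>a<n. \<Sum>b<n. q a b * E A a b) = real n / (2 * sqrt d) * \<sigma> * (\<Sum>a<n. \<Sum>b<n. light (lat_vec k a * lat_vec k' b) * E A a b)" for A
      by (simp add: q_def sum_distrib_left mult.assoc)
    show "PP (ev j) \<le> exp (real n / 2) * exp (- (40 * real n))"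
      using PP_Markov'[OF b, of "40 * real n"] unfolding j ev_def prod.case eq .
  qed
  also have "\<dots> = 2 * (real (card lattice) * real (card lattice)) * (exp (real n / 2) * exp (- (40 * real n)))"
    by (simp add: card_cartesian_product mult_ac)
  also have "\<dots> \<le> 2 * (exp (18 * real n) * exp (18 * real n)) * (exp (real n / 2) * exp (- (40 * real n)))"
    by (intro mult_right_mono mult_left_mono mult_mono card_lattice) auto
  also have "\<dots> \<le> 2 * exp (- (2 * real n))" by (simp add: exp_add[symmetric])
  also have "\<dots> \<le> 2 * (1 / (real n)\<^sup>2)"
  proof -
    have "real n \<le> exp (real n)" using exp_ge_add_one_self[of "real n"] by linarith
    then have "(real n)\<^sup>2 \<le> exp (real n) ^ 2" by (intro power_mono) auto
    also have "\<dots> = exp (2 * real n)" by (simp add: exp_double)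
    finally show ?thesis using n_pos by (simp add: exp_minus field_simps)
  qed
  finally show ?thesis by simp
qed

end

section \<open>Heavy pairs through discrepancy\<close>

lemma sum_swap4:
  "(\<Sum>a\<in>A. \<Sum>b\<in>B. \<Sum>i\<in>I. \<Sum>j\<in>J. f a b i j) = (\<Sum>i\<in>I. \<Sum>j\<in>J. \<Sum>a\<in>A. \<Sum>b\<in>B. f a b i j)"
proof -
  have "(\<Sum>a\<in>A. \<Sum>b\<in>B. \<Sum>i\<in>I. \<Sum>j\<in>J. f a b i j) = (\<Sum>a\<in>A. \<Sum>i\<in>I. \<Sum>j\<in>J. \<Sum>b\<in>B. f a b i j)"
    by (rule sum.cong[OF refl], subst sum.swap, intro sum.cong refl, rule sum.swap)
  also have "\<dots> = (\<Sum>i\<in>I. \<Sum>j\<in>J. \<Sum>a\<in>A. \<Sum>b\<in>B. f a b i j)"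
    by (subst sum.swap, intro sum.cong refl, rule sum.swap)
  finally show ?thesis .
qed

text \<open>640 = 2 * 320 comes from the unbalanced pairs, which are charged to degrees; the rest is
  the sum over level sets (\<open>sumbd\<close> in \<open>heavy_bound\<close>), once for each order
  of the set sizes.\<close>

definition heavy_const :: real where "heavy_const = 640 + 2 * (2 * exp 5 + 1008 * exp 3)"

context random_graph
begin

text \<open>Above 320 \<open>d\<close> the squared degrees sum to at most a multiple of n exp (- 7
  d) (\<open>sum_deg_sq_large\<close>), and exp (- 7 d) is what beats the factor exp (4 d) allowed
  in \<alpha>.\<close>

definition good_nodes :: "(nat \<times> nat) set \<Rightarrow> nat set" where
  "good_nodes A = {a. a < n \<and> deg A a \<le> 320 * d}"

lemma good_nodes: "good_nodes A \<subseteq> {..<n}" "finite (good_nodes A)"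
  by (auto simp: good_nodes_def)

text \<open>The discrepancy bound on a pair of level sets with values about \<open>exp i / sqrt n\<close> and
  \<open>exp j / sqrt n\<close>, where \<open>i + j\<close> is at least \<open>ln (sqrt d)\<close> up to a constant; the choice
  \<open>exp l \<approx> exp (i + j) / sqrt d\<close> balances the two terms.\<close>
lemma level_pair_bound:
  fixes i j :: nat
  assumes disc: "discrepancy_bounded A" and S: "S \<subseteq> {..<n}" "S \<noteq> {}" and T: "T \<subseteq> {..<n}" "T \<noteq> {}"
    and ST: "card S \<le> card T"
    and ij: "real i + real j + 2 > ln d / 2" "real i \<le> real j + ln d / 2 + 1" "real j \<le> real i + ln d / 2 + 1"
    and up: "i + j + 6 \<le> n" "1 \<le> d"
    and \<beta>: "exp (2 * real j) * real (card T) / real n \<le> 1"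
  shows "exp (real i + real j + 2) / real n * edges_between A S T \<le>
    sqrt d * (2 * exp 5 * (exp (2 * real i) * real (card S) / real n) * (exp (2 * real j) * real (card T) / real n)
      + 56 * exp 3 * exp (- (real j + ln d / 2 + 1 - real i) / 2) * (exp (2 * real j) * real (card T) / real n + exp (- real j)))"
proof -
  define q where "q = ln d / 2"
  define s where "s = real (card S)"
  define t where "t = real (card T)"
  define \<beta> where "\<beta> = exp (2 * real j) * t / real n"
  define e where "e = edges_between A S T"
  \<comment> \<open>Since i + j - q > -2, the offset 3 makes l \<ge> 1; it also places l between i +
    j - q + 2 and i + j - q + 3.\<close>
  define l where "l = nat (\<lfloor>real i + real j - q\<rfloor> + 3)"
  have n: "0 < real n" using n_pos by simp
  have q: "exp q = sqrt d" "0 \<le> q"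
  proof -
    have "exp q ^ 2 = d" using d_pos by (simp add: q_def exp_double[symmetric])
    then show "exp q = sqrt d" by (metis exp_ge_zero real_sqrt_unique)
  qed (use up in \<open>simp add: q_def\<close>)
  have lpos: "\<lfloor>real i + real j - q\<rfloor> + 3 \<ge> 1" using ij(1) by (simp add: q_def le_floor_iff; linarith)
  have l: "real l = of_int \<lfloor>real i + real j - q\<rfloor> + 3" using lpos by (simp add: l_def)
  have l1: "1 \<le> l" using lpos by (simp add: l_def)
  have l2: "real l \<ge> real i + real j - q + 2" "real l \<le> real i + real j - q + 3" unfolding l by linarith+
  have ln: "l \<le> n" 
  proof -
    have "real l \<le> real (i + j + 6)" using l2 q by simp
    then show ?thesis using up by linarith
  qed
  have t: "1 \<le> t" "1 \<le> s" using card_bounds[OF S] card_bounds[OF T] by (auto simp: t_def s_def)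
  have \<beta>0: "0 < \<beta>" "\<beta> \<le> 1" using t n \<beta> by (auto simp: \<beta>_def t_def)
  have disc': "real l * e \<le> 2 * (exp (real l) * L * s * t + 7 * set_entropy n (card T))"
    using disc S T ST l1 ln by (auto simp: discrepancy_bounded_def e_def s_def t_def)
  have e0: "0 \<le> e" by (auto simp: e_def edges_between_def intro!: sum_nonneg)
  have lr: "1 \<le> real l" using l1 by simp
  have term_split: "e \<le> 2 * exp (real l) * L * s * t + 14 * set_entropy n (card T) / real l"
  proof -
    have "e \<le> 2 * (exp (real l) * L * s * t + 7 * set_entropy n (card T)) / real l"
      using disc' lr by (simp add: field_simps)
    also have "\<dots> = 2 * exp (real l) * L * s * t / real l + 14 * set_entropy n (card T) / real l"
      by (simp add: add_divide_distrib distrib_left mult.assoc)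
    also have "2 * exp (real l) * L * s * t / real l \<le> 2 * exp (real l) * L * s * t / 1"
      using lr L_pos t by (intro divide_left_mono) auto
    finally show ?thesis by simp
  qed
  have first: "exp (real i + real j + 2) / real n * (2 * exp (real l) * L * s * t) \<le>
     sqrt d * (2 * exp 5 * (exp (2 * real i) * s / real n) * (exp (2 * real j) * t / real n))"
  proof -
    have "exp (real i + real j + 2) * exp (real l) \<le> exp (real i + real j + 2) * exp (real i + real j - q + 3)"
      using l2 by simp
    also have "\<dots> = exp 5 * exp (2 * real i) * exp (2 * real j) / sqrt d"
      by (simp add: exp_add[symmetric] q(1)[symmetric] exp_diff[symmetric])
    finally have "exp (real i + real j + 2) * exp (real l) * (2 * L * s * t / real n) \<le>
      exp 5 * exp (2 * real i) * exp (2 * real j) / sqrt d * (2 * L * s * t / real n)"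
      using L_pos t by (intro mult_right_mono) auto
    also have "\<dots> = sqrt d * (2 * exp 5 * (exp (2 * real i) * s / real n) * (exp (2 * real j) * t / real n))"
    proof -
      have "L = sqrt d * sqrt d / real n" using d_pos n by (simp add: d_def)
      then show ?thesis using d_pos n by (simp add: field_simps)
    qed
    finally show ?thesis by (simp add: mult_ac)
  qed
  \<comment> \<open>The slack in i \<le> j + q + 1. The final bound decays like exp (- u / 2), so
    that the sum over i is geometric.\<close>
  define u where "u = real j + q + 1 - real i"
  have u: "0 \<le> u" using ij(2) by (simp add: u_def q_def)
  have lu: "2 * real j + 3 - u \<le> real l" using l2 by (simp add: u_def)
  have ent: "set_entropy n (card T) = \<beta> * real n * exp (- 2 * real j) * (1 + 2 * real j - ln \<beta>)"
  proof -
    have "\<beta> * real n * exp (- 2 * real j) = t" using n by (simp add: \<beta>_def exp_minus)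
    moreover have "ln \<beta> = 2 * real j + ln t - ln (real n)"
      using t n by (simp add: \<beta>_def ln_div ln_mult)
    moreover have "ln (real n / t) = ln (real n) - ln t" using t n by (simp add: ln_div)
    ultimately show ?thesis by (simp add: set_entropy_def t_def)
  qed
  \<comment> \<open>The entropy contains - \<beta> ln \<beta>, which no multiple of \<beta>
    dominates. Applying ln x \<le> x - 1 at the x below moves the excess into exp (- 2 j), which is
    summable over the levels.\<close>
  have neglog: "- \<beta> * ln \<beta> \<le> (2 * real j + 1) * \<beta> + exp (- 2 * real j)"
  proof -
    define x where "x = exp (- (2 * real j + 2)) / \<beta>"
    have "ln x \<le> x - 1" using \<beta>0 by (intro ln_le_minus_one) (auto simp: x_def)
    moreover have "ln x = - (2 * real j + 2) - ln \<beta>" using \<beta>0 by (simp add: x_def ln_div)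
    ultimately have "\<beta> * (- (2 * real j + 2) - ln \<beta>) \<le> \<beta> * (x - 1)" using \<beta>0 by (intro mult_left_mono) auto
    also have "\<dots> = exp (- (2 * real j + 2)) - \<beta>" using \<beta>0 by (simp add: x_def right_diff_distrib)
    also have "exp (- (2 * real j + 2)) \<le> exp (- 2 * real j)" by simp
    finally show ?thesis by (simp add: algebra_simps)
  qed
  have key: "\<beta> * (1 + 2 * real j - ln \<beta>) / real l \<le> 2 * (1 + u) * (\<beta> + exp (- real j))"
  proof -
    have "\<beta> * (1 + 2 * real j - ln \<beta>) \<le> 2 * (2 * real j + 1) * \<beta> + exp (- 2 * real j)"
      using neglog by (simp add: algebra_simps)
    also have "\<dots> \<le> 2 * ((1 + u) * real l) * \<beta> + (2 * (1 + u) * real l) * exp (- real j)"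
    proof (intro add_mono mult_right_mono mult_left_mono)
      \<comment> \<open>As l is at least both 1 and 2 j + 3 - u, division by l removes the factor 2
        j + 1 of the entropy at the price of 1 + u, which exp (- u) absorbs afterwards.\<close>
      show "2 * real j + 1 \<le> (1 + u) * real l"
      proof (cases "2 * real j + 3 - u \<ge> 1")
        case True
        have "(1 + u) * (2 * real j + 3 - u) \<le> (1 + u) * real l" using lu u by (intro mult_left_mono) auto
        moreover have "u * 1 \<le> u * (2 * real j + 3 - u)" using True u by (intro mult_left_mono) auto
        ultimately show ?thesis by (simp add: algebra_simps)
      next
        case False
        have "2 * real j + 1 \<le> (1 + u) * 1" using False by simp
        also have "\<dots> \<le> (1 + u) * real l" using lr u by (intro mult_left_mono) auto
        finally show ?thesis .
      qed
      have "1 * exp (- 2 * real j) \<le> (2 * (1 + u) * real l) * exp (- real j)"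
      proof (rule mult_mono)
        have "1 * 1 \<le> (2 * (1 + u)) * real l" using u lr by (intro mult_mono) auto
        then show "1 \<le> 2 * (1 + u) * real l" by simp
      qed (use u lr in auto)
      then show "exp (- 2 * real j) \<le> (2 * (1 + u) * real l) * exp (- real j)" by simp
    qed (use \<beta>0 in auto)
    also have "\<dots> = (2 * (1 + u) * (\<beta> + exp (- real j))) * real l" by (simp add: algebra_simps)
    finally show ?thesis using lr by (simp add: pos_divide_le_eq)
  qed
  have second: "exp (real i + real j + 2) / real n * (14 * set_entropy n (card T) / real l) \<le>
     sqrt d * (56 * exp 3 * exp (- u / 2) * (\<beta> + exp (- real j)))"
  proof -
    have ex: "exp (real i + real j + 2) * exp (- 2 * real j) = exp 3 * sqrt d * exp (- u)"
      by (simp add: q(1)[symmetric] exp_add[symmetric] u_def)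
    have "exp (real i + real j + 2) / real n * (14 * set_entropy n (card T) / real l) =
      14 * (exp (real i + real j + 2) * exp (- 2 * real j)) * (\<beta> * (1 + 2 * real j - ln \<beta>) / real l)"
    proof -
      have "x / N * (14 * (b * N * y * z) / w) = 14 * (x * y) * (b * z / w)" if "N \<noteq> 0" for x N b y z w :: real
        using that by simp
      from this[of "real n"] show ?thesis unfolding ent using n by simp
    qed
    also have "\<dots> \<le> 14 * (exp 3 * sqrt d * exp (- u)) * (2 * (1 + u) * (\<beta> + exp (- real j)))"
      unfolding ex using d_pos by (intro mult_left_mono[OF key]) auto
    also have "\<dots> = 28 * exp 3 * sqrt d * (\<beta> + exp (- real j)) * (exp (- u) * (1 + u))" by (simp add: algebra_simps)
    also have "\<dots> \<le> 28 * exp 3 * sqrt d * (\<beta> + exp (- real j)) * (2 * exp (- u / 2))"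
    proof (rule mult_left_mono)
      have "1 + u \<le> 2 * exp (u / 2)" using exp_ge_add_one_self[of "u / 2"] by linarith
      then have "exp (- u) * (1 + u) \<le> exp (- u) * (2 * exp (u / 2))" by (rule mult_left_mono) simp
      also have "\<dots> = 2 * exp (- u / 2)" by (simp add: exp_add[symmetric])
      finally show "exp (- u) * (1 + u) \<le> 2 * exp (- u / 2)" .
    qed (use \<beta>0 d_pos in auto)
    finally show ?thesis by (simp add: algebra_simps)
  qed
  have "exp (real i + real j + 2) / real n * e \<le> exp (real i + real j + 2) / real n * (2 * exp (real l) * L * s * t + 14 * set_entropy n (card T) / real l)"
    by (rule mult_left_mono[OF term_split]) auto
  also have "\<dots> \<le> sqrt d * (2 * exp 5 * (exp (2 * real i) * s / real n) * (exp (2 * real j) * t / real n))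
    + sqrt d * (56 * exp 3 * exp (- u / 2) * (\<beta> + exp (- real j)))"
    by (subst distrib_left) (intro add_mono first second)
  finally show ?thesis by (simp add: e_def s_def t_def \<beta>_def u_def q_def distrib_left)
qed


text \<open>If x_a \<ge> sqrt d y_b, then x_a y_b \<le> x_a^2 / sqrt d is charged to the degree of
  a, at most 320 d; the reversed case is symmetric. The remaining heavy pairs have balanced
  coordinates and are sorted into level sets, to which the discrepancy property applies.\<close>

lemma heavy_bound:
  fixes x y :: "nat \<Rightarrow> real"
  assumes disc: "discrepancy_bounded A" and V: "V \<subseteq> good_nodes A"
    and x: "\<And>a. a \<in> V \<Longrightarrow> 0 \<le> x a" "(\<Sum>a\<in>V. (x a)\<^sup>2) \<le> 1"
    and y: "\<And>a. a \<in> V \<Longrightarrow> 0 \<le> y a" "(\<Sum>a\<in>V. (y a)\<^sup>2) \<le> 1"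
    and d1: "1 \<le> d" and nbig: "ln (real n) + 6 \<le> real n"
  shows "(\<Sum>a\<in>V. \<Sum>b\<in>V. (if x a * y b > sqrt d / real n then x a * y b * adj A a b else 0)) \<le> heavy_const * sqrt d"
proof -
  have Vn: "V \<subseteq> {..<n}" "finite V" using V good_nodes by (auto intro: finite_subset)
  have n: "0 < real n" using n_pos by simp
  have sd: "0 < sqrt d" "1 \<le> sqrt d" using d1 by auto
  define q where "q = ln d / 2"
  have q: "exp q = sqrt d" "0 \<le> q"
  proof -
    have "exp q ^ 2 = d" using d_pos by (simp add: q_def exp_double[symmetric])
    then show "exp q = sqrt d" by (metis exp_ge_zero real_sqrt_unique)
  qed (use d1 in \<open>simp add: q_def\<close>)
  have deg: "(\<Sum>b\<in>V. adj A a b) \<le> 320 * d" if "a \<in> V" for a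
  proof -
    have "(\<Sum>b\<in>V. adj A a b) \<le> deg A a" unfolding deg_def by (rule sum_mono2) (use Vn in auto)
    then show ?thesis using that V by (force simp: good_nodes_def)
  qed
  \<comment> \<open>Coordinates are graded by powers of e relative to 1 / sqrt n. Values below 1 /
    sqrt n need no level, since no balanced heavy pair involves them (\<open>one\<close>
    below).\<close>
  define lev where "lev z = nat \<lfloor>ln (sqrt (real n) * z)\<rfloor>" for z :: real
  define S where "S z i = {a\<in>V. 1 \<le> sqrt (real n) * z a \<and> lev (z a) = i}" for z :: "nat \<Rightarrow> real" and i
  define N where "N = nat \<lfloor>ln (real n) / 2\<rfloor>"
  have lev: "exp (real (lev z)) \<le> sqrt (real n) * z" "sqrt (real n) * z < exp (real (lev z) + 1)"
    if "1 \<le> sqrt (real n) * z" for z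
  proof -
    have pos: "0 < sqrt (real n) * z" using that by linarith
    have "0 \<le> ln (sqrt (real n) * z)" using that by simp
    then have "real (lev z) = of_int \<lfloor>ln (sqrt (real n) * z)\<rfloor>" by (simp add: lev_def)
    then have "real (lev z) \<le> ln (sqrt (real n) * z)" "ln (sqrt (real n) * z) < real (lev z) + 1" by linarith+
    then show "exp (real (lev z)) \<le> sqrt (real n) * z" "sqrt (real n) * z < exp (real (lev z) + 1)"
      using pos by (simp_all add: ln_ge_iff) (metis exp_less_cancel_iff exp_ln)
  qed
  have Nub: "2 * real N \<le> ln (real n)"
    using n_pos of_int_floor_le[of "ln (real n) / 2"] unfolding N_def by (simp; linarith)
  have N6: "i + j + 6 \<le> n" if "i \<le> N" "j \<le> N" for i j
  proof -
    have "real (i + j + 6) \<le> real n" using that Nub nbig by simp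
    then show ?thesis by linarith
  qed
  define \<alpha> where "\<alpha> z i = exp (2 * real i) * real (card (S z i)) / real n" for z i
  have \<alpha>0: "0 \<le> \<alpha> z i" for z i by (simp add: \<alpha>_def)
  have sum\<alpha>: "(\<Sum>i\<le>N. \<alpha> z i) \<le> 1" if z: "(\<Sum>a\<in>V. (z a)\<^sup>2) \<le> 1" for z
  proof -
    have "(\<Sum>i\<le>N. \<alpha> z i) \<le> (\<Sum>i\<le>N. \<Sum>a\<in>S z i. (z a)\<^sup>2)"
    proof (rule sum_mono)
      fix i
      have "\<alpha> z i = (\<Sum>a\<in>S z i. exp (2 * real i) / real n)" by (simp add: \<alpha>_def)
      also have "\<dots> \<le> (\<Sum>a\<in>S z i. (z a)\<^sup>2)"
      proof (rule sum_mono)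
        fix a assume a: "a \<in> S z i"
        have "exp (real i) ^ 2 \<le> (sqrt (real n) * z a)\<^sup>2"
          using lev(1)[of "z a"] a by (intro power_mono) (auto simp: S_def)
        then show "exp (2 * real i) / real n \<le> (z a)\<^sup>2"
          unfolding exp_double using n by (simp add: power_mult_distrib field_simps)
      qed
      finally show "\<alpha> z i \<le> (\<Sum>a\<in>S z i. (z a)\<^sup>2)" .
    qed
    also have "\<dots> = (\<Sum>a\<in>(\<Union>i\<in>{..N}. S z i). (z a)\<^sup>2)"
      by (subst sum.UNION_disjoint) (use Vn in \<open>auto simp: S_def\<close>)
    also have "\<dots> \<le> (\<Sum>a\<in>V. (z a)\<^sup>2)" by (rule sum_mono2) (use Vn in \<open>auto simp: S_def\<close>)
    finally show ?thesis using z by simp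
  qed
  have levN: "lev (z a) \<le> N" if "a \<in> V" "(\<Sum>a\<in>V. (z a)\<^sup>2) \<le> 1" "1 \<le> sqrt (real n) * z a" for z a
  proof -
    have "(z a)\<^sup>2 \<le> (\<Sum>a\<in>V. (z a)\<^sup>2)" using that(1) Vn by (intro member_le_sum) auto
    then have "z a \<le> 1" using that(2) by (meson order_trans power2_le_imp_le one_power2 zero_le_one abs_le_D1 abs_square_le_1)
    then have "sqrt (real n) * z a \<le> sqrt (real n)" using n by simp
    then have "ln (sqrt (real n) * z a) \<le> ln (sqrt (real n))" using that(3) n_pos by (subst ln_le_cancel_iff) auto
    also have "\<dots> = ln (real n) / 2" using n by (simp add: ln_sqrt)
    finally show ?thesis unfolding lev_def N_def by (intro nat_mono floor_mono)
  qed
  define near where "near i j \<longleftrightarrow> real i + real j + 2 > q \<and> real i \<le> real j + q + 1 \<and> real j \<le> real i + q + 1" for i j :: nat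
  define tm where "tm i j = (if near i j then exp (real i + real j + 2) / real n * edges_between A (S x i) (S y j) else 0)" for i j
  \<comment> \<open>The bound of \<open>level_pair_bound\<close> without the factor sqrt d, with w
    belonging to the larger set. For fixed j the truncated exponential sums to at most 3 over
    i.\<close>
  define bd where "bd z w i j = 2 * exp 5 * \<alpha> z i * \<alpha> w j + 56 * exp 3 * ((if real i \<le> real j + q + 1 then exp (- (real j + q + 1 - real i) / 2) else 0) * (\<alpha> w j + exp (- real j)))" for z w i j
  have bd0: "0 \<le> bd z w i j" for z w i j by (auto simp: bd_def \<alpha>0 intro!: add_nonneg_nonneg mult_nonneg_nonneg)
  have sumbd: "(\<Sum>i\<le>N. \<Sum>j\<le>N. bd z w i j) \<le> 2 * exp 5 + 1008 * exp 3" 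
    if z: "(\<Sum>a\<in>V. (z a)\<^sup>2) \<le> 1" and w: "(\<Sum>a\<in>V. (w a)\<^sup>2) \<le> 1" for z w
  proof -
    have "(\<Sum>i\<le>N. \<Sum>j\<le>N. 2 * exp 5 * \<alpha> z i * \<alpha> w j) = 2 * exp 5 * ((\<Sum>i\<le>N. \<alpha> z i) * (\<Sum>j\<le>N. \<alpha> w j))"
      unfolding sum_product by (simp add: sum_distrib_left mult.assoc)
    also have "\<dots> \<le> 2 * exp 5 * (1 * 1)"
      by (intro mult_left_mono mult_mono sum\<alpha> z w) (auto intro!: sum_nonneg \<alpha>0)
    finally have 1: "(\<Sum>i\<le>N. \<Sum>j\<le>N. 2 * exp 5 * \<alpha> z i * \<alpha> w j) \<le> 2 * exp 5" by simp
    have "(\<Sum>i\<le>N. \<Sum>j\<le>N. (if real i \<le> real j + q + 1 then exp (- (real j + q + 1 - real i) / 2) else 0) * (\<alpha> w j + exp (- real j)))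
      = (\<Sum>j\<le>N. (\<Sum>i\<le>N. if real i \<le> real j + q + 1 then exp (- (real j + q + 1 - real i) / 2) else 0) * (\<alpha> w j + exp (- real j)))"
      by (subst sum.swap) (simp add: sum_distrib_right)
    also have "\<dots> \<le> (\<Sum>j\<le>N. 3 * (\<alpha> w j + exp (- real j)))"
    proof (intro sum_mono mult_right_mono)
      fix j
      have "(\<Sum>i\<le>N. if real i \<le> real j + q + 1 then exp (- (real j + q + 1 - real i) / 2) else 0)
        = (\<Sum>i\<in>{i\<in>{..N}. real i \<le> real j + q + 1}. exp (- (real j + q + 1 - real i) / 2))"
        by (rule sum.inter_filter[symmetric]) auto
      also have "\<dots> \<le> 3" by (rule sum_exp_half_le) auto
      finally show "(\<Sum>i\<le>N. if real i \<le> real j + q + 1 then exp (- (real j + q + 1 - real i) / 2) else 0) \<le> 3" .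
      show "0 \<le> \<alpha> w j + exp (- real j)" using \<alpha>0[of w j] by simp
    qed
    also have "\<dots> = 3 * ((\<Sum>j\<le>N. \<alpha> w j) + (\<Sum>j\<le>N. exp (- real j)))" by (simp add: sum_distrib_left sum.distrib distrib_left)
    also have "\<dots> \<le> 3 * (1 + 3)" by (intro mult_left_mono add_mono sum\<alpha>[OF w] sum_exp_minus_le) auto
    finally have 2: "(\<Sum>i\<le>N. \<Sum>j\<le>N. (if real i \<le> real j + q + 1 then exp (- (real j + q + 1 - real i) / 2) else 0) * (\<alpha> w j + exp (- real j))) \<le> 18" by simp
    have "(\<Sum>i\<le>N. \<Sum>j\<le>N. bd z w i j) = (\<Sum>i\<le>N. \<Sum>j\<le>N. 2 * exp 5 * \<alpha> z i * \<alpha> w j) + 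
      56 * exp 3 * (\<Sum>i\<le>N. \<Sum>j\<le>N. (if real i \<le> real j + q + 1 then exp (- (real j + q + 1 - real i) / 2) else 0) * (\<alpha> w j + exp (- real j)))"
      unfolding bd_def sum.distrib sum_distrib_left ..
    also have "\<dots> \<le> 2 * exp 5 + 56 * exp 3 * 18" by (intro add_mono 1 mult_left_mono[OF 2]) auto
    finally show ?thesis by simp
  qed
  have tm: "tm i j \<le> sqrt d * (bd x y i j + bd y x j i)" if ijN: "i \<le> N" "j \<le> N" for i j
  proof (cases "near i j \<and> S x i \<noteq> {} \<and> S y j \<noteq> {}")
    case False
    then have "tm i j = 0" by (auto simp: tm_def edges_between_def)
    then show ?thesis using bd0[of x y i j] bd0[of y x j i] sd by simp
  next
    case True
    have sub: "S z i \<subseteq> {..<n}" for z i using Vn by (auto simp: S_def)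
    have \<alpha>1: "\<alpha> z i \<le> 1" if "i \<le> N" "(\<Sum>a\<in>V. (z a)\<^sup>2) \<le> 1" for z i
      using member_le_sum[of i "{..N}" "\<alpha> z"] that sum\<alpha>[OF that(2)] \<alpha>0 by auto
    have nr: "real i + real j + 2 > ln d / 2" "real i \<le> real j + ln d / 2 + 1" "real j \<le> real i + ln d / 2 + 1"
      using True by (auto simp: near_def q_def)
    have tm_eq: "tm i j = exp (real i + real j + 2) / real n * edges_between A (S x i) (S y j)" using True by (simp add: tm_def)
    show ?thesis
    proof (cases "card (S x i) \<le> card (S y j)")
      case le: True
      have "tm i j \<le> sqrt d * bd x y i j"
        unfolding tm_eq bd_def \<alpha>_def q_def
        using level_pair_bound[OF disc sub _ sub _ le nr N6[OF ijN] d1] \<alpha>1[OF ijN(2) y(2)] True nr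
        by (simp add: \<alpha>_def mult.assoc)
      then show ?thesis using bd0[of y x j i] sd by (simp add: distrib_left add_increasing2)
    next
      case False
      \<comment> \<open>\<open>level_pair_bound\<close> wants the larger set second, so x and y
        exchange roles; the term \<open>bd y x j i\<close> is there for this case.\<close>
      then have le: "card (S y j) \<le> card (S x i)" by simp
      have nr': "real j + real i + 2 > ln d / 2" using nr by simp
      have c: "exp (real i + real j + 2) = exp (real j + real i + 2)" by (simp add: add.commute)
      have "tm i j \<le> sqrt d * bd y x j i"
        unfolding tm_eq edges_between_sym[of A "S x i"] bd_def \<alpha>_def q_def c
        using level_pair_bound[OF disc sub _ sub _ le nr' nr(3) nr(2) N6[OF ijN(2,1)] d1] \<alpha>1[OF ijN(1) x(2)] True nr
        by (simp add: \<alpha>_def mult.assoc)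
      then show ?thesis using bd0[of x y i j] sd by (simp add: distrib_left add_increasing)
    qed
  qed
  define hv where "hv a b \<longleftrightarrow> x a * y b > sqrt d / real n" for a b
  \<comment> \<open>The balanced heavy pairs; in any other heavy pair one coordinate is at least
    sqrt d times the other.\<close>
  define c3 where "c3 a b \<longleftrightarrow> hv a b \<and> x a < sqrt d * y b \<and> y b < sqrt d * x a" for a b
  have "(\<Sum>a\<in>V. \<Sum>b\<in>V. (if hv a b then x a * y b * adj A a b else 0)) \<le>
     (\<Sum>a\<in>V. \<Sum>b\<in>V. (x a)\<^sup>2 / sqrt d * adj A a b + (y b)\<^sup>2 / sqrt d * adj A b a + (if c3 a b then x a * y b * adj A a b else 0))"
  proof (intro sum_mono)
    fix a b assume ab: "a \<in> V" "b \<in> V"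
    have pos: "0 \<le> x a" "0 \<le> y b" using x y ab by auto
    have r: "0 \<le> (x a)\<^sup>2 / sqrt d * adj A a b" "0 \<le> (y b)\<^sup>2 / sqrt d * adj A b a" using sd by auto
    show "(if hv a b then x a * y b * adj A a b else 0) \<le> (x a)\<^sup>2 / sqrt d * adj A a b + (y b)\<^sup>2 / sqrt d * adj A b a + (if c3 a b then x a * y b * adj A a b else 0)"
    proof (cases "hv a b \<and> \<not> c3 a b")
      case False then show ?thesis using r by (auto simp: c3_def)
    next
      case True
      then consider "sqrt d * y b \<le> x a" | "sqrt d * x a \<le> y b" by (fastforce simp: c3_def)
      then show ?thesis
      proof cases
        case 1
        then have "x a * (sqrt d * y b) \<le> x a * x a" using pos by (intro mult_left_mono)
        then have "x a * y b \<le> (x a)\<^sup>2 / sqrt d" using sd by (simp add: field_simps power2_eq_square)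
        then have "x a * y b * adj A a b \<le> (x a)\<^sup>2 / sqrt d * adj A a b" by (intro mult_right_mono) auto
        then show ?thesis using True r by auto
      next
        case 2
        then have "y b * (sqrt d * x a) \<le> y b * y b" using pos by (intro mult_left_mono)
        then have "x a * y b \<le> (y b)\<^sup>2 / sqrt d" using sd by (simp add: field_simps power2_eq_square)
        then have "x a * y b * adj A a b \<le> (y b)\<^sup>2 / sqrt d * adj A b a"
          unfolding adj_sym[of A a b] by (intro mult_right_mono) auto
        then show ?thesis using True r by auto
      qed
    qed
  qed
  also have "\<dots> = (\<Sum>a\<in>V. (x a)\<^sup>2 / sqrt d * (\<Sum>b\<in>V. adj A a b)) + (\<Sum>b\<in>V. (y b)\<^sup>2 / sqrt d * (\<Sum>a\<in>V. adj A b a))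
     + (\<Sum>a\<in>V. \<Sum>b\<in>V. if c3 a b then x a * y b * adj A a b else 0)"
    unfolding sum.distrib sum_distrib_left by (subst (2) sum.swap) simp
  also have "\<dots> \<le> 320 * sqrt d + 320 * sqrt d + sqrt d * (2 * (2 * exp 5 + 1008 * exp 3))"
  proof (intro add_mono)
    have g: "(\<Sum>a\<in>V. (z a)\<^sup>2 / sqrt d * (\<Sum>b\<in>V. adj A a b)) \<le> 320 * sqrt d" if "(\<Sum>a\<in>V. (z a)\<^sup>2) \<le> 1" for z
    proof -
      have "(\<Sum>a\<in>V. (z a)\<^sup>2 / sqrt d * (\<Sum>b\<in>V. adj A a b)) \<le> (\<Sum>a\<in>V. (z a)\<^sup>2 / sqrt d * (320 * d))"
        using deg sd by (intro sum_mono mult_left_mono) auto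
      also have "\<dots> = (\<Sum>a\<in>V. (z a)\<^sup>2) * (320 * d / sqrt d)" by (simp add: sum_distrib_right sum_divide_distrib)
      also have "\<dots> \<le> 1 * (320 * d / sqrt d)" using that d_pos sd by (intro mult_right_mono) auto
      also have "\<dots> = 320 * (d / sqrt d)" by simp
      also have "\<dots> = 320 * sqrt d" using d_pos by (subst real_div_sqrt) auto
      finally show ?thesis .
    qed
    show "(\<Sum>a\<in>V. (x a)\<^sup>2 / sqrt d * (\<Sum>b\<in>V. adj A a b)) \<le> 320 * sqrt d" by (rule g[OF x(2)])
    show "(\<Sum>a\<in>V. (y a)\<^sup>2 / sqrt d * (\<Sum>b\<in>V. adj A a b)) \<le> 320 * sqrt d" by (rule g[OF y(2)])
    have c3_lev: "1 \<le> sqrt (real n) * x a" "1 \<le> sqrt (real n) * y b" "near (lev (x a)) (lev (y b))" if c: "c3 a b" "a \<in> V" "b \<in> V" for a b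
    proof -
      have pos: "0 \<le> x a" "0 \<le> y b" using x y c by auto
      have h: "sqrt d / real n < x a * y b" "x a < sqrt d * y b" "y b < sqrt d * x a" using c by (auto simp: c3_def hv_def)
      \<comment> \<open>From w < sqrt d z and z w > sqrt d / n it follows that z^2 > 1 / n; hence
        both coordinates of a balanced heavy pair have a level.\<close>
      have one: "1 \<le> sqrt (real n) * z" if "sqrt d / real n < z * w" "w < sqrt d * z" "0 \<le> z" for z w
      proof -
        have "z * w \<le> z * (sqrt d * z)" using that by (intro mult_left_mono) auto
        then have "sqrt d * (1 / real n) < sqrt d * z\<^sup>2" using that by (simp add: power2_eq_square algebra_simps)
        then have "1 / real n < z\<^sup>2" by (rule mult_left_less_imp_less) (use sd in simp)
        then have "1 < (sqrt (real n) * z)\<^sup>2" using n by (simp add: power_mult_distrib field_simps)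
        then show ?thesis using power_le_one[of "sqrt (real n) * z" 2] that(3) by (meson linorder_not_le mult_nonneg_nonneg of_nat_0_le_iff real_sqrt_ge_zero less_imp_le)
      qed
      show 1: "1 \<le> sqrt (real n) * x a" by (rule one[OF h(1) h(3) pos(1)])
      show 2: "1 \<le> sqrt (real n) * y b" by (rule one[of "y b" "x a"]) (use h pos in \<open>auto simp: mult.commute\<close>)
      have sn: "0 < sqrt (real n)" using n by simp
      show "near (lev (x a)) (lev (y b))" unfolding near_def
      proof (intro conjI)
        have "sqrt d < (sqrt (real n) * x a) * (sqrt (real n) * y b)" using h(1) n by (simp add: field_simps)
        also have "\<dots> \<le> exp (real (lev (x a)) + 1) * exp (real (lev (y b)) + 1)"
          using lev(2)[OF 1] lev(2)[OF 2] 1 2 by (intro mult_mono) auto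
        also have "\<dots> = exp (real (lev (x a)) + real (lev (y b)) + 2)" by (simp add: exp_add[symmetric])
        finally show "q < real (lev (x a)) + real (lev (y b)) + 2" unfolding q(1)[symmetric] by simp
        have "exp (real (lev (x a))) \<le> sqrt (real n) * x a" by (rule lev(1)[OF 1])
        also have "\<dots> \<le> sqrt d * (sqrt (real n) * y b)" using h(2) sn by (simp add: mult_ac)
        also have "\<dots> \<le> exp q * exp (real (lev (y b)) + 1)" unfolding q(1) using lev(2)[OF 2] sd by (intro mult_left_mono) auto
        also have "\<dots> = exp (real (lev (y b)) + q + 1)" by (simp add: exp_add[symmetric])
        finally show "real (lev (x a)) \<le> real (lev (y b)) + q + 1" by simp
        have "exp (real (lev (y b))) \<le> sqrt (real n) * y b" by (rule lev(1)[OF 2])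
        also have "\<dots> \<le> sqrt d * (sqrt (real n) * x a)" using h(3) sn by (simp add: mult_ac)
        also have "\<dots> \<le> exp q * exp (real (lev (x a)) + 1)" unfolding q(1) using lev(2)[OF 1] sd by (intro mult_left_mono) auto
        also have "\<dots> = exp (real (lev (x a)) + q + 1)" by (simp add: exp_add[symmetric])
        finally show "real (lev (y b)) \<le> real (lev (x a)) + q + 1" by simp
      qed
    qed
    have "(\<Sum>a\<in>V. \<Sum>b\<in>V. if c3 a b then x a * y b * adj A a b else 0) \<le> 
      (\<Sum>a\<in>V. \<Sum>b\<in>V. \<Sum>i\<le>N. \<Sum>j\<le>N. if near i j \<and> a \<in> S x i \<and> b \<in> S y j then exp (real i + real j + 2) / real n * adj A a b else 0)"
    proof (intro sum_mono)
      fix a b assume ab: "a \<in> V" "b \<in> V"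
      let ?f = "\<lambda>i j. if near i j \<and> a \<in> S x i \<and> b \<in> S y j then exp (real i + real j + 2) / real n * adj A a b else 0"
      have nn: "0 \<le> ?f i j" for i j by simp
      show "(if c3 a b then x a * y b * adj A a b else 0) \<le> (\<Sum>i\<le>N. \<Sum>j\<le>N. ?f i j)"
      proof (cases "c3 a b")
        case False then show ?thesis by (simp add: sum_nonneg)
      next
        case True
        note c = c3_lev[OF True ab]
        let ?i = "lev (x a)" and ?j = "lev (y b)"
        have m: "?i \<le> N" "?j \<le> N" using levN[OF ab(1) x(2) c(1)] levN[OF ab(2) y(2) c(2)] .
        have "(sqrt (real n) * x a) * (sqrt (real n) * y b) \<le> exp (real ?i + 1) * exp (real ?j + 1)"
          using lev(2)[OF c(1)] lev(2)[OF c(2)] c(1,2) by (intro mult_mono) auto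
        then have "x a * y b \<le> exp (real ?i + real ?j + 2) / real n" using n by (simp add: exp_add[symmetric] field_simps)
        then have "x a * y b * adj A a b \<le> exp (real ?i + real ?j + 2) / real n * adj A a b" by (rule mult_right_mono) simp
        also have "\<dots> = ?f ?i ?j" using c ab by (simp add: S_def)
        also have "\<dots> \<le> (\<Sum>j\<le>N. ?f ?i j)" using member_le_sum[of ?j "{..N}" "?f ?i"] m nn by auto
        also have "\<dots> \<le> (\<Sum>i\<le>N. \<Sum>j\<le>N. ?f i j)" using member_le_sum[of ?i "{..N}" "\<lambda>i. \<Sum>j\<le>N. ?f i j"] m nn by (auto simp: sum_nonneg)
        finally show ?thesis using True by simp
      qed
    qed
    also have "\<dots> = (\<Sum>i\<le>N. \<Sum>j\<le>N. \<Sum>a\<in>V. \<Sum>b\<in>V. if near i j \<and> a \<in> S x i \<and> b \<in> S y j then exp (real i + real j + 2) / real n * adj A a b else 0)"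
      by (rule sum_swap4)
    also have "\<dots> = (\<Sum>i\<le>N. \<Sum>j\<le>N. tm i j)"
    proof (intro sum.cong refl)
      fix i j
      have SV: "S z i \<subseteq> V" for z i by (auto simp: S_def)
      have "(\<Sum>a\<in>V. \<Sum>b\<in>V. if near i j \<and> a \<in> S x i \<and> b \<in> S y j then exp (real i + real j + 2) / real n * adj A a b else 0)
        = (\<Sum>a\<in>S x i. \<Sum>b\<in>V. if near i j \<and> a \<in> S x i \<and> b \<in> S y j then exp (real i + real j + 2) / real n * adj A a b else 0)"
        by (rule sum.mono_neutral_right) (use Vn SV in auto)
      also have "\<dots> = (\<Sum>a\<in>S x i. \<Sum>b\<in>S y j. if near i j \<and> a \<in> S x i \<and> b \<in> S y j then exp (real i + real j + 2) / real n * adj A a b else 0)"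
        by (intro sum.cong refl sum.mono_neutral_right) (use Vn SV in auto)
      also have "\<dots> = (\<Sum>a\<in>S x i. \<Sum>b\<in>S y j. if near i j then exp (real i + real j + 2) / real n * adj A a b else 0)"
        by (intro sum.cong refl) auto
      also have "\<dots> = tm i j" by (simp add: tm_def edges_between_def sum_distrib_left)
      finally show "(\<Sum>a\<in>V. \<Sum>b\<in>V. if near i j \<and> a \<in> S x i \<and> b \<in> S y j then exp (real i + real j + 2) / real n * adj A a b else 0) = tm i j" .
    qed
    also have "\<dots> \<le> (\<Sum>i\<le>N. \<Sum>j\<le>N. sqrt d * (bd x y i j + bd y x j i))"
      by (intro sum_mono tm) auto
    also have "\<dots> = sqrt d * ((\<Sum>i\<le>N. \<Sum>j\<le>N. bd x y i j) + (\<Sum>j\<le>N. \<Sum>i\<le>N. bd y x j i))"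
      by (subst (3) sum.swap) (simp add: sum_distrib_left sum.distrib distrib_left)
    also have "\<dots> \<le> sqrt d * ((2 * exp 5 + 1008 * exp 3) + (2 * exp 5 + 1008 * exp 3))"
      using sd by (intro mult_left_mono add_mono sumbd x(2) y(2)) auto
    finally show "(\<Sum>a\<in>V. \<Sum>b\<in>V. if c3 a b then x a * y b * adj A a b else 0) \<le> sqrt d * (2 * (2 * exp 5 + 1008 * exp 3))" by simp
  qed
  also have "\<dots> = heavy_const * sqrt d" by (simp add: heavy_const_def algebra_simps)
  finally show ?thesis by (simp add: hv_def)
qed

end

section \<open>The operator norm of the noise on nodes of moderate degree\<close>

text \<open>82 collects 80 for the light pairs, 1 for the mean inside the heavy pairs and 1 for the
  diagonal of \<open>W\<close>; the factor 2 is lost in passing from the net to the ball.\<close>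

definition op_const :: real where "op_const = 2 * (82 + heavy_const)"

lemma op_const_pos: "0 < op_const" by (simp add: op_const_def heavy_const_def add_pos_pos)

context random_graph
begin

text \<open>The diagonal is - M a a rather than 0. In a block model \<open>adj\<close> is then
  exactly a matrix constant on blocks plus \<open>W\<close>, and the expansions below need no
  diagonal correction.\<close>

definition W :: "(nat \<times> nat) set \<Rightarrow> nat \<Rightarrow> nat \<Rightarrow> real" where
  "W A a b = adj A a b - M a b"

lemma W_sym: "a < n \<Longrightarrow> b < n \<Longrightarrow> W A a b = W A b a"
  using M_sym adj_sym by (auto simp: W_def)

lemma abs_W_le: "a < n \<Longrightarrow> b < n \<Longrightarrow> \<bar>W A a b\<bar> \<le> adj A a b + L"
  using M_nonneg[of a b] M_le_L[of a b] adj_nonneg[of A a b] L_pos unfolding W_def abs_le_iff by linarith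

lemma W_eq_E: "A \<subseteq> pairs n \<Longrightarrow> W A a b = E A a b - (if a = b then M a b else 0)"
  by (auto simp: W_def E_def adj_diag)

lemma M_diag_le: "a < n \<Longrightarrow> M a a \<le> sqrt d"
proof -
  assume a: "a < n"
  have "M a a * M a a \<le> 1 * L" using M_nonneg[OF a a] M_le_1[OF a a] M_le_L[OF a a] by (intro mult_mono) auto
  also have "\<dots> \<le> d" using n_pos L_pos by (simp add: d_def)
  finally show ?thesis by (intro real_le_rsqrt) (simp add: power2_eq_square)
qed

lemma quadratic_form_lattice:
  assumes A: "A \<subseteq> pairs n" and light: "light_bounded A" and disc: "discrepancy_bounded A" and V: "V \<subseteq> good_nodes A"
    and k: "k \<in> lattice" "\<And>a. a < n \<Longrightarrow> a \<notin> V \<Longrightarrow> k a = 0"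
    and k': "k' \<in> lattice" "\<And>a. a < n \<Longrightarrow> a \<notin> V \<Longrightarrow> k' a = 0"
    and d1: "1 \<le> d" and nbig: "ln (real n) + 6 \<le> real n"
  shows "\<bar>\<Sum>a\<in>V. \<Sum>b\<in>V. lat_vec k a * lat_vec k' b * W A a b\<bar> \<le> (82 + heavy_const) * sqrt d"
proof -
  have Vn: "V \<subseteq> {..<n}" "finite V" using V good_nodes by (auto intro: finite_subset)
  define x where "x = lat_vec k"
  define y where "y = lat_vec k'"
  have n: "0 < real n" using n_pos by simp
  have sd: "0 < sqrt d" using d1 by auto
  have x0: "x a = 0" if "a < n" "a \<notin> V" for a using k(2)[OF that] by (simp add: x_def lat_vec_def)
  have y0: "y a = 0" if "a < n" "a \<notin> V" for a using k'(2)[OF that] by (simp add: y_def lat_vec_def)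
  have x1: "(\<Sum>a\<in>V. (x a)\<^sup>2) \<le> 1"
    using sum_mono2[OF _ Vn(1), of "\<lambda>a. (x a)\<^sup>2"] sum_sq_lat_vec[OF k(1)] by (auto simp: x_def)
  have y1: "(\<Sum>a\<in>V. (y a)\<^sup>2) \<le> 1"
    using sum_mono2[OF _ Vn(1), of "\<lambda>a. (y a)\<^sup>2"] sum_sq_lat_vec[OF k'(1)] by (auto simp: y_def)
  define hvy where "hvy z = (if \<bar>z\<bar> > sqrt d / real n then z else 0)" for z
  have lh: "z = light z + hvy z" for z by (simp add: light_def hvy_def)
  have restr: "(\<Sum>a<n. \<Sum>b<n. f (x a * y b) * E A a b) = (\<Sum>a\<in>V. \<Sum>b\<in>V. f (x a * y b) * E A a b)" if "f 0 = 0" for f :: "real \<Rightarrow> real"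
  proof -
    have "(\<Sum>a<n. \<Sum>b<n. f (x a * y b) * E A a b) = (\<Sum>a\<in>V. \<Sum>b<n. f (x a * y b) * E A a b)"
      by (rule sum.mono_neutral_right) (use Vn x0 that in \<open>auto intro!: sum.neutral\<close>)
    also have "\<dots> = (\<Sum>a\<in>V. \<Sum>b\<in>V. f (x a * y b) * E A a b)"
      by (intro sum.cong refl sum.mono_neutral_right) (use Vn y0 that in auto)
    finally show ?thesis .
  qed
  have "(\<Sum>a\<in>V. \<Sum>b\<in>V. x a * y b * W A a b) = (\<Sum>a\<in>V. \<Sum>b\<in>V. x a * y b * E A a b) - (\<Sum>a\<in>V. \<Sum>b\<in>V. if a = b then x a * y b * M a b else 0)"
    unfolding sum_subtractf[symmetric] W_eq_E[OF A] by (intro sum.cong refl) (auto simp: algebra_simps)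
  also have "(\<Sum>a\<in>V. \<Sum>b\<in>V. x a * y b * E A a b) = (\<Sum>a\<in>V. \<Sum>b\<in>V. light (x a * y b) * E A a b) + (\<Sum>a\<in>V. \<Sum>b\<in>V. hvy (x a * y b) * E A a b)"
    unfolding sum.distrib[symmetric] distrib_right[symmetric] lh[symmetric] ..
  also have "(\<Sum>a\<in>V. \<Sum>b\<in>V. if a = b then x a * y b * M a b else 0) = (\<Sum>a\<in>V. x a * y a * M a a)"
    using Vn by simp
  finally have eq: "(\<Sum>a\<in>V. \<Sum>b\<in>V. x a * y b * W A a b) = (\<Sum>a\<in>V. \<Sum>b\<in>V. light (x a * y b) * E A a b) + (\<Sum>a\<in>V. \<Sum>b\<in>V. hvy (x a * y b) * E A a b)
     - (\<Sum>a\<in>V. x a * y a * M a a)" .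
  have 1: "\<bar>\<Sum>a\<in>V. \<Sum>b\<in>V. light (x a * y b) * E A a b\<bar> \<le> 80 * sqrt d"
  proof -
    have "light 0 = 0" by (simp add: light_def)
    from restr[of light, OF this] light[unfolded light_bounded_def, rule_format, OF k(1) k'(1)]
    show ?thesis by (simp add: x_def y_def)
  qed
  have 3: "\<bar>\<Sum>a\<in>V. x a * y a * M a a\<bar> \<le> sqrt d"
  proof -
    have "\<bar>\<Sum>a\<in>V. x a * y a * M a a\<bar> \<le> (\<Sum>a\<in>V. ((x a)\<^sup>2 + (y a)\<^sup>2) / 2 * sqrt d)"
    proof (rule order_trans[OF sum_abs sum_mono])
      fix a assume "a \<in> V"
      then have a: "a < n" using Vn by auto
      have "2 * (\<bar>x a\<bar> * \<bar>y a\<bar>) \<le> (x a)\<^sup>2 + (y a)\<^sup>2"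
        using sum_squares_ge_zero[of "\<bar>x a\<bar> - \<bar>y a\<bar>" 0] by (simp add: power2_eq_square algebra_simps)
      then have "\<bar>x a * y a\<bar> \<le> ((x a)\<^sup>2 + (y a)\<^sup>2) / 2" by (simp add: abs_mult)
      then show "\<bar>x a * y a * M a a\<bar> \<le> ((x a)\<^sup>2 + (y a)\<^sup>2) / 2 * sqrt d"
        using M_diag_le[OF a] M_nonneg[OF a a] unfolding abs_mult[of "x a * y a"] by (intro mult_mono) auto
    qed
    also have "\<dots> = ((\<Sum>a\<in>V. (x a)\<^sup>2) + (\<Sum>a\<in>V. (y a)\<^sup>2)) / 2 * sqrt d"
      by (simp add: sum.distrib[symmetric] sum_divide_distrib sum_distrib_right)
    also have "\<dots> \<le> (1 + 1) / 2 * sqrt d" using x1 y1 sd by (intro mult_right_mono divide_right_mono add_mono) auto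
    finally show ?thesis by simp
  qed
  have 2: "\<bar>\<Sum>a\<in>V. \<Sum>b\<in>V. hvy (x a * y b) * E A a b\<bar> \<le> heavy_const * sqrt d + sqrt d"
  proof -
    let ?x = "\<lambda>a. \<bar>x a\<bar>" and ?y = "\<lambda>a. \<bar>y a\<bar>"
    have "\<bar>\<Sum>a\<in>V. \<Sum>b\<in>V. hvy (x a * y b) * E A a b\<bar> \<le> (\<Sum>a\<in>V. \<Sum>b\<in>V. \<bar>hvy (x a * y b) * E A a b\<bar>)"
      by (rule order_trans[OF sum_abs sum_mono[OF sum_abs]])
    also have "\<dots> \<le> (\<Sum>a\<in>V. \<Sum>b\<in>V. (if ?x a * ?y b > sqrt d / real n then ?x a * ?y b * adj A a b else 0) + (x a)\<^sup>2 * (y b)\<^sup>2 * sqrt d)"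
    proof (intro sum_mono)
      fix a b assume "a \<in> V" "b \<in> V"
      then have ab: "a < n" "b < n" using Vn by auto
      show "\<bar>hvy (x a * y b) * E A a b\<bar> \<le> (if ?x a * ?y b > sqrt d / real n then ?x a * ?y b * adj A a b else 0) + (x a)\<^sup>2 * (y b)\<^sup>2 * sqrt d"
      proof (cases "?x a * ?y b > sqrt d / real n")
        case False then show ?thesis using sd by (simp add: hvy_def abs_mult)
      next
        case True
        have "\<bar>hvy (x a * y b) * E A a b\<bar> \<le> ?x a * ?y b * (adj A a b + L)"
          using True abs_E_le[OF ab] by (auto simp: hvy_def abs_mult intro!: mult_left_mono)
        \<comment> \<open>On a heavy pair sqrt d / n is less than |x_a y_b|, and L = (sqrt d / n)
          sqrt d; one factor is traded for |x_a y_b|, whose square is summable over the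
          pairs.\<close>
        moreover have "?x a * ?y b * L \<le> (x a)\<^sup>2 * (y b)\<^sup>2 * sqrt d"
        proof -
          have "?x a * ?y b * (sqrt d / real n) \<le> ?x a * ?y b * (?x a * ?y b)" using True by (intro mult_left_mono) auto
          then have "?x a * ?y b * (sqrt d / real n) * sqrt d \<le> ?x a * ?y b * (?x a * ?y b) * sqrt d" using sd by (intro mult_right_mono) auto
          moreover have "?x a * ?y b * (sqrt d / real n) * sqrt d = ?x a * ?y b * L"
          proof -
            have "sqrt d / real n * sqrt d = (sqrt d * sqrt d) / real n" by simp
            also have "sqrt d * sqrt d = d" using d_pos by simp
            also have "d / real n = L" using n by (simp add: d_def)
            finally show ?thesis unfolding mult.assoc by (simp only:)
          qed
          moreover have "?x a * ?y b * (?x a * ?y b) = (x a)\<^sup>2 * (y b)\<^sup>2"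
            unfolding power2_abs[of "x a", symmetric] power2_abs[of "y b", symmetric] power2_eq_square by (simp only: mult_ac)
          ultimately show ?thesis by simp
        qed
        ultimately show ?thesis using True by (simp add: distrib_left)
      qed
    qed
    also have "\<dots> = (\<Sum>a\<in>V. \<Sum>b\<in>V. (if ?x a * ?y b > sqrt d / real n then ?x a * ?y b * adj A a b else 0)) + (\<Sum>a\<in>V. (x a)\<^sup>2) * (\<Sum>b\<in>V. (y b)\<^sup>2) * sqrt d"
    proof -
      have "(\<Sum>a\<in>V. (x a)\<^sup>2) * (\<Sum>b\<in>V. (y b)\<^sup>2) * sqrt d = (\<Sum>a\<in>V. \<Sum>b\<in>V. (x a)\<^sup>2 * (y b)\<^sup>2 * sqrt d)"
        by (simp only: sum_product) (simp only: sum_distrib_right)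
      then show ?thesis by (simp only: sum.distrib)
    qed
    also have "\<dots> \<le> heavy_const * sqrt d + 1 * 1 * sqrt d"
      by (intro add_mono mult_mono heavy_bound disc V d1 nbig) (use x1 y1 sd in \<open>auto intro: sum_nonneg\<close>)
    finally show ?thesis by simp
  qed
  show ?thesis using 1 2 3 eq unfolding x_def y_def by (simp add: algebra_simps)
qed


lemma lattice_approx:
  fixes x :: "nat \<Rightarrow> real"
  assumes V: "V \<subseteq> {..<n}" and x: "(\<Sum>a\<in>V. (x a)\<^sup>2) \<le> 1"
  obtains k where "k \<in> lattice" "\<And>a. a < n \<Longrightarrow> a \<notin> V \<Longrightarrow> k a = 0"
    "(\<Sum>a\<in>V. (lat_vec k a)\<^sup>2) \<le> 1" "(\<Sum>a\<in>V. (4 * (x a - lat_vec k a))\<^sup>2) \<le> 1"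
proof -
  have fV: "finite V" using V finite_subset by auto
  define r where "r = 4 * sqrt (real n)"
  have r: "0 < r" "r\<^sup>2 = 16 * real n" using n_pos by (auto simp: r_def power_mult_distrib)
  \<comment> \<open>Rounding towards zero does not increase absolute values, so the lattice point
    stays in the unit ball. The error per coordinate is at most 1 / (4 sqrt n), whence the factor 4
    in the last conclusion.\<close>
  define tr where "tr z = (if 0 \<le> z then \<lfloor>z\<rfloor> else - \<lfloor>- z\<rfloor>)" for z :: real
  have tr: "\<bar>real_of_int (tr z)\<bar> \<le> \<bar>z\<bar>" "\<bar>z - real_of_int (tr z)\<bar> \<le> 1" for z
    unfolding tr_def by (cases "0 \<le> z"; simp add: abs_le_iff; linarith)+
  define k where "k = restrict (\<lambda>a. if a \<in> V then tr (r * x a) else 0) {..<n}"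
  have kV: "k a = tr (r * x a)" if "a \<in> V" for a using that V by (auto simp: k_def)
  have k0: "k a = 0" if "a < n" "a \<notin> V" for a using that by (auto simp: k_def)
  have sq: "(real_of_int (k a))\<^sup>2 \<le> 16 * real n * (x a)\<^sup>2" if "a \<in> V" for a
  proof -
    have "\<bar>real_of_int (k a)\<bar>\<^sup>2 \<le> \<bar>r * x a\<bar>\<^sup>2" unfolding kV[OF that] by (rule power_mono[OF tr(1)]) simp
    then show ?thesis by (simp add: power_mult_distrib r)
  qed
  have lv: "lat_vec k a = real_of_int (k a) / r" for a by (simp add: lat_vec_def r_def)
  have s: "(\<Sum>a<n. (real_of_int (k a))\<^sup>2) \<le> 16 * real n"
  proof -
    have "(\<Sum>a<n. (real_of_int (k a))\<^sup>2) = (\<Sum>a\<in>V. (real_of_int (k a))\<^sup>2)"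
      by (rule sum.mono_neutral_right) (use V k0 in auto)
    also have "\<dots> \<le> (\<Sum>a\<in>V. 16 * real n * (x a)\<^sup>2)" by (rule sum_mono) (rule sq)
    also have "\<dots> \<le> 16 * real n * 1" unfolding sum_distrib_left[symmetric] by (intro mult_left_mono x) auto
    finally show ?thesis by simp
  qed
  have "k \<in> lattice"
  proof -
    have "k a \<in> {- int (16 * n)..int (16 * n)}" if "a < n" for a
    proof -
      have "(real_of_int (k a))\<^sup>2 \<le> 16 * real n"
        using member_le_sum[of a "{..<n}" "\<lambda>a. (real_of_int (k a))\<^sup>2"] that s by auto
      then have "real_of_int ((k a)\<^sup>2) \<le> real_of_int (int (16 * n))" by simp
      then have "(k a)\<^sup>2 \<le> int (16 * n)" by (simp only: of_int_le_iff)
      moreover have "\<bar>k a\<bar> \<le> (k a)\<^sup>2" 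
      proof (cases "k a = 0")
        case False
        then have "\<bar>k a\<bar> * 1 \<le> \<bar>k a\<bar> * \<bar>k a\<bar>" by (intro mult_left_mono) auto
        then show ?thesis by (simp add: power2_eq_square)
      qed simp
      ultimately show ?thesis by auto
    qed
    moreover have "k \<in> extensional {..<n}" by (simp add: k_def)
    ultimately show ?thesis using s by (auto simp: lattice_def PiE_iff)
  qed
  moreover have "(\<Sum>a\<in>V. (lat_vec k a)\<^sup>2) \<le> 1"
  proof -
    have "(\<Sum>a\<in>V. (lat_vec k a)\<^sup>2) \<le> (\<Sum>a\<in>V. (x a)\<^sup>2)"
    proof (rule sum_mono)
      fix a assume "a \<in> V"
      then show "(lat_vec k a)\<^sup>2 \<le> (x a)\<^sup>2" using sq[of a] n_pos by (simp add: lv power_divide r field_simps)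
    qed
    then show ?thesis using x by linarith
  qed
  moreover have "(\<Sum>a\<in>V. (4 * (x a - lat_vec k a))\<^sup>2) \<le> 1"
  proof -
    have "(\<Sum>a\<in>V. (4 * (x a - lat_vec k a))\<^sup>2) \<le> (\<Sum>a\<in>V. 1 / real n)"
    proof (rule sum_mono)
      fix a assume a: "a \<in> V"
      have "4 * (x a - lat_vec k a) = 4 / r * (r * x a - real_of_int (k a))" using r by (simp add: lv field_simps)
      then have "(4 * (x a - lat_vec k a))\<^sup>2 = (4 / r)\<^sup>2 * \<bar>r * x a - real_of_int (k a)\<bar>\<^sup>2" by (simp only: power_mult_distrib power2_abs)
      also have "\<dots> \<le> (4 / r)\<^sup>2 * 1\<^sup>2" unfolding kV[OF a] by (intro mult_left_mono power_mono tr(2)) auto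
      also have "\<dots> = 1 / real n" using n_pos by (simp add: power_divide r)
      finally show "(4 * (x a - lat_vec k a))\<^sup>2 \<le> 1 / real n" .
    qed
    also have "\<dots> = real (card V) / real n" by simp
    also have "\<dots> \<le> 1" using card_mono[of "{..<n}" V] V n_pos by simp
    finally show ?thesis .
  qed
  ultimately show ?thesis using that k0 by blast
qed

text \<open>Net argument for bilinear forms: replacing x and then y by lattice points costs a
  quarter of the supremum each, so the supremum over the ball is at most twice the bound on the
  net.\<close>

lemma op_norm_bound:
  assumes A: "A \<subseteq> pairs n" and light: "light_bounded A" and disc: "discrepancy_bounded A" and V: "V \<subseteq> good_nodes A"
    and d1: "1 \<le> d" and nbig: "ln (real n) + 6 \<le> real n"
  shows "\<bar>\<Sum>a\<in>V. \<Sum>b\<in>V. x a * y b * W A a b\<bar> \<le> op_const * sqrt d * (sqrt (\<Sum>a\<in>V. (x a)\<^sup>2) * sqrt (\<Sum>a\<in>V. (y a)\<^sup>2))"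
proof -
  have Vn: "V \<subseteq> {..<n}" "finite V" using V good_nodes by (auto intro: finite_subset)
  define F where "F x y = (\<Sum>a\<in>V. \<Sum>b\<in>V. x a * y b * W A a b)" for x y :: "nat \<Rightarrow> real"
  define \<beta> where "\<beta> = (82 + heavy_const) * sqrt d"
  define U where "U = {x :: nat \<Rightarrow> real. (\<Sum>a\<in>V. (x a)\<^sup>2) \<le> 1}"
  have F_add: "F (\<lambda>a. x a + x' a) y = F x y + F x' y" "F x (\<lambda>a. y a + y' a) = F x y + F x y'" for x x' y y'
    by (simp_all add: F_def sum.distrib[symmetric] algebra_simps)
  have F_scale: "F (\<lambda>a. c * x a) y = c * F x y" "F x (\<lambda>a. c * y a) = c * F x y" for c x y
    by (simp_all add: F_def sum_distrib_left mult_ac)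
  define B where "B = (\<lambda>(x, y). \<bar>F x y\<bar>) ` (U \<times> U)"
  \<comment> \<open>Finiteness of the supremum is required before half of it can be absorbed on the
    left.\<close>
  have bdd: "bdd_above B"
  proof (rule bdd_aboveI)
    fix z assume "z \<in> B"
    then obtain x y where z: "z = \<bar>F x y\<bar>" and xy: "x \<in> U" "y \<in> U" by (auto simp: B_def)
    have le1: "\<bar>w a\<bar> \<le> 1" if "w \<in> U" "a \<in> V" for w a
    proof -
      have "(w a)\<^sup>2 \<le> (\<Sum>a\<in>V. (w a)\<^sup>2)" using that(2) Vn by (intro member_le_sum) auto
      then have "(w a)\<^sup>2 \<le> 1" using that(1) by (simp add: U_def)
      then show ?thesis by (simp add: abs_square_le_1)
    qed
    have "z \<le> (\<Sum>a\<in>V. \<Sum>b\<in>V. \<bar>x a * y b * W A a b\<bar>)"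
      unfolding z F_def by (rule order_trans[OF sum_abs sum_mono[OF sum_abs]])
    also have "\<dots> \<le> (\<Sum>a\<in>V. \<Sum>b\<in>V. 1 * 1 * \<bar>W A a b\<bar>)"
      unfolding abs_mult by (intro sum_mono mult_right_mono mult_mono) (use le1 xy in auto)
    finally show "z \<le> (\<Sum>a\<in>V. \<Sum>b\<in>V. 1 * 1 * \<bar>W A a b\<bar>)" .
  qed
  define \<Lambda> where "\<Lambda> = Sup B"
  have U0: "(\<lambda>_. 0) \<in> U" by (simp add: U_def)
  have le: "\<bar>F x y\<bar> \<le> \<Lambda>" if "x \<in> U" "y \<in> U" for x y
    unfolding \<Lambda>_def by (rule cSup_upper[OF _ bdd]) (use that in \<open>auto simp: B_def\<close>)
  have "\<Lambda> \<le> \<beta> + \<Lambda> / 2" unfolding \<Lambda>_def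
  proof (rule cSup_least)
    show "B \<noteq> {}" using U0 by (auto simp: B_def)
    fix z assume "z \<in> B"
    then obtain x y where z: "z = \<bar>F x y\<bar>" and xy: "x \<in> U" "y \<in> U" by (auto simp: B_def)
    obtain k where k: "k \<in> lattice" "\<And>a. a < n \<Longrightarrow> a \<notin> V \<Longrightarrow> k a = 0" "lat_vec k \<in> U" "(\<lambda>a. 4 * (x a - lat_vec k a)) \<in> U"
      using lattice_approx[OF Vn(1), of x] xy unfolding U_def by auto
    obtain k' where k': "k' \<in> lattice" "\<And>a. a < n \<Longrightarrow> a \<notin> V \<Longrightarrow> k' a = 0" "lat_vec k' \<in> U" "(\<lambda>a. 4 * (y a - lat_vec k' a)) \<in> U"
      using lattice_approx[OF Vn(1), of y] xy unfolding U_def by auto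
    have FF: "F x y = F (lat_vec k) (lat_vec k') + F (\<lambda>a. x a - lat_vec k a) y + F (lat_vec k) (\<lambda>a. y a - lat_vec k' a)"
      using F_add(1)[of "lat_vec k" "\<lambda>a. x a - lat_vec k a" y] F_add(2)[of "lat_vec k" "lat_vec k'" "\<lambda>a. y a - lat_vec k' a"] by simp
    have F1: "\<bar>F (lat_vec k) (lat_vec k')\<bar> \<le> \<beta>"
      unfolding F_def \<beta>_def by (rule quadratic_form_lattice[OF A light disc V k(1,2) k'(1,2) d1 nbig])
    have F2: "\<bar>4 * F (\<lambda>a. x a - lat_vec k a) y\<bar> \<le> \<Lambda>"
      using le[OF k(4) xy(2)] unfolding F_scale .
    have F3: "\<bar>4 * F (lat_vec k) (\<lambda>a. y a - lat_vec k' a)\<bar> \<le> \<Lambda>"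
      using le[OF k(3) k'(4)] unfolding F_scale .
    have "\<bar>f1 + f2 + f3\<bar> \<le> b + l / 2" if "\<bar>f1\<bar> \<le> b" "\<bar>4 * f2\<bar> \<le> l" "\<bar>4 * f3\<bar> \<le> l" for f1 f2 f3 b l :: real
      using that by linarith
    from this[OF F1 F2 F3] show "z \<le> \<beta> + Sup B / 2" unfolding z \<Lambda>_def[symmetric] FF .
  qed
  moreover have "op_const * sqrt d = 2 * \<beta>" by (simp add: \<beta>_def op_const_def)
  ultimately have \<Lambda>: "\<Lambda> \<le> op_const * sqrt d" by linarith
  have "\<bar>F x y\<bar> \<le> \<Lambda> * (sqrt (\<Sum>a\<in>V. (x a)\<^sup>2) * sqrt (\<Sum>a\<in>V. (y a)\<^sup>2))"
  proof (cases "(\<Sum>a\<in>V. (x a)\<^sup>2) = 0 \<or> (\<Sum>a\<in>V. (y a)\<^sup>2) = 0")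
    case True
    then have "F x y = 0" using Vn by (auto simp: sum_nonneg_eq_0_iff F_def)
    then show ?thesis using True by auto
  next
    case False
    define sx where "sx = sqrt (\<Sum>a\<in>V. (x a)\<^sup>2)"
    define sy where "sy = sqrt (\<Sum>a\<in>V. (y a)\<^sup>2)"
    have nn: "0 \<le> (\<Sum>a\<in>V. (z a)\<^sup>2)" for z :: "nat \<Rightarrow> real" by (intro sum_nonneg) auto
    have p: "0 < sx" "0 < sy" using False nn[of x] nn[of y] by (auto simp: sx_def sy_def)
    have sq: "sx\<^sup>2 = (\<Sum>a\<in>V. (x a)\<^sup>2)" "sy\<^sup>2 = (\<Sum>a\<in>V. (y a)\<^sup>2)" using nn by (auto simp: sx_def sy_def)
    have "(\<lambda>a. 1 / sx * x a) \<in> U" "(\<lambda>a. 1 / sy * y a) \<in> U"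
      using p sq by (auto simp: U_def power_divide sum_divide_distrib[symmetric])
    from le[OF this] have "\<bar>F x y / (sx * sy)\<bar> \<le> \<Lambda>" unfolding F_scale by (simp add: mult.commute)
    then show ?thesis using p by (simp add: sx_def[symmetric] sy_def[symmetric] abs_mult pos_divide_le_eq)
  qed
  also have "\<dots> \<le> op_const * sqrt d * (sqrt (\<Sum>a\<in>V. (x a)\<^sup>2) * sqrt (\<Sum>a\<in>V. (y a)\<^sup>2))"
    by (intro mult_right_mono \<Lambda> mult_nonneg_nonneg) (auto intro: sum_nonneg)
  finally show ?thesis by (simp add: F_def)
qed

section \<open>Nodes of large degree\<close>

text \<open>Total absolute weight of the triples lost when W W^T is restricted to
  \<open>good_nodes\<close> in rows and in the summation index. It bounds the restriction error
  against any matrix with bounded entries.\<close>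

definition truncation_error :: "(nat \<times> nat) set \<Rightarrow> real" where
  "truncation_error A = (\<Sum>a<n. \<Sum>b<n. \<Sum>c<n.
     of_bool (\<not> (a \<in> good_nodes A \<and> b \<in> good_nodes A \<and> c \<in> good_nodes A)) * (\<bar>W A a c\<bar> * \<bar>W A b c\<bar>))"

lemma truncation_bound:
  fixes A :: "(nat \<times> nat) set"
  assumes Q: "\<And>a b. a < n \<Longrightarrow> b < n \<Longrightarrow> \<bar>Q a b\<bar> \<le> q"
  defines "V \<equiv> good_nodes A"
  shows "\<bar>(\<Sum>a<n. \<Sum>b<n. Q a b * (\<Sum>c<n. W A a c * W A b c)) - (\<Sum>a\<in>V. \<Sum>b\<in>V. Q a b * (\<Sum>c\<in>V. W A a c * W A b c))\<bar>
    \<le> q * truncation_error A"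
proof -
  have Vn: "V \<subseteq> {..<n}" unfolding V_def by (rule good_nodes)
  have "(\<Sum>a\<in>V. \<Sum>b\<in>V. Q a b * (\<Sum>c\<in>V. W A a c * W A b c)) = (\<Sum>a<n. \<Sum>b<n. \<Sum>c<n. of_bool (a \<in> V \<and> b \<in> V \<and> c \<in> V) * (Q a b * (W A a c * W A b c)))"
  proof -
    have "(\<Sum>a<n. \<Sum>b<n. \<Sum>c<n. of_bool (a \<in> V \<and> b \<in> V \<and> c \<in> V) * (Q a b * (W A a c * W A b c)))
      = (\<Sum>a\<in>V. \<Sum>b<n. \<Sum>c<n. of_bool (a \<in> V \<and> b \<in> V \<and> c \<in> V) * (Q a b * (W A a c * W A b c)))"
      by (rule sum.mono_neutral_right) (use Vn in auto)
    also have "\<dots> = (\<Sum>a\<in>V. \<Sum>b\<in>V. \<Sum>c<n. of_bool (a \<in> V \<and> b \<in> V \<and> c \<in> V) * (Q a b * (W A a c * W A b c)))"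
      by (intro sum.cong refl sum.mono_neutral_right) (use Vn in auto)
    also have "\<dots> = (\<Sum>a\<in>V. \<Sum>b\<in>V. \<Sum>c\<in>V. of_bool (a \<in> V \<and> b \<in> V \<and> c \<in> V) * (Q a b * (W A a c * W A b c)))"
      by (intro sum.cong refl sum.mono_neutral_right) (use Vn in auto)
    also have "\<dots> = (\<Sum>a\<in>V. \<Sum>b\<in>V. \<Sum>c\<in>V. Q a b * (W A a c * W A b c))"
      by (intro sum.cong refl) auto
    finally show ?thesis by (simp add: sum_distrib_left)
  qed
  then have eq: "(\<Sum>a<n. \<Sum>b<n. Q a b * (\<Sum>c<n. W A a c * W A b c)) - (\<Sum>a\<in>V. \<Sum>b\<in>V. Q a b * (\<Sum>c\<in>V. W A a c * W A b c))
     = (\<Sum>a<n. \<Sum>b<n. \<Sum>c<n. of_bool (\<not> (a \<in> V \<and> b \<in> V \<and> c \<in> V)) * (Q a b * (W A a c * W A b c)))"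
    unfolding sum_distrib_left by (simp only: sum_subtractf[symmetric]) (intro sum.cong refl, auto)
  have "\<bar>\<Sum>a<n. \<Sum>b<n. \<Sum>c<n. of_bool (\<not> (a \<in> V \<and> b \<in> V \<and> c \<in> V)) * (Q a b * (W A a c * W A b c))\<bar> \<le> (\<Sum>a<n. \<Sum>b<n. \<Sum>c<n. \<bar>of_bool (\<not> (a \<in> V \<and> b \<in> V \<and> c \<in> V)) * (Q a b * (W A a c * W A b c))\<bar>)"
    by (rule order_trans[OF sum_abs sum_mono[OF order_trans[OF sum_abs sum_mono[OF sum_abs]]]])
  also have "\<dots> \<le> (\<Sum>a<n. \<Sum>b<n. \<Sum>c<n. q * (of_bool (\<not> (a \<in> V \<and> b \<in> V \<and> c \<in> V)) * (\<bar>W A a c\<bar> * \<bar>W A b c\<bar>)))"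
  proof (intro sum_mono)
    fix a b c assume "a \<in> {..<n}" "b \<in> {..<n}"
    then have "\<bar>Q a b\<bar> * (\<bar>W A a c\<bar> * \<bar>W A b c\<bar>) \<le> q * (\<bar>W A a c\<bar> * \<bar>W A b c\<bar>)" using Q by (intro mult_right_mono) auto
    then show "\<bar>of_bool (\<not> (a \<in> V \<and> b \<in> V \<and> c \<in> V)) * (Q a b * (W A a c * W A b c))\<bar> \<le> q * (of_bool (\<not> (a \<in> V \<and> b \<in> V \<and> c \<in> V)) * (\<bar>W A a c\<bar> * \<bar>W A b c\<bar>))"
      by (auto simp: abs_mult)
  qed
  also have "\<dots> = q * truncation_error A" unfolding truncation_error_def V_def sum_distrib_left ..
  finally show ?thesis unfolding eq .
qed

text \<open>Degree regularity, applied to the r nodes of degree exactly j, gives j \<le> 2 d + 10 (1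
  + ln (n / r)), that is r \<le> n exp (1 - (j - 2 d) / 10). The sum of r j^2 over j > 320 d is then
  of order n exp (- 7 d).\<close>

lemma sum_deg_sq_large:
  assumes reg: "degree_regular A"
  shows "(\<Sum>a\<in>{..<n} - good_nodes A. (deg A a)\<^sup>2) \<le> 100000 * real n * exp (- 7 * d)"
proof -
  define nd where "nd a = card {b\<in>{..<n}. (max a b, min a b) \<in> A}" for a
  have nd: "deg A a = real (nd a)" for a
    unfolding deg_def adj_def nd_def by (simp add: of_bool_def sum.If_cases Int_def)
  have ndn: "nd a \<le> n" for a
    unfolding nd_def using card_mono[of "{..<n}" "{b\<in>{..<n}. (max a b, min a b) \<in> A}"] by auto
  let ?H = "{..<n} - good_nodes A"
  have "(\<Sum>a\<in>?H. (deg A a)\<^sup>2) = (\<Sum>j\<le>n. \<Sum>a\<in>{a\<in>?H. nd a = j}. (deg A a)\<^sup>2)"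
    by (rule sum.group[symmetric]) (auto simp: ndn)
  also have "\<dots> \<le> (\<Sum>j\<le>n. 2400 * real n * exp (- 7 * d) * exp (- real j / 40))"
  proof (rule sum_mono)
    fix j
    define S where "S = {a\<in>?H. nd a = j}"
    define r where "r = real (card S)"
    have "(\<Sum>a\<in>S. (deg A a)\<^sup>2) = r * (real j)\<^sup>2" by (simp add: S_def nd r_def)
    also have "\<dots> \<le> 2400 * real n * exp (- 7 * d) * exp (- real j / 40)"
    proof (cases "S = {}")
      case True then show ?thesis by (simp add: r_def)
    next
      case False
      then obtain a where "a \<in> S" by auto
      then have j: "320 * d < real j" by (auto simp: S_def good_nodes_def nd)
      have Sn: "S \<subseteq> {..<n}" by (auto simp: S_def)
      have r: "1 \<le> r" using card_bounds[OF Sn False] by (simp add: r_def)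
      have "r * real j = (\<Sum>a\<in>S. deg A a)" by (simp add: r_def nd S_def)
      also have "\<dots> \<le> 2 * d * r + 10 * set_entropy n (card S)" using reg Sn False by (simp add: degree_regular_def r_def)
      also have "\<dots> = r * (2 * d + 10 * (1 + ln (real n / r)))" by (simp add: set_entropy_def r_def algebra_simps)
      finally have j_le: "real j \<le> 2 * d + 10 * (1 + ln (real n / r))" using r by simp
      have "ln (real n / r) \<ge> (real j - 2 * d) / 10 - 1"
      proof -
        have "(x - 2 * y) / 10 - 1 \<le> z" if "x \<le> 2 * y + 10 * (1 + z)" for x y z :: real
          using that by (simp add: field_simps)
        from this[OF j_le] show ?thesis .
      qed
      then have "exp ((real j - 2 * d) / 10 - 1) \<le> real n / r" using r n_pos by (simp add: ln_ge_iff)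
      then have "r * exp ((real j - 2 * d) / 10 - 1) \<le> real n" using r by (simp add: field_simps)
      then have "r * exp ((real j - 2 * d) / 10 - 1) * exp (- ((real j - 2 * d) / 10 - 1)) \<le> real n * exp (- ((real j - 2 * d) / 10 - 1))"
        by (rule mult_right_mono) simp
      then have r_le: "r \<le> real n * exp (1 - (real j - 2 * d) / 10)" by (simp add: exp_minus_inverse mult.assoc exp_add[symmetric])
      \<comment> \<open>Half of the decay exp (- j / 10) absorbs j^2. Of the remaining exp (- j /
        20), one half yields exp (- 7 d) because j > 320 d, the other makes the sum over j
        geometric.\<close>
      have "exp (real j / 20) \<ge> 1 + real j / 20 + (real j / 20)\<^sup>2 / 2" by (rule exp_lower_Taylor_quadratic) simp
      then have j2: "(real j)\<^sup>2 \<le> 800 * exp (real j / 20)" by (simp add: power2_eq_square field_simps; linarith)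
      have "r * (real j)\<^sup>2 \<le> real n * exp (1 - (real j - 2 * d) / 10) * (800 * exp (real j / 20))"
        using r by (intro mult_mono r_le j2) auto
      also have "\<dots> = 800 * real n * exp 1 * exp (d / 5 - real j / 20)" by (simp add: exp_add[symmetric] field_simps)
      also have "\<dots> \<le> 800 * real n * 3 * exp (- 7 * d - real j / 40)"
      proof (intro mult_mono mult_left_mono)
        show "exp 1 \<le> (3::real)" by (rule exp_le)
        show "exp (d / 5 - real j / 20) \<le> exp (- 7 * d - real j / 40)" using j d_pos by simp
      qed auto
      also have "\<dots> = 2400 * real n * exp (- 7 * d) * exp (- real j / 40)" by (simp add: exp_add[symmetric])
      finally show ?thesis .
    qed
    finally show "(\<Sum>a\<in>{a\<in>?H. nd a = j}. (deg A a)\<^sup>2) \<le> 2400 * real n * exp (- 7 * d) * exp (- real j / 40)" by (simp add: S_def)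
  qed
  also have "\<dots> = 2400 * real n * exp (- 7 * d) * (\<Sum>j\<le>n. exp (- real j / 40))" by (simp add: sum_distrib_left)
  also have "\<dots> \<le> 2400 * real n * exp (- 7 * d) * 41"
  proof (rule mult_left_mono)
    define r :: real where "r = exp (- 1 / 40)"
    have r: "0 < r" "r \<le> 40 / 41"
      using exp_ge_add_one_self[of "1/40 :: real"] by (auto simp: r_def exp_minus field_simps)
    have "(\<Sum>j\<le>n. exp (- real j / 40)) = (\<Sum>j\<le>n. r ^ j)"
      by (rule sum.cong) (auto simp: r_def exp_of_nat_mult[symmetric])
    also have "(1 - r) * \<dots> \<le> 1" unfolding sum_gp_basic using r by simp
    finally have "(1 - r) * (\<Sum>j\<le>n. exp (- real j / 40)) \<le> 1" .
    moreover have "1 / 41 * (\<Sum>j\<le>n. exp (- real j / 40)) \<le> (1 - r) * (\<Sum>j\<le>n. exp (- real j / 40))"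
      using r by (intro mult_right_mono sum_nonneg) auto
    ultimately show "(\<Sum>j\<le>n. exp (- real j / 40)) \<le> 41" by simp
  qed auto
  also have "\<dots> \<le> 100000 * real n * exp (- 7 * d)" by simp
  finally show ?thesis .
qed

text \<open>A triple (a, b, c) is lost because of c, a or b. In the first case the column sums
  \<rho> c are squared. In the other two, \<rho> c is at most 321 d unless c is itself lost, and d
  is below deg / 320 at the lost row. All three are multiples of the sum s of squared degrees
  outside \<open>V\<close>, with 2 + 4 + 4 = 10.\<close>

lemma truncation_error_le:
  assumes reg: "degree_regular A"
  shows "truncation_error A \<le> 1000000 * real n * exp (- 7 * d)"
proof -
  define V where "V = good_nodes A"
  define h :: "nat \<Rightarrow> real" where "h a = of_bool (a \<notin> V)" for a
  define w where "w a b = \<bar>W A a b\<bar>" for a b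
  define \<rho> where "\<rho> c = (\<Sum>a<n. w a c)" for c
  have wsym: "w a b = w b a" if "a < n" "b < n" for a b using W_sym[OF that] by (simp add: w_def)
  have w0: "0 \<le> w a b" for a b by (simp add: w_def)
  have \<rho>0: "0 \<le> \<rho> c" for c by (simp add: \<rho>_def w0 sum_nonneg)
  have h0: "0 \<le> h a" for a by (simp add: h_def)
  have \<rho>': "(\<Sum>b<n. w c b) = \<rho> c" if "c < n" for c unfolding \<rho>_def by (rule sum.cong) (use wsym that in auto)
  have \<rho>_le: "\<rho> c \<le> deg A c + d" if "c < n" for c
  proof -
    have "\<rho> c \<le> (\<Sum>b<n. adj A c b + L)"
      unfolding \<rho>'[OF that, symmetric] by (rule sum_mono) (use abs_W_le that in \<open>auto simp: w_def\<close>)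
    then show ?thesis by (simp add: sum.distrib deg_def d_def)
  qed
  have \<rho>V: "\<rho> c \<le> 321 * d + h c * \<rho> c" if "c < n" for c
    using \<rho>_le[OF that] d_pos by (auto simp: h_def V_def good_nodes_def)
  have \<rho>H: "h c * d \<le> h c * (deg A c / 320)" "h c * \<rho> c \<le> h c * (321 / 320 * deg A c)" if "c < n" for c
    using \<rho>_le[OF that] that by (auto simp: h_def V_def good_nodes_def)
  define s where "s = (\<Sum>c<n. h c * (deg A c)\<^sup>2)"
  have sH: "s = (\<Sum>a\<in>{..<n} - good_nodes A. (deg A a)\<^sup>2)"
  proof -
    have "s = (\<Sum>a\<in>{..<n} - good_nodes A. h a * (deg A a)\<^sup>2)"
      unfolding s_def by (rule sum.mono_neutral_right) (auto simp: h_def V_def)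
    also have "\<dots> = (\<Sum>a\<in>{..<n} - good_nodes A. (deg A a)\<^sup>2)" by (rule sum.cong) (auto simp: h_def V_def)
    finally show ?thesis .
  qed
  have deg0: "0 \<le> deg A c" for c by (simp add: deg_def sum_nonneg)
  have \<rho>sq: "(\<Sum>c<n. h c * (\<rho> c)\<^sup>2) \<le> 2 * s"
    unfolding s_def sum_distrib_left
  proof (rule sum_mono)
    fix c assume "c \<in> {..<n}"
    then have "h c = 1 \<Longrightarrow> (\<rho> c)\<^sup>2 \<le> (321 / 320 * deg A c)\<^sup>2" using \<rho>H(2)[of c] \<rho>0[of c] by (intro power_mono) auto
    moreover have "(321 / 320 * deg A c)\<^sup>2 \<le> 2 * (deg A c)\<^sup>2" unfolding power_mult_distrib by (intro mult_right_mono) (auto simp: power2_eq_square)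
    ultimately show "h c * (\<rho> c)\<^sup>2 \<le> 2 * (h c * (deg A c)\<^sup>2)" by (auto simp: h_def)
  qed
  have T1: "(\<Sum>a<n. \<Sum>b<n. \<Sum>c<n. h c * (w a c * w b c)) \<le> 2 * s"
  proof -
    have "(\<Sum>a<n. \<Sum>b<n. \<Sum>c<n. h c * (w a c * w b c)) = (\<Sum>c<n. \<Sum>a<n. \<Sum>b<n. h c * (w a c * w b c))"
    proof -
      have "(\<Sum>a<n. \<Sum>b<n. \<Sum>c<n. h c * (w a c * w b c)) = (\<Sum>a<n. \<Sum>c<n. \<Sum>b<n. h c * (w a c * w b c))"
        by (rule sum.cong[OF refl], rule sum.swap)
      also have "\<dots> = (\<Sum>c<n. \<Sum>a<n. \<Sum>b<n. h c * (w a c * w b c))" by (rule sum.swap)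
      finally show ?thesis .
    qed
    also have "\<dots> = (\<Sum>c<n. h c * (\<rho> c)\<^sup>2)"
      by (simp only: \<rho>_def power2_eq_square sum_product) (simp only: sum_distrib_left)
    finally show ?thesis using \<rho>sq by simp
  qed
  have T2: "(\<Sum>a<n. \<Sum>c<n. h a * (w a c * \<rho> c)) \<le> 4 * s"
  proof -
    have "(\<Sum>a<n. \<Sum>c<n. h a * (w a c * \<rho> c)) \<le> (\<Sum>a<n. \<Sum>c<n. h a * w a c * (321 * d) + w a c * (h c * \<rho> c))"
    proof (intro sum_mono)
      fix a c assume ac: "a \<in> {..<n}" "c \<in> {..<n}"
      have "h a * w a c * \<rho> c \<le> h a * w a c * (321 * d + h c * \<rho> c)" using \<rho>V[of c] ac w0 h0 by (intro mult_left_mono) auto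
      also have "\<dots> = h a * w a c * (321 * d) + h a * (w a c * (h c * \<rho> c))" by (simp add: algebra_simps)
      also have "h a * (w a c * (h c * \<rho> c)) \<le> 1 * (w a c * (h c * \<rho> c))"
        using w0 h0 \<rho>0 by (intro mult_right_mono) (auto simp: h_def)
      finally show "h a * (w a c * \<rho> c) \<le> h a * w a c * (321 * d) + w a c * (h c * \<rho> c)" by (simp add: mult.assoc)
    qed
    also have "\<dots> = (\<Sum>a<n. h a * \<rho> a * (321 * d)) + (\<Sum>c<n. h c * (\<rho> c)\<^sup>2)"
    proof -
      have "(\<Sum>a<n. \<Sum>c<n. h a * w a c * (321 * d)) = (\<Sum>a<n. h a * \<rho> a * (321 * d))"
        by (rule sum.cong) (auto simp: \<rho>'[symmetric] sum_distrib_left sum_distrib_right)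
      moreover have "(\<Sum>a<n. \<Sum>c<n. w a c * (h c * \<rho> c)) = (\<Sum>c<n. h c * (\<rho> c)\<^sup>2)"
      proof (subst sum.swap, rule sum.cong[OF refl])
        fix c
        have "(\<Sum>a<n. w a c * (h c * \<rho> c)) = (\<Sum>a<n. w a c) * (h c * \<rho> c)" by (rule sum_distrib_right[symmetric])
        then show "(\<Sum>a<n. w a c * (h c * \<rho> c)) = h c * (\<rho> c)\<^sup>2" unfolding \<rho>_def[symmetric] by (simp add: power2_eq_square)
      qed
      ultimately show ?thesis by (simp add: sum.distrib)
    qed
    also have "\<dots> \<le> (\<Sum>a<n. 2 * (h a * (deg A a)\<^sup>2)) + 2 * s"
    proof (intro add_mono sum_mono \<rho>sq)
      fix a assume "a \<in> {..<n}"
      then have a: "a < n" by simp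
      show "h a * \<rho> a * (321 * d) \<le> 2 * (h a * (deg A a)\<^sup>2)"
      proof (cases "a \<in> V")
        case False
        then have h: "h a = 1" by (simp add: h_def)
        have "\<rho> a * (321 * d) \<le> (321 / 320 * deg A a) * (321 * (deg A a / 320))"
          using \<rho>H[OF a] h \<rho>0[of a] d_pos deg0[of a] by (intro mult_mono) auto
        also have "\<dots> \<le> 2 * (deg A a)\<^sup>2" by (simp add: power2_eq_square)
        finally show ?thesis using h by simp
      qed (simp add: h_def)
    qed
    also have "\<dots> = 4 * s" by (simp add: s_def sum_distrib_left)
    finally show ?thesis .
  qed
  have T2a: "(\<Sum>a<n. \<Sum>b<n. \<Sum>c<n. h a * (w a c * w b c)) \<le> 4 * s"
  proof -
    have "(\<Sum>a<n. \<Sum>b<n. \<Sum>c<n. h a * (w a c * w b c)) = (\<Sum>a<n. \<Sum>c<n. h a * (w a c * \<rho> c))"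
      unfolding \<rho>_def sum_distrib_left by (rule sum.cong[OF refl], rule sum.swap)
    then show ?thesis using T2 by simp
  qed
  have T2b: "(\<Sum>a<n. \<Sum>b<n. \<Sum>c<n. h b * (w a c * w b c)) \<le> 4 * s"
  proof -
    have "(\<Sum>a<n. \<Sum>b<n. \<Sum>c<n. h b * (w a c * w b c)) = (\<Sum>b<n. \<Sum>a<n. \<Sum>c<n. h b * (w b c * w a c))"
      by (subst sum.swap) (simp add: mult.commute)
    then show ?thesis using T2a by simp
  qed
  have "truncation_error A \<le> (\<Sum>a<n. \<Sum>b<n. \<Sum>c<n. h c * (w a c * w b c) + h a * (w a c * w b c) + h b * (w a c * w b c))"
    unfolding truncation_error_def
    by (intro sum_mono) (auto simp: h_def V_def w_def)
  also have "\<dots> \<le> 10 * s" using T1 T2a T2b by (simp add: sum.distrib)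
  also have "\<dots> \<le> 10 * (100000 * real n * exp (- 7 * d))"
    unfolding sH by (intro mult_left_mono sum_deg_sq_large[OF reg]) auto
  finally show ?thesis by simp
qed

end

section \<open>The stochastic block model\<close>

text \<open>\<open>m\<close> and \<open>D\<close> are only lower bounds for the group sizes and the
  squared separations; the minima of the model are inserted at the end. Groups are given by the
  labelling g instead of a family of sets.\<close>

locale block_graph = random_graph +
  fixes K :: nat and g :: "nat \<Rightarrow> nat" and p :: "nat \<Rightarrow> nat \<Rightarrow> real" and m :: real and D :: real
  assumes g_less: "a < n \<Longrightarrow> g a < K"
    and M_eq: "a < n \<Longrightarrow> b < n \<Longrightarrow> M a b = p (g a) (g b)"
    and m_ge_1: "1 \<le> m"
    and m_le: "k < K \<Longrightarrow> m \<le> real (card {a. a < n \<and> g a = k})"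
    and D_le: "j < K \<Longrightarrow> k < K \<Longrightarrow> j \<noteq> k \<Longrightarrow> D \<le> (\<Sum>b<n. (p j (g b) - p k (g b))\<^sup>2)"
    and mL_ge_1: "1 \<le> m * L"
begin

definition grp :: "nat \<Rightarrow> nat set" where "grp k = {a. a < n \<and> g a = k}"
definition size :: "nat \<Rightarrow> real" where "size k = real (card (grp k))"
definition sep :: "nat \<Rightarrow> nat \<Rightarrow> real" where "sep j k = (\<Sum>b<n. (p j (g b) - p k (g b))\<^sup>2)"
definition s2 :: real where "s2 = D / L"

lemma m_pos: "0 < m" using m_ge_1 by simp

lemma grp: "grp k \<subseteq> {..<n}" "finite (grp k)" by (auto simp: grp_def)

lemma size_ge: "k < K \<Longrightarrow> m \<le> size k" using m_le by (simp add: size_def grp_def)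

lemma size_pos: "k < K \<Longrightarrow> 0 < size k" using size_ge m_pos by fastforce

lemma grp_ne: "k < K \<Longrightarrow> grp k \<noteq> {}" using size_pos[of k] by (auto simp: size_def)

lemma p_bounds: "j < K \<Longrightarrow> k < K \<Longrightarrow> 0 \<le> p j k \<and> p j k \<le> L \<and> p j k \<le> 1"
proof -
  assume "j < K" "k < K"
  then obtain a b where "a < n" "b < n" "g a = j" "g b = k" using grp_ne[of j] grp_ne[of k] by (auto simp: grp_def)
  then show ?thesis using M_eq[of a b] M_nonneg[of a b] M_le_L[of a b] M_le_1[of a b] by auto
qed

lemma sum_by_group: "(\<Sum>a<n. f a) = (\<Sum>k<K. \<Sum>a\<in>grp k. f a)"
  using sum.group[of "{..<n}" "{..<K}" g f] g_less by (simp add: grp_def image_subset_iff)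

lemma K_m_le: "real K * m \<le> real n"
proof -
  have "real n = (\<Sum>k<K. size k)" using sum_by_group[of "\<lambda>_. 1::real"] by (simp add: size_def)
  also have "\<dots> \<ge> (\<Sum>k<K. m)" by (rule sum_mono) (use size_ge in auto)
  finally show ?thesis by simp
qed

lemma sep_ge: "j < K \<Longrightarrow> k < K \<Longrightarrow> j \<noteq> k \<Longrightarrow> D \<le> sep j k"
  using D_le by (simp add: sep_def)

subsection \<open>The linear noise term\<close>

text \<open>The linear noise with the sign in which it does harm, minus the share of the signal
  reserved for it; only a positive value has to be paid for.\<close>

definition lin_noise :: "(nat \<times> nat) set \<Rightarrow> nat \<Rightarrow> nat \<Rightarrow> real" where
  "lin_noise A a k = - (\<Sum>b<n. W A a b * (p (g a) (g b) - p k (g b))) - sep (g a) k / 16"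

text \<open>The weights of a row may concentrate on the worst competing group, hence the
  maximum.\<close>

definition lin_excess :: "(nat \<times> nat) set \<Rightarrow> nat \<Rightarrow> real" where
  "lin_excess A a = Max (insert 0 (lin_noise A a ` ({..<K} - {g a})))"

lemma lin_excess: "0 \<le> lin_excess A a" "k < K \<Longrightarrow> k \<noteq> g a \<Longrightarrow> lin_noise A a k \<le> lin_excess A a"
  by (auto simp: lin_excess_def intro!: Max_ge)

text \<open>Rows are dependent, so the rows of S, each with a competing group chosen by f, are
  treated in a single moment. With multiplier 1 / (128 L) the signal gains sep / (4096 L) and the
  variance costs sep / (8192 L).\<close>

lemma EE_lin_noise:
  assumes S: "S \<subseteq> {..<n}" "\<And>a. a \<in> S \<Longrightarrow> f a < K \<and> f a \<noteq> g a" and s: "32 \<le> s2"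
  shows "EE (\<lambda>A. exp (1 / (128 * L) * (\<Sum>a\<in>S. lin_noise A a (f a)))) \<le> exp (- s2 / 8192) ^ card S"
proof -
  have fS: "finite S" using S finite_subset by auto
  define lam where "lam = 1 / (128 * L)"
  have lam: "0 < lam" using L_pos by (simp add: lam_def)
  define v where "v a b = p (g a) (g b) - p (f a) (g b)" for a b
  define q where "q a b = (if a \<in> S then - lam * v a b else 0)" for a b
  have v: "\<bar>v a b\<bar> \<le> L" if "a \<in> S" "b < n" for a b
    using p_bounds[of "g a" "g b"] p_bounds[of "f a" "g b"] that S g_less[of a] g_less[of b] by (force simp: v_def)
  have sepS: "sep (g a) (f a) \<ge> 32 * L" "sep (g a) (f a) / L \<ge> s2" if "a \<in> S" for a
  proof -
    have "D \<le> sep (g a) (f a)" by (intro sep_ge) (use S(1) S(2)[OF that] that g_less[of a] in auto)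
    moreover have "32 * L \<le> D" using s L_pos by (simp add: s2_def field_simps)
    ultimately show "sep (g a) (f a) \<ge> 32 * L" "sep (g a) (f a) / L \<ge> s2" using L_pos by (auto simp: s2_def divide_right_mono)
  qed
  have "EE (\<lambda>A. exp (lam * (\<Sum>a\<in>S. lin_noise A a (f a)))) \<le> EE (\<lambda>A. exp (- lam / 32 * (\<Sum>a\<in>S. sep (g a) (f a))) * exp (\<Sum>a<n. \<Sum>b<n. q a b * E A a b))"
  proof (rule EE_mono)
    fix A assume A: "A \<subseteq> pairs n"
    have "lam * (\<Sum>a\<in>S. lin_noise A a (f a)) \<le> (\<Sum>a\<in>S. (\<Sum>b<n. q a b * E A a b) - lam / 32 * sep (g a) (f a))"
      unfolding sum_distrib_left
    proof (rule sum_mono)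
      fix a assume a: "a \<in> S"
      then have an: "a < n" using S by auto
      have "(\<Sum>b<n. W A a b * v a b) = (\<Sum>b<n. E A a b * v a b - (if a = b then M a b * v a b else 0))"
        by (rule sum.cong) (auto simp: W_eq_E[OF A] algebra_simps)
      also have "\<dots> = (\<Sum>b<n. E A a b * v a b) - M a a * v a a" using an by (simp add: sum_subtractf)
      finally have 1: "(\<Sum>b<n. W A a b * v a b) = (\<Sum>b<n. E A a b * v a b) - M a a * v a a" .
      have "M a a * v a a \<le> M a a * L" using M_nonneg[OF an an] v[OF a an] by (intro mult_left_mono) auto
      also have "\<dots> \<le> 1 * L" using M_le_1[OF an an] L_pos by (intro mult_right_mono) auto
      finally have "M a a * v a a \<le> 1 * L" .
      \<comment> \<open>Passing from \<open>W\<close> to \<open>E\<close> costs a diagonal term of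
        at most L \<le> sep / 32, half of the sep / 16 in \<open>lin_noise\<close>.\<close>
      then have 2: "M a a * v a a \<le> sep (g a) (f a) / 32" using sepS(1)[OF a] by simp
      have "lin_noise A a (f a) \<le> - (\<Sum>b<n. E A a b * v a b) - sep (g a) (f a) / 32"
        using 1 2 by (simp add: lin_noise_def v_def)
      then have "lam * lin_noise A a (f a) \<le> lam * (- (\<Sum>b<n. E A a b * v a b) - sep (g a) (f a) / 32)" using lam by (intro mult_left_mono) auto
      also have "\<dots> = (\<Sum>b<n. q a b * E A a b) - lam / 32 * sep (g a) (f a)"
        using a by (simp add: q_def sum_distrib_left sum_negf[symmetric] algebra_simps)
      finally show "lam * lin_noise A a (f a) \<le> (\<Sum>b<n. q a b * E A a b) - lam / 32 * sep (g a) (f a)" .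
    qed
    also have "\<dots> = (\<Sum>a<n. \<Sum>b<n. q a b * E A a b) - lam / 32 * (\<Sum>a\<in>S. sep (g a) (f a))"
    proof -
      have "(\<Sum>a\<in>S. \<Sum>b<n. q a b * E A a b) = (\<Sum>a<n. \<Sum>b<n. q a b * E A a b)"
        by (rule sum.mono_neutral_left) (use S in \<open>auto simp: q_def\<close>)
      then show ?thesis by (simp add: sum_subtractf sum_distrib_left)
    qed
    finally show "exp (lam * (\<Sum>a\<in>S. lin_noise A a (f a))) \<le> exp (- lam / 32 * (\<Sum>a\<in>S. sep (g a) (f a))) * exp (\<Sum>a<n. \<Sum>b<n. q a b * E A a b)"
      by (simp add: exp_add[symmetric])
  qed
  also have "\<dots> \<le> exp (- lam / 32 * (\<Sum>a\<in>S. sep (g a) (f a))) * exp (2 * L * (\<Sum>a<n. \<Sum>b<n. (q a b)\<^sup>2))"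
    unfolding bern_cmult
  proof (intro mult_left_mono EE_exp_centered)
    fix a b assume "a < n" "b < n"
    then have "a \<in> S \<Longrightarrow> lam * \<bar>v a b\<bar> \<le> lam * L" using v lam by (intro mult_left_mono) auto
    then show "\<bar>q a b\<bar> \<le> 1 / 2" using L_pos lam by (auto simp: q_def abs_mult) (simp add: lam_def)
  qed simp
  also have "(\<Sum>a<n. \<Sum>b<n. (q a b)\<^sup>2) = lam\<^sup>2 * (\<Sum>a\<in>S. sep (g a) (f a))"
  proof -
    have "(\<Sum>a<n. \<Sum>b<n. (q a b)\<^sup>2) = (\<Sum>a\<in>S. \<Sum>b<n. (q a b)\<^sup>2)"
      by (rule sum.mono_neutral_right) (use S in \<open>auto simp: q_def\<close>)
    also have "\<dots> = (\<Sum>a\<in>S. lam\<^sup>2 * sep (g a) (f a))"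
      by (rule sum.cong) (auto simp: q_def sep_def v_def power_mult_distrib sum_distrib_left)
    finally show ?thesis by (simp add: sum_distrib_left)
  qed
  also have "exp (- lam / 32 * (\<Sum>a\<in>S. sep (g a) (f a))) * exp (2 * L * (lam\<^sup>2 * (\<Sum>a\<in>S. sep (g a) (f a))))
     = exp (- (\<Sum>a\<in>S. sep (g a) (f a)) / (8192 * L))"
    using L_pos by (simp add: exp_add[symmetric] lam_def power2_eq_square field_simps)
  also have "\<dots> \<le> exp (real (card S) * (- s2 / 8192))"
  proof -
    have "real (card S) * s2 \<le> (\<Sum>a\<in>S. sep (g a) (f a) / L)"
      using sum_mono[of S "\<lambda>_. s2" "\<lambda>a. sep (g a) (f a) / L"] sepS(2) by simp
    then show ?thesis by (simp add: sum_divide_distrib[symmetric] field_simps)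
  qed
  also have "\<dots> = exp (- s2 / 8192) ^ card S" by (rule exp_of_nat_mult)
  finally show ?thesis by (simp add: lam_def)
qed

text \<open>Union bound over rows and groups, effective once s2 exceeds a multiple of ln n.\<close>

lemma PP_lin_excess_pos:
  assumes "32 \<le> s2"
  shows "PP (\<lambda>A. 0 < (\<Sum>a<n. lin_excess A a)) \<le> real n * real K * exp (- s2 / 8192)"
proof -
  let ?J = "{..<n} \<times> {..<K}"
  have "PP (\<lambda>A. 0 < (\<Sum>a<n. lin_excess A a)) \<le> PP (\<lambda>A. \<exists>j\<in>?J. snd j \<noteq> g (fst j) \<and> 1 / (128 * L) * lin_noise A (fst j) (snd j) \<ge> 0)"
  proof (rule PP_mono)
    fix A assume "0 < (\<Sum>a<n. lin_excess A a)"
    then obtain a where a: "a < n" "0 < lin_excess A a" by (metis lessThan_iff not_le sum_nonpos)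
    have "lin_excess A a \<in> insert 0 (lin_noise A a ` ({..<K} - {g a}))" unfolding lin_excess_def by (rule Max_in) auto
    then obtain k where "k \<in> {..<K} - {g a}" "lin_excess A a = lin_noise A a k" using a(2) by fastforce
    then have "k < K" "k \<noteq> g a" "0 < lin_noise A a k" using a by auto
    then show "\<exists>j\<in>?J. snd j \<noteq> g (fst j) \<and> 1 / (128 * L) * lin_noise A (fst j) (snd j) \<ge> 0"
      using a L_pos by (intro bexI[of _ "(a, k)"]) auto
  qed
  also have "\<dots> \<le> (\<Sum>j\<in>?J. PP (\<lambda>A. snd j \<noteq> g (fst j) \<and> 1 / (128 * L) * lin_noise A (fst j) (snd j) \<ge> 0))"
    by (rule PP_Ex) auto
  also have "\<dots> \<le> (\<Sum>j\<in>?J. exp (- s2 / 8192))"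
  proof (rule sum_mono)
    fix j assume j: "j \<in> ?J"
    show "PP (\<lambda>A. snd j \<noteq> g (fst j) \<and> 1 / (128 * L) * lin_noise A (fst j) (snd j) \<ge> 0) \<le> exp (- s2 / 8192)"
    proof (cases "snd j = g (fst j)")
      case True
      then have "PP (\<lambda>A. snd j \<noteq> g (fst j) \<and> 1 / (128 * L) * lin_noise A (fst j) (snd j) \<ge> 0) = 0" by (simp add: bprob_def bern_const)
      then show ?thesis by simp
    next
      case False
      have "EE (\<lambda>A. exp (1 / (128 * L) * lin_noise A (fst j) (snd j))) \<le> exp (- s2 / 8192)"
        using EE_lin_noise[of "{fst j}" "\<lambda>_. snd j"] j False assms by auto
      from PP_Markov'[OF this, of 0] False show ?thesis by simp
    qed
  qed
  finally show ?thesis by (simp add: card_cartesian_product)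
qed

text \<open>For smaller s2 some rows may fail. The exponential of a sum of maxima is at most a
  product of sums over groups; expanding it gives one moment of \<open>EE_lin_noise\<close> for each
  way of assigning a group, or none, to every row, and these moments add up to (1 + K e)^n.\<close>

lemma PP_lin_excess:
  assumes "32 \<le> s2"
  shows "PP (\<lambda>A. x \<le> (\<Sum>a<n. lin_excess A a)) \<le> exp (real n * real K * exp (- s2 / 8192)) * exp (- x / (128 * L))"
proof -
  define lam where "lam = 1 / (128 * L)"
  have lam: "0 < lam" using L_pos by (simp add: lam_def)
  define e where "e = exp (- s2 / 8192)"
  \<comment> \<open>The value k = K stands for the 0 inside the maximum; the own group g a does not
    compete and gets weight 0.\<close>
  define h where "h A a k = (if k = K then 1 else if k = g a then 0 else exp (lam * lin_noise A a k))" for A a k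
  let ?P = "PiE {..<n} (\<lambda>_. {..K})"
  have "EE (\<lambda>A. exp (lam * (\<Sum>a<n. lin_excess A a))) \<le> EE (\<lambda>A. \<Prod>a<n. \<Sum>k\<in>{..K}. h A a k)"
  proof (rule EE_mono)
    fix A assume "A \<subseteq> pairs n"
    have "exp (lam * (\<Sum>a<n. lin_excess A a)) = (\<Prod>a<n. exp (lam * lin_excess A a))"
      by (simp add: sum_distrib_left exp_sum)
    also have "\<dots> \<le> (\<Prod>a<n. \<Sum>k\<in>{..K}. h A a k)"
    proof (rule prod_mono)
      fix a assume a: "a \<in> {..<n}"
      have h0: "0 \<le> h A a k" for k by (simp add: h_def)
      have "lin_excess A a \<in> insert 0 (lin_noise A a ` ({..<K} - {g a}))" unfolding lin_excess_def by (rule Max_in) auto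
      then obtain k where k: "k \<le> K" "exp (lam * lin_excess A a) \<le> h A a k"
      proof
        assume "lin_excess A a = 0" then show ?thesis using that[of K] by (simp add: h_def)
      next
        assume "lin_excess A a \<in> lin_noise A a ` ({..<K} - {g a})"
        then obtain k where "k < K" "k \<noteq> g a" "lin_excess A a = lin_noise A a k" by auto
        then show ?thesis using that[of k] by (simp add: h_def)
      qed
      note k(2)
      also have "h A a k \<le> (\<Sum>k\<in>{..K}. h A a k)" using k(1) h0 by (intro member_le_sum) auto
      finally show "0 \<le> exp (lam * lin_excess A a) \<and> exp (lam * lin_excess A a) \<le> (\<Sum>k\<in>{..K}. h A a k)" by simp
    qed
    finally show "exp (lam * (\<Sum>a<n. lin_excess A a)) \<le> (\<Prod>a<n. \<Sum>k\<in>{..K}. h A a k)" .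
  qed
  also have "\<dots> = (\<Sum>f\<in>?P. EE (\<lambda>A. \<Prod>a<n. h A a (f a)))"
    unfolding bern_sum[symmetric] by (subst prod_sum_PiE) auto
  also have "\<dots> \<le> (\<Sum>f\<in>?P. \<Prod>a<n. if f a = K then 1 else e)"
  proof (rule sum_mono)
    fix f assume f: "f \<in> ?P"
    define S where "S = {a. a < n \<and> f a \<noteq> K}"
    have S: "S \<subseteq> {..<n}" "finite S" by (auto simp: S_def)
    have R: "(\<Prod>a<n. if f a = K then 1 else e) = e ^ card S"
    proof -
      have "(\<Prod>a<n. if f a = K then 1 else e) = (\<Prod>a\<in>S. e)"
        by (rule prod.mono_neutral_cong_right) (auto simp: S_def)
      then show ?thesis by simp
    qed
    show "EE (\<lambda>A. \<Prod>a<n. h A a (f a)) \<le> (\<Prod>a<n. if f a = K then 1 else e)"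
    proof (cases "\<exists>a\<in>S. f a = g a")
      case True
      then obtain a where "a < n" "f a \<noteq> K" "f a = g a" by (auto simp: S_def)
      then have z: "(\<Prod>a<n. h A a (f a)) = 0" for A by (intro prod_zero) (auto simp: h_def)
      show ?thesis unfolding R z by (simp add: bern_const e_def)
    next
      case False
      have "(\<Prod>a<n. h A a (f a)) = exp (lam * (\<Sum>a\<in>S. lin_noise A a (f a)))" for A
      proof -
        have "(\<Prod>a<n. h A a (f a)) = (\<Prod>a\<in>S. exp (lam * lin_noise A a (f a)))"
          by (rule prod.mono_neutral_cong_right) (use False in \<open>auto simp: S_def h_def\<close>)
        then show ?thesis using S by (simp add: exp_sum sum_distrib_left)
      qed
      then have "EE (\<lambda>A. \<Prod>a<n. h A a (f a)) = EE (\<lambda>A. exp (1 / (128 * L) * (\<Sum>a\<in>S. lin_noise A a (f a))))" by (simp add: lam_def)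
      also have "\<dots> \<le> e ^ card S" unfolding e_def
        by (rule EE_lin_noise) (use S False f assms in \<open>auto simp: S_def PiE_iff le_less\<close>)
      finally show ?thesis unfolding R .
    qed
  qed
  also have "\<dots> = (\<Prod>a<n. \<Sum>k\<in>{..K}. if k = K then 1 else e)" by (subst prod_sum_PiE) auto
  also have "\<dots> = (1 + real K * e) ^ n"
  proof -
    have "(\<Sum>k\<in>{..K}. if k = K then 1 else e) = 1 + real K * e"
      by (simp add: lessThan_Suc_atMost[symmetric] add.commute)
    then show ?thesis by simp
  qed
  also have "\<dots> \<le> exp (real K * e) ^ n"
    using exp_ge_add_one_self[of "real K * e"] by (intro power_mono) (auto simp: add_ac e_def)
  also have "\<dots> = exp (real n * real K * e)" by (simp add: exp_of_nat_mult[symmetric] mult_ac)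
  finally have "EE (\<lambda>A. exp (lam * (\<Sum>a<n. lin_excess A a))) \<le> exp (real n * real K * e)" .
  from PP_Markov'[OF this, of "lam * x"] have "PP (\<lambda>A. lam * x \<le> lam * (\<Sum>a<n. lin_excess A a)) \<le> exp (real n * real K * e) * exp (- (lam * x))" .
  then show ?thesis unfolding mult_le_cancel_left_pos[OF lam] by (simp add: lam_def e_def)
qed

end

text \<open>It replaces the square of a neighbour count by an exponential, whose expectation
  factorises over edges.\<close>

lemma sq_le_3_pow2: "(real k)\<^sup>2 \<le> 3 * (2 ^ k - 1)"
proof -
  have "(real k)\<^sup>2 + 3 \<le> 3 * 2 ^ k"
  proof (induction k)
    case (Suc k)
    have "(real (Suc k))\<^sup>2 + 3 \<le> 2 * ((real k)\<^sup>2 + 3)"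
      using sum_squares_ge_zero[of "real k - 1" 0] by (simp add: power2_eq_square algebra_simps)
    then show ?case using Suc by simp
  qed simp
  then show ?thesis by simp
qed

context block_graph
begin

subsection \<open>The quadratic noise term\<close>

text \<open>Average of the rows of \<open>W\<close> over group k: a row of Bst W.\<close>

definition Wbar :: "(nat \<times> nat) set \<Rightarrow> nat \<Rightarrow> nat \<Rightarrow> real" where
  "Wbar A k c = (\<Sum>a\<in>grp k. W A a c) / size k"

text \<open>On a row that is not bad the quadratic noise against any group is at most 2 D / 32,
  which the signal absorbs.\<close>

definition bad :: "(nat \<times> nat) set \<Rightarrow> nat \<Rightarrow> bool" where
  "bad A b \<longleftrightarrow> (\<exists>k<K. D / 32 < \<bar>\<Sum>c<n. Wbar A k c * W A b c\<bar>)"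

definition nbrs_in :: "nat set \<Rightarrow> (nat \<times> nat) set \<Rightarrow> nat \<Rightarrow> real" where
  "nbrs_in S A c = (\<Sum>b\<in>S. adj A b c)"

text \<open>Squares of neighbour counts with Poisson-like tails have no useful exponential moments;
  the cap restores them.\<close>

definition capped :: "nat set \<Rightarrow> real \<Rightarrow> nat set \<Rightarrow> (nat \<times> nat) set \<Rightarrow> bool" where
  "capped S v X A \<longleftrightarrow> (\<forall>c\<in>X. nbrs_in S A c \<le> v)"

lemma nbrs_in_nonneg: "0 \<le> nbrs_in S A c"
  by (simp add: nbrs_in_def sum_nonneg)

text \<open>Below the cap y = 2 \<kappa> N^2 satisfies exp y \<le> 1 + 2 y, and N^2 \<le> 3 (2^N -
  1), so each factor is at most \<theta> 2^N + 1 - \<theta>. Expanding over the set T of columns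
  that take the first term leaves exponential moments of the number of edges between S and T. No
  independence of the columns is used, so X may meet S.\<close>

lemma EE_exp_nbrs_sq:
  assumes S: "S \<subseteq> {..<n}" and X: "X \<subseteq> {..<n}" and \<kappa>: "0 \<le> \<kappa>" "12 * \<kappa> \<le> 1" "4 * \<kappa> * v\<^sup>2 \<le> 1" and r: "real (card S) * L \<le> 1"
  shows "EE (\<lambda>A. of_bool (capped S v X A) * exp (2 * \<kappa> * (\<Sum>c\<in>X. (nbrs_in S A c)\<^sup>2))) \<le> exp (162 * \<kappa> * real n * (real (card S) * L))"
proof -
  have fin: "finite X" "finite S" using X S finite_subset by auto
  \<comment> \<open>12 = 4 * 3: 4 \<kappa> from linearising the exponential, 3 from
    \<open>sq_le_3_pow2\<close>.\<close>
  define \<theta> where "\<theta> = 12 * \<kappa>"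
  have \<theta>: "0 \<le> \<theta>" "\<theta> \<le> 1" using \<kappa> by (auto simp: \<theta>_def)
  define x where "x = real (card S) * L"
  have x: "0 \<le> x" "x \<le> 1" using r L_pos by (auto simp: x_def)
  have nat: "\<exists>k. nbrs_in S A c = real k" for A c
    by (rule exI[of _ "card (S \<inter> {b. (max b c, min b c) \<in> A})"]) (use fin in \<open>simp add: nbrs_in_def adj_def of_bool_def sum.If_cases\<close>)
  define N2 where "N2 A c = exp (ln 2 * nbrs_in S A c)" for A c
  have N2: "(nbrs_in S A c)\<^sup>2 \<le> 3 * (N2 A c - 1)" for A c
  proof -
    obtain k where k: "nbrs_in S A c = real k" using nat by blast
    have "exp (ln 2 * real k) = (2::real) ^ k" by (simp add: mult.commute[of "ln 2"] exp_of_nat_mult)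
    then show ?thesis using sq_le_3_pow2[of k] by (simp add: N2_def k)
  qed
  have "EE (\<lambda>A. of_bool (capped S v X A) * exp (2 * \<kappa> * (\<Sum>c\<in>X. (nbrs_in S A c)\<^sup>2))) \<le> EE (\<lambda>A. \<Prod>c\<in>X. \<theta> * N2 A c + (1 - \<theta>))"
  proof (rule EE_mono)
    fix A assume "A \<subseteq> pairs n"
    have pos: "0 \<le> \<theta> * N2 A c + (1 - \<theta>)" for c using \<theta> by (simp add: N2_def)
    show "of_bool (capped S v X A) * exp (2 * \<kappa> * (\<Sum>c\<in>X. (nbrs_in S A c)\<^sup>2)) \<le> (\<Prod>c\<in>X. \<theta> * N2 A c + (1 - \<theta>))"
    proof (cases "capped S v X A")
      case False then show ?thesis using pos by (simp add: prod_nonneg)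
    next
      case True
      have "exp (2 * \<kappa> * (\<Sum>c\<in>X. (nbrs_in S A c)\<^sup>2)) = (\<Prod>c\<in>X. exp (2 * \<kappa> * (nbrs_in S A c)\<^sup>2))"
        using fin by (simp add: sum_distrib_left exp_sum)
      also have "\<dots> \<le> (\<Prod>c\<in>X. \<theta> * N2 A c + (1 - \<theta>))"
      proof (rule prod_mono)
        fix c assume c: "c \<in> X"
        define y where "y = 2 * \<kappa> * (nbrs_in S A c)\<^sup>2"
        have "(nbrs_in S A c)\<^sup>2 \<le> v\<^sup>2" using True c nbrs_in_nonneg[of S A c] by (intro power_mono) (auto simp: capped_def)
        then have "y \<le> 2 * \<kappa> * v\<^sup>2" unfolding y_def using \<kappa> by (intro mult_left_mono) auto
        then have y: "0 \<le> y" "y \<le> 1" using \<kappa> by (auto simp: y_def)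
        then have "y\<^sup>2 \<le> y" by (simp add: power2_eq_square mult_left_le)
        then have "exp y \<le> 1 + 2 * y" using exp_le_1_plus_sq[of y] y by simp
        also have "\<dots> \<le> 1 + 4 * \<kappa> * (3 * (N2 A c - 1))" 
          using mult_left_mono[OF N2[of A c], of "4 * \<kappa>"] \<kappa> by (simp add: y_def)
        also have "\<dots> = \<theta> * N2 A c + (1 - \<theta>)" by (simp add: \<theta>_def algebra_simps)
        finally show "0 \<le> exp (2 * \<kappa> * (nbrs_in S A c)\<^sup>2) \<and> exp (2 * \<kappa> * (nbrs_in S A c)\<^sup>2) \<le> \<theta> * N2 A c + (1 - \<theta>)" by (simp add: y_def)
      qed
      finally show ?thesis using True by simp
    qed
  qed
  also have "\<dots> = (\<Sum>T\<in>Pow X. (\<theta> ^ card T * (1 - \<theta>) ^ card (X - T)) * EE (\<lambda>A. exp (2 * ln 2 / 2 * edges_between A S T)))"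
  proof -
    have "(\<Prod>c\<in>X. \<theta> * N2 A c + (1 - \<theta>)) = (\<Sum>T\<in>Pow X. (\<theta> ^ card T * (1 - \<theta>) ^ card (X - T)) * exp (2 * ln 2 / 2 * edges_between A S T))" for A
      unfolding prod_add[OF fin(1)]
    proof (rule sum.cong[OF refl])
      fix T assume "T \<in> Pow X"
      then have fT: "finite T" using fin finite_subset by auto
      have "(\<Prod>c\<in>T. N2 A c) = exp (ln 2 * edges_between A S T)"
        unfolding edges_between_sym[of A S T] using fT by (simp add: N2_def exp_sum[symmetric] edges_between_def nbrs_in_def sum_distrib_left adj_sym)
      then show "(\<Prod>c\<in>T. \<theta> * N2 A c) * (\<Prod>c\<in>X - T. 1 - \<theta>) = (\<theta> ^ card T * (1 - \<theta>) ^ card (X - T)) * exp (2 * ln 2 / 2 * edges_between A S T)"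
        by (simp add: prod.distrib)
    qed
    then show ?thesis by (simp only: bern_sum bern_cmult)
  qed
  also have "\<dots> \<le> (\<Sum>T\<in>Pow X. (\<theta> ^ card T * (1 - \<theta>) ^ card (X - T)) * exp (3 / 2 * x) ^ card T)"
  proof (intro sum_mono mult_left_mono)
    fix T assume T: "T \<in> Pow X"
    have "EE (\<lambda>A. exp (2 * ln 2 / 2 * edges_between A S T)) \<le> exp (L / 2 * (real (card S) * real (card T)) * (exp (2 * ln 2) - 1))"
      by (rule EE_exp_edges) (use S T X in auto)
    also have "exp (2 * ln 2) = (4::real)" by (simp add: exp_double)
    also have "L / 2 * (real (card S) * real (card T)) * (4 - 1) = real (card T) * (3 / 2 * x)" by (simp add: x_def)
    finally show "EE (\<lambda>A. exp (2 * ln 2 / 2 * edges_between A S T)) \<le> exp (3 / 2 * x) ^ card T" by (simp only: exp_of_nat_mult)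
  qed (use \<theta> in auto)
  also have "\<dots> = (\<Prod>c\<in>X. \<theta> * exp (3 / 2 * x) + (1 - \<theta>))"
    unfolding prod_add[OF fin(1)] by (intro sum.cong refl) (simp add: power_mult_distrib mult_ac)
  also have "\<dots> \<le> (\<Prod>c\<in>X. exp (\<theta> * (exp (3 / 2 * x) - 1)))"
  proof (intro prod_mono conjI)
    show "0 \<le> \<theta> * exp (3 / 2 * x) + (1 - \<theta>)" using \<theta> by simp
    show "\<theta> * exp (3 / 2 * x) + (1 - \<theta>) \<le> exp (\<theta> * (exp (3 / 2 * x) - 1))"
      using exp_ge_add_one_self[of "\<theta> * (exp (3 / 2 * x) - 1)"] by (simp add: algebra_simps)
  qed
  also have "\<dots> = exp (real (card X) * (\<theta> * (exp (3 / 2 * x) - 1)))" by (simp add: exp_of_nat_mult)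
  also have "\<dots> \<le> exp (real n * (\<theta> * (27 / 2 * x)))"
  proof -
    have "1 - 3 / 2 * x \<le> exp (- (3 / 2 * x))" using exp_ge_add_one_self[of "- (3 / 2 * x)"] by simp
    then have "exp (3 / 2 * x) * (1 - 3 / 2 * x) \<le> exp (3 / 2 * x) * exp (- (3 / 2 * x))" by (intro mult_left_mono) auto
    also have "\<dots> = 1" by (simp add: exp_minus_inverse)
    finally have "exp (3 / 2 * x) - 1 \<le> 3 / 2 * x * exp (3 / 2 * x)" by (simp add: algebra_simps)
    also have "\<dots> \<le> 3 / 2 * x * 9"
    proof (rule mult_left_mono)
      have "exp (3 / 2 * x) \<le> exp 2" using x by simp
      also have "\<dots> = exp 1 ^ 2" by (simp add: exp_double[symmetric])
      also have "\<dots> \<le> (3::real) ^ 2" by (intro power_mono exp_le) auto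
      finally show "exp (3 / 2 * x) \<le> 9" by simp
    qed (use x in auto)
    finally have e: "exp (3 / 2 * x) - 1 \<le> 27 / 2 * x" by simp
    have "card X \<le> n" using card_mono[of "{..<n}" X] X by simp
    moreover have "\<theta> * (exp (3 / 2 * x) - 1) \<le> \<theta> * (27 / 2 * x)" by (rule mult_left_mono[OF e \<theta>(1)])
    moreover have "0 \<le> \<theta> * (exp (3 / 2 * x) - 1)" using \<theta> x by simp
    ultimately have "real (card X) * (\<theta> * (exp (3 / 2 * x) - 1)) \<le> real n * (\<theta> * (27 / 2 * x))"
      using \<open>card X \<le> n\<close> by (rule_tac mult_mono) auto
    then show ?thesis by simp
  qed
  also have "\<dots> = exp (162 * \<kappa> * real n * (real (card S) * L))" by (simp add: \<theta>_def x_def)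
  finally show ?thesis .
qed

section \<open>Exponential moments for a fixed set of rows with chosen groups and signs\<close>

context
  fixes S :: "nat set" and fk :: "nat \<Rightarrow> nat" and sg :: "nat \<Rightarrow> real" and v \<eta> :: real
  assumes S: "S \<subseteq> {..<n}" "S \<noteq> {}" and fk: "\<And>b. b \<in> S \<Longrightarrow> fk b < K" and sg: "\<And>b. b \<in> S \<Longrightarrow> \<bar>sg b\<bar> \<le> 1"
    and rL: "real (card S) * L \<le> 1" and v: "1 \<le> v" and \<eta>: "0 < \<eta>" "12 * \<eta> \<le> 1" "4 * (\<eta> / (m * L)) * v\<^sup>2 \<le> 1"
begin

text \<open>Coefficient of \<open>E A a c\<close>, for a in group j, in the signed sum over b in S
  of the inner products of row b with the average row of group \<open>fk b\<close>. It depends on a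
  only through the group of a.\<close>

definition chU :: "(nat \<times> nat) set \<Rightarrow> nat \<Rightarrow> nat \<Rightarrow> real" where
  "chU A c j = (\<Sum>b\<in>S. if fk b = j then sg b * E A b c else 0) / size j"

definition chV :: "(nat \<times> nat) set \<Rightarrow> nat \<Rightarrow> real" where
  "chV A c = (\<Sum>b\<in>S. \<bar>E A b c\<bar>)"

text \<open>The multiplier \<eta> / L combined with the factor 1 / m of
  \<open>sum_sq_chU_le\<close>; it is what multiplies the squared column sums
  \<open>chV\<close>.\<close>

definition \<kappa> :: real where "\<kappa> = \<eta> / (m * L)"

lemma \<kappa>: "0 < \<kappa>" "12 * \<kappa> \<le> 1" "4 * \<kappa> * v\<^sup>2 \<le> 1" "\<kappa> * v \<le> 1 / 4"
proof -
  show 0: "0 < \<kappa>" using \<eta> m_pos L_pos by (simp add: \<kappa>_def)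
  have "\<eta> / (m * L) \<le> \<eta> / 1" using \<eta> mL_ge_1 by (intro divide_left_mono) auto
  then show "12 * \<kappa> \<le> 1" using \<eta> by (simp add: \<kappa>_def)
  show 3: "4 * \<kappa> * v\<^sup>2 \<le> 1" using \<eta> by (simp add: \<kappa>_def)
  have "\<kappa> * v * 1 \<le> \<kappa> * v * v" using v 0 by (intro mult_left_mono) auto
  then show "\<kappa> * v \<le> 1 / 4" using 3 by (simp add: power2_eq_square)
qed

lemma \<kappa>nL: "\<kappa> * real n * L = \<eta> * real n / m" using L_pos by (simp add: \<kappa>_def)

lemma chV_nonneg: "0 \<le> chV A c" by (simp add: chV_def sum_nonneg)

lemma chV_le: "c < n \<Longrightarrow> chV A c \<le> nbrs_in S A c + real (card S) * L"
proof -
  assume "c < n"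
  then have "chV A c \<le> (\<Sum>b\<in>S. adj A b c + L)" unfolding chV_def using S by (intro sum_mono abs_E_le) auto
  then show ?thesis by (simp add: sum.distrib nbrs_in_def)
qed

lemma abs_chU_le: "j < K \<Longrightarrow> \<bar>chU A c j\<bar> \<le> chV A c / m"
proof -
  assume j: "j < K"
  have "\<bar>\<Sum>b\<in>S. if fk b = j then sg b * E A b c else 0\<bar> \<le> (\<Sum>b\<in>S. \<bar>E A b c\<bar>)"
    by (rule order_trans[OF sum_abs sum_mono]) (use sg in \<open>auto simp: abs_mult intro: mult_left_le_one_le\<close>)
  then have "\<bar>chU A c j\<bar> \<le> chV A c / size j" unfolding chU_def chV_def using size_pos[OF j] by (simp add: abs_divide divide_right_mono)
  also have "\<dots> \<le> chV A c / m" using size_ge[OF j] m_pos chV_nonneg by (intro divide_left_mono) auto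
  finally show ?thesis .
qed

text \<open>Each b in S spreads |E b c| evenly over the group \<open>fk b\<close>, so no mass is
  gained.\<close>

lemma sum_abs_chU_le: "(\<Sum>a<n. \<bar>chU A c (g a)\<bar>) \<le> chV A c"
proof -
  have "(\<Sum>a<n. \<bar>chU A c (g a)\<bar>) \<le> (\<Sum>a<n. \<Sum>b\<in>S. if fk b = g a then \<bar>E A b c\<bar> / size (g a) else 0)"
  proof (rule sum_mono)
    fix a assume "a \<in> {..<n}"
    then have sz: "0 < size (g a)" using g_less size_pos by auto
    have "\<bar>\<Sum>b\<in>S. if fk b = g a then sg b * E A b c else 0\<bar> \<le> (\<Sum>b\<in>S. if fk b = g a then \<bar>E A b c\<bar> else 0)"
      by (rule order_trans[OF sum_abs sum_mono]) (use sg in \<open>auto simp: abs_mult intro: mult_left_le_one_le\<close>)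
    then have "\<bar>chU A c (g a)\<bar> \<le> (\<Sum>b\<in>S. if fk b = g a then \<bar>E A b c\<bar> else 0) / size (g a)"
      unfolding chU_def using sz by (simp add: abs_divide divide_right_mono)
    also have "\<dots> = (\<Sum>b\<in>S. if fk b = g a then \<bar>E A b c\<bar> / size (g a) else 0)"
      by (simp only: sum_divide_distrib) (intro sum.cong refl, auto)
    finally show "\<bar>chU A c (g a)\<bar> \<le> (\<Sum>b\<in>S. if fk b = g a then \<bar>E A b c\<bar> / size (g a) else 0)" .
  qed
  also have "\<dots> = (\<Sum>b\<in>S. \<Sum>a<n. if fk b = g a then \<bar>E A b c\<bar> / size (g a) else 0)" by (rule sum.swap)
  also have "\<dots> = chV A c" unfolding chV_def
  proof (rule sum.cong[OF refl])
    fix b assume b: "b \<in> S"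
    have "(\<Sum>a<n. if fk b = g a then \<bar>E A b c\<bar> / size (g a) else 0) = (\<Sum>a\<in>grp (fk b). \<bar>E A b c\<bar> / size (fk b))"
      by (rule sum.mono_neutral_cong_right) (auto simp: grp_def)
    also have "\<dots> = \<bar>E A b c\<bar>" using size_pos[OF fk[OF b]] by (simp add: size_def)
    finally show "(\<Sum>a<n. if fk b = g a then \<bar>E A b c\<bar> / size (g a) else 0) = \<bar>E A b c\<bar>" .
  qed
  finally show ?thesis .
qed

text \<open>Sup norm \<open>chV\<close> / m times l1 norm \<open>chV\<close>: averaging over groups
  of at least m nodes gains the factor 1 / m.\<close>

lemma sum_sq_chU_le: "(\<Sum>a<n. (chU A c (g a))\<^sup>2) \<le> (chV A c)\<^sup>2 / m"
proof -
  have "(\<Sum>a<n. (chU A c (g a))\<^sup>2) \<le> (\<Sum>a<n. \<bar>chU A c (g a)\<bar> * (chV A c / m))"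
  proof (rule sum_mono)
    fix a assume "a \<in> {..<n}"
    then have "\<bar>chU A c (g a)\<bar> * \<bar>chU A c (g a)\<bar> \<le> \<bar>chU A c (g a)\<bar> * (chV A c / m)"
      using abs_chU_le[OF g_less] by (intro mult_left_mono) auto
    then show "(chU A c (g a))\<^sup>2 \<le> \<bar>chU A c (g a)\<bar> * (chV A c / m)" by (simp add: power2_eq_square)
  qed
  also have "\<dots> = (\<Sum>a<n. \<bar>chU A c (g a)\<bar>) * (chV A c / m)" by (rule sum_distrib_right[symmetric])
  also have "\<dots> \<le> chV A c * (chV A c / m)" using chV_nonneg m_pos by (intro mult_right_mono sum_abs_chU_le) auto
  finally show ?thesis by (simp add: power2_eq_square)
qed

lemma EE_exp_chV_sq:
  assumes X: "X \<subseteq> {..<n}"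
  shows "EE (\<lambda>A. of_bool (capped S v X A) * exp (\<kappa> * (\<Sum>c\<in>X. (chV A c)\<^sup>2))) \<le> exp (164 * \<eta> * real n / m * real (card S))"
proof -
  define x where "x = real (card S) * L"
  have x: "0 \<le> x" "x \<le> 1" using rL L_pos by (auto simp: x_def)
  have "EE (\<lambda>A. of_bool (capped S v X A) * exp (\<kappa> * (\<Sum>c\<in>X. (chV A c)\<^sup>2))) \<le>
    EE (\<lambda>A. exp (2 * \<kappa> * real n * x) * (of_bool (capped S v X A) * exp (2 * \<kappa> * (\<Sum>c\<in>X. (nbrs_in S A c)\<^sup>2))))"
  proof (rule EE_mono)
    fix A
    have "(\<Sum>c\<in>X. (chV A c)\<^sup>2) \<le> (\<Sum>c\<in>X. 2 * (nbrs_in S A c)\<^sup>2 + 2 * x)"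
    proof (rule sum_mono)
      fix c assume "c \<in> X"
      then have "(chV A c)\<^sup>2 \<le> (nbrs_in S A c + x)\<^sup>2" using chV_le[of c A] chV_nonneg X by (intro power_mono) (auto simp: x_def)
      also have "\<dots> \<le> 2 * (nbrs_in S A c)\<^sup>2 + 2 * x\<^sup>2"
        using sum_squares_ge_zero[of "nbrs_in S A c - x" 0] by (simp add: power2_eq_square algebra_simps)
      also have "x\<^sup>2 \<le> x" using x by (simp add: power2_eq_square mult_left_le)
      finally show "(chV A c)\<^sup>2 \<le> 2 * (nbrs_in S A c)\<^sup>2 + 2 * x" by simp
    qed
    also have "\<dots> = 2 * (\<Sum>c\<in>X. (nbrs_in S A c)\<^sup>2) + 2 * x * real (card X)" by (simp add: sum.distrib sum_distrib_left)
    also have "\<dots> \<le> 2 * (\<Sum>c\<in>X. (nbrs_in S A c)\<^sup>2) + 2 * x * real n"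
      using card_mono[of "{..<n}" X] X x by (intro add_left_mono mult_left_mono) auto
    finally have "\<kappa> * (\<Sum>c\<in>X. (chV A c)\<^sup>2) \<le> \<kappa> * (2 * (\<Sum>c\<in>X. (nbrs_in S A c)\<^sup>2) + 2 * x * real n)" using \<kappa> by (intro mult_left_mono) auto
    also have "\<dots> = 2 * \<kappa> * real n * x + 2 * \<kappa> * (\<Sum>c\<in>X. (nbrs_in S A c)\<^sup>2)" by (simp add: algebra_simps)
    finally have "exp (\<kappa> * (\<Sum>c\<in>X. (chV A c)\<^sup>2)) \<le> exp (2 * \<kappa> * real n * x) * exp (2 * \<kappa> * (\<Sum>c\<in>X. (nbrs_in S A c)\<^sup>2))" by (simp only: exp_add[symmetric] exp_le_cancel_iff)
    then show "of_bool (capped S v X A) * exp (\<kappa> * (\<Sum>c\<in>X. (chV A c)\<^sup>2)) \<le> exp (2 * \<kappa> * real n * x) * (of_bool (capped S v X A) * exp (2 * \<kappa> * (\<Sum>c\<in>X. (nbrs_in S A c)\<^sup>2)))"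
      by auto
  qed
  also have "\<dots> \<le> exp (2 * \<kappa> * real n * x) * exp (162 * \<kappa> * real n * x)"
    unfolding bern_cmult x_def using \<kappa> by (intro mult_left_mono EE_exp_nbrs_sq S X rL) auto
  also have "\<dots> = exp (164 * (\<kappa> * real n * L) * real (card S))" by (simp add: exp_add[symmetric] x_def)
  also have "164 * (\<kappa> * real n * L) * real (card S) = 164 * \<eta> * real n / m * real (card S)" unfolding \<kappa>nL by simp
  finally show ?thesis .
qed

text \<open>Here \<open>X\<close> is \<open>S\<close> or its complement: in both cases no edge between a node outside \<open>S\<close> and
  a node of \<open>X\<close> joins a node of \<open>S\<close> to a node of \<open>X\<close> in the coefficients \<open>chU\<close>, so that one can
  condition on the latter.\<close>
lemma EE_exp_chaos:
  assumes X: "X = S \<or> X = {..<n} - S"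
  shows "EE (\<lambda>A. of_bool (capped S v X A) * exp (\<eta> / L * (\<Sum>a\<in>{..<n}-S. \<Sum>c\<in>X. chU A c (g a) * E A a c))) \<le> exp (164 * \<eta> * real n / m * real (card S))"
proof -
  have Xn: "X \<subseteq> {..<n}" using X S by auto
  define q where "q A a c = (if a \<notin> S \<and> c \<in> X then \<eta> / L * chU A c (g a) else 0)" for A a c
  \<comment> \<open>The pairs that carry the factor \<open>E A a c\<close>. For X = S they join S to
    its complement while the coefficients see pairs inside S; for X the complement they lie inside
    the complement while the coefficients see pairs between S and it. Deleting J thus changes
    neither the coefficients nor the cap.\<close>
  define J where "J = {(x, y) \<in> pairs n. (x \<notin> S \<and> y \<in> X) \<or> (y \<notin> S \<and> x \<in> X)}"
  define ce where "ce e A = (case e of (x, y) \<Rightarrow> q A x y + q A y x)" for e A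
  have J: "J \<subseteq> pairs n" by (auto simp: J_def)
  have \<eta>L: "0 < \<eta> / L" using \<eta> L_pos by simp
  have sum_eq: "\<eta> / L * (\<Sum>a\<in>{..<n}-S. \<Sum>c\<in>X. chU A c (g a) * E A a c) = (\<Sum>e\<in>J. ce e A * (of_bool (e \<in> A) - case_prod M e))" for A
  proof -
    have "\<eta> / L * (\<Sum>a\<in>{..<n}-S. \<Sum>c\<in>X. chU A c (g a) * E A a c) = (\<Sum>a\<in>{..<n}-S. \<Sum>c\<in>X. q A a c * E A a c)"
      by (simp add: sum_distrib_left q_def mult.assoc)
    also have "\<dots> = (\<Sum>a\<in>{..<n}-S. \<Sum>c<n. q A a c * E A a c)"
      by (intro sum.cong refl sum.mono_neutral_left) (use Xn in \<open>auto simp: q_def\<close>)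
    also have "\<dots> = (\<Sum>a<n. \<Sum>c<n. q A a c * E A a c)"
      by (rule sum.mono_neutral_left) (auto simp: q_def)
    also have "\<dots> = (\<Sum>e\<in>pairs n. ce e A * (of_bool (e \<in> A) - case_prod M e))"
      unfolding sum_E ce_def ..
    also have "\<dots> = (\<Sum>e\<in>J. ce e A * (of_bool (e \<in> A) - case_prod M e))"
    proof (rule sum.mono_neutral_right[OF finite_pairs J], rule ballI)
      fix e assume e: "e \<in> pairs n - J"
      obtain x y where "e = (x, y)" by (cases e)
      then have "\<not> (x \<notin> S \<and> y \<in> X)" "\<not> (y \<notin> S \<and> x \<in> X)" using e by (auto simp: J_def)
      then have "ce e A = 0" unfolding \<open>e = (x, y)\<close> ce_def q_def prod.case by (simp only: if_False)
      then show "ce e A * (of_bool (e \<in> A) - case_prod M e) = 0" by simp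
    qed
    finally show ?thesis .
  qed
  have adj_J: "adj (A - J) b c = adj A b c" if "b \<in> S" "c \<in> X" for A b c
    unfolding adj_def J_def using that X by (auto simp: max_def min_def)
  have nb_J: "nbrs_in S (A - J) c = nbrs_in S A c" if "c \<in> X" for A c
    unfolding nbrs_in_def using adj_J that by (intro sum.cong) auto
  have U_J: "chU (A - J) c j = chU A c j" if "c \<in> X" for A c j
    unfolding chU_def E_def by (intro arg_cong2[of _ _ _ _ "(/)"] sum.cong refl) (use adj_J that in auto)
  have q_J: "q (A - J) a c = q A a c" for A a c by (simp add: q_def U_J)
  \<comment> \<open>The cap bounds the conditional coefficients: (\<eta> / L) (v + 1) / m = \<kappa>
    v + \<kappa> \<le> 1/4 + 1/12.\<close>
  have q_le: "\<bar>q A a c\<bar> \<le> 1 / 2" if "capped S v X A" "a < n" for A a c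
  proof (cases "a \<notin> S \<and> c \<in> X")
    case True
    then have c: "c < n" using Xn by auto
    have "chV A c \<le> v + 1" using chV_le[OF c, of A] rL that True by (force simp: capped_def)
    then have "chV A c / m \<le> (v + 1) / m" using m_pos by (intro divide_right_mono) auto
    with abs_chU_le[OF g_less[OF that(2)], of A c] have "\<bar>chU A c (g a)\<bar> \<le> (v + 1) / m" by (rule order_trans)
    then have "\<eta> / L * \<bar>chU A c (g a)\<bar> \<le> \<eta> / L * ((v + 1) / m)"
      using \<eta>L by (intro mult_left_mono) auto
    also have "\<dots> = \<kappa> * v + \<kappa>" using L_pos m_pos by (simp add: \<kappa>_def field_simps)
    also have "\<dots> \<le> 1 / 2" using \<kappa> by simp
    finally show ?thesis using True \<eta>L \<eta> L_pos by (simp add: q_def abs_mult)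
  qed (auto simp: q_def)
  have "EE (\<lambda>A. of_bool (capped S v X A) * exp (\<eta> / L * (\<Sum>a\<in>{..<n}-S. \<Sum>c\<in>X. chU A c (g a) * E A a c)))
    \<le> EE (\<lambda>A. of_bool (capped S v X A) * exp (L * (\<Sum>e\<in>J. (ce e A)\<^sup>2)))"
    unfolding sum_eq
  proof (rule bern_exp_conditional[OF finite_pairs J case_M(2)])
    fix A e assume A: "A \<subseteq> pairs n"
    show "ce e (A - J) = ce e A" by (simp add: ce_def q_J)
    show "capped S v X (A - J) = capped S v X A" by (simp add: capped_def nb_J)
    assume e: "e \<in> J" "capped S v X A"
    obtain x y where xy: "e = (x, y)" by (cases e)
    then have "x < n" "y < n" using e J by (auto simp: pairs_def)
    then show "\<bar>ce e A\<bar> \<le> 1" using q_le[OF e(2), of x y] q_le[OF e(2), of y x] by (auto simp: ce_def xy)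
  qed
  also have "\<dots> \<le> EE (\<lambda>A. of_bool (capped S v X A) * exp (\<kappa> * (\<Sum>c\<in>X. (chV A c)\<^sup>2)))"
  proof (rule EE_mono)
    fix A
    have "(\<Sum>e\<in>J. (ce e A)\<^sup>2) \<le> (\<Sum>e\<in>pairs n. (ce e A)\<^sup>2)" by (rule sum_mono2) (use J in auto)
    also have "\<dots> \<le> 2 * (\<Sum>a<n. \<Sum>c<n. (q A a c)\<^sup>2)" unfolding ce_def by (rule sum_sq_pairs)
    also have "(\<Sum>a<n. \<Sum>c<n. (q A a c)\<^sup>2) = (\<Sum>a<n. \<Sum>c\<in>X. (q A a c)\<^sup>2)"
      by (intro sum.cong refl sum.mono_neutral_right) (use Xn in \<open>auto simp: q_def\<close>)
    also have "\<dots> \<le> (\<Sum>a<n. \<Sum>c\<in>X. (\<eta> / L)\<^sup>2 * (chU A c (g a))\<^sup>2)"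
      by (intro sum_mono) (auto simp: q_def power_mult_distrib power_divide)
    also have "\<dots> = (\<eta> / L)\<^sup>2 * (\<Sum>c\<in>X. \<Sum>a<n. (chU A c (g a))\<^sup>2)" by (subst sum.swap) (simp add: sum_distrib_left)
    also have "\<dots> \<le> (\<eta> / L)\<^sup>2 * (\<Sum>c\<in>X. (chV A c)\<^sup>2 / m)" by (intro mult_left_mono sum_mono sum_sq_chU_le) auto
    finally have "L * (\<Sum>e\<in>J. (ce e A)\<^sup>2) \<le> L * (2 * ((\<eta> / L)\<^sup>2 * (\<Sum>c\<in>X. (chV A c)\<^sup>2 / m)))" using L_pos by (intro mult_left_mono) auto
    \<comment> \<open>The conditional variance has the form treated in \<open>EE_exp_chV_sq\<close>,
      with the multiplier \<kappa> reduced by the factor 2 \<eta> \<le> 1.\<close>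
    also have "\<dots> = 2 * \<eta> * (\<kappa> * (\<Sum>c\<in>X. (chV A c)\<^sup>2))"
      using L_pos m_pos by (simp add: \<kappa>_def power2_eq_square sum_divide_distrib[symmetric] field_simps)
    also have "\<dots> \<le> 1 * (\<kappa> * (\<Sum>c\<in>X. (chV A c)\<^sup>2))"
      using \<eta> \<kappa> by (intro mult_right_mono mult_nonneg_nonneg sum_nonneg) auto
    finally show "of_bool (capped S v X A) * exp (L * (\<Sum>e\<in>J. (ce e A)\<^sup>2)) \<le> of_bool (capped S v X A) * exp (\<kappa> * (\<Sum>c\<in>X. (chV A c)\<^sup>2))"
      by simp
  qed
  also have "\<dots> \<le> exp (164 * \<eta> * real n / m * real (card S))" by (rule EE_exp_chV_sq[OF Xn])
  finally show ?thesis .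
qed

text \<open>The sum splits according to the position of a and c: a outside S with c in S, both
  outside S, and a in S. To the first two \<open>EE_exp_chaos\<close> applies; the third is bounded
  by the squared column sums without using cancellation. Each may take one third of 3 y.\<close>

lemma PP_fixed_signs:
  "PP (\<lambda>A. capped S v {..<n} A \<and> (\<Sum>b\<in>S. sg b * (\<Sum>c<n. (\<Sum>a\<in>grp (fk b). E A a c) / size (fk b) * E A b c)) \<ge> 3 * y)
    \<le> 3 * (exp (164 * \<eta> * real n / m * real (card S)) * exp (- (\<eta> / L * y)))"
proof -
  let ?b = "exp (164 * \<eta> * real n / m * real (card S))"
  define Y where "Y A X = (\<Sum>a\<in>{..<n}-S. \<Sum>c\<in>X. chU A c (g a) * E A a c)" for A X
  define V2 where "V2 A = (\<Sum>c<n. (chV A c)\<^sup>2)" for A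
  have \<eta>L: "0 < \<eta> / L" using \<eta> L_pos by simp
  have decomp: "(\<Sum>b\<in>S. sg b * (\<Sum>c<n. (\<Sum>a\<in>grp (fk b). E A a c) / size (fk b) * E A b c)) \<le> Y A S + Y A ({..<n} - S) + V2 A / m" for A
  proof -
    have 1: "(\<Sum>b\<in>S. sg b * (\<Sum>c<n. (\<Sum>a\<in>grp (fk b). E A a c) / size (fk b) * E A b c))
      = (\<Sum>b\<in>S. \<Sum>c<n. \<Sum>a<n. (if fk b = g a then sg b * E A b c else 0) / size (g a) * E A a c)"
    proof (intro sum.cong refl)
      fix b assume "b \<in> S"
      have "(\<Sum>a\<in>grp (fk b). E A a c) / size (fk b) * E A b c = (\<Sum>a<n. (if fk b = g a then E A b c / size (g a) * E A a c else 0))" for c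
      proof -
        have "(\<Sum>a<n. (if fk b = g a then E A b c / size (g a) * E A a c else 0)) = (\<Sum>a\<in>grp (fk b). E A b c / size (fk b) * E A a c)"
          by (rule sum.mono_neutral_cong_right) (auto simp: grp_def)
        also have "\<dots> = E A b c / size (fk b) * (\<Sum>a\<in>grp (fk b). E A a c)" by (simp add: sum_distrib_left)
        finally show ?thesis by simp
      qed
      then show "sg b * (\<Sum>c<n. (\<Sum>a\<in>grp (fk b). E A a c) / size (fk b) * E A b c) = (\<Sum>c<n. \<Sum>a<n. (if fk b = g a then sg b * E A b c else 0) / size (g a) * E A a c)"
        by (simp only: sum_distrib_left) (intro sum.cong refl, auto)
    qed
    have "(\<Sum>b\<in>S. \<Sum>c<n. \<Sum>a<n. F b c a) = (\<Sum>a<n. \<Sum>c<n. \<Sum>b\<in>S. F b c a)" for F :: "nat \<Rightarrow> nat \<Rightarrow> nat \<Rightarrow> real"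
    proof -
      have "(\<Sum>b\<in>S. \<Sum>c<n. \<Sum>a<n. F b c a) = (\<Sum>b\<in>S. \<Sum>a<n. \<Sum>c<n. F b c a)" by (rule sum.cong[OF refl], rule sum.swap)
      also have "\<dots> = (\<Sum>a<n. \<Sum>b\<in>S. \<Sum>c<n. F b c a)" by (rule sum.swap)
      also have "\<dots> = (\<Sum>a<n. \<Sum>c<n. \<Sum>b\<in>S. F b c a)" by (rule sum.cong[OF refl], rule sum.swap)
      finally show ?thesis .
    qed
    note 2 = this[of "\<lambda>b c a. (if fk b = g a then sg b * E A b c else 0) / size (g a) * E A a c"]
    have 3: "(\<Sum>a<n. \<Sum>c<n. \<Sum>b\<in>S. (if fk b = g a then sg b * E A b c else 0) / size (g a) * E A a c) = (\<Sum>a<n. \<Sum>c<n. chU A c (g a) * E A a c)"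
      by (simp only: chU_def sum_distrib_right sum_divide_distrib)
    have 4: "(\<Sum>a<n. \<Sum>c<n. chU A c (g a) * E A a c) = (\<Sum>a\<in>{..<n}-S. \<Sum>c<n. chU A c (g a) * E A a c) + (\<Sum>a\<in>S. \<Sum>c<n. chU A c (g a) * E A a c)"
      by (rule sum.subset_diff) (use S in auto)
    have 5: "(\<Sum>a\<in>{..<n}-S. \<Sum>c<n. chU A c (g a) * E A a c) = Y A ({..<n} - S) + Y A S"
      unfolding Y_def sum.distrib[symmetric] by (intro sum.cong[OF refl] sum.subset_diff) (use S in auto)
    have 6: "(\<Sum>a\<in>S. \<Sum>c<n. chU A c (g a) * E A a c) \<le> (\<Sum>a\<in>S. \<Sum>c<n. chV A c / m * \<bar>E A a c\<bar>)"
    proof (intro sum_mono)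
      fix a c assume "a \<in> S"
      then have "g a < K" using S g_less by auto
      have "chU A c (g a) * E A a c \<le> \<bar>chU A c (g a)\<bar> * \<bar>E A a c\<bar>" by (metis abs_ge_self abs_mult)
      also have "\<dots> \<le> chV A c / m * \<bar>E A a c\<bar>" using abs_chU_le[OF \<open>g a < K\<close>] by (intro mult_right_mono) auto
      finally show "chU A c (g a) * E A a c \<le> chV A c / m * \<bar>E A a c\<bar>" .
    qed
    have 7: "(\<Sum>a\<in>S. \<Sum>c<n. chV A c / m * \<bar>E A a c\<bar>) = V2 A / m"
    proof -
      have "(\<Sum>a\<in>S. \<Sum>c<n. chV A c / m * \<bar>E A a c\<bar>) = (\<Sum>c<n. chV A c / m * (\<Sum>a\<in>S. \<bar>E A a c\<bar>))"
        by (subst sum.swap) (simp only: sum_distrib_left)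
      then show ?thesis unfolding chV_def[symmetric] by (simp add: V2_def sum_divide_distrib power2_eq_square)
    qed
    show ?thesis using 4 5 6 unfolding 1 2 3 7 by linarith
  qed
  define e1 where "e1 A \<longleftrightarrow> capped S v S A \<and> \<eta> / L * Y A S \<ge> \<eta> / L * y" for A
  define e2 where "e2 A \<longleftrightarrow> capped S v ({..<n} - S) A \<and> \<eta> / L * Y A ({..<n} - S) \<ge> \<eta> / L * y" for A
  define e3 where "e3 A \<longleftrightarrow> capped S v {..<n} A \<and> \<kappa> * V2 A \<ge> \<eta> / L * y" for A
  have "PP (\<lambda>A. capped S v {..<n} A \<and> (\<Sum>b\<in>S. sg b * (\<Sum>c<n. (\<Sum>a\<in>grp (fk b). E A a c) / size (fk b) * E A b c)) \<ge> 3 * y) \<le> PP (\<lambda>A. e1 A \<or> (e2 A \<or> e3 A))"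
  proof (rule PP_mono)
    fix A assume A: "capped S v {..<n} A \<and> (\<Sum>b\<in>S. sg b * (\<Sum>c<n. (\<Sum>a\<in>grp (fk b). E A a c) / size (fk b) * E A b c)) \<ge> 3 * y"
    then have "3 * y \<le> Y A S + Y A ({..<n} - S) + V2 A / m" using decomp[of A] by linarith
    then consider "y \<le> Y A S" | "y \<le> Y A ({..<n} - S)" | "y \<le> V2 A / m" by linarith
    moreover have "capped S v S A" "capped S v ({..<n} - S) A" using A S by (auto simp: capped_def)
    moreover have "\<kappa> * V2 A = \<eta> / L * (V2 A / m)" using L_pos by (simp add: \<kappa>_def)
    ultimately show "e1 A \<or> (e2 A \<or> e3 A)"
    proof cases
      case 1 
      then have "\<eta> / L * Y A S \<ge> \<eta> / L * y" using \<eta>L by (intro mult_left_mono) auto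
      then show ?thesis using \<open>capped S v S A\<close> by (simp add: e1_def)
    next
      case 2 
      then have "\<eta> / L * Y A ({..<n} - S) \<ge> \<eta> / L * y" using \<eta>L by (intro mult_left_mono) auto
      then show ?thesis using \<open>capped S v ({..<n} - S) A\<close> by (simp add: e2_def)
    next
      case 3 
      then have "\<eta> / L * (V2 A / m) \<ge> \<eta> / L * y" using \<eta>L by (intro mult_left_mono) auto
      then show ?thesis using A \<open>\<kappa> * V2 A = \<eta> / L * (V2 A / m)\<close> by (simp add: e3_def)
    qed
  qed
  also have "\<dots> \<le> PP e1 + (PP e2 + PP e3)" using PP_or[of e1 "\<lambda>A. e2 A \<or> e3 A"] PP_or[of e2 e3] by linarith
  also have "\<dots> \<le> ?b * exp (- (\<eta> / L * y)) + (?b * exp (- (\<eta> / L * y)) + ?b * exp (- (\<eta> / L * y)))"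
  proof (intro add_mono)
    show "PP e1 \<le> ?b * exp (- (\<eta> / L * y))"
      unfolding e1_def Y_def by (rule PP_Markov[OF EE_exp_chaos]) simp
    show "PP e2 \<le> ?b * exp (- (\<eta> / L * y))"
      unfolding e2_def Y_def by (rule PP_Markov[OF EE_exp_chaos]) simp
    show "PP e3 \<le> ?b * exp (- (\<eta> / L * y))"
      unfolding e3_def V2_def by (rule PP_Markov[OF EE_exp_chV_sq]) simp
  qed
  also have "\<dots> = 3 * (?b * exp (- (\<eta> / L * y)))" by simp
  finally show ?thesis .
qed

end

end

section \<open>Joint probability that all rows of a set are bad\<close>

context block_graph
begin

text \<open>\<open>W\<close> and \<open>E\<close> differ only on the diagonal, which leaves three
  corrections of size at most L.\<close>

lemma W_E_product:
  assumes A: "A \<subseteq> pairs n" and ab: "a < n" "b < n"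
  shows "\<bar>(\<Sum>c<n. W A a c * W A b c) - (\<Sum>c<n. E A a c * E A b c)\<bar> \<le> 3 * L"
proof -
  have "(\<Sum>c<n. W A a c * W A b c) = (\<Sum>c<n. E A a c * E A b c - (if b = c then E A a c * M b c else 0) - (if a = c then E A b c * M a c else 0)
      + (if a = c then (if b = c then M a c * M b c else 0) else 0))"
    by (rule sum.cong) (auto simp: W_eq_E[OF A] algebra_simps)
  also have "\<dots> = (\<Sum>c<n. E A a c * E A b c) - E A a b * M b b - E A b a * M a a + (if b = a then M a a * M b b else 0)"
    using ab by (simp add: sum.distrib sum_subtractf)
  finally have eq: "(\<Sum>c<n. W A a c * W A b c) - (\<Sum>c<n. E A a c * E A b c) = - (E A a b * M b b) - E A b a * M a a + (if b = a then M a a * M b b else 0)"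
    by simp
  have EM: "\<bar>E A x y * M z z\<bar> \<le> L" if "x < n" "y < n" "z < n" for x y z
    using mult_mono[OF abs_E_le_1[OF that(1,2)] M_le_L[OF that(3,3)]] M_nonneg[OF that(3,3)] by (simp add: abs_mult)
  have MM: "\<bar>if b = a then M a a * M b b else 0\<bar> \<le> L"
    using mult_mono[OF M_le_1[OF ab(1,1)] M_le_L[OF ab(2,2)]] M_nonneg[OF ab(1,1)] M_nonneg[OF ab(2,2)] L_pos by (auto simp: abs_mult)
  have "\<bar>- x - y + z\<bar> \<le> 3 * l" if "\<bar>x\<bar> \<le> l" "\<bar>y\<bar> \<le> l" "\<bar>z\<bar> \<le> l" for x y z l :: real using that by linarith
  from this[OF EM[OF ab ab(2)] EM[OF ab(2,1) ab(1)] MM] show ?thesis unfolding eq .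
qed

text \<open>The diagonal corrections cost 3 L \<le> D / 64, half of the threshold D / 32. A sign is
  extracted because the moment bounds are one-sided.\<close>

lemma bad_imp_sign:
  assumes A: "A \<subseteq> pairs n" and b: "b < n" and bad: "bad A b" and D: "192 * L \<le> D"
  shows "\<exists>k<K. \<exists>\<sigma>\<in>{1, -1}. D / 64 \<le> \<sigma> * (\<Sum>c<n. (\<Sum>a\<in>grp k. E A a c) / size k * E A b c)"
proof -
  from bad obtain k where k: "k < K" and gt: "D / 32 < \<bar>\<Sum>c<n. Wbar A k c * W A b c\<bar>" by (auto simp: bad_def)
  have av: "(\<Sum>c<n. (\<Sum>a\<in>grp k. F a c) / size k * H c) = (\<Sum>a\<in>grp k. \<Sum>c<n. F a c * H c) / size k" for F :: "nat \<Rightarrow> nat \<Rightarrow> real" and H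
  proof -
    have "(\<Sum>c<n. (\<Sum>a\<in>grp k. F a c) / size k * H c) = (\<Sum>c<n. \<Sum>a\<in>grp k. F a c * H c) / size k"
      by (simp add: sum_divide_distrib sum_distrib_right)
    then show ?thesis by (subst sum.swap)
  qed
  let ?e = "\<Sum>c<n. (\<Sum>a\<in>grp k. E A a c) / size k * E A b c"
  have "\<bar>(\<Sum>a\<in>grp k. \<Sum>c<n. W A a c * W A b c) - (\<Sum>a\<in>grp k. \<Sum>c<n. E A a c * E A b c)\<bar> \<le> (\<Sum>a\<in>grp k. 3 * L)"
    unfolding sum_subtractf[symmetric]
    by (rule order_trans[OF sum_abs sum_mono]) (use W_E_product[OF A _ b] in \<open>auto simp: grp_def sum_subtractf\<close>)
  also have "\<dots> = size k * (3 * L)" by (simp add: size_def)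
  finally have "\<bar>(\<Sum>a\<in>grp k. \<Sum>c<n. W A a c * W A b c) - (\<Sum>a\<in>grp k. \<Sum>c<n. E A a c * E A b c)\<bar> / size k \<le> 3 * L"
    using size_pos[OF k] by (simp add: pos_divide_le_eq mult.commute)
  then have "\<bar>(\<Sum>c<n. Wbar A k c * W A b c) - ?e\<bar> \<le> 3 * L"
    unfolding Wbar_def av using size_pos[OF k] by (simp add: abs_divide diff_divide_distrib[symmetric])
  then have "D / 64 \<le> \<bar>?e\<bar>" using gt D by linarith
  then show ?thesis using k by (intro exI[of _ k]) (auto simp: abs_if split: if_splits)
qed

text \<open>Union over a group and a sign for each row, with |S| D / 64 = 3 (|S| D / 192) in
  \<open>PP_fixed_signs\<close>. The threshold 65600 = 164 * 400 makes the moment term 164 \<eta> n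
  / m at most \<eta> s2 / 400 per row, less than half of the gain \<eta> s2 / 192.\<close>

lemma PP_all_bad_capped:
  assumes S: "S \<subseteq> {..<n}" "S \<noteq> {}" and rL: "real (card S) * L \<le> 1" and v: "1 \<le> v" 
    and \<eta>: "0 < \<eta>" "12 * \<eta> \<le> 1" "4 * (\<eta> / (m * L)) * v\<^sup>2 \<le> 1"
    and s: "65600 * (real n / m) \<le> s2"
  shows "PP (\<lambda>A. capped S v {..<n} A \<and> (\<forall>b\<in>S. bad A b)) \<le> (2 * real K) ^ card S * (3 * exp (- \<eta> * real (card S) * s2 / 400))"
proof -
  have fS: "finite S" using S finite_subset by auto
  have "1 * m \<le> real K * m" using g_less[OF n_pos] m_pos by (intro mult_right_mono) auto
  with K_m_le have "m \<le> real n" by linarith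
  with m_pos have "1 \<le> real n / m" by (simp add: pos_le_divide_eq)
  then have s65: "65600 \<le> s2" using s by linarith
  then have D: "192 * L \<le> D" using L_pos by (simp add: s2_def field_simps)
  let ?F = "PiE S (\<lambda>_. {..<K} \<times> {1, -1 :: real})"
  let ?ev = "\<lambda>f A. capped S v {..<n} A \<and> (\<Sum>b\<in>S. snd (f b) * (\<Sum>c<n. (\<Sum>a\<in>grp (fst (f b)). E A a c) / size (fst (f b)) * E A b c)) \<ge> 3 * (real (card S) * D / 192)"
  have "PP (\<lambda>A. capped S v {..<n} A \<and> (\<forall>b\<in>S. bad A b)) \<le> PP (\<lambda>A. \<exists>f\<in>?F. ?ev f A)"
  proof (rule PP_mono)
    fix A assume A: "A \<subseteq> pairs n" and h: "capped S v {..<n} A \<and> (\<forall>b\<in>S. bad A b)"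
    have "\<forall>b\<in>S. \<exists>z. z \<in> {..<K} \<times> {1, -1} \<and> D / 64 \<le> snd z * (\<Sum>c<n. (\<Sum>a\<in>grp (fst z). E A a c) / size (fst z) * E A b c)"
    proof
      fix b assume "b \<in> S"
      then obtain k \<sigma> where "k < K" "\<sigma> \<in> {1, -1}" "D / 64 \<le> \<sigma> * (\<Sum>c<n. (\<Sum>a\<in>grp k. E A a c) / size k * E A b c)"
        using bad_imp_sign[OF A _ _ D, of b] h S by blast
      then show "\<exists>z. z \<in> {..<K} \<times> {1, -1} \<and> D / 64 \<le> snd z * (\<Sum>c<n. (\<Sum>a\<in>grp (fst z). E A a c) / size (fst z) * E A b c)"
        by (intro exI[of _ "(k, \<sigma>)"]) simp
    qed
    from bchoice[OF this] obtain f where f0: "\<forall>b\<in>S. f b \<in> {..<K} \<times> {1, -1} \<and>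
      D / 64 \<le> snd (f b) * (\<Sum>c<n. (\<Sum>a\<in>grp (fst (f b)). E A a c) / size (fst (f b)) * E A b c)" ..
    have f1: "f b \<in> {..<K} \<times> {1, -1}" if "b \<in> S" for b
      using f0[rule_format, OF that] by (rule conjunct1)
    have f2: "D / 64 \<le> snd (f b) * (\<Sum>c<n. (\<Sum>a\<in>grp (fst (f b)). E A a c) / size (fst (f b)) * E A b c)" if "b \<in> S" for b
      using f0[rule_format, OF that] by (rule conjunct2)
    let ?f = "restrict f S"
    have "(\<Sum>b\<in>S. D / 64) \<le> (\<Sum>b\<in>S. snd (?f b) * (\<Sum>c<n. (\<Sum>a\<in>grp (fst (?f b)). E A a c) / size (fst (?f b)) * E A b c))"
      by (rule sum_mono) (use f2 in auto)
    moreover have "(\<Sum>b\<in>S. D / 64) = 3 * (real (card S) * D / 192)" by simp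
    ultimately have "?ev ?f A" using h by (simp only:)
    moreover have "?f \<in> ?F" using f1 by (auto simp: PiE_iff)
    ultimately show "\<exists>f\<in>?F. ?ev f A" by blast
  qed
  also have "\<dots> \<le> (\<Sum>f\<in>?F. PP (?ev f))" by (rule PP_Ex) (auto intro!: finite_PiE fS)
  also have "\<dots> \<le> (\<Sum>f\<in>?F. 3 * exp (- \<eta> * real (card S) * s2 / 400))"
  proof (rule sum_mono)
    fix f assume f: "f \<in> ?F"
    have f1: "fst (f b) < K" "\<bar>snd (f b)\<bar> \<le> 1" if "b \<in> S" for b
      using PiE_mem[OF f that] by (auto simp: mem_Times_iff)
    have "PP (?ev f) \<le> 3 * (exp (164 * \<eta> * real n / m * real (card S)) * exp (- (\<eta> / L * (real (card S) * D / 192))))"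
      by (rule PP_fixed_signs[where fk = "\<lambda>b. fst (f b)" and sg = "\<lambda>b. snd (f b)", OF S f1(1) f1(2) rL v \<eta>])
    also have "\<dots> \<le> 3 * exp (- \<eta> * real (card S) * s2 / 400)"
    proof -
      have "164 * \<eta> * real n / m * real (card S) = \<eta> * real (card S) * (164 * (real n / m))" by simp
      also have "\<dots> \<le> \<eta> * real (card S) * (s2 / 400)" using s \<eta> by (intro mult_left_mono) auto
      finally have 1: "164 * \<eta> * real n / m * real (card S) \<le> \<eta> * real (card S) * (s2 / 400)" .
      have 2: "\<eta> / L * (real (card S) * D / 192) = \<eta> * real (card S) * (s2 / 192)" by (simp add: s2_def)
      have "\<eta> * real (card S) * (s2 / 200) \<le> \<eta> * real (card S) * (s2 / 192)" using \<eta> s65 by (intro mult_left_mono) auto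
      moreover have "\<eta> * real (card S) * (s2 / 200) = 2 * (\<eta> * real (card S) * (s2 / 400))" "- \<eta> * real (card S) * s2 / 400 = - (\<eta> * real (card S) * (s2 / 400))" by simp_all
      ultimately have "164 * \<eta> * real n / m * real (card S) + - (\<eta> / L * (real (card S) * D / 192)) \<le> - \<eta> * real (card S) * s2 / 400"
        using 1 unfolding 2 by linarith
      then show ?thesis unfolding exp_add[symmetric] by simp
    qed
    finally show "PP (?ev f) \<le> 3 * exp (- \<eta> * real (card S) * s2 / 400)" .
  qed
  also have "\<dots> = (2 * real K) ^ card S * (3 * exp (- \<eta> * real (card S) * s2 / 400))"
    using fS by (simp add: card_PiE card_cartesian_product mult.commute)
  finally show ?thesis .
qed

lemma nbrs_in_le_card: "nbrs_in S A c \<le> real (card S)"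
  unfolding nbrs_in_def using sum_mono[of S "\<lambda>b. adj A b c" "\<lambda>_. 1"] by simp

text \<open>Chernoff bound with exp f = 1 / x: the moment is at most exp (1/2) \<le> 2 and exceeding
  v costs x^(v / 2), a negative power of n as soon as x is one.\<close>

lemma PP_not_capped:
  assumes S: "S \<subseteq> {..<n}" "S \<noteq> {}" and rL: "real (card S) * L \<le> x" and x: "x \<le> 1"
  shows "PP (\<lambda>A. \<not> capped S v {..<n} A) \<le> real n * (2 * exp (v / 2 * ln x))"
proof -
  have pos: "0 < real (card S) * L" using S L_pos finite_subset[OF S(1)] by (simp add: card_gt_0_iff)
  then have x0: "0 < x" using rL by linarith
  define f where "f = - ln x"
  have f: "0 \<le> f" "exp f = 1 / x" using x x0 by (auto simp: f_def exp_minus field_simps)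
  have "PP (\<lambda>A. \<not> capped S v {..<n} A) \<le> PP (\<lambda>A. \<exists>c\<in>{..<n}. f / 2 * edges_between A S {c} \<ge> f / 2 * v)"
  proof (rule PP_mono)
    fix A assume "\<not> capped S v {..<n} A"
    then obtain c where "c < n" "v < nbrs_in S A c" by (auto simp: capped_def not_le)
    then show "\<exists>c\<in>{..<n}. f / 2 * edges_between A S {c} \<ge> f / 2 * v"
      using f by (intro bexI[of _ c] mult_left_mono) (auto simp: edges_between_def nbrs_in_def)
  qed
  also have "\<dots> \<le> (\<Sum>c<n. PP (\<lambda>A. f / 2 * edges_between A S {c} \<ge> f / 2 * v))" by (rule PP_Ex) auto
  also have "\<dots> \<le> (\<Sum>c<n. 2 * exp (v / 2 * ln x))"
  proof (rule sum_mono)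
    fix c assume "c \<in> {..<n}"
    then have "PP (\<lambda>A. f / 2 * edges_between A S {c} \<ge> f / 2 * v) \<le> exp (L / 2 * (real (card S) * real (card {c})) * (exp f - 1)) * exp (- (f / 2 * v))"
      by (intro PP_Markov'[OF EE_exp_edges] S f) auto
    also have "\<dots> \<le> 2 * exp (- (f / 2 * v))"
    proof (rule mult_right_mono)
      have "L / 2 * (real (card S) * real (card {c})) * (exp f - 1) \<le> 1 / 2 * x * (1 / x)"
        unfolding f(2)
      proof (rule mult_mono)
        show "L / 2 * (real (card S) * real (card {c})) \<le> 1 / 2 * x" using rL by (simp add: mult.commute)
      qed (use x0 x in auto)
      also have "\<dots> = 1 / 2" using x0 by simp
      finally have "exp (L / 2 * (real (card S) * real (card {c})) * (exp f - 1)) \<le> exp (1 / 2)" by simp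
      also have "exp (1 / 2) \<le> (2::real)" using exp_bound[of "1/2::real"] by (simp add: power2_eq_square)
      finally show "exp (L / 2 * (real (card S) * real (card {c})) * (exp f - 1)) \<le> 2" .
    qed simp
    also have "- (f / 2 * v) = v / 2 * ln x" by (simp add: f_def)
    finally show "PP (\<lambda>A. f / 2 * edges_between A S {c} \<ge> f / 2 * v) \<le> 2 * exp (v / 2 * ln x)" .
  qed
  finally show ?thesis by simp
qed

end

section \<open>Few failing rows, for all sizes of the separation\<close>

text \<open>1 / (2048 * 400): the multiplier \<eta> = 1 / 2048 in \<open>PP_all_bad_capped\<close>,
  whose exponent is \<eta> s2 / 400 per row.\<close>

definition rate :: real where "rate = 1 / 819200"

locale block_graph_separated = block_graph +
  assumes sep_large: "10 ^ 7 * (real n / m) \<le> s2"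
    and L_le: "L \<le> 1 / ln (real n)"
    and n_large: "2 \<le> ln (real n)" "ln (real n) ^ 4 \<le> sqrt (real n)"
begin

lemma K_pos: "1 \<le> K" using g_less[OF n_pos] by simp

lemma n_over_m: "1 \<le> real n / m" "real K \<le> real n / m"
proof -
  show K: "real K \<le> real n / m" using K_m_le m_pos by (simp add: pos_le_divide_eq)
  then show "1 \<le> real n / m" using K_pos by linarith
qed

lemma s65: "65600 * (real n / m) \<le> s2" and s2_ge: "10 ^ 7 \<le> s2"
  and K_le_s2: "real K \<le> s2 / 10 ^ 7"
proof -
  have *: "10 ^ 7 * z \<le> y \<Longrightarrow> 1 \<le> z \<Longrightarrow> z \<le> y / 10 ^ 7 \<and> 65600 * z \<le> y \<and> 10 ^ 7 \<le> y" for z y :: real by simp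
  have s: "real n / m \<le> s2 / 10 ^ 7 \<and> 65600 * (real n / m) \<le> s2 \<and> 10 ^ 7 \<le> s2" by (rule *[OF sep_large n_over_m(1)])
  then show "65600 * (real n / m) \<le> s2" "10 ^ 7 \<le> s2" by blast+
  show "real K \<le> s2 / 10 ^ 7" using n_over_m(2) s by linarith
qed


text \<open>K \<le> n / m is at most a small multiple of s2, so the choice of a group and a sign per
  row costs no more than a quarter of the exponent.\<close>

lemma two_K_le: "2 * real K \<le> exp (rate * s2 / 4)"
proof -
  have "2 * real K \<le> rate * s2 / 4" using K_le_s2 s2_ge by (simp add: rate_def)
  also have "\<dots> \<le> exp (rate * s2 / 4)" using exp_ge_add_one_self[of "rate * s2 / 4"] by linarith
  finally show ?thesis .
qed

lemma n_exp: "real n = exp (ln (real n))" using n_pos by simp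

lemma exp_le_inverse_sq:
  assumes "2 * ln (real n) \<le> x" shows "exp (- x) \<le> 1 / (real n)\<^sup>2"
proof -
  have "exp (- x) \<le> exp (- (2 * ln (real n)))" using assms by simp
  also have "\<dots> = 1 / (real n)\<^sup>2" using n_pos by (simp add: exp_minus exp_double inverse_eq_divide)
  finally show ?thesis .
qed

lemma L_le_1: "L \<le> 1"
proof -
  have "1 / ln (real n) \<le> 1 / 2" using n_large by (intro divide_left_mono) auto
  then show ?thesis using L_le by linarith
qed

text \<open>While s2 is at most of order ln n, the admissible number of failing rows is at least
  sqrt n; this leaves room for deviation bounds of order n^-2.\<close>

lemma mod_exp_ge:
  assumes "s2 \<le> 4 / rate * ln (real n)"
  shows "sqrt (real n) \<le> real n * exp (- (rate / 8 * s2))"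
proof -
  have "rate / 8 * s2 \<le> rate / 8 * (4 / rate * ln (real n))" using assms by (intro mult_left_mono) (auto simp: rate_def)
  then have "rate / 8 * s2 \<le> ln (real n) / 2" by (simp add: rate_def)
  then have "real n * exp (- (ln (real n) / 2)) \<le> real n * exp (- (rate / 8 * s2))" by (intro mult_left_mono) auto
  moreover have "exp (ln (real n) / 2) = sqrt (real n)" using n_pos by (simp add: ln_sqrt[symmetric])
  then have "real n * exp (- (ln (real n) / 2)) = sqrt (real n)" using n_pos by (simp add: exp_minus field_simps real_div_sqrt)
  ultimately show ?thesis by simp
qed

lemma ln_le_sqrt: "ln (real n) \<le> sqrt (real n)" "4 * ln (real n) \<le> sqrt (real n)"
proof -
  have "ln (real n) * 8 \<le> ln (real n) * ln (real n) ^ 3"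
    using power_mono[of 2 "ln (real n)" 3] n_large by (intro mult_left_mono) auto
  also have "\<dots> = ln (real n) ^ 4" by (simp add: power_Suc[symmetric] del: power_Suc)
  finally show "ln (real n) \<le> sqrt (real n)" "4 * ln (real n) \<le> sqrt (real n)" using n_large by linarith+
qed

text \<open>For s2 > (4 / rate) ln n a union bound excludes any excess. Otherwise, with e the
  admissible proportion, the moment costs at most n e s2 / 10^7 in the exponent, while Markov's
  inequality gains n e s2 / 128.\<close>

lemma PP_lin_excess_large:
  "PP (\<lambda>A. D * real n * exp (- (rate / 8 * s2)) < (\<Sum>a<n. lin_excess A a)) \<le> 1 / (real n)\<^sup>2"
proof (cases "s2 \<le> 4 / rate * ln (real n)")
  case False
  have "D = s2 * L" using L_pos by (simp add: s2_def)
  moreover have "0 \<le> s2 * L" using s2_ge L_pos by simp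
  ultimately have D0: "0 \<le> D" by (simp only:)
  have "PP (\<lambda>A. D * real n * exp (- (rate / 8 * s2)) < (\<Sum>a<n. lin_excess A a)) \<le> PP (\<lambda>A. 0 < (\<Sum>a<n. lin_excess A a))"
    by (rule PP_mono) (use D0 in \<open>auto elim!: order_le_less_trans[rotated]\<close>)
  also have "\<dots> \<le> real n * real K * exp (- s2 / 8192)" by (rule PP_lin_excess_pos) (use s2_ge in simp)
  also have "\<dots> \<le> exp (ln (real n)) * exp (rate * s2 / 4) * exp (- s2 / 8192)"
    using two_K_le n_exp by (intro mult_right_mono mult_mono) auto
  also have "\<dots> = exp (- (s2 / 8192 - rate * s2 / 4 - ln (real n)))" by (simp add: exp_add[symmetric])
  also have "\<dots> \<le> 1 / (real n)\<^sup>2" by (rule exp_le_inverse_sq) (use False n_large in \<open>simp add: rate_def\<close>)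
  finally show ?thesis .
next
  case True
  define e where "e = exp (- (rate / 8 * s2))"
  have "PP (\<lambda>A. D * real n * e < (\<Sum>a<n. lin_excess A a)) \<le> PP (\<lambda>A. D * real n * e \<le> (\<Sum>a<n. lin_excess A a))"
    by (rule PP_mono) auto
  also have "\<dots> \<le> exp (real n * real K * exp (- s2 / 8192)) * exp (- (D * real n * e) / (128 * L))"
    by (rule PP_lin_excess) (use s2_ge in simp)
  also have "\<dots> \<le> exp (real n * (s2 / 10 ^ 7) * e) * exp (- (real n * s2 * e / 128))"
  proof (intro mult_mono)
    have "exp (- s2 / 8192) \<le> e" using s2_ge by (simp add: e_def rate_def)
    then show "exp (real n * real K * exp (- s2 / 8192)) \<le> exp (real n * (s2 / 10 ^ 7) * e)"
      unfolding exp_le_cancel_iff using K_le_s2 by (intro mult_mono) (auto simp: e_def)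
  qed (simp_all add: s2_def mult_ac)
  also have "\<dots> \<le> exp (- (real n * e * (s2 / 256)))"
  proof -
    have "0 \<le> real n * s2 * e" using s2_ge by (simp add: e_def)
    then show ?thesis unfolding exp_add[symmetric] by (simp add: field_simps)
  qed
  also have "\<dots> \<le> 1 / (real n)\<^sup>2"
  proof (rule exp_le_inverse_sq)
    have "ln (real n) * 2 \<le> (real n * e) * (s2 / 256)"
      using ln_le_sqrt(1) mod_exp_ge[OF True] s2_ge n_large by (intro mult_mono) (auto simp: e_def)
    then show "2 * ln (real n) \<le> real n * e * (s2 / 256)" by simp
  qed
  finally show ?thesis by (simp add: e_def)
qed

text \<open>For s2 > (4 / rate) ln n a union bound over single rows shows that none is bad.
  Otherwise \<open>bprob_many_bad\<close> is applied to sets of r rows, and the work lies in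
  choosing r and a cap for which \<open>PP_all_bad_capped\<close> is available.\<close>

lemma PP_many_bad_rows:
  "PP (\<lambda>A. real n * exp (- (rate / 8 * s2)) < real (card {b\<in>{..<n}. bad A b})) \<le> 5 / (real n)\<^sup>2"
proof (cases "s2 \<le> 4 / rate * ln (real n)")
  case False
  have one: "PP (\<lambda>A. bad A b) \<le> 2 * real K * (3 * exp (- rate * s2))" if b: "b < n" for b
  proof -
    have "PP (\<lambda>A. bad A b) \<le> PP (\<lambda>A. capped {b} 1 {..<n} A \<and> (\<forall>b\<in>{b}. bad A b))"
      by (rule PP_mono) (auto simp: capped_def nbrs_in_def)
    also have "\<dots> \<le> (2 * real K) ^ card {b} * (3 * exp (- (1 / 2048) * real (card {b}) * s2 / 400))"
    proof (rule PP_all_bad_capped)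
      show "4 * (1 / 2048 / (m * L)) * 1\<^sup>2 \<le> 1" using mL_ge_1 by (simp add: field_simps)
    qed (use b L_le_1 s65 in auto)
    finally show ?thesis by (simp add: rate_def)
  qed
  have "PP (\<lambda>A. real n * exp (- (rate / 8 * s2)) < real (card {b\<in>{..<n}. bad A b})) \<le> PP (\<lambda>A. \<exists>b\<in>{..<n}. bad A b)"
  proof (rule PP_mono)
    fix A assume h: "real n * exp (- (rate / 8 * s2)) < real (card {b\<in>{..<n}. bad A b})"
    then have "{b\<in>{..<n}. bad A b} \<noteq> {}" by (metis card.empty exp_ge_zero mult_nonneg_nonneg not_less of_nat_0 of_nat_0_le_iff)
    then show "\<exists>b\<in>{..<n}. bad A b" by auto
  qed
  also have "\<dots> \<le> (\<Sum>b<n. PP (\<lambda>A. bad A b))" by (rule PP_Ex) auto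
  also have "\<dots> \<le> (\<Sum>b<n. 2 * real K * (3 * exp (- rate * s2)))" by (rule sum_mono) (use one in auto)
  also have "\<dots> = 3 * (real n * (2 * real K) * exp (- rate * s2))" by simp
  also have "\<dots> \<le> 3 * (exp (ln (real n)) * exp (rate * s2 / 4) * exp (- rate * s2))"
    using two_K_le n_exp by (intro mult_left_mono mult_right_mono mult_mono) auto
  also have "\<dots> = 3 * exp (- (3 / 4 * rate * s2 - ln (real n)))" by (simp add: exp_add[symmetric])
  also have "\<dots> \<le> 3 * (1 / (real n)\<^sup>2)"
    by (intro mult_left_mono exp_le_inverse_sq) (use False n_large in \<open>simp_all add: rate_def\<close>)
  also have "\<dots> \<le> 5 / (real n)\<^sup>2" by (simp add: divide_right_mono)
  finally show ?thesis .
next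
  case True
  have s0: "0 < s2" using s2_ge by simp
  have rate0: "0 < rate" by (simp add: rate_def)
  define l where "l = ln (real n)"
  have l2: "2 \<le> l" using n_large by (simp add: l_def)
  \<comment> \<open>With about (4 / rate) ln n / s2 rows the joint probability exp (- (3/4) rate r
    s2) is below n^-2 even after the binomial ratio exp (rate r s2 / 4). On the other hand r \<le>
    ln n, and then L \<le> 1 / ln n gives r L \<le> 1.\<close>
  define r where "r = nat \<lceil>4 / rate * l / s2\<rceil>"
  have rpos: "0 < 4 / rate * l / s2" using rate0 l2 s0 by simp
  have r_real: "real r = of_int \<lceil>4 / rate * l / s2\<rceil>" using rpos by (simp add: r_def)
  have r1: "1 \<le> r" using rpos by (simp add: r_def Suc_le_eq)
  have r_lo: "4 / rate * l / s2 \<le> real r" and r_hi: "real r \<le> 4 / rate * l / s2 + 1" unfolding r_real by linarith+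
  have rs_lo: "4 / rate * l \<le> real r * s2" using r_lo unfolding pos_divide_le_eq[OF s0] .
  have rs_hi: "real r * s2 \<le> 8 / rate * l"
  proof -
    have "real r * s2 \<le> (4 / rate * l / s2 + 1) * s2" using r_hi s0 by (intro mult_right_mono) auto
    also have "\<dots> = 4 / rate * l + s2" using s0 by (simp add: field_simps)
    finally show ?thesis using True by (simp add: l_def)
  qed
  have r_l: "real r \<le> l / 3 + 1"
  proof -
    have "4 / rate * l / s2 \<le> 4 / rate * l / 10 ^ 7" using s2_ge rate0 l2 by (intro divide_left_mono) auto
    also have "\<dots> \<le> l / 3" using l2 by (simp add: rate_def)
    finally show ?thesis using r_hi by linarith
  qed
  have r_le_l: "real r \<le> l" using r_l l2 by linarith
  have rL: "real r * L \<le> 1"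
  proof -
    have "real r * L \<le> l * (1 / l)" using r_le_l L_le L_pos l2 by (intro mult_mono) (auto simp: l_def)
    then show ?thesis using l2 by simp
  qed
  define x where "x = real n * exp (- (rate / 8 * s2))"
  have x: "sqrt (real n) \<le> x" unfolding x_def by (rule mod_exp_ge[OF True])
  have lx: "4 * l \<le> x" using ln_le_sqrt(2) x by (simp add: l_def)
  define t where "t = nat \<lceil>x\<rceil>"
  have t: "x \<le> real t" unfolding t_def by linarith
  have rt: "r \<le> t" "x / 2 \<le> real t - real r + 1"
  proof -
    have "real r \<le> real t" using r_le_l lx t l2 by linarith
    then show "r \<le> t" by simp
    show "x / 2 \<le> real t - real r + 1" using r_l lx t l2 by linarith
  qed
  have x0: "0 < x" using lx l2 by linarith
  define q where "q = exp (- (3 / 4 * rate * (real r * s2))) * 3 + real n * (2 * exp (- (11 / 2) * l))"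
  have q0: "0 \<le> q" by (simp add: q_def)
  have all_bad: "PP (\<lambda>A. \<forall>b\<in>S. bad A b) \<le> q" if S: "S \<subseteq> {..<n}" "card S = r" for S
  proof -
    have Sne: "S \<noteq> {}" using S r1 by auto
    have p: "PP (\<lambda>A. capped S v {..<n} A \<and> (\<forall>b\<in>S. bad A b)) \<le> exp (- (3 / 4 * rate * (real r * s2))) * 3"
      if v: "1 \<le> v" "4 * (1 / 2048 / (m * L)) * v\<^sup>2 \<le> 1" for v
    proof -
      have "PP (\<lambda>A. capped S v {..<n} A \<and> (\<forall>b\<in>S. bad A b)) \<le> (2 * real K) ^ card S * (3 * exp (- (1 / 2048) * real (card S) * s2 / 400))"
        by (rule PP_all_bad_capped) (use S Sne rL v s65 in auto)
      also have "\<dots> \<le> exp (rate * s2 / 4) ^ r * (3 * exp (- rate * (real r * s2)))"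
        unfolding S(2) using two_K_le by (intro mult_mono power_mono) (auto simp: rate_def)
      also have "\<dots> = 3 * exp (real r * (rate * s2 / 4) + - rate * (real r * s2))"
        unfolding exp_add exp_of_nat_mult by simp
      also have "real r * (rate * s2 / 4) + - rate * (real r * s2) = - (3 / 4 * rate * (real r * s2))" by simp
      finally show ?thesis by simp
    qed
    show ?thesis
    \<comment> \<open>If m L is large compared with r^2, the trivial cap v = r is admissible.
      Otherwise m L \<le> (ln n)^2, and as n / m is at most ln n in this regime, r L \<le> 1 / sqrt
      n: edges into S are so rare that a constant cap rarely fails.\<close>
    proof (cases "4 * (1 / 2048) * (real r)\<^sup>2 \<le> m * L")
      case True
      have "PP (\<lambda>A. \<forall>b\<in>S. bad A b) \<le> PP (\<lambda>A. capped S (real r) {..<n} A \<and> (\<forall>b\<in>S. bad A b))"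
        by (rule PP_mono) (use S(2) nbrs_in_le_card[of S] in \<open>auto simp: capped_def\<close>)
      also have "\<dots> \<le> exp (- (3 / 4 * rate * (real r * s2))) * 3"
      proof (rule p)
        have "4 * (1 / 2048) * (real r)\<^sup>2 / (m * L) \<le> 1" using True mL_ge_1 by (subst pos_divide_le_eq) auto
        then show "4 * (1 / 2048 / (m * L)) * (real r)\<^sup>2 \<le> 1" by (simp add: mult_ac)
      qed (use r1 in simp)
      also have "\<dots> \<le> q" by (simp add: q_def)
      finally show ?thesis .
    next
      case False
      have m_lo: "real n \<le> m * l"
      proof -
        have "10 ^ 7 * (real n / m) \<le> 4 / rate * l" using sep_large True by (simp add: l_def)
        then have "10 ^ 7 * real n \<le> 4 / rate * l * m" using m_pos by (simp add: field_simps)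
        also have "\<dots> \<le> 10 ^ 7 * (m * l)" using m_pos l2 by (simp add: rate_def)
        finally show ?thesis by simp
      qed
      have "real r * L \<le> 1 / sqrt (real n)"
      proof -
        have "m * L \<le> (real r)\<^sup>2" using False mL_ge_1 by linarith
        also have "\<dots> \<le> l\<^sup>2" using r_le_l by (intro power_mono) auto
        finally have mL: "m * L \<le> l\<^sup>2" .
        have "real n * L \<le> m * l * L" using m_lo L_pos by (intro mult_right_mono) auto
        also have "\<dots> = l * (m * L)" by simp
        also have "\<dots> \<le> l * l\<^sup>2" using mL l2 by (intro mult_left_mono) auto
        finally have nL: "real n * L \<le> l * l\<^sup>2" .
        have "real r * (real n * L) \<le> l * (l * l\<^sup>2)" by (rule mult_mono[OF r_le_l nL]) (use l2 L_pos in auto)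
        also have "\<dots> = l ^ 4" by (simp add: power2_eq_square power4_eq_xxxx)
        also have "\<dots> \<le> sqrt (real n)" using n_large by (simp add: l_def)
        finally have "real r * (real n * L) \<le> sqrt (real n)" .
        then have "real r * L \<le> sqrt (real n) / real n" using n_pos by (simp add: field_simps)
        also have "sqrt (real n) / real n = 1 / sqrt (real n)" using n_pos by (simp add: field_simps)
        finally show ?thesis .
      qed
      \<comment> \<open>22 is the largest integer with 4 * 22^2 / 2048 \<le> 1. A violation costs
        n^(- 11 / 2); the union over columns takes one power of n and the binomial ratio at most
        two.\<close>
      then have nc: "PP (\<lambda>A. \<not> capped S 22 {..<n} A) \<le> real n * (2 * exp (22 / 2 * ln (1 / sqrt (real n))))"
        by (intro PP_not_capped) (use S Sne n_pos in auto)
      have "22 / 2 * ln (1 / sqrt (real n)) = - (11 / 2) * l" using n_pos by (simp add: l_def ln_div ln_sqrt)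
      with nc have nc': "PP (\<lambda>A. \<not> capped S 22 {..<n} A) \<le> real n * (2 * exp (- (11 / 2) * l))" by simp
      have "PP (\<lambda>A. \<forall>b\<in>S. bad A b) \<le> PP (\<lambda>A. (capped S 22 {..<n} A \<and> (\<forall>b\<in>S. bad A b)) \<or> \<not> capped S 22 {..<n} A)"
        by (rule PP_mono) auto
      also have "\<dots> \<le> PP (\<lambda>A. capped S 22 {..<n} A \<and> (\<forall>b\<in>S. bad A b)) + PP (\<lambda>A. \<not> capped S 22 {..<n} A)" by (rule PP_or)
      also have "PP (\<lambda>A. capped S 22 {..<n} A \<and> (\<forall>b\<in>S. bad A b)) \<le> exp (- (3 / 4 * rate * (real r * s2))) * 3"
      proof (rule p)
        have "4 * (1 / 2048 / (m * L)) * 22\<^sup>2 \<le> 4 * (1 / 2048 / 1) * 22\<^sup>2"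
          using mL_ge_1 by (intro mult_right_mono mult_left_mono divide_left_mono) auto
        also have "\<dots> \<le> (1 :: real)" by (simp add: power2_eq_square)
        finally show "4 * (1 / 2048 / (m * L)) * 22\<^sup>2 \<le> 1" .
      qed simp
      finally show ?thesis using nc' by (simp add: q_def)
    qed
  qed
  have "PP (\<lambda>A. x < real (card {b\<in>{..<n}. bad A b})) \<le> PP (\<lambda>A. t \<le> card {b\<in>{..<n}. bad A b})"
    by (rule PP_mono) (simp add: t_def nat_le_iff ceiling_le_iff)
  also have "\<dots> \<le> q * (real (card {..<n}) / (real t - real r + 1)) ^ r"
    using PP_many_bad[of "{..<n}" r "\<lambda>b A. bad A b" q t] all_bad rt(1) r1 q0 by auto
  also have "\<dots> \<le> q * exp (rate * (real r * s2) / 4)"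
  proof (rule mult_left_mono[OF _ q0])
    have "real (card {..<n}) / (real t - real r + 1) \<le> real n / (x / 2)"
      unfolding card_lessThan by (rule divide_left_mono) (use rt x0 in auto)
    also have "\<dots> = 2 * exp (rate / 8 * s2)" using n_pos by (simp add: x_def exp_minus field_simps)
    also have "\<dots> \<le> exp (rate / 8 * s2) * exp (rate / 8 * s2)"
    proof (rule mult_right_mono)
      have "2 \<le> 1 + rate / 8 * s2" using s2_ge by (simp add: rate_def)
      also have "\<dots> \<le> exp (rate / 8 * s2)" by (rule exp_ge_add_one_self)
      finally show "2 \<le> exp (rate / 8 * s2)" .
    qed simp
    also have "\<dots> = exp (rate * s2 / 4)" by (simp add: exp_add[symmetric])
    finally have "(real (card {..<n}) / (real t - real r + 1)) ^ r \<le> exp (rate * s2 / 4) ^ r"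
      using rt x0 by (intro power_mono divide_nonneg_nonneg) auto
    also have "\<dots> = exp (rate * (real r * s2) / 4)" unfolding exp_of_nat_mult[symmetric] by (simp add: mult_ac)
    finally show "(real (card {..<n}) / (real t - real r + 1)) ^ r \<le> exp (rate * (real r * s2) / 4)" .
  qed
  also have "\<dots> = 3 * exp (- (rate * (real r * s2) / 2)) + 2 * exp (- (9 / 2 * l - rate * (real r * s2) / 4))"
  proof -
    have "real n = exp l" using n_pos by (simp add: l_def)
    then show ?thesis unfolding q_def distrib_right by (simp add: exp_add[symmetric] mult_ac)
  qed
  also have "\<dots> \<le> 3 * (1 / (real n)\<^sup>2) + 2 * (1 / (real n)\<^sup>2)"
  proof (intro add_mono mult_left_mono exp_le_inverse_sq)
    show "2 * ln (real n) \<le> rate * (real r * s2) / 2" using rs_lo by (simp add: rate_def l_def)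
    show "2 * ln (real n) \<le> 9 / 2 * l - rate * (real r * s2) / 4" using rs_hi l2 by (simp add: rate_def l_def)
  qed auto
  finally show ?thesis by (simp add: x_def)
qed

end

section \<open>Positive semidefinite kernels\<close>

text \<open>Kernels on an index set instead of matrices, so that restriction to the nodes of
  moderate degree needs no reindexing.\<close>

definition psd_on :: "nat set \<Rightarrow> (nat \<Rightarrow> nat \<Rightarrow> real) \<Rightarrow> bool" where
  "psd_on I R \<longleftrightarrow> (\<forall>i\<in>I. \<forall>j\<in>I. R i j = R j i) \<and> (\<forall>x. 0 \<le> (\<Sum>i\<in>I. \<Sum>j\<in>I. x i * x j * R i j))"

lemma psd_onI:
  assumes "\<And>i j. i \<in> I \<Longrightarrow> j \<in> I \<Longrightarrow> R i j = R j i" "\<And>x. 0 \<le> (\<Sum>i\<in>I. \<Sum>j\<in>I. x i * x j * R i j)"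
  shows "psd_on I R"
  unfolding psd_on_def by (intro conjI ballI allI assms)

lemma psd_on_sym: "psd_on I R \<Longrightarrow> i \<in> I \<Longrightarrow> j \<in> I \<Longrightarrow> R i j = R j i"
  unfolding psd_on_def by (elim conjE) (drule (1) bspec, erule (1) bspec)

lemma psd_on_form: "psd_on I R \<Longrightarrow> 0 \<le> (\<Sum>i\<in>I. \<Sum>j\<in>I. x i * x j * R i j)"
  unfolding psd_on_def by (elim conjE) (erule spec)

lemma sum2_insert:
  fixes f :: "nat \<Rightarrow> nat \<Rightarrow> real"
  assumes "finite I" "i \<notin> I"
  shows "(\<Sum>a\<in>insert i I. \<Sum>b\<in>insert i I. f a b) = f i i + (\<Sum>b\<in>I. f i b) + (\<Sum>a\<in>I. f a i) + (\<Sum>a\<in>I. \<Sum>b\<in>I. f a b)"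
  using assms by (simp add: sum.distrib)

lemma psd_on_subset:
  assumes "psd_on J R" "I \<subseteq> J" "finite J" shows "psd_on I R"
proof -
  have "0 \<le> (\<Sum>i\<in>I. \<Sum>j\<in>I. x i * x j * R i j)" for x
  proof -
    define y where "y i = (if i \<in> I then x i else 0)" for i
    have "(\<Sum>i\<in>J. \<Sum>j\<in>J. y i * y j * R i j) = (\<Sum>i\<in>I. \<Sum>j\<in>J. y i * y j * R i j)"
      by (rule sum.mono_neutral_right) (use assms in \<open>auto simp: y_def\<close>)
    also have "\<dots> = (\<Sum>i\<in>I. \<Sum>j\<in>I. y i * y j * R i j)"
      by (intro sum.cong refl sum.mono_neutral_right) (use assms in \<open>auto simp: y_def\<close>)
    also have "\<dots> = (\<Sum>i\<in>I. \<Sum>j\<in>I. x i * x j * R i j)"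
      by (intro sum.cong refl) (auto simp: y_def)
    finally show ?thesis using psd_on_form[OF assms(1), of y] by linarith
  qed
  then show ?thesis by (intro psd_onI psd_on_sym[OF assms(1)]) (use assms(2) in auto)
qed

lemma psd_on_diag: "psd_on I R \<Longrightarrow> finite I \<Longrightarrow> i \<in> I \<Longrightarrow> 0 \<le> R i i"
  using psd_on_form[OF psd_on_subset[of I R "{i}"], of "\<lambda>_. 1"] by simp

text \<open>The form on {i, j} at the vectors (1, 1) and (1, -1). It converts trace bounds into l1
  bounds.\<close>

lemma psd_on_entry:
  assumes "psd_on I R" "finite I" "i \<in> I" "j \<in> I"
  shows "\<bar>R i j\<bar> \<le> (R i i + R j j) / 2"
proof (cases "i = j")
  case True then show ?thesis using psd_on_diag[OF assms(1-3)] by simp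
next
  case False
  have "psd_on {i, j} R" by (rule psd_on_subset[OF assms(1) _ assms(2)]) (use assms in auto)
  note h = psd_on_form[OF this]
  have "R j i = R i j" using assms by (intro psd_on_sym[OF assms(1)])
  then show ?thesis using h[of "\<lambda>_. 1"] h[of "\<lambda>a. if a = i then 1 else -1"] False by (simp add: abs_le_iff)
qed

text \<open>Schur complements reduce the number of nonzero rows of \<open>R\<close>.\<close>
lemma psd_on_inner_nonneg:
  assumes "finite I" "psd_on I N" "psd_on I R"
  shows "0 \<le> (\<Sum>i\<in>I. \<Sum>j\<in>I. N i j * R i j)"
  using assms
proof (induction I arbitrary: R rule: finite_induct)
  case (insert i I)
  note f = insert(1,2)
  have N: "psd_on I N" by (rule psd_on_subset[OF insert(4)]) (use f in auto)
  have symN: "N a i = N i a" if "a \<in> I" for a by (rule psd_on_sym[OF insert(4)]) (use that in auto)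
  have symR: "R a b = R b a" if "a \<in> insert i I" "b \<in> insert i I" for a b by (rule psd_on_sym[OF insert(5) that])
  show ?case
  proof (cases "R i i = 0")
    case True
    have z: "R i j = 0" if "j \<in> I" for j
    proof -
      have ps: "psd_on {i, j} R" by (rule psd_on_subset[OF insert(5)]) (use f that in auto)
      have ij: "i \<noteq> j" using f that by auto
      \<comment> \<open>With R i i = 0 the form is affine in t, and an affine function that stays
        nonnegative has slope 0.\<close>
      have q: "0 \<le> 2 * t * R i j + R j j" for t
      proof -
        have "0 \<le> (\<Sum>a\<in>{i, j}. \<Sum>b\<in>{i, j}. (if a = i then t else 1) * (if b = i then t else 1) * R a b)"
          by (rule psd_on_form[OF ps])
        also have "\<dots> = t * t * R i i + t * R i j + (t * R j i + R j j)" using ij by simp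
        also have "\<dots> = 2 * t * R i j + R j j" using True symR[of j i] that by simp
        finally show ?thesis .
      qed
      show ?thesis
      proof (rule ccontr)
        assume nz: "R i j \<noteq> 0"
        from q[of "- (R j j + 1) / (2 * R i j)"] nz show False by (simp add: field_simps)
      qed
    qed
    have "(\<Sum>a\<in>insert i I. \<Sum>b\<in>insert i I. N a b * R a b) = (\<Sum>a\<in>I. \<Sum>b\<in>I. N a b * R a b)"
    proof -
      have "R a i = 0" if "a \<in> I" for a using z[OF that] symR[of a i] that by simp
      then show ?thesis unfolding sum2_insert[OF f] using z True by simp
    qed
    moreover have "psd_on I R" by (rule psd_on_subset[OF insert(5)]) (use f in auto)
    ultimately show ?thesis using insert.IH[OF N] by simp
  next
    case False
    define r where "r = R i i"
    have r: "0 < r" using False psd_on_diag[OF insert(5)] f by (simp add: r_def less_le)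
    define R' where "R' a b = R a b - R a i * R b i / r" for a b
    have R'_eq: "(\<Sum>a\<in>I. \<Sum>b\<in>I. F a b * R' a b) = (\<Sum>a\<in>I. \<Sum>b\<in>I. F a b * R a b) - (\<Sum>a\<in>I. \<Sum>b\<in>I. F a b * (R a i * R b i)) / r" for F
      by (simp add: R'_def right_diff_distrib sum_subtractf sum_divide_distrib)
    have "psd_on I R'"
    proof (rule psd_onI)
      fix a b assume "a \<in> I" "b \<in> I" then show "R' a b = R' b a" using symR[of a b] by (simp add: R'_def)
    next
      fix x
      define u where "u = (\<Sum>a\<in>I. x a * R a i)"
      \<comment> \<open>The coordinate at i minimises the form for the given x; the minimum is the
        form of the Schur complement.\<close>
      define y where "y a = (if a = i then - u / r else x a)" for a
      have yI: "y a = x a" if "a \<in> I" for a using that f by (auto simp: y_def)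
      have yi: "y i = - u / r" by (simp add: y_def)
      have "0 \<le> (\<Sum>a\<in>insert i I. \<Sum>b\<in>insert i I. y a * y b * R a b)" by (rule psd_on_form[OF insert(5)])
      also have "\<dots> = y i * y i * r + y i * u + y i * u + (\<Sum>a\<in>I. \<Sum>b\<in>I. x a * x b * R a b)"
      proof -
        have 1: "(\<Sum>b\<in>I. y i * y b * R i b) = y i * u"
          unfolding u_def sum_distrib_left by (rule sum.cong[OF refl]) (use symR[of i] in \<open>simp add: yI mult_ac\<close>)
        have 2: "(\<Sum>a\<in>I. y a * y i * R a i) = y i * u"
          unfolding u_def sum_distrib_left by (rule sum.cong) (auto simp: yI mult_ac)
        have 3: "(\<Sum>a\<in>I. \<Sum>b\<in>I. y a * y b * R a b) = (\<Sum>a\<in>I. \<Sum>b\<in>I. x a * x b * R a b)"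
          by (intro sum.cong refl) (simp add: yI)
        show ?thesis unfolding sum2_insert[OF f] 1 2 3 r_def by simp
      qed
      also have "\<dots> = (\<Sum>a\<in>I. \<Sum>b\<in>I. x a * x b * R a b) - u * u / r" using r by (simp add: yi field_simps)
      also have "u * u = (\<Sum>a\<in>I. \<Sum>b\<in>I. x a * x b * (R a i * R b i))"
        unfolding u_def sum_product by (intro sum.cong refl) (simp add: mult_ac)
      finally show "0 \<le> (\<Sum>a\<in>I. \<Sum>b\<in>I. x a * x b * R' a b)" unfolding R'_eq .
    qed
    then have IH: "0 \<le> (\<Sum>a\<in>I. \<Sum>b\<in>I. N a b * R' a b)" by (rule insert.IH[OF N])
    \<comment> \<open>N tested at the i-th column of R: the rank one part split off from R has a
      nonnegative inner product with N.\<close>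
    have "0 \<le> (\<Sum>a\<in>insert i I. \<Sum>b\<in>insert i I. R a i * R b i * N a b)" by (rule psd_on_form[OF insert(4)])
    also have "\<dots> = r * r * N i i + 2 * r * (\<Sum>a\<in>I. N a i * R a i) + (\<Sum>a\<in>I. \<Sum>b\<in>I. N a b * (R a i * R b i))"
    proof -
      have 1: "(\<Sum>b\<in>I. R i i * R b i * N i b) = r * (\<Sum>a\<in>I. N a i * R a i)"
        unfolding r_def sum_distrib_left by (rule sum.cong[OF refl]) (use symN in simp)
      have 2: "(\<Sum>a\<in>I. R a i * R i i * N a i) = r * (\<Sum>a\<in>I. N a i * R a i)"
        unfolding r_def sum_distrib_left by (rule sum.cong) auto
      have 3: "(\<Sum>a\<in>I. \<Sum>b\<in>I. R a i * R b i * N a b) = (\<Sum>a\<in>I. \<Sum>b\<in>I. N a b * (R a i * R b i))"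
        by (intro sum.cong refl) (simp add: mult_ac)
      show ?thesis unfolding sum2_insert[OF f] 1 2 3 by (simp add: r_def)
    qed
    finally have q: "0 \<le> r * r * N i i + 2 * r * (\<Sum>a\<in>I. N a i * R a i) + (\<Sum>a\<in>I. \<Sum>b\<in>I. N a b * (R a i * R b i))" .
    have "(\<Sum>a\<in>insert i I. \<Sum>b\<in>insert i I. N a b * R a b) = r * N i i + 2 * (\<Sum>a\<in>I. N a i * R a i) + (\<Sum>a\<in>I. \<Sum>b\<in>I. N a b * R a b)"
    proof -
      have 1: "(\<Sum>b\<in>I. N i b * R i b) = (\<Sum>a\<in>I. N a i * R a i)" by (rule sum.cong[OF refl]) (use symR[of i] symN in simp)
      show ?thesis unfolding sum2_insert[OF f] 1 by (simp add: r_def)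
    qed
    also have "\<dots> = (\<Sum>a\<in>I. \<Sum>b\<in>I. N a b * R' a b) + (r * r * N i i + 2 * r * (\<Sum>a\<in>I. N a i * R a i) + (\<Sum>a\<in>I. \<Sum>b\<in>I. N a b * (R a i * R b i))) / r"
      unfolding R'_eq using r by (simp add: field_simps)
    finally show ?thesis using IH q r by simp
  qed
qed simp

lemma sum_mult_le_sqrt:
  fixes f h :: "nat \<Rightarrow> real"
  shows "(\<Sum>i\<in>I. f i * h i) \<le> sqrt (\<Sum>i\<in>I. (f i)\<^sup>2) * sqrt (\<Sum>i\<in>I. (h i)\<^sup>2)"
proof -
  have "(\<Sum>i\<in>I. f i * h i) \<le> (\<Sum>i\<in>I. \<bar>f i\<bar> * \<bar>h i\<bar>)" by (rule sum_mono) (simp add: abs_mult[symmetric])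
  also have "\<dots> \<le> L2_set f I * L2_set h I" by (rule L2_set_mult_ineq)
  finally show ?thesis by (simp add: L2_set_def)
qed

context random_graph
begin

text \<open>The bilinear bound with the image of x as second argument, after which one factor of its
  norm cancels.\<close>

lemma op_norm_sq:
  assumes A: "A \<subseteq> pairs n" and light: "light_bounded A" and disc: "discrepancy_bounded A"
    and d1: "1 \<le> d" and nbig: "ln (real n) + 6 \<le> real n"
  defines "V \<equiv> good_nodes A"
  shows "(\<Sum>c\<in>V. (\<Sum>a\<in>V. x a * W A a c)\<^sup>2) \<le> op_const\<^sup>2 * d * (\<Sum>a\<in>V. (x a)\<^sup>2)"
proof -
  define y where "y c = (\<Sum>a\<in>V. x a * W A a c)" for c
  define sx where "sx = (\<Sum>a\<in>V. (x a)\<^sup>2)"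
  define sy where "sy = (\<Sum>c\<in>V. (y c)\<^sup>2)"
  have nn: "0 \<le> sx" "0 \<le> sy" by (auto simp: sx_def sy_def intro: sum_nonneg)
  have "sy = (\<Sum>a\<in>V. \<Sum>c\<in>V. x a * y c * W A a c)"
    unfolding sy_def power2_eq_square by (subst sum.swap) (simp add: y_def[of c for c] sum_distrib_right[symmetric] sum_distrib_left mult_ac)
  also have "\<dots> \<le> op_const * sqrt d * (sqrt sx * sqrt sy)"
    using op_norm_bound[OF A light disc _ d1 nbig, of V x y] by (simp add: V_def sx_def sy_def abs_le_iff)
  finally have h: "sqrt sy * sqrt sy \<le> (op_const * sqrt d * sqrt sx) * sqrt sy" using nn by (simp add: mult.assoc)
  have c0: "0 \<le> op_const * sqrt d * sqrt sx" using op_const_pos d_pos nn by simp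
  have "sqrt sy \<le> op_const * sqrt d * sqrt sx"
  proof (cases "sqrt sy = 0")
    case False
    then have "0 < sqrt sy" using nn by simp
    then show ?thesis using h by (simp only: mult_le_cancel_right_pos)
  qed (use c0 in simp)
  then have "(sqrt sy)\<^sup>2 \<le> (op_const * sqrt d * sqrt sx)\<^sup>2" using nn by (intro power_mono) auto
  then show ?thesis using nn d_pos by (simp add: power_mult_distrib sy_def[symmetric] sx_def[symmetric] y_def[symmetric])
qed

end

section \<open>Feasible points of the relaxed problem\<close>

lemma sum_swap3:
  "(\<Sum>a\<in>I. \<Sum>b\<in>J. \<Sum>c\<in>H. f a b c) = (\<Sum>c\<in>H. \<Sum>a\<in>I. \<Sum>b\<in>J. f a b c)"
proof -
  have "(\<Sum>a\<in>I. \<Sum>b\<in>J. \<Sum>c\<in>H. f a b c) = (\<Sum>a\<in>I. \<Sum>c\<in>H. \<Sum>b\<in>J. f a b c)"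
    by (rule sum.cong[OF refl], rule sum.swap)
  also have "\<dots> = (\<Sum>c\<in>H. \<Sum>a\<in>I. \<Sum>b\<in>J. f a b c)" by (rule sum.swap)
  finally show ?thesis .
qed

text \<open>Kernel form of a point of \<open>C_set\<close>. The lower bound 1 / m on \<alpha> makes
  \<open>Bst\<close> feasible as well.\<close>

locale relaxed = block_graph +
  fixes B :: "nat \<Rightarrow> nat \<Rightarrow> real" and \<alpha> :: real
  assumes B_sym: "a < n \<Longrightarrow> b < n \<Longrightarrow> B a b = B b a"
    and B_nonneg: "a < n \<Longrightarrow> b < n \<Longrightarrow> 0 \<le> B a b"
    and B_le: "a < n \<Longrightarrow> b < n \<Longrightarrow> B a b \<le> \<alpha>"
    and B_row: "a < n \<Longrightarrow> (\<Sum>b<n. B a b) = 1"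
    and B_trace: "(\<Sum>a<n. B a a) = real K"
    and B_psd: "psd_on {..<n} B"
    and \<alpha>_ge: "1 / m \<le> \<alpha>"
begin

definition Bst :: "nat \<Rightarrow> nat \<Rightarrow> real" where
  "Bst a b = (if g a = g b then 1 / size (g a) else 0)"

definition wt :: "nat \<Rightarrow> nat \<Rightarrow> real" where "wt a k = (\<Sum>b\<in>grp k. B a b)"

definition off :: real where "off = (\<Sum>a<n. \<Sum>k\<in>{..<K}-{g a}. wt a k)"

definition avg :: "(nat \<Rightarrow> real) \<Rightarrow> nat \<Rightarrow> real" where "avg x k = (\<Sum>a\<in>grp k. x a) / size k"

text \<open>The entry of Bst B Bst on the block of groups j and k.\<close>

definition block_avg :: "nat \<Rightarrow> nat \<Rightarrow> real" where
  "block_avg j k = (\<Sum>a\<in>grp j. wt a k) / (size j * size k)"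

text \<open>The kernel of \<open>(I - Bst) B (I - Bst)\<close>.\<close>
definition res :: "nat \<Rightarrow> nat \<Rightarrow> real" where
  "res a b = B a b - wt b (g a) / size (g a) - wt a (g b) / size (g b) + block_avg (g a) (g b)"

lemma \<alpha>_pos: "0 < \<alpha>"
proof -
  have "0 < 1 / m" using m_pos by simp
  then show ?thesis using \<alpha>_ge by linarith
qed

lemma size_inv: "k < K \<Longrightarrow> 1 / size k \<le> 1 / m" "k < K \<Longrightarrow> 1 / size k \<le> \<alpha>"
proof -
  assume k: "k < K"
  show 1: "1 / size k \<le> 1 / m" using size_ge[OF k] m_pos by (intro divide_left_mono) auto
  then show "1 / size k \<le> \<alpha>" using \<alpha>_ge by linarith
qed

lemma wt_nonneg: "a < n \<Longrightarrow> 0 \<le> wt a k"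
  unfolding wt_def by (intro sum_nonneg B_nonneg) (auto simp: grp_def)

lemma sum_B_group: "a < n \<Longrightarrow> (\<Sum>b<n. B a b * f (g b)) = (\<Sum>k<K. wt a k * f k)"
  unfolding sum_by_group wt_def sum_distrib_right by (intro sum.cong refl) (auto simp: grp_def)

lemma sum_wt: "a < n \<Longrightarrow> (\<Sum>k<K. wt a k) = 1"
  using sum_B_group[of a "\<lambda>_. 1"] B_row[of a] by simp

lemma wt_le_1: "a < n \<Longrightarrow> k < K \<Longrightarrow> wt a k \<le> 1"
  using member_le_sum[of k "{..<K}" "wt a"] wt_nonneg sum_wt by fastforce

text \<open>The weights of a row sum to 1, so a weighted mean over groups is the value at the own
  group corrected by weights outside it. All terms of the expansion are brought to this form in
  order to be compared with \<open>off\<close>.\<close>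

lemma wt_split: "a < n \<Longrightarrow> (\<Sum>k<K. wt a k * f k) = f (g a) - (\<Sum>k\<in>{..<K}-{g a}. wt a k * (f (g a) - f k))"
proof -
  assume a: "a < n"
  have rem: "(\<Sum>k<K. h k) = h (g a) + (\<Sum>k\<in>{..<K}-{g a}. h k)" for h :: "nat \<Rightarrow> real"
    using g_less[OF a] by (intro sum.remove) auto
  have "(\<Sum>k\<in>{..<K}-{g a}. wt a k * (f (g a) - f k)) = (\<Sum>k<K. wt a k * (f (g a) - f k))"
    unfolding rem by simp
  also have "\<dots> = f (g a) * (\<Sum>k<K. wt a k) - (\<Sum>k<K. wt a k * f k)"
    by (simp only: right_diff_distrib sum_subtractf) (simp add: sum_distrib_left mult.commute)
  finally show ?thesis using sum_wt[OF a] by simp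
qed

lemma one_minus_wt: "a < n \<Longrightarrow> 1 - wt a (g a) = (\<Sum>k\<in>{..<K}-{g a}. wt a k)"
proof -
  assume a: "a < n"
  have "(\<Sum>k<K. wt a k) = wt a (g a) + (\<Sum>k\<in>{..<K}-{g a}. wt a k)"
    using g_less[OF a] by (intro sum.remove) auto
  then show ?thesis using sum_wt[OF a] by simp
qed

lemma off_nonneg: "0 \<le> off"
  unfolding off_def by (intro sum_nonneg wt_nonneg) auto

lemma off_le: "off \<le> real n"
proof -
  have "off \<le> (\<Sum>a<n. 1)" unfolding off_def
  proof (rule sum_mono)
    fix a assume "a \<in> {..<n}"
    then show "(\<Sum>k\<in>{..<K}-{g a}. wt a k) \<le> 1" using one_minus_wt[of a] wt_nonneg[of a "g a"] by simp
  qed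
  then show ?thesis by simp
qed

lemma sum_B_col: "(\<Sum>a<n. \<Sum>b<n. B a b * f b) = (\<Sum>b<n. f b)"
proof -
  have "(\<Sum>a<n. \<Sum>b<n. B a b * f b) = (\<Sum>b<n. (\<Sum>a<n. B b a) * f b)"
    by (subst sum.swap) (auto simp: sum_distrib_right B_sym intro!: sum.cong)
  then show ?thesis using B_row by simp
qed

lemma sum_Bst: "a < n \<Longrightarrow> (\<Sum>b<n. Bst a b * x b) = avg x (g a)"
proof -
  assume a: "a < n"
  have "(\<Sum>b<n. Bst a b * x b) = (\<Sum>b\<in>grp (g a). 1 / size (g a) * x b)"
    by (rule sum.mono_neutral_cong_right) (auto simp: Bst_def grp_def)
  then show ?thesis by (simp add: avg_def sum_divide_distrib)
qed

lemma avg_const: "k < K \<Longrightarrow> avg (\<lambda>b. f (g b)) k = f k"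
proof -
  assume k: "k < K"
  have "(\<Sum>a\<in>grp k. f (g a)) = (\<Sum>a\<in>grp k. f k)" by (rule sum.cong) (auto simp: grp_def)
  then show ?thesis using size_pos[OF k] by (simp add: avg_def size_def)
qed

lemma sum_avg: "(\<Sum>a<n. x a * f (g a)) = (\<Sum>a<n. avg x (g a) * f (g a))"
proof -
  have "(\<Sum>a\<in>grp k. x a * f (g a)) = (\<Sum>a\<in>grp k. avg x (g a) * f (g a))" if k: "k < K" for k
  proof -
    have "(\<Sum>a\<in>grp k. x a * f (g a)) = (\<Sum>a\<in>grp k. x a) * f k" unfolding sum_distrib_right by (rule sum.cong) (auto simp: grp_def)
    moreover have "(\<Sum>a\<in>grp k. avg x (g a) * f (g a)) = (\<Sum>a\<in>grp k. avg x k * f k)" by (rule sum.cong) (auto simp: grp_def)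
    ultimately show ?thesis using size_pos[OF k] by (simp add: avg_def size_def)
  qed
  then show ?thesis unfolding sum_by_group by (rule sum.cong[OF refl]) (simp only: lessThan_iff)
qed

lemma sum_wt_avg: "(\<Sum>k<K. wt a k * avg x k) = (\<Sum>b<n. wt a (g b) / size (g b) * x b)"
  unfolding sum_by_group avg_def sum_divide_distrib sum_distrib_left
  by (intro sum.cong refl) (auto simp: grp_def)

lemma sum_block_avg: "(\<Sum>a<n. \<Sum>k<K. wt a k * (avg x (g a) * avg x k)) = (\<Sum>a<n. \<Sum>b<n. block_avg (g a) (g b) * (x a * x b))"
proof -
  have "(\<Sum>a<n. \<Sum>k<K. wt a k * (avg x (g a) * avg x k)) = (\<Sum>j<K. \<Sum>a\<in>grp j. \<Sum>k<K. wt a k * (avg x j * avg x k))"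
    unfolding sum_by_group by (intro sum.cong refl) (auto simp: grp_def)
  also have "\<dots> = (\<Sum>j<K. \<Sum>k<K. (\<Sum>a\<in>grp j. wt a k) * (avg x j * avg x k))"
    by (rule sum.cong[OF refl], subst sum.swap) (simp add: sum_distrib_right)
  also have "\<dots> = (\<Sum>j<K. \<Sum>k<K. block_avg j k * ((\<Sum>a\<in>grp j. x a) * (\<Sum>b\<in>grp k. x b)))"
    by (simp add: block_avg_def avg_def mult_ac)
  also have "\<dots> = (\<Sum>j<K. \<Sum>k<K. \<Sum>a\<in>grp j. \<Sum>b\<in>grp k. block_avg (g a) (g b) * (x a * x b))"
    by (simp only: sum_product) (simp only: sum_distrib_left, intro sum.cong refl, auto simp: grp_def)
  also have "\<dots> = (\<Sum>j<K. \<Sum>a\<in>grp j. \<Sum>k<K. \<Sum>b\<in>grp k. block_avg (g a) (g b) * (x a * x b))"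
    by (rule sum.cong[OF refl], rule sum.swap)
  also have "\<dots> = (\<Sum>a<n. \<Sum>b<n. block_avg (g a) (g b) * (x a * x b))"
    unfolding sum_by_group ..
  finally show ?thesis .
qed

lemma res_form: "(\<Sum>a<n. \<Sum>b<n. res a b * (x a * x b)) =
  (\<Sum>a<n. \<Sum>b<n. B a b * (x a * x b)) - 2 * (\<Sum>a<n. \<Sum>k<K. wt a k * (x a * avg x k)) + (\<Sum>a<n. \<Sum>k<K. wt a k * (avg x (g a) * avg x k))"
proof -
  have 1: "(\<Sum>a<n. \<Sum>k<K. wt a k * (x a * avg x k)) = (\<Sum>a<n. \<Sum>b<n. wt a (g b) / size (g b) * (x a * x b))"
  proof (rule sum.cong[OF refl])
    fix a
    have "(\<Sum>k<K. wt a k * (x a * avg x k)) = x a * (\<Sum>k<K. wt a k * avg x k)" by (simp add: sum_distrib_left mult_ac)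
    also have "\<dots> = (\<Sum>b<n. wt a (g b) / size (g b) * (x a * x b))" unfolding sum_wt_avg sum_distrib_left by (simp add: mult_ac)
    finally show "(\<Sum>k<K. wt a k * (x a * avg x k)) = (\<Sum>b<n. wt a (g b) / size (g b) * (x a * x b))" .
  qed
  have 2: "(\<Sum>a<n. \<Sum>b<n. wt b (g a) / size (g a) * (x a * x b)) = (\<Sum>a<n. \<Sum>b<n. wt a (g b) / size (g b) * (x a * x b))"
    by (subst sum.swap) (simp add: mult_ac)
  show ?thesis unfolding sum_block_avg 1 res_def
    by (simp only: distrib_right left_diff_distrib sum.distrib sum_subtractf 2)
qed

text \<open>The form of B at the group-centred vector, which gives positivity of \<open>res\<close>;
  \<open>res_form\<close> is the version that enters the expansion of the objective.\<close>

lemma res_form': "(\<Sum>a<n. \<Sum>b<n. res a b * (x a * x b)) = (\<Sum>a<n. \<Sum>b<n. B a b * ((x a - avg x (g a)) * (x b - avg x (g b))))"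
proof -
  have 1: "(\<Sum>a<n. \<Sum>b<n. B a b * (x a * avg x (g b))) = (\<Sum>a<n. \<Sum>k<K. wt a k * (x a * avg x k))"
    by (intro sum.cong[OF refl]) (use sum_B_group[of _ "\<lambda>k. x a * avg x k" for a] in auto)
  have 2: "(\<Sum>a<n. \<Sum>b<n. B a b * (avg x (g a) * avg x (g b))) = (\<Sum>a<n. \<Sum>k<K. wt a k * (avg x (g a) * avg x k))"
    by (intro sum.cong[OF refl]) (use sum_B_group[of _ "\<lambda>k. avg x (g a) * avg x k" for a] in auto)
  have 3: "(\<Sum>a<n. \<Sum>b<n. B a b * (avg x (g a) * x b)) = (\<Sum>a<n. \<Sum>b<n. B a b * (x a * avg x (g b)))"
    by (subst sum.swap) (auto simp: B_sym mult_ac intro!: sum.cong)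
  have "(\<Sum>a<n. \<Sum>b<n. B a b * ((x a - avg x (g a)) * (x b - avg x (g b)))) =
    (\<Sum>a<n. \<Sum>b<n. B a b * (x a * x b) - B a b * (x a * avg x (g b)) - B a b * (avg x (g a) * x b) + B a b * (avg x (g a) * avg x (g b)))"
    by (intro sum.cong refl) (simp add: algebra_simps)
  also have "\<dots> = (\<Sum>a<n. \<Sum>b<n. B a b * (x a * x b)) - 2 * (\<Sum>a<n. \<Sum>k<K. wt a k * (x a * avg x k)) + (\<Sum>a<n. \<Sum>k<K. wt a k * (avg x (g a) * avg x k))"
    by (simp only: sum.distrib sum_subtractf 3) (simp only: 1 2)
  finally show ?thesis unfolding res_form by simp
qed

lemma block_avg_bounds: "j < K \<Longrightarrow> k < K \<Longrightarrow> 0 \<le> block_avg j k \<and> block_avg j k \<le> \<alpha>"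
  and wt_size_bounds: "a < n \<Longrightarrow> k < K \<Longrightarrow> 0 \<le> wt a k / size k \<and> wt a k / size k \<le> \<alpha>"
proof -
  have wt: "wt a k \<le> size k * \<alpha>" if "a < n" for a k
    unfolding wt_def size_def using sum_mono[of "grp k" "B a" "\<lambda>_. \<alpha>"] B_le that by (auto simp: grp_def)
  show "0 \<le> wt a k / size k \<and> wt a k / size k \<le> \<alpha>" if "a < n" "k < K" for a k
    using wt[of a k] wt_nonneg[of a k] size_pos[of k] that by (simp add: pos_divide_le_eq mult.commute)
  assume jk: "j < K" "k < K"
  have "(\<Sum>a\<in>grp j. wt a k) \<le> (\<Sum>a\<in>grp j. size k * \<alpha>)" by (rule sum_mono) (use wt in \<open>auto simp: grp_def\<close>)
  then have "(\<Sum>a\<in>grp j. wt a k) \<le> \<alpha> * (size j * size k)" by (simp add: size_def mult_ac)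
  moreover have "0 \<le> (\<Sum>a\<in>grp j. wt a k)" by (intro sum_nonneg wt_nonneg) (auto simp: grp_def)
  ultimately show "0 \<le> block_avg j k \<and> block_avg j k \<le> \<alpha>"
    using size_pos[OF jk(1)] size_pos[OF jk(2)] by (simp add: block_avg_def pos_divide_le_eq)
qed

lemma abs_res_le: "a < n \<Longrightarrow> b < n \<Longrightarrow> \<bar>res a b\<bar> \<le> 2 * \<alpha>"
  using B_nonneg[of a b] B_le[of a b] wt_size_bounds[OF _ g_less, of b a] wt_size_bounds[OF _ g_less, of a b]
    block_avg_bounds[OF g_less g_less, of a b] unfolding res_def abs_le_iff by linarith

lemma res_psd: "psd_on {..<n} res"
proof (rule psd_onI)
  have ba: "block_avg j k = block_avg k j" for j k
  proof -
    have "(\<Sum>a\<in>grp j. wt a k) = (\<Sum>a\<in>grp k. wt a j)"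
      unfolding wt_def by (subst sum.swap) (intro sum.cong refl B_sym, auto simp: grp_def)
    then show ?thesis by (simp add: block_avg_def mult.commute)
  qed
  show "res a b = res b a" if "a \<in> {..<n}" "b \<in> {..<n}" for a b
    using B_sym[of a b] that ba[of "g a" "g b"] by (simp add: res_def)
  show "0 \<le> (\<Sum>a<n. \<Sum>b<n. x a * x b * res a b)" for x
  proof -
    have "0 \<le> (\<Sum>a<n. \<Sum>b<n. (x a - avg x (g a)) * (x b - avg x (g b)) * B a b)" by (rule psd_on_form[OF B_psd])
    then show ?thesis using res_form'[of x] by (simp add: mult.commute)
  qed
qed

lemma sum_inv_size: "(\<Sum>a<n. 1 / size (g a)) = real K"
proof -
  have "(\<Sum>a\<in>grp k. 1 / size (g a)) = 1" if "k < K" for k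
  proof -
    have "(\<Sum>a\<in>grp k. 1 / size (g a)) = (\<Sum>a\<in>grp k. 1 / size k)" by (rule sum.cong) (auto simp: grp_def)
    then show ?thesis using size_pos[OF that] by (simp add: size_def)
  qed
  then show ?thesis unfolding sum_by_group by simp
qed

text \<open>The trace constraint enters here: B and \<open>Bst\<close> both have trace K, so that
  the trace of \<open>res\<close> is the sum of (1 - wt a (g a)) / size (g a).\<close>

lemma res_trace: "(\<Sum>a<n. res a a) \<le> off / m"
proof -
  have "(\<Sum>a<n. block_avg (g a) (g a)) = (\<Sum>a<n. wt a (g a) / size (g a))"
    unfolding sum_by_group
  proof (rule sum.cong[OF refl])
    fix k assume "k \<in> {..<K}"
    then have k: "0 < size k" using size_pos by auto
    have "(\<Sum>a\<in>grp k. block_avg (g a) (g a)) = (\<Sum>a\<in>grp k. block_avg k k)" by (rule sum.cong) (auto simp: grp_def)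
    also have "\<dots> = (\<Sum>a\<in>grp k. wt a k) / size k" using k by (simp add: block_avg_def size_def)
    also have "\<dots> = (\<Sum>a\<in>grp k. wt a (g a) / size (g a))" unfolding sum_divide_distrib by (rule sum.cong) (auto simp: grp_def)
    finally show "(\<Sum>a\<in>grp k. block_avg (g a) (g a)) = (\<Sum>a\<in>grp k. wt a (g a) / size (g a))" .
  qed
  moreover have "(\<Sum>a<n. res a a) = (\<Sum>a<n. B a a) - (\<Sum>a<n. wt a (g a) / size (g a)) - (\<Sum>a<n. wt a (g a) / size (g a)) + (\<Sum>a<n. block_avg (g a) (g a))"
    by (simp only: res_def sum.distrib sum_subtractf)
  ultimately have "(\<Sum>a<n. res a a) = (\<Sum>a<n. 1 / size (g a)) - (\<Sum>a<n. wt a (g a) / size (g a))"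
    unfolding sum_inv_size B_trace by linarith
  also have "\<dots> = (\<Sum>a<n. (1 - wt a (g a)) * (1 / size (g a)))"
    by (simp add: sum_subtractf[symmetric] diff_divide_distrib)
  also have "\<dots> \<le> (\<Sum>a<n. (\<Sum>k\<in>{..<K}-{g a}. wt a k) * (1 / m))"
  proof (rule sum_mono)
    fix a assume "a \<in> {..<n}"
    then have a: "a < n" by simp
    show "(1 - wt a (g a)) * (1 / size (g a)) \<le> (\<Sum>k\<in>{..<K}-{g a}. wt a k) * (1 / m)"
      unfolding one_minus_wt[OF a] by (intro mult_left_mono size_inv g_less a sum_nonneg wt_nonneg)
  qed
  also have "\<dots> = off / m" by (simp add: off_def sum_distrib_right[symmetric] sum_divide_distrib)
  finally show ?thesis .
qed

text \<open>Expansion of the objective along one column \<open>f (g a) + x a\<close> of the adjacency matrix.\<close>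
lemma column_identity:
  "(\<Sum>a<n. \<Sum>b<n. (Bst a b - B a b) * ((f (g a) + x a) * (f (g b) + x b))) =
    (\<Sum>a<n. \<Sum>k\<in>{..<K}-{g a}. wt a k * ((f (g a) - f k)\<^sup>2 / 2 + 2 * (x a * (f (g a) - f k))
      + 2 * (x a * (avg x (g a) - avg x k)) - avg x (g a) * (avg x (g a) - avg x k)))
    - (\<Sum>a<n. \<Sum>b<n. res a b * (x a * x b))"
proof -
  let ?C = "\<lambda>a b. Bst a b - B a b"
  let ?s = "\<lambda>F. \<Sum>a<n. \<Sum>k\<in>{..<K}-{g a}. wt a k * F a k"
  have C_sym: "?C a b = ?C b a" if "a < n" "b < n" for a b using B_sym[OF that] by (simp add: Bst_def)
  have Cf: "(\<Sum>b<n. ?C a b * h (g b)) = (\<Sum>k\<in>{..<K}-{g a}. wt a k * (h (g a) - h k))" if a: "a < n" for a h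
  proof -
    have "(\<Sum>b<n. ?C a b * h (g b)) = h (g a) - (\<Sum>k<K. wt a k * h k)"
      using sum_Bst[OF a, of "\<lambda>b. h (g b)"] avg_const[OF g_less[OF a]] sum_B_group[OF a, of h]
      by (simp add: left_diff_distrib sum_subtractf)
    then show ?thesis using wt_split[OF a, of h] by simp
  qed
  have xf: "(\<Sum>a<n. \<Sum>b<n. ?C a b * (x a * f (g b))) = ?s (\<lambda>a k. x a * (f (g a) - f k))"
  proof (rule sum.cong[OF refl])
    fix a assume "a \<in> {..<n}"
    then have a: "a < n" by simp
    have "(\<Sum>b<n. ?C a b * (x a * f (g b))) = x a * (\<Sum>b<n. ?C a b * f (g b))" by (simp add: sum_distrib_left mult_ac)
    also have "\<dots> = (\<Sum>k\<in>{..<K}-{g a}. wt a k * (x a * (f (g a) - f k)))" unfolding Cf[OF a] by (simp add: sum_distrib_left mult_ac)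
    finally show "(\<Sum>b<n. ?C a b * (x a * f (g b))) = (\<Sum>k\<in>{..<K}-{g a}. wt a k * (x a * (f (g a) - f k)))" .
  qed
  have fx: "(\<Sum>a<n. \<Sum>b<n. ?C a b * (f (g a) * x b)) = (\<Sum>a<n. \<Sum>b<n. ?C a b * (x a * f (g b)))"
    by (subst sum.swap) (auto intro!: sum.cong simp: C_sym mult_ac)
  have ff: "(\<Sum>a<n. \<Sum>b<n. ?C a b * (f (g a) * f (g b))) = ?s (\<lambda>a k. (f (g a) - f k)\<^sup>2 / 2)"
  proof -
    have 1: "(\<Sum>a<n. \<Sum>b<n. ?C a b * (f (g a) * f (g b))) = ?s (\<lambda>a k. f (g a) * (f (g a) - f k))"
    proof (rule sum.cong[OF refl])
      fix a assume "a \<in> {..<n}"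
      then have a: "a < n" by simp
      have "(\<Sum>b<n. ?C a b * (f (g a) * f (g b))) = f (g a) * (\<Sum>b<n. ?C a b * f (g b))" by (simp add: sum_distrib_left mult_ac)
      also have "\<dots> = (\<Sum>k\<in>{..<K}-{g a}. wt a k * (f (g a) * (f (g a) - f k)))" unfolding Cf[OF a] by (simp add: sum_distrib_left mult_ac)
      finally show "(\<Sum>b<n. ?C a b * (f (g a) * f (g b))) = (\<Sum>k\<in>{..<K}-{g a}. wt a k * (f (g a) * (f (g a) - f k)))" .
    qed
    \<comment> \<open>Unit column sums of B make the differences of squares cancel in total, so f (f
      - f') may be replaced by (f - f')^2 / 2, the signal.\<close>
    have 2: "?s (\<lambda>a k. (f (g a))\<^sup>2 - (f k)\<^sup>2) = 0"
    proof -
      have "?s (\<lambda>a k. (f (g a))\<^sup>2 - (f k)\<^sup>2) = (\<Sum>a<n. (f (g a))\<^sup>2 - (\<Sum>b<n. B a b * (f (g b))\<^sup>2))"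
      proof (rule sum.cong[OF refl])
        fix a assume "a \<in> {..<n}"
        then have a: "a < n" by simp
        show "(\<Sum>k\<in>{..<K}-{g a}. wt a k * ((f (g a))\<^sup>2 - (f k)\<^sup>2)) = (f (g a))\<^sup>2 - (\<Sum>b<n. B a b * (f (g b))\<^sup>2)"
          using wt_split[OF a, of "\<lambda>k. (f k)\<^sup>2"] sum_B_group[OF a, of "\<lambda>k. (f k)\<^sup>2"] by simp
      qed
      then show ?thesis using sum_B_col[of "\<lambda>b. (f (g b))\<^sup>2"] by (simp add: sum_subtractf)
    qed
    have "?s (\<lambda>a k. f (g a) * (f (g a) - f k)) = ?s (\<lambda>a k. (f (g a) - f k)\<^sup>2 / 2) + ?s (\<lambda>a k. (f (g a))\<^sup>2 - (f k)\<^sup>2) / 2"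
      by (simp add: sum.distrib[symmetric] sum_divide_distrib) (intro sum.cong refl, simp add: power2_eq_square field_simps)
    then show ?thesis using 1 2 by simp
  qed
  have xx: "(\<Sum>a<n. \<Sum>b<n. ?C a b * (x a * x b)) = 2 * ?s (\<lambda>a k. x a * (avg x (g a) - avg x k)) - ?s (\<lambda>a k. avg x (g a) * (avg x (g a) - avg x k))
    - (\<Sum>a<n. \<Sum>b<n. res a b * (x a * x b))"
  proof -
    define P where "P = (\<Sum>a<n. x a * avg x (g a))"
    have P': "P = (\<Sum>a<n. avg x (g a) * avg x (g a))" unfolding P_def by (rule sum_avg)
    have st: "(\<Sum>a<n. \<Sum>b<n. Bst a b * (x a * x b)) = P"
      unfolding P_def
    proof (rule sum.cong[OF refl])
      fix a assume "a \<in> {..<n}"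
      then have "(\<Sum>b<n. Bst a b * x b) = avg x (g a)" by (simp add: sum_Bst)
      then show "(\<Sum>b<n. Bst a b * (x a * x b)) = x a * avg x (g a)" by (simp add: sum_distrib_left mult_ac flip: \<open>(\<Sum>b<n. Bst a b * x b) = avg x (g a)\<close>)
    qed
    have X1: "(\<Sum>a<n. \<Sum>k<K. wt a k * (x a * avg x k)) = P - ?s (\<lambda>a k. x a * (avg x (g a) - avg x k))"
      unfolding P_def sum_subtractf[symmetric]
      by (rule sum.cong[OF refl]) (use wt_split[of _ "\<lambda>k. x a * avg x k" for a] in \<open>simp add: right_diff_distrib\<close>)
    have X0: "(\<Sum>a<n. \<Sum>k<K. wt a k * (avg x (g a) * avg x k)) = P - ?s (\<lambda>a k. avg x (g a) * (avg x (g a) - avg x k))"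
      unfolding P' sum_subtractf[symmetric]
      by (rule sum.cong[OF refl]) (use wt_split[of _ "\<lambda>k. avg x (g a) * avg x k" for a] in \<open>simp add: right_diff_distrib\<close>)
    have "(\<Sum>a<n. \<Sum>b<n. ?C a b * (x a * x b)) = P - (\<Sum>a<n. \<Sum>b<n. B a b * (x a * x b))"
      unfolding st[symmetric] by (simp only: left_diff_distrib sum_subtractf)
    moreover have "c = 2 * t - t0 - r" if "c = P - b" "r = b - 2 * (P - t) + (P - t0)" for c b r t t0 :: real
      using that by simp
    ultimately show ?thesis using res_form[of x] unfolding X1 X0 by blast
  qed
  have "(\<Sum>a<n. \<Sum>b<n. ?C a b * ((f (g a) + x a) * (f (g b) + x b))) =
    (\<Sum>a<n. \<Sum>b<n. ?C a b * (f (g a) * f (g b)) + ?C a b * (x a * f (g b)) + ?C a b * (f (g a) * x b) + ?C a b * (x a * x b))"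
    by (intro sum.cong refl) (simp add: algebra_simps)
  also have "\<dots> = ?s (\<lambda>a k. (f (g a) - f k)\<^sup>2 / 2) + 2 * ?s (\<lambda>a k. x a * (f (g a) - f k)) + (2 * ?s (\<lambda>a k. x a * (avg x (g a) - avg x k)) - ?s (\<lambda>a k. avg x (g a) * (avg x (g a) - avg x k))
    - (\<Sum>a<n. \<Sum>b<n. res a b * (x a * x b)))"
    by (simp only: sum.distrib fx) (simp only: ff xf xx)
  also have "\<dots> = (\<Sum>a<n. \<Sum>k\<in>{..<K}-{g a}. wt a k * ((f (g a) - f k)\<^sup>2 / 2 + 2 * (x a * (f (g a) - f k))
      + 2 * (x a * (avg x (g a) - avg x k)) - avg x (g a) * (avg x (g a) - avg x k)))
    - (\<Sum>a<n. \<Sum>b<n. res a b * (x a * x b))"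
  proof -
    have "?s (\<lambda>a k. F1 a k + 2 * F2 a k + 2 * F3 a k - F4 a k) = ?s F1 + 2 * ?s F2 + 2 * ?s F3 - ?s F4" for F1 F2 F3 F4 :: "nat \<Rightarrow> nat \<Rightarrow> real"
      by (simp only: distrib_left right_diff_distrib sum.distrib sum_subtractf) (simp add: sum_distrib_left mult_ac)
    from this[of "\<lambda>a k. (f (g a) - f k)\<^sup>2 / 2"] show ?thesis by simp
  qed
  finally show ?thesis .
qed

end

section \<open>The basic inequality for the off-block mass\<close>

lemma sum_gram:
  fixes F H :: "nat \<Rightarrow> nat \<Rightarrow> real"
  shows "(\<Sum>a\<in>I. \<Sum>b\<in>J. (x a * y b) * (\<Sum>c\<in>C. F a c * H b c)) = (\<Sum>c\<in>C. (\<Sum>a\<in>I. x a * F a c) * (\<Sum>b\<in>J. y b * H b c))"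
proof -
  have "(\<Sum>a\<in>I. \<Sum>b\<in>J. (x a * y b) * (\<Sum>c\<in>C. F a c * H b c)) = (\<Sum>a\<in>I. \<Sum>b\<in>J. \<Sum>c\<in>C. (x a * F a c) * (y b * H b c))"
    by (intro sum.cong refl) (simp add: sum_distrib_left mult_ac)
  also have "\<dots> = (\<Sum>c\<in>C. \<Sum>a\<in>I. \<Sum>b\<in>J. (x a * F a c) * (y b * H b c))" by (rule sum_swap3)
  finally show ?thesis by (simp only: sum_product)
qed

context relaxed
begin

lemma avg_W: "avg (\<lambda>a. W A a c) k = Wbar A k c"
  by (simp add: avg_def Wbar_def)

context
  fixes A :: "(nat \<times> nat) set"
  assumes A: "A \<subseteq> pairs n" and light: "light_bounded A" and disc: "discrepancy_bounded A"
    and d1: "1 \<le> d" and nbig: "ln (real n) + 6 \<le> real n"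
begin

abbreviation V :: "nat set" where "V \<equiv> good_nodes A"
abbreviation \<Theta> :: real where "\<Theta> \<equiv> truncation_error A"

definition op2 :: real where "op2 = op_const\<^sup>2 * d"

lemma op2: "(\<Sum>c\<in>V. (\<Sum>a\<in>V. x a * W A a c)\<^sup>2) \<le> op2 * (\<Sum>a\<in>V. (x a)\<^sup>2)"
  unfolding op2_def by (rule op_norm_sq[OF A light disc d1 nbig])

lemma op2_nonneg: "0 \<le> op2" using d_pos by (simp add: op2_def)

lemma \<Theta>_nonneg: "0 \<le> \<Theta>" unfolding truncation_error_def by (intro sum_nonneg) auto

lemma finV: "finite V" "V \<subseteq> {..<n}" by (rule good_nodes)+

text \<open>On V both op2 I - W W^T and \<open>res\<close> are positive semidefinite, so their inner
  product is nonnegative, which bounds the term by op2 times the trace of \<open>res\<close>.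
  Leaving V costs 2 \<alpha> \<Theta>.\<close>

lemma residual_term: "(\<Sum>a<n. \<Sum>b<n. res a b * (\<Sum>c<n. W A a c * W A b c)) \<le> op2 * (off / m) + 2 * \<alpha> * \<Theta>"
proof -
  define N where "N a b = (if a = b then op2 else 0) - (\<Sum>c\<in>V. W A a c * W A b c)" for a b
  have Nform: "(\<Sum>a\<in>V. \<Sum>b\<in>V. F a b * N a b) = op2 * (\<Sum>a\<in>V. F a a) - (\<Sum>a\<in>V. \<Sum>b\<in>V. F a b * (\<Sum>c\<in>V. W A a c * W A b c))" for F :: "nat \<Rightarrow> nat \<Rightarrow> real"
  proof -
    have "(\<Sum>a\<in>V. \<Sum>b\<in>V. F a b * N a b) = (\<Sum>a\<in>V. \<Sum>b\<in>V. (if a = b then op2 * F a b else 0) - F a b * (\<Sum>c\<in>V. W A a c * W A b c))"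
      by (intro sum.cong refl) (auto simp: N_def algebra_simps)
    also have "\<dots> = (\<Sum>a\<in>V. op2 * F a a) - (\<Sum>a\<in>V. \<Sum>b\<in>V. F a b * (\<Sum>c\<in>V. W A a c * W A b c))"
      using finV by (simp add: sum_subtractf)
    finally show ?thesis by (simp add: sum_distrib_left)
  qed
  have "psd_on V N"
  proof (rule psd_onI)
    show "N a b = N b a" for a b by (simp add: N_def mult.commute)
    fix x
    have "(\<Sum>a\<in>V. \<Sum>b\<in>V. x a * x b * (\<Sum>c\<in>V. W A a c * W A b c)) = (\<Sum>c\<in>V. (\<Sum>a\<in>V. x a * W A a c)\<^sup>2)"
      by (simp only: sum_gram power2_eq_square)
    also have "\<dots> \<le> op2 * (\<Sum>a\<in>V. x a * x a)" using op2[of x] by (simp add: power2_eq_square)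
    finally show "0 \<le> (\<Sum>a\<in>V. \<Sum>b\<in>V. x a * x b * N a b)" unfolding Nform[of "\<lambda>a b. x a * x b"] by simp
  qed
  from psd_on_inner_nonneg[OF finV(1) this psd_on_subset[OF res_psd finV(2)]]
  have "0 \<le> (\<Sum>a\<in>V. \<Sum>b\<in>V. res a b * N a b)" by (simp add: mult.commute)
  then have "(\<Sum>a\<in>V. \<Sum>b\<in>V. res a b * (\<Sum>c\<in>V. W A a c * W A b c)) \<le> op2 * (\<Sum>a\<in>V. res a a)"
    unfolding Nform by simp
  also have "\<dots> \<le> op2 * (\<Sum>a<n. res a a)"
    by (intro mult_left_mono sum_mono2 op2_nonneg) (use finV psd_on_diag[OF res_psd] in auto)
  also have "\<dots> \<le> op2 * (off / m)" by (intro mult_left_mono res_trace op2_nonneg)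
  finally have "(\<Sum>a\<in>V. \<Sum>b\<in>V. res a b * (\<Sum>c\<in>V. W A a c * W A b c)) \<le> op2 * (off / m)" .
  then show ?thesis using truncation_bound[of res "2 * \<alpha>" A, OF abs_res_le] by linarith
qed

text \<open>\<open>Wbar\<close> is the noise applied to the normalised indicator of a group, of
  squared length 1 / size \<le> 1 / m.\<close>

lemma Wbar_sq: 
  assumes k: "k < K"
  shows "(\<Sum>c<n. (Wbar A k c)\<^sup>2) \<le> op2 / m + \<alpha> * \<Theta> / m"
proof -
  define z where "z a = (if g a = k then 1 / size k else 0)" for a
  have z0: "0 \<le> z a" "z a \<le> \<alpha>" "z a \<le> 1 / m" for a
    using size_inv[OF k] size_pos[OF k] \<alpha>_pos m_pos by (auto simp: z_def)
  have "(\<Sum>c<n. (Wbar A k c)\<^sup>2) = (\<Sum>c<n. (\<Sum>a<n. z a * W A a c) * (\<Sum>b<n. z b * W A b c))"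
  proof (rule sum.cong[OF refl])
    fix c
    have "(\<Sum>a<n. z a * W A a c) = (\<Sum>a\<in>grp k. 1 / size k * W A a c)"
      by (rule sum.mono_neutral_cong_right) (auto simp: z_def grp_def)
    then have "Wbar A k c = (\<Sum>a<n. z a * W A a c)" by (simp add: Wbar_def sum_divide_distrib)
    then show "(Wbar A k c)\<^sup>2 = (\<Sum>a<n. z a * W A a c) * (\<Sum>b<n. z b * W A b c)" by (simp add: power2_eq_square)
  qed
  also have "\<dots> = (\<Sum>a<n. \<Sum>b<n. (z a * z b) * (\<Sum>c<n. W A a c * W A b c))"
    by (rule sum_gram[symmetric])
  also have "\<dots> \<le> (\<Sum>a\<in>V. \<Sum>b\<in>V. (z a * z b) * (\<Sum>c\<in>V. W A a c * W A b c)) + \<alpha> * (1 / m) * \<Theta>"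
  proof -
    have "\<bar>z a * z b\<bar> \<le> \<alpha> * (1 / m)" for a b 
      using mult_mono[OF z0(2)[of a] z0(3)[of b]] z0(1)[of a] z0(1)[of b] \<alpha>_pos by (simp add: abs_mult)
    from truncation_bound[of "\<lambda>a b. z a * z b" "\<alpha> * (1 / m)" A, OF this] show ?thesis by linarith
  qed
  also have "(\<Sum>a\<in>V. \<Sum>b\<in>V. (z a * z b) * (\<Sum>c\<in>V. W A a c * W A b c)) = (\<Sum>c\<in>V. (\<Sum>a\<in>V. z a * W A a c)\<^sup>2)"
    by (simp only: sum_gram power2_eq_square)
  also have "\<dots> \<le> op2 * (\<Sum>a\<in>V. (z a)\<^sup>2)" by (rule op2)
  also have "(\<Sum>a\<in>V. (z a)\<^sup>2) \<le> (\<Sum>a<n. (z a)\<^sup>2)" by (rule sum_mono2) (use finV in auto)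
  also have "(\<Sum>a<n. (z a)\<^sup>2) = (\<Sum>a\<in>grp k. (1 / size k)\<^sup>2)"
    by (rule sum.mono_neutral_cong_right) (auto simp: z_def grp_def)
  also have "\<dots> = 1 / size k" using size_pos[OF k] by (simp add: size_def power2_eq_square)
  also have "1 / size k \<le> 1 / m" by (rule size_inv[OF k])
  finally show ?thesis using op2_nonneg by (simp add: mult_left_mono)
qed

definition quad :: "nat \<Rightarrow> nat \<Rightarrow> real" where
  "quad a k = (\<Sum>c<n. W A a c * (Wbar A (g a) c - Wbar A k c))"

text \<open>No pointwise bound is available on bad rows. The term is a sum over k of inner products
  of the noise applied to q k, the weight deviations on bad rows, and to z k, the normalised group
  indicator. Cauchy-Schwarz for each k and then over the K groups produces the square root.\<close>

lemma bad_rows_term: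
  assumes Bd: "Bd \<subseteq> {..<n}"
  shows "\<bar>\<Sum>a\<in>Bd. \<Sum>k\<in>{..<K}-{g a}. wt a k * quad a k\<bar> \<le> op2 * sqrt (2 * real K * real (card Bd) / m) + \<alpha> * \<Theta>"
proof -
  have finB: "finite Bd" using Bd finite_subset by auto
  \<comment> \<open>True assignment minus weights. The squares sum to at most 2 in each bad row,
    which gives the 2 under the root.\<close>
  define q where "q a k = (if a \<in> Bd then of_bool (k = g a) - wt a k else 0)" for a k
  define z where "z k b = (if g b = k then 1 / size k else 0)" for k b
  have q1: "\<bar>q a k\<bar> \<le> 1" if "a < n" "k < K" for a k
    using wt_nonneg[of a k] wt_le_1[of a k] that by (auto simp: q_def)
  have WW: "(\<Sum>c<n. W A a c * Wbar A k c) = (\<Sum>b<n. z k b * (\<Sum>c<n. W A a c * W A b c))" for a k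
  proof -
    have "Wbar A k c = (\<Sum>b<n. z k b * W A b c)" for c
    proof -
      have "(\<Sum>a<n. z k a * W A a c) = (\<Sum>a\<in>grp k. 1 / size k * W A a c)"
        by (rule sum.mono_neutral_cong_right) (auto simp: z_def grp_def)
      then show ?thesis by (simp add: Wbar_def sum_divide_distrib)
    qed
    then have "(\<Sum>c<n. W A a c * Wbar A k c) = (\<Sum>c<n. \<Sum>b<n. z k b * (W A a c * W A b c))" by (simp add: sum_distrib_left mult_ac)
    also have "\<dots> = (\<Sum>b<n. \<Sum>c<n. z k b * (W A a c * W A b c))" by (rule sum.swap)
    finally show ?thesis by (simp add: sum_distrib_left)
  qed
  define Q where "Q a b = (\<Sum>k<K. q a k * z k b)" for a b
  have Q_eq: "Q a b = q a (g b) / size (g b)" if "b < n" for a b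
  proof -
    have "Q a b = (\<Sum>k<K. if k = g b then q a (g b) / size (g b) else 0)" unfolding Q_def by (rule sum.cong) (auto simp: z_def)
    then show ?thesis using g_less[OF that] by simp
  qed
  have Q_le: "\<bar>Q a b\<bar> \<le> \<alpha>" if "a < n" "b < n" for a b
  proof -
    have "\<bar>Q a b\<bar> = \<bar>q a (g b)\<bar> * (1 / size (g b))" using Q_eq[OF that(2)] size_pos[OF g_less[OF that(2)]] by (simp add: abs_divide)
    also have "\<dots> \<le> 1 * \<alpha>" using q1[OF that(1) g_less[OF that(2)]] size_inv(2)[OF g_less[OF that(2)]] size_pos[OF g_less[OF that(2)]] by (intro mult_mono) auto
    finally show ?thesis by simp
  qed
  have "(\<Sum>a\<in>Bd. \<Sum>k\<in>{..<K}-{g a}. wt a k * quad a k) = (\<Sum>a\<in>Bd. \<Sum>k<K. q a k * (\<Sum>c<n. W A a c * Wbar A k c))"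
  proof (rule sum.cong[OF refl])
    fix a assume a: "a \<in> Bd"
    then have an: "a < n" using Bd by auto
    let ?h = "\<lambda>k. \<Sum>c<n. W A a c * Wbar A k c"
    have "(\<Sum>k\<in>{..<K}-{g a}. wt a k * quad a k) = (\<Sum>k\<in>{..<K}-{g a}. wt a k * (?h (g a) - ?h k))"
      by (simp add: quad_def right_diff_distrib sum_subtractf)
    also have "\<dots> = ?h (g a) - (\<Sum>k<K. wt a k * ?h k)" using wt_split[OF an, of ?h] by simp
    also have "\<dots> = (\<Sum>k<K. of_bool (k = g a) * ?h k) - (\<Sum>k<K. wt a k * ?h k)" using g_less[OF an] by simp
    also have "\<dots> = (\<Sum>k<K. q a k * ?h k)" unfolding sum_subtractf[symmetric] left_diff_distrib[symmetric] by (rule sum.cong[OF refl]) (use a in \<open>simp add: q_def\<close>)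
    finally show "(\<Sum>k\<in>{..<K}-{g a}. wt a k * quad a k) = (\<Sum>k<K. q a k * ?h k)" .
  qed
  also have "\<dots> = (\<Sum>a<n. \<Sum>k<K. q a k * (\<Sum>c<n. W A a c * Wbar A k c))"
    by (rule sum.mono_neutral_left) (use Bd in \<open>auto simp: q_def\<close>)
  also have "\<dots> = (\<Sum>a<n. \<Sum>b<n. Q a b * (\<Sum>c<n. W A a c * W A b c))"
    unfolding WW Q_def sum_distrib_right
    by (rule sum.cong[OF refl], subst sum.swap) (simp add: sum_distrib_left mult.assoc)
  finally have eq: "(\<Sum>a\<in>Bd. \<Sum>k\<in>{..<K}-{g a}. wt a k * quad a k) = (\<Sum>a<n. \<Sum>b<n. Q a b * (\<Sum>c<n. W A a c * W A b c))" .
  have eqQ: "(\<Sum>a\<in>V. \<Sum>b\<in>V. Q a b * (\<Sum>c\<in>V. W A a c * W A b c)) = (\<Sum>k<K. \<Sum>c\<in>V. (\<Sum>a\<in>V. q a k * W A a c) * (\<Sum>b\<in>V. z k b * W A b c))"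
  proof -
    have "(\<Sum>a\<in>V. \<Sum>b\<in>V. Q a b * (\<Sum>c\<in>V. W A a c * W A b c)) = (\<Sum>a\<in>V. \<Sum>b\<in>V. \<Sum>k<K. \<Sum>c\<in>V. (q a k * W A a c) * (z k b * W A b c))"
    proof (intro sum.cong refl)
      fix a b
      show "Q a b * (\<Sum>c\<in>V. W A a c * W A b c) = (\<Sum>k<K. \<Sum>c\<in>V. (q a k * W A a c) * (z k b * W A b c))"
        by (simp only: Q_def sum_product) (intro sum.cong refl, simp add: mult_ac)
    qed
    also have "\<dots> = (\<Sum>k<K. \<Sum>c\<in>V. \<Sum>a\<in>V. \<Sum>b\<in>V. (q a k * W A a c) * (z k b * W A b c))" by (rule sum_swap4)
    finally show ?thesis by (simp only: sum_product)
  qed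
  have "\<bar>\<Sum>k<K. \<Sum>c\<in>V. (\<Sum>a\<in>V. q a k * W A a c) * (\<Sum>b\<in>V. z k b * W A b c)\<bar> \<le> (\<Sum>k<K. op2 * sqrt (1 / m) * sqrt (\<Sum>a<n. (q a k)\<^sup>2))"
  proof (rule order_trans[OF sum_abs sum_mono])
    fix k assume "k \<in> {..<K}"
    then have k: "k < K" by simp
    define u where "u c = (\<Sum>a\<in>V. q a k * W A a c)" for c
    define v where "v c = (\<Sum>b\<in>V. z k b * W A b c)" for c
    have "\<bar>\<Sum>c\<in>V. u c * v c\<bar> \<le> sqrt (\<Sum>c\<in>V. (u c)\<^sup>2) * sqrt (\<Sum>c\<in>V. (v c)\<^sup>2)"
      using sum_mult_le_sqrt[of u v V] sum_mult_le_sqrt[of "\<lambda>c. - u c" v V] by (simp add: sum_negf abs_le_iff)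
    also have "\<dots> \<le> sqrt (op2 * (\<Sum>a<n. (q a k)\<^sup>2)) * sqrt (op2 * (1 / m))"
    proof (intro mult_mono real_sqrt_le_mono)
      have "(\<Sum>c\<in>V. (u c)\<^sup>2) \<le> op2 * (\<Sum>a\<in>V. (q a k)\<^sup>2)" unfolding u_def by (rule op2)
      also have "\<dots> \<le> op2 * (\<Sum>a<n. (q a k)\<^sup>2)" by (intro mult_left_mono sum_mono2 op2_nonneg) (use finV in auto)
      finally show "(\<Sum>c\<in>V. (u c)\<^sup>2) \<le> op2 * (\<Sum>a<n. (q a k)\<^sup>2)" .
      have "(\<Sum>c\<in>V. (v c)\<^sup>2) \<le> op2 * (\<Sum>a\<in>V. (z k a)\<^sup>2)" unfolding v_def by (rule op2)
      also have "\<dots> \<le> op2 * (1 / m)"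
      proof (rule mult_left_mono[OF _ op2_nonneg])
        have "(\<Sum>a\<in>V. (z k a)\<^sup>2) \<le> (\<Sum>a<n. (z k a)\<^sup>2)" by (rule sum_mono2) (use finV in auto)
        also have "(\<Sum>a<n. (z k a)\<^sup>2) = (\<Sum>a\<in>grp k. (1 / size k)\<^sup>2)"
          by (rule sum.mono_neutral_cong_right) (auto simp: z_def grp_def)
        also have "\<dots> = 1 / size k" using size_pos[OF k] by (simp add: size_def power2_eq_square)
        also have "\<dots> \<le> 1 / m" by (rule size_inv[OF k])
        finally show "(\<Sum>a\<in>V. (z k a)\<^sup>2) \<le> 1 / m" .
      qed
      finally show "(\<Sum>c\<in>V. (v c)\<^sup>2) \<le> op2 * (1 / m)" .
    qed (use op2_nonneg in \<open>auto intro!: sum_nonneg mult_nonneg_nonneg\<close>)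
    also have "\<dots> = op2 * sqrt (1 / m) * sqrt (\<Sum>a<n. (q a k)\<^sup>2)"
    proof -
      have "sqrt op2 * x * (sqrt op2 * y) = op2 * y * x" for x y
        using real_sqrt_mult_self[of op2] op2_nonneg by (simp add: mult_ac)
      then show ?thesis unfolding real_sqrt_mult by blast
    qed
    finally show "\<bar>\<Sum>c\<in>V. (\<Sum>a\<in>V. q a k * W A a c) * (\<Sum>b\<in>V. z k b * W A b c)\<bar> \<le> op2 * sqrt (1 / m) * sqrt (\<Sum>a<n. (q a k)\<^sup>2)"
      by (simp only: u_def v_def)
  qed
  also have "\<dots> = op2 * sqrt (1 / m) * (\<Sum>k<K. 1 * sqrt (\<Sum>a<n. (q a k)\<^sup>2))" by (simp add: sum_distrib_left)
  also have "\<dots> \<le> op2 * sqrt (1 / m) * (sqrt (\<Sum>k<K. 1\<^sup>2) * sqrt (\<Sum>k<K. (sqrt (\<Sum>a<n. (q a k)\<^sup>2))\<^sup>2))"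
    by (intro mult_left_mono sum_mult_le_sqrt mult_nonneg_nonneg op2_nonneg) (use m_pos in auto)
  also have "\<dots> \<le> op2 * sqrt (1 / m) * (sqrt (real K) * sqrt (2 * real (card Bd)))"
  proof -
    have "(\<Sum>k<K. \<Sum>a<n. (q a k)\<^sup>2) = (\<Sum>a<n. \<Sum>k<K. (q a k)\<^sup>2)" by (rule sum.swap)
    also have "\<dots> = (\<Sum>a\<in>Bd. \<Sum>k<K. (q a k)\<^sup>2)" by (rule sum.mono_neutral_right) (use Bd in \<open>auto simp: q_def\<close>)
    also have "\<dots> \<le> (\<Sum>a\<in>Bd. 2)"
    proof (rule sum_mono)
      fix a assume a: "a \<in> Bd"
      then have an: "a < n" using Bd by auto
      have "(\<Sum>k<K. (q a k)\<^sup>2) \<le> (\<Sum>k<K. of_bool (k = g a) + wt a k)"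
      proof (rule sum_mono)
        fix k assume "k \<in> {..<K}"
        then have k: "k < K" by simp
        have "(q a k)\<^sup>2 = \<bar>q a k\<bar> * \<bar>q a k\<bar>" by (simp add: power2_eq_square)
        also have "\<dots> \<le> 1 * \<bar>q a k\<bar>" by (rule mult_right_mono[OF q1[OF an k]]) simp
        also have "\<dots> \<le> of_bool (k = g a) + wt a k" using a wt_nonneg[OF an, of k] by (auto simp: q_def)
        finally show "(q a k)\<^sup>2 \<le> of_bool (k = g a) + wt a k" .
      qed
      also have "\<dots> = 2" using g_less[OF an] sum_wt[OF an] by (simp add: sum.distrib)
      finally show "(\<Sum>k<K. (q a k)\<^sup>2) \<le> 2" .
    qed
    finally have "(\<Sum>k<K. \<Sum>a<n. (q a k)\<^sup>2) \<le> 2 * real (card Bd)" by simp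
    then have "sqrt (\<Sum>k<K. \<Sum>a<n. (q a k)\<^sup>2) \<le> sqrt (2 * real (card Bd))" by (rule real_sqrt_le_mono)
    moreover have "(\<Sum>k<K. (sqrt (\<Sum>a<n. (q a k)\<^sup>2))\<^sup>2) = (\<Sum>k<K. \<Sum>a<n. (q a k)\<^sup>2)"
      by (simp add: sum_nonneg)
    moreover have "(\<Sum>k<K. 1\<^sup>2) = real K" by simp
    moreover have "0 \<le> op2 * sqrt (1 / m)" using op2_nonneg m_pos by simp
    ultimately show ?thesis by (simp only: mult_left_mono real_sqrt_ge_zero of_nat_0_le_iff)
  qed
  also have "\<dots> = op2 * sqrt (2 * real K * real (card Bd) / m)"
    by (simp add: real_sqrt_mult[symmetric] mult_ac)
  finally have "\<bar>\<Sum>a\<in>V. \<Sum>b\<in>V. Q a b * (\<Sum>c\<in>V. W A a c * W A b c)\<bar> \<le> op2 * sqrt (2 * real K * real (card Bd) / m)" unfolding eqQ .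
  then show ?thesis unfolding eq using truncation_bound[of Q \<alpha> A, OF Q_le] by linarith
qed

text \<open>\<open>column_identity\<close> is summed over the columns c, with f the mean part and x
  the noise part of column c; by optimality the left side is nonpositive.\<close>

lemma main_inequality:
  assumes opt: "(\<Sum>a<n. \<Sum>b<n. (Bst a b - B a b) * (\<Sum>c<n. adj A a c * adj A b c)) \<le> 0"
    and big: "40 * op_const\<^sup>2 * (real n / m) \<le> s2"
  shows "D * off / 8 \<le> 2 * (\<Sum>a<n. lin_excess A a) + 2 * (op2 * sqrt (2 * real K * real (card {b\<in>{..<n}. bad A b}) / m)) + 4 * \<alpha> * \<Theta> * (1 + real n / m)"
proof -
  define \<omega> where "\<omega> = op2 / m + \<alpha> * \<Theta> / m"
  define lin where "lin a k = (\<Sum>c<n. W A a c * (p (g a) (g c) - p k (g c)))" for a k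
  define cross where "cross a k = (\<Sum>c<n. Wbar A (g a) c * (Wbar A (g a) c - Wbar A k c))" for a k
  define Bd where "Bd = {b\<in>{..<n}. bad A b}"
  let ?s = "\<lambda>F. \<Sum>a<n. \<Sum>k\<in>{..<K}-{g a}. wt a k * F a k"
  have s_mono: "?s F \<le> ?s F'" if "\<And>a k. a < n \<Longrightarrow> k < K \<Longrightarrow> k \<noteq> g a \<Longrightarrow> F a k \<le> F' a k" for F F' :: "nat \<Rightarrow> nat \<Rightarrow> real"
    by (intro sum_mono mult_left_mono wt_nonneg) (use that in auto)
  have s_const: "?s (\<lambda>a k. c) = c * off" for c by (simp add: off_def sum_distrib_left mult.commute)
  have D0: "0 < D"
  proof -
    have "0 < 40 * op_const\<^sup>2 * (real n / m)" using op_const_pos m_pos n_pos by simp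
    then have "0 < s2" using big by linarith
    then show ?thesis using L_pos by (simp add: s2_def zero_less_divide_iff)
  qed
  have "0 \<ge> (\<Sum>a<n. \<Sum>b<n. (Bst a b - B a b) * (\<Sum>c<n. (p (g a) (g c) + W A a c) * (p (g b) (g c) + W A b c)))"
  proof -
    have "(\<Sum>a<n. \<Sum>b<n. (Bst a b - B a b) * (\<Sum>c<n. (p (g a) (g c) + W A a c) * (p (g b) (g c) + W A b c))) = (\<Sum>a<n. \<Sum>b<n. (Bst a b - B a b) * (\<Sum>c<n. adj A a c * adj A b c))"
      by (intro sum.cong refl arg_cong2[of _ _ _ _ "(*)"]) (simp_all add: W_def M_eq)
    then show ?thesis using opt by simp
  qed
  also have "(\<Sum>a<n. \<Sum>b<n. (Bst a b - B a b) * (\<Sum>c<n. (p (g a) (g c) + W A a c) * (p (g b) (g c) + W A b c)))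
    = (\<Sum>c<n. \<Sum>a<n. \<Sum>b<n. (Bst a b - B a b) * ((p (g a) (g c) + W A a c) * (p (g b) (g c) + W A b c)))"
    unfolding sum_distrib_left by (rule sum_swap3)
  also have "\<dots> = (\<Sum>c<n. ?s (\<lambda>a k. (p (g a) (g c) - p k (g c))\<^sup>2 / 2 + 2 * (W A a c * (p (g a) (g c) - p k (g c)))
      + 2 * (W A a c * (Wbar A (g a) c - Wbar A k c)) - Wbar A (g a) c * (Wbar A (g a) c - Wbar A k c))
    - (\<Sum>a<n. \<Sum>b<n. res a b * (W A a c * W A b c)))"
  proof (rule sum.cong[OF refl])
    fix c
    show "(\<Sum>a<n. \<Sum>b<n. (Bst a b - B a b) * ((p (g a) (g c) + W A a c) * (p (g b) (g c) + W A b c))) =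
      ?s (\<lambda>a k. (p (g a) (g c) - p k (g c))\<^sup>2 / 2 + 2 * (W A a c * (p (g a) (g c) - p k (g c)))
      + 2 * (W A a c * (Wbar A (g a) c - Wbar A k c)) - Wbar A (g a) c * (Wbar A (g a) c - Wbar A k c))
      - (\<Sum>a<n. \<Sum>b<n. res a b * (W A a c * W A b c))"
      using column_identity[of "\<lambda>k. p k (g c)" "\<lambda>a. W A a c"] unfolding avg_W .
  qed
  also have "\<dots> = ?s (\<lambda>a k. sep (g a) k / 2 + 2 * lin a k + 2 * quad a k - cross a k) - (\<Sum>a<n. \<Sum>b<n. res a b * (\<Sum>c<n. W A a c * W A b c))"
  proof -
    have 1: "(\<Sum>c<n. ?s (\<lambda>a k. F a k c)) = ?s (\<lambda>a k. \<Sum>c<n. F a k c)" for F :: "nat \<Rightarrow> nat \<Rightarrow> nat \<Rightarrow> real"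
    proof -
      have "(\<Sum>c<n. ?s (\<lambda>a k. F a k c)) = (\<Sum>a<n. \<Sum>c<n. \<Sum>k\<in>{..<K}-{g a}. wt a k * F a k c)" by (rule sum.swap)
      also have "\<dots> = ?s (\<lambda>a k. \<Sum>c<n. F a k c)" by (rule sum.cong[OF refl], subst sum.swap) (simp add: sum_distrib_left)
      finally show ?thesis .
    qed
    have 2: "(\<Sum>c<n. \<Sum>a<n. \<Sum>b<n. res a b * (W A a c * W A b c)) = (\<Sum>a<n. \<Sum>b<n. res a b * (\<Sum>c<n. W A a c * W A b c))"
      unfolding sum_distrib_left by (rule sum_swap3[symmetric])
    have 3: "(\<Sum>c<n. (p (g a) (g c) - p k (g c))\<^sup>2 / 2 + 2 * (W A a c * (p (g a) (g c) - p k (g c)))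
      + 2 * (W A a c * (Wbar A (g a) c - Wbar A k c)) - Wbar A (g a) c * (Wbar A (g a) c - Wbar A k c)) = sep (g a) k / 2 + 2 * lin a k + 2 * quad a k - cross a k" for a k
      by (simp only: sum.distrib sum_subtractf sum_distrib_left[symmetric] sum_divide_distrib[symmetric] sep_def lin_def quad_def cross_def)
    show ?thesis by (subst sum_subtractf) (simp only: 1 2 3)
  qed
  finally have main: "?s (\<lambda>a k. sep (g a) k / 2 + 2 * lin a k + 2 * quad a k - cross a k) \<le> op2 * (off / m) + 2 * \<alpha> * \<Theta>"
    using residual_term by linarith
  have lin_ge: "- sep (g a) k / 16 - lin_excess A a \<le> lin a k" if "k < K" "k \<noteq> g a" for a k
    using lin_excess(2)[OF that, of A] unfolding lin_noise_def lin_def by linarith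
  have cross_le: "cross a k \<le> 2 * \<omega>" if "a < n" "k < K" for a k
  proof -
    have "cross a k \<le> (\<Sum>c<n. 3 / 2 * (Wbar A (g a) c)\<^sup>2 + 1 / 2 * (Wbar A k c)\<^sup>2)"
      unfolding cross_def
    proof (rule sum_mono)
      fix c
      show "Wbar A (g a) c * (Wbar A (g a) c - Wbar A k c) \<le> 3 / 2 * (Wbar A (g a) c)\<^sup>2 + 1 / 2 * (Wbar A k c)\<^sup>2"
        using sum_squares_ge_zero[of "Wbar A (g a) c + Wbar A k c" 0] by (simp add: power2_eq_square algebra_simps)
    qed
    also have "\<dots> = 3 / 2 * (\<Sum>c<n. (Wbar A (g a) c)\<^sup>2) + 1 / 2 * (\<Sum>c<n. (Wbar A k c)\<^sup>2)" by (simp only: sum.distrib sum_distrib_left)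
    also have "\<dots> \<le> 3 / 2 * \<omega> + 1 / 2 * \<omega>"
      unfolding \<omega>_def by (intro add_mono mult_left_mono Wbar_sq g_less that) auto
    finally show ?thesis by simp
  qed
  have quad_ge: "?s quad \<ge> - (D / 16) * off - (op2 * sqrt (2 * real K * real (card Bd) / m) + \<alpha> * \<Theta>)"
  proof -
    have BdN: "Bd \<subseteq> {..<n}" by (auto simp: Bd_def)
    have "?s quad = (\<Sum>a\<in>{..<n}-Bd. \<Sum>k\<in>{..<K}-{g a}. wt a k * quad a k) + (\<Sum>a\<in>Bd. \<Sum>k\<in>{..<K}-{g a}. wt a k * quad a k)"
      by (rule sum.subset_diff[OF BdN]) simp
    moreover have "(\<Sum>a\<in>Bd. \<Sum>k\<in>{..<K}-{g a}. wt a k * quad a k) \<ge> - (op2 * sqrt (2 * real K * real (card Bd) / m) + \<alpha> * \<Theta>)"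
      using bad_rows_term[OF BdN] by linarith
    moreover have "(\<Sum>a\<in>{..<n}-Bd. \<Sum>k\<in>{..<K}-{g a}. wt a k * quad a k) \<ge> - (D / 16) * off"
    proof -
      have "- (D / 16) * off = (\<Sum>a<n. \<Sum>k\<in>{..<K}-{g a}. wt a k * - (D / 16))" unfolding s_const ..
      also have "\<dots> \<le> (\<Sum>a\<in>{..<n}-Bd. \<Sum>k\<in>{..<K}-{g a}. wt a k * - (D / 16))"
      proof -
        have "(\<Sum>a<n. \<Sum>k\<in>{..<K}-{g a}. wt a k * - (D / 16)) = (\<Sum>a\<in>{..<n}-Bd. \<Sum>k\<in>{..<K}-{g a}. wt a k * - (D / 16)) + (\<Sum>a\<in>Bd. \<Sum>k\<in>{..<K}-{g a}. wt a k * - (D / 16))"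
          by (rule sum.subset_diff[OF BdN]) simp
        moreover have "(\<Sum>a\<in>Bd. \<Sum>k\<in>{..<K}-{g a}. wt a k * - (D / 16)) \<le> 0"
        proof (intro sum_nonpos)
          fix a k assume "a \<in> Bd"
          then have "0 \<le> wt a k" using BdN wt_nonneg[of a k] by auto
          then show "wt a k * - (D / 16) \<le> 0" using D0 by (simp add: mult_nonneg_nonneg)
        qed
        ultimately show ?thesis by linarith
      qed
      also have "\<dots> \<le> (\<Sum>a\<in>{..<n}-Bd. \<Sum>k\<in>{..<K}-{g a}. wt a k * quad a k)"
      proof (intro sum_mono mult_left_mono)
        fix a k assume a: "a \<in> {..<n} - Bd" and k: "k \<in> {..<K} - {g a}"
        then show "0 \<le> wt a k" using wt_nonneg by auto
        have nb: "\<bar>\<Sum>c<n. Wbar A j c * W A a c\<bar> \<le> D / 32" if "j < K" for j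
        proof -
          have "\<not> bad A a" using a by (simp add: Bd_def)
          then show ?thesis using that unfolding bad_def by (meson not_less)
        qed
        have "quad a k = (\<Sum>c<n. Wbar A (g a) c * W A a c) - (\<Sum>c<n. Wbar A k c * W A a c)"
          by (simp add: quad_def right_diff_distrib sum_subtractf mult.commute)
        then show "- (D / 16) \<le> quad a k" using nb[of "g a"] nb[of k] g_less[of a] a k by (simp add: abs_le_iff)
      qed
      finally show ?thesis .
    qed
    ultimately show ?thesis by linarith
  qed
  have exc: "?s (\<lambda>a k. lin_excess A a) \<le> (\<Sum>a<n. lin_excess A a)"
  proof (rule sum_mono)
    fix a assume "a \<in> {..<n}"
    then have a: "a < n" by simp
    have "(\<Sum>k\<in>{..<K}-{g a}. wt a k * lin_excess A a) = (1 - wt a (g a)) * lin_excess A a"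
      unfolding one_minus_wt[OF a] by (simp add: sum_distrib_right)
    also have "\<dots> \<le> 1 * lin_excess A a" using wt_nonneg[OF a, of "g a"] lin_excess(1)[of A a] by (intro mult_right_mono) auto
    finally show "(\<Sum>k\<in>{..<K}-{g a}. wt a k * lin_excess A a) \<le> lin_excess A a" by simp
  qed
  have "?s (\<lambda>a k. 3 / 8 * D - 2 * \<omega> - 2 * lin_excess A a + 2 * quad a k) \<le> ?s (\<lambda>a k. sep (g a) k / 2 + 2 * lin a k + 2 * quad a k - cross a k)"
  proof (rule s_mono)
    fix a k assume "a < n" "k < K" "k \<noteq> g a"
    then show "3 / 8 * D - 2 * \<omega> - 2 * lin_excess A a + 2 * quad a k \<le> sep (g a) k / 2 + 2 * lin a k + 2 * quad a k - cross a k"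
      using lin_ge[of k a] cross_le[of a k] sep_ge[of "g a" k] g_less[of a] by auto
  qed
  note low = this
  have split: "?s (\<lambda>a k. 3 / 8 * D - 2 * \<omega> - 2 * lin_excess A a + 2 * quad a k) = (3 / 8 * D - 2 * \<omega>) * off - 2 * ?s (\<lambda>a k. lin_excess A a) + 2 * ?s quad"
    unfolding s_const[symmetric] by (simp only: distrib_left right_diff_distrib sum.distrib sum_subtractf) (simp add: sum_distrib_left mult_ac)
  have "c * x - 2 * e' + 2 * w \<le> z" if "l \<le> y" "l = c * x - 2 * e + 2 * u" "y \<le> z" "e \<le> e'" "w \<le> u" for c x e e' w z l y u :: real
    using that by linarith
  from this[OF low split main exc quad_ge] have fin: "(3 / 8 * D - 2 * \<omega>) * off - 2 * (\<Sum>a<n. lin_excess A a) + 2 * (- (D / 16) * off - (op2 * sqrt (2 * real K * real (card Bd) / m) + \<alpha> * \<Theta>)) \<le> op2 * (off / m) + 2 * \<alpha> * \<Theta>" .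
  have op2m: "op2 / m \<le> D / 40"
  proof -
    have "40 * op_const\<^sup>2 * (real n / m) * L \<le> s2 * L" using big L_pos by (intro mult_right_mono) auto
    then show ?thesis using L_pos m_pos by (simp add: op2_def d_def s2_def field_simps)
  qed
  then have f1: "op2 / m * off \<le> D / 40 * off" using off_nonneg by (intro mult_right_mono) auto
  have f2: "\<alpha> * \<Theta> / m * off \<le> \<alpha> * \<Theta> / m * real n"
    using \<alpha>_pos \<Theta>_nonneg m_pos by (intro mult_left_mono off_le) auto
  have f3: "0 \<le> \<alpha> * \<Theta> / m * real n" using \<alpha>_pos \<Theta>_nonneg m_pos by simp
  have f4: "0 \<le> D * off" using D0 off_nonneg by simp
  \<comment> \<open>Budget for e = D * off: of the signal 1/2 the linear noise takes 1/8, the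
    quadratic noise on rows that are not bad 1/8, and the three operator norm terms 3/40. What
    remains is 7/40, more than 1/8.\<close>
  have "e / 8 \<le> 2 * z + 2 * r + 4 * t + 4 * u"
    if "(3 / 8 * e - 2 * x - 2 * y) - 2 * z + 2 * (- (e / 16) - (r + t)) \<le> x + 2 * t" "x \<le> e / 40" "y \<le> u" "0 \<le> u" "0 \<le> e"
    for e x y z r t u :: real using that by (simp add: field_simps)
  note arith = this
  have "D * off / 8 \<le> 2 * (\<Sum>a<n. lin_excess A a) + 2 * (op2 * sqrt (2 * real K * real (card Bd) / m)) + 4 * (\<alpha> * \<Theta>) + 4 * (\<alpha> * \<Theta> / m * real n)"
  proof (rule arith[where x = "op2 / m * off" and y = "\<alpha> * \<Theta> / m * off"])
    have "(3 / 8 * D - 2 * \<omega>) * off = 3 / 8 * (D * off) - 2 * (op2 / m * off) - 2 * (\<alpha> * \<Theta> / m * off)" by (simp add: \<omega>_def algebra_simps)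
    moreover have "- (D / 16) * off = - (D * off / 16)" "op2 * (off / m) = op2 / m * off" "2 * \<alpha> * \<Theta> = 2 * (\<alpha> * \<Theta>)" by simp_all
    ultimately show "(3 / 8 * (D * off) - 2 * (op2 / m * off) - 2 * (\<alpha> * \<Theta> / m * off)) - 2 * (\<Sum>a<n. lin_excess A a)
       + 2 * (- (D * off / 16) - (op2 * sqrt (2 * real K * real (card Bd) / m) + \<alpha> * \<Theta>)) \<le> op2 / m * off + 2 * (\<alpha> * \<Theta>)"
      using fin by (simp only:)
  qed (use f1 f2 f3 f4 in simp_all)
  then show ?thesis by (simp add: Bd_def algebra_simps)
qed

end

end

section \<open>From the off-block mass to the l1 distance\<close>

context relaxed
begin

text \<open>B - Bst is \<open>res\<close> plus the deviations of Bst B and B Bst from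
  \<open>Bst\<close>, minus that of Bst B Bst. Averaging does not increase l1 norms, so each
  deviation is at most 2 off; positivity bounds the entries of \<open>res\<close> by its diagonal,
  hence its l1 norm by n times its trace.\<close>

lemma l1_distance_le: "(\<Sum>a<n. \<Sum>b<n. \<bar>B a b - Bst a b\<bar>) \<le> 7 * (real n / m) * off"
proof -
  let ?d = "\<lambda>a b. wt a (g b) / size (g b) - Bst a b"
  have d_row: "(\<Sum>b<n. \<bar>?d a b\<bar>) = (\<Sum>k<K. \<bar>wt a k - of_bool (k = g a)\<bar>)" for a
    unfolding sum_by_group
  proof (rule sum.cong[OF refl])
    fix k assume "k \<in> {..<K}"
    then have k: "0 < size k" using size_pos by auto
    have "(\<Sum>b\<in>grp k. \<bar>?d a b\<bar>) = (\<Sum>b\<in>grp k. \<bar>wt a k - of_bool (k = g a)\<bar> / size k)"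
      by (rule sum.cong[OF refl]) (use k in \<open>auto simp: grp_def Bst_def diff_divide_distrib[symmetric] abs_divide\<close>)
    then show "(\<Sum>b\<in>grp k. \<bar>?d a b\<bar>) = \<bar>wt a k - of_bool (k = g a)\<bar>" using k by (simp add: size_def)
  qed
  have d_sum: "(\<Sum>a<n. \<Sum>b<n. \<bar>?d a b\<bar>) \<le> 2 * off"
    unfolding off_def sum_distrib_left[of 2 _ "{..<n}"]
  proof (rule sum_mono)
    fix a assume "a \<in> {..<n}"
    then have a: "a < n" by simp
    have "(\<Sum>k<K. \<bar>wt a k - of_bool (k = g a)\<bar>) = \<bar>wt a (g a) - 1\<bar> + (\<Sum>k\<in>{..<K}-{g a}. \<bar>wt a k - of_bool (k = g a)\<bar>)"
      by (subst sum.remove[of _ "g a"]) (use g_less[OF a] in auto)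
    also have "(\<Sum>k\<in>{..<K}-{g a}. \<bar>wt a k - of_bool (k = g a)\<bar>) = (\<Sum>k\<in>{..<K}-{g a}. wt a k)"
      by (rule sum.cong) (use wt_nonneg[OF a] in auto)
    also have "\<bar>wt a (g a) - 1\<bar> = (\<Sum>k\<in>{..<K}-{g a}. wt a k)"
      using one_minus_wt[OF a] wt_le_1[OF a g_less[OF a]] by simp
    finally show "(\<Sum>b<n. \<bar>?d a b\<bar>) \<le> 2 * (\<Sum>k\<in>{..<K}-{g a}. wt a k)" unfolding d_row by simp
  qed
  have d_sum': "(\<Sum>a<n. \<Sum>b<n. \<bar>wt b (g a) / size (g a) - Bst a b\<bar>) \<le> 2 * off"
  proof -
    have "(\<Sum>a<n. \<Sum>b<n. \<bar>wt b (g a) / size (g a) - Bst a b\<bar>) = (\<Sum>a<n. \<Sum>b<n. \<bar>?d a b\<bar>)"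
      by (subst sum.swap) (auto simp: Bst_def intro!: sum.cong)
    then show ?thesis using d_sum by simp
  qed
  have avg_d: "block_avg (g a) (g b) - Bst a b = (\<Sum>a'\<in>grp (g a). ?d a' b) / size (g a)" if "a < n" "b < n" for a b
  proof -
    have "(\<Sum>a'\<in>grp (g a). Bst a' b) = (\<Sum>a'\<in>grp (g a). Bst a b)" by (rule sum.cong) (auto simp: grp_def Bst_def)
    then have "(\<Sum>a'\<in>grp (g a). Bst a' b) = size (g a) * Bst a b" by (simp add: size_def)
    then show ?thesis using size_pos[OF g_less[OF that(1)]] 
      by (simp add: block_avg_def sum_subtractf diff_divide_distrib sum_divide_distrib[symmetric])
  qed
  have b_sum: "(\<Sum>a<n. \<Sum>b<n. \<bar>block_avg (g a) (g b) - Bst a b\<bar>) \<le> 2 * off"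
  proof -
    have "(\<Sum>a<n. \<Sum>b<n. \<bar>block_avg (g a) (g b) - Bst a b\<bar>) \<le> (\<Sum>a<n. \<Sum>b<n. (\<Sum>a'\<in>grp (g a). \<bar>?d a' b\<bar>) / size (g a))"
    proof (intro sum_mono)
      fix a b assume "a \<in> {..<n}" "b \<in> {..<n}"
      then have ab: "a < n" "b < n" by auto
      show "\<bar>block_avg (g a) (g b) - Bst a b\<bar> \<le> (\<Sum>a'\<in>grp (g a). \<bar>?d a' b\<bar>) / size (g a)"
        unfolding avg_d[OF ab] abs_divide using size_pos[OF g_less[OF ab(1)]] by (simp add: divide_right_mono sum_abs)
    qed
    also have "\<dots> = (\<Sum>a<n. (\<Sum>a'\<in>grp (g a). \<Sum>b<n. \<bar>?d a' b\<bar>) / size (g a))"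
      by (rule sum.cong[OF refl]) (simp add: sum_divide_distrib[symmetric] sum.swap[of _ "grp (g a)" "{..<n}" for a])
    also have "\<dots> = (\<Sum>k<K. \<Sum>a\<in>grp k. (\<Sum>a'\<in>grp k. \<Sum>b<n. \<bar>?d a' b\<bar>) / size k)"
      unfolding sum_by_group[of "\<lambda>a. (\<Sum>a'\<in>grp (g a). \<Sum>b<n. \<bar>?d a' b\<bar>) / size (g a)"] by (intro sum.cong refl) (auto simp: grp_def)
    also have "\<dots> = (\<Sum>k<K. \<Sum>a'\<in>grp k. \<Sum>b<n. \<bar>?d a' b\<bar>)"
      by (rule sum.cong[OF refl]) (use size_pos in \<open>auto simp: size_def\<close>)
    also have "\<dots> = (\<Sum>a<n. \<Sum>b<n. \<bar>?d a b\<bar>)" by (rule sum_by_group[symmetric])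
    finally show ?thesis using d_sum by simp
  qed
  have r_sum: "(\<Sum>a<n. \<Sum>b<n. \<bar>res a b\<bar>) \<le> real n * (off / m)"
  proof -
    have "(\<Sum>a<n. \<Sum>b<n. \<bar>res a b\<bar>) \<le> (\<Sum>a<n. \<Sum>b<n. (res a a + res b b) / 2)"
      by (intro sum_mono psd_on_entry[OF res_psd]) auto
    also have "\<dots> = real n * (\<Sum>a<n. res a a)"
      by (simp add: sum_divide_distrib[symmetric] sum.distrib sum_distrib_left[symmetric])
    also have "\<dots> \<le> real n * (off / m)" by (intro mult_left_mono res_trace) auto
    finally show ?thesis .
  qed
  have "(\<Sum>a<n. \<Sum>b<n. \<bar>B a b - Bst a b\<bar>) \<le> (\<Sum>a<n. \<Sum>b<n. \<bar>res a b\<bar> + \<bar>wt b (g a) / size (g a) - Bst a b\<bar> + \<bar>?d a b\<bar> + \<bar>block_avg (g a) (g b) - Bst a b\<bar>)"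
  proof (intro sum_mono)
    fix a b
    have "B a b - Bst a b = res a b + (wt b (g a) / size (g a) - Bst a b) + ?d a b - (block_avg (g a) (g b) - Bst a b)"
      by (simp add: res_def)
    then show "\<bar>B a b - Bst a b\<bar> \<le> \<bar>res a b\<bar> + \<bar>wt b (g a) / size (g a) - Bst a b\<bar> + \<bar>?d a b\<bar> + \<bar>block_avg (g a) (g b) - Bst a b\<bar>" by linarith
  qed
  also have "\<dots> \<le> real n * (off / m) + 2 * off + 2 * off + 2 * off"
    unfolding sum.distrib by (intro add_mono r_sum d_sum' d_sum b_sum)
  also have "\<dots> = (real n / m + 6) * off" by (simp add: algebra_simps)
  also have "\<dots> \<le> (7 * (real n / m)) * off"
  proof (rule mult_right_mono[OF _ off_nonneg])
    have "1 * m \<le> real K * m" using g_less[OF n_pos] m_pos by (intro mult_right_mono) auto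
    then have "m \<le> real n" using K_m_le by linarith
    then have "1 \<le> real n / m" using m_pos by (simp add: pos_le_divide_eq)
    then show "real n / m + 6 \<le> 7 * (real n / m)" by simp
  qed
  finally show ?thesis .
qed

end

section \<open>From the relaxed solution to the partition\<close>

text \<open>Outside I equal labels h force equal groups g, and every group has a representative
  outside I. Sending a group to the label of its representative is injective on K groups, hence a
  permutation, and it is correct outside I. A node of I occurs in at most two symmetric differences,
  which cancels the 2 in the error.\<close>

lemma misclass_error_le:
  assumes n: "0 < n" and g: "\<And>a. a < n \<Longrightarrow> g a < K" and h: "\<And>a. a < n \<Longrightarrow> h a < K"
    and G: "\<And>k. k < K \<Longrightarrow> G k = {a. a < n \<and> g a = k}" and H: "\<And>k. k < K \<Longrightarrow> H k = {a. a < n \<and> h a = k}"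
    and sep: "\<And>a b. a < n \<Longrightarrow> b < n \<Longrightarrow> a \<notin> I \<Longrightarrow> b \<notin> I \<Longrightarrow> h a = h b \<Longrightarrow> g a = g b"
    and rep: "\<And>k. k < K \<Longrightarrow> \<exists>a<n. a \<notin> I \<and> g a = k" and I: "I \<subseteq> {..<n}"
  shows "misclass_error n K H G \<le> real (card I) / real n"
proof -
  from rep have "\<forall>k\<in>{..<K}. \<exists>a. a < n \<and> a \<notin> I \<and> g a = k" by auto
  from bchoice[OF this] obtain r where r: "\<forall>k\<in>{..<K}. r k < n \<and> r k \<notin> I \<and> g (r k) = k" by blast
  define \<pi> where "\<pi> k = (if k < K then h (r k) else k)" for k
  have inj: "inj_on \<pi> {..<K}"
  proof (rule inj_onI)
    fix j k assume jk: "j \<in> {..<K}" "k \<in> {..<K}" "\<pi> j = \<pi> k"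
    then have "g (r j) = g (r k)" using r by (intro sep) (auto simp: \<pi>_def)
    then show "j = k" using r jk by auto
  qed
  have im: "\<pi> ` {..<K} \<subseteq> {..<K}" using r h by (auto simp: \<pi>_def)
  have bij: "bij_betw \<pi> {..<K} {..<K}"
    using inj im by (metis bij_betw_def card_image card_subset_eq finite_lessThan)
  have perm: "\<pi> permutes {..<K}" by (rule bij_imp_permutes[OF bij]) (simp add: \<pi>_def)
  have good: "h a = \<pi> (g a)" if "a < n" "a \<notin> I" for a
  proof -
    have "h a \<in> \<pi> ` {..<K}" using bij h[OF that(1)] by (auto simp: bij_betw_def)
    then obtain k where k: "k < K" "h a = h (r k)" by (auto simp: \<pi>_def)
    then have "g a = g (r k)" using r that by (intro sep) auto
    then show ?thesis using k r by (auto simp: \<pi>_def)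
  qed
  have fI: "finite I" using I finite_subset by auto
  have cnt: "(\<Sum>k<K. real (card {a\<in>I. f a = k})) \<le> real (card I)" for f
  proof -
    have "(\<Sum>k<K. card {a\<in>I. f a = k}) = card (\<Union>k<K. {a\<in>I. f a = k})"
      by (rule card_UN_disjoint[symmetric]) (use fI in auto)
    also have "\<dots> \<le> card I" by (rule card_mono) (use fI in auto)
    finally have "real (\<Sum>k<K. card {a\<in>I. f a = k}) \<le> real (card I)" by (rule of_nat_mono)
    then show ?thesis by simp
  qed
  have "(\<Sum>k<K. real (card (sym_diff (G k) (H (\<pi> k))))) \<le> (\<Sum>k<K. real (card {a\<in>I. g a = k}) + real (card {a\<in>I. inv_into UNIV \<pi> (h a) = k}))"
  proof (rule sum_mono)
    fix k assume "k \<in> {..<K}"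
    then have k: "k < K" "\<pi> k < K" using im by auto
    have "sym_diff (G k) (H (\<pi> k)) \<subseteq> {a\<in>I. g a = k} \<union> {a\<in>I. inv_into UNIV \<pi> (h a) = k}"
      unfolding G[OF k(1)] H[OF k(2)] using good permutes_inverses(2)[OF perm] inj_eq[OF permutes_inj[OF perm]] by auto
    then have "card (sym_diff (G k) (H (\<pi> k))) \<le> card ({a\<in>I. g a = k} \<union> {a\<in>I. inv_into UNIV \<pi> (h a) = k})"
      by (rule card_mono[rotated]) (use fI in auto)
    also have "\<dots> \<le> card {a\<in>I. g a = k} + card {a\<in>I. inv_into UNIV \<pi> (h a) = k}" by (rule card_Un_le)
    finally show "real (card (sym_diff (G k) (H (\<pi> k)))) \<le> real (card {a\<in>I. g a = k}) + real (card {a\<in>I. inv_into UNIV \<pi> (h a) = k})"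
      by (simp only: of_nat_add[symmetric] of_nat_le_iff)
  qed
  also have "\<dots> \<le> real (card I) + real (card I)" unfolding sum.distrib by (intro add_mono cnt)
  finally have le: "(\<Sum>k<K. real (card (sym_diff (G k) (H (\<pi> k))))) \<le> 2 * real (card I)" by simp
  have "misclass_error n K H G \<le> 1 / (2 * real n) * (\<Sum>k<K. real (card (sym_diff (G k) (H (\<pi> k)))))"
    unfolding misclass_error_def
    by (rule Min_le) (use perm in \<open>auto simp: finite_permutations\<close>)
  also have "\<dots> \<le> 1 / (2 * real n) * (2 * real (card I))" by (rule mult_left_mono[OF le]) simp
  finally show ?thesis by simp
qed

text \<open>The row of S closest to the common row of st, followed by the triangle
  inequality.\<close>

lemma medoid_representative:
  fixes B st :: "nat \<Rightarrow> nat \<Rightarrow> real"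
  assumes S: "finite S" "S \<noteq> {}" and st: "\<And>i j b. i \<in> S \<Longrightarrow> j \<in> S \<Longrightarrow> st i b = st j b"
  shows "\<exists>r\<in>S. (\<Sum>i\<in>S. \<Sum>b<n. \<bar>B r b - B i b\<bar>) \<le> 2 * (\<Sum>i\<in>S. \<Sum>b<n. \<bar>B i b - st i b\<bar>)"
proof -
  define e where "e i = (\<Sum>b<n. \<bar>B i b - st i b\<bar>)" for i
  define r where "r = arg_min_on e S"
  have r: "r \<in> S" "\<And>i. i \<in> S \<Longrightarrow> e r \<le> e i"
    using arg_min_if_finite[OF S, of e] unfolding r_def by (auto simp: not_less)
  have "(\<Sum>i\<in>S. \<Sum>b<n. \<bar>B r b - B i b\<bar>) \<le> (\<Sum>i\<in>S. e r + e i)"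
  proof (rule sum_mono)
    fix i assume i: "i \<in> S"
    have "(\<Sum>b<n. \<bar>B r b - B i b\<bar>) \<le> (\<Sum>b<n. \<bar>B r b - st r b\<bar> + \<bar>B i b - st i b\<bar>)"
      by (rule sum_mono) (use st[OF r(1) i] in \<open>smt (verit)\<close>)
    then show "(\<Sum>b<n. \<bar>B r b - B i b\<bar>) \<le> e r + e i" by (simp add: e_def sum.distrib)
  qed
  also have "\<dots> \<le> (\<Sum>i\<in>S. 2 * e i)" by (rule sum_mono) (use r in auto)
  also have "\<dots> = 2 * (\<Sum>i\<in>S. e i)" by (simp add: sum_distrib_left)
  finally show ?thesis using r(1) unfolding e_def by blast
qed

section \<open>Bound for the off-block mass on the good event\<close>

context relaxed
begin

lemma off_bound:
  assumes A: "A \<subseteq> pairs n" and light: "light_bounded A" and disc: "discrepancy_bounded A" and reg: "degree_regular A"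
    and nbig: "ln (real n) + 6 \<le> real n"
    and opt: "(\<Sum>a<n. \<Sum>b<n. (Bst a b - B a b) * (\<Sum>c<n. adj A a c * adj A b c)) \<le> 0"
    and lin: "(\<Sum>a<n. lin_excess A a) \<le> D * real n * exp (- (rate / 8 * s2))"
    and bad: "real (card {b\<in>{..<n}. bad A b}) \<le> real n * exp (- (rate / 8 * s2))"
    and big: "40 * op_const\<^sup>2 * (real n / m) \<le> s2" "real n / m \<le> s2" "2 * 10 ^ 8 \<le> s2" "s2 \<le> d"
    and \<alpha>_le: "\<alpha> \<le> real K ^ 3 / real n * exp (4 * d)"
  shows "off \<le> 8 * (3 + 4 * op_const\<^sup>2) * real n * exp (- (rate / 16 * s2))"
proof -
  define \<epsilon> where "\<epsilon> = exp (- (rate / 16 * s2))"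
  have \<epsilon>2: "exp (- (rate / 8 * s2)) = \<epsilon>\<^sup>2" by (simp add: \<epsilon>_def exp_double[symmetric])
  have \<epsilon>: "0 < \<epsilon>" "\<epsilon> \<le> 1" using big(3) by (auto simp: \<epsilon>_def rate_def)
  have \<epsilon>sq: "\<epsilon>\<^sup>2 \<le> \<epsilon>" using \<epsilon> by (simp add: power2_eq_square)
  have s0: "0 < s2" and d1: "1 \<le> d" using big by auto
  have Ds: "s2 * L = D" using L_pos by (simp add: s2_def)
  have n0: "0 < real n" using n_pos by simp
  have D0: "0 < s2 * L" using s0 L_pos by simp
  have m1: "1 \<le> real n / m"
  proof -
    have "1 * m \<le> real K * m" using g_less[OF n_pos] m_pos by (intro mult_right_mono) auto
    then have "m \<le> real n" using K_m_le by linarith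
    then show ?thesis using m_pos by (simp add: pos_le_divide_eq)
  qed
  have Knm: "real K \<le> real n / m" using K_m_le m_pos by (simp add: pos_le_divide_eq)
  have T1: "(\<Sum>a<n. lin_excess A a) \<le> s2 * L * real n * \<epsilon>"
  proof -
    have "D * real n * \<epsilon>\<^sup>2 \<le> D * real n * \<epsilon>" using D0 n0 unfolding Ds by (intro mult_left_mono[OF \<epsilon>sq]) simp
    then show ?thesis using lin unfolding \<epsilon>2 Ds by linarith
  qed
  \<comment> \<open>From K \<le> n / m \<le> s2 and at most n \<epsilon>^2 bad rows. The square root
    turns \<epsilon>^2 into \<epsilon>, which is where half of the rate is lost.\<close>
  have T2: "op_const\<^sup>2 * d * sqrt (2 * real K * real (card {b\<in>{..<n}. bad A b}) / m) \<le> op_const\<^sup>2 * d * (2 * s2 * \<epsilon>)"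
  proof (intro mult_left_mono real_le_lsqrt)
    have "real K * (real (card {b\<in>{..<n}. bad A b}) / m) \<le> s2 * (real n * \<epsilon>\<^sup>2 / m)"
      using Knm big(2) bad m_pos s0 unfolding \<epsilon>2 by (intro mult_mono divide_right_mono) auto
    also have "\<dots> = s2 * (real n / m) * \<epsilon>\<^sup>2" by simp
    also have "\<dots> \<le> s2 * s2 * \<epsilon>\<^sup>2" using big(2) s0 by (intro mult_right_mono mult_left_mono) auto
    finally have h: "real K * (real (card {b\<in>{..<n}. bad A b}) / m) \<le> (s2 * \<epsilon>)\<^sup>2" by (simp add: power2_eq_square mult_ac)
    have "2 * real K * real (card {b\<in>{..<n}. bad A b}) / m = 2 * (real K * (real (card {b\<in>{..<n}. bad A b}) / m))" by simp
    also have "\<dots> \<le> 4 * (s2 * \<epsilon>)\<^sup>2" using h zero_le_power2[of "s2 * \<epsilon>"] by linarith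
    also have "\<dots> = (2 * s2 * \<epsilon>)\<^sup>2" by (simp add: power_mult_distrib)
    finally show "2 * real K * real (card {b\<in>{..<n}. bad A b}) / m \<le> (2 * s2 * \<epsilon>)\<^sup>2" .
  qed (use s0 \<epsilon> d1 in auto)
  \<comment> \<open>The upper bound on \<alpha> enters here: K \<le> d gives \<alpha> \<le> (d^3 /
    n) exp (4 d), against exp (- 7 d) in the truncation error. Of the surplus exp (- 3 d), exp (- d)
    is at most \<epsilon> because s2 \<le> d, and exp (- 2 d) absorbs the powers of d.\<close>
  have T3: "4 * \<alpha> * truncation_error A * (1 + real n / m) \<le> s2 * L * real n * \<epsilon>"
  proof -
    have "real K ^ 3 \<le> d ^ 3" using Knm big by (intro power_mono) auto
    then have a: "\<alpha> \<le> d ^ 3 / real n * exp (4 * d)"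
      using \<alpha>_le n0 by (elim order_trans) (intro mult_right_mono divide_right_mono, auto)
    have b: "1 + real n / m \<le> 2 * d" using big(2,4) m1 by linarith
    have "4 * \<alpha> * truncation_error A * (1 + real n / m) \<le> 4 * (d ^ 3 / real n * exp (4 * d)) * (1000000 * real n * exp (- 7 * d)) * (2 * d)"
      using a b truncation_error_le[OF reg] \<alpha>_pos \<Theta>_nonneg[OF A light disc d1 nbig] d1 m_pos by (intro mult_mono mult_nonneg_nonneg add_nonneg_nonneg) auto
    also have "\<dots> = 8000000 * d ^ 4 * (exp (4 * d) * exp (- 7 * d))" using n0 by (simp add: power4_eq_xxxx power3_eq_cube)
    also have "\<dots> = 8000000 * d ^ 4 * (exp (- d) * exp (- 2 * d))" unfolding exp_add[symmetric] by simp
    also have "\<dots> \<le> 8000000 * d ^ 4 * (exp (- d) * (1 / (8000000 * d ^ 3)))"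
    proof (intro mult_left_mono)
      have "(d / 2) ^ 4 \<le> exp (d / 2) ^ 4" using exp_ge_add_one_self[of "d / 2"] d1 by (intro power_mono) (linarith, simp)
      also have "\<dots> = exp (2 * d)" by (simp add: exp_of_nat_mult[symmetric])
      finally have "d ^ 4 / 16 \<le> exp (2 * d)" by (simp add: power_divide)
      moreover have "8000000 * d ^ 3 \<le> d ^ 4 / 16"
      proof -
        have "d ^ 3 * 128000000 \<le> d ^ 3 * d" using big d1 by (intro mult_left_mono) auto
        then show ?thesis by (simp add: power4_eq_xxxx power3_eq_cube)
      qed
      ultimately have "8000000 * d ^ 3 \<le> exp (2 * d)" by linarith
      then have "inverse (exp (2 * d)) \<le> inverse (8000000 * d ^ 3)" using d1 by (intro le_imp_inverse_le) auto
      then show "exp (- 2 * d) \<le> 1 / (8000000 * d ^ 3)" by (simp add: exp_minus inverse_eq_divide)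
    qed (use d1 in auto)
    also have "\<dots> = d * exp (- d)" using d1 by (simp add: power4_eq_xxxx power3_eq_cube)
    also have "\<dots> \<le> (s2 * d) * \<epsilon>"
    proof (rule mult_mono)
      show "d \<le> s2 * d" using big(3) d1 by simp
      have "rate / 16 * s2 \<le> 1 * s2" using s0 by (intro mult_right_mono) (auto simp: rate_def)
      then show "exp (- d) \<le> \<epsilon>" using big(4) by (simp add: \<epsilon>_def)
    qed (use s0 d1 in auto)
    finally show ?thesis by (simp add: d_def mult_ac)
  qed
  have "D * off / 8 \<le> 2 * (\<Sum>a<n. lin_excess A a) + 2 * (op_const\<^sup>2 * d * sqrt (2 * real K * real (card {b\<in>{..<n}. bad A b}) / m)) + 4 * \<alpha> * truncation_error A * (1 + real n / m)"
    using main_inequality[OF A light disc d1 nbig opt big(1)] unfolding op2_def[OF A light disc d1 nbig] .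
  also have "\<dots> \<le> 2 * (s2 * L * real n * \<epsilon>) + 2 * (op_const\<^sup>2 * d * (2 * s2 * \<epsilon>)) + s2 * L * real n * \<epsilon>"
    using T1 T2 T3 by linarith
  also have "\<dots> = (s2 * L) * ((3 + 4 * op_const\<^sup>2) * real n * \<epsilon>)" by (simp add: d_def algebra_simps)
  finally have "(s2 * L) * (off / 8) \<le> (s2 * L) * ((3 + 4 * op_const\<^sup>2) * real n * \<epsilon>)" by (simp add: Ds)
  then have "off / 8 \<le> (3 + 4 * op_const\<^sup>2) * real n * \<epsilon>" using D0 by (simp only: mult_le_cancel_left_pos)
  then show ?thesis by (simp add: \<epsilon>_def algebra_simps)
qed

end

section \<open>The law of the adjacency matrix\<close>

definition edges :: "nat \<Rightarrow> real mat \<Rightarrow> (nat \<times> nat) set" where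
  "edges n X = {(a, b) \<in> pairs n. X $$ (a, b) = 1}"

text \<open>For independent entries with values 0 and 1 the law of the edge set is given by the
  weights of \<open>bern\<close>, which links the finite sums to the model. The target event is only
  required to contain the good one.\<close>

lemma prob_ge_bprob:
  fixes Q :: "real mat pmf" and M :: "nat \<Rightarrow> nat \<Rightarrow> real"
  assumes ind: "prob_space.indep_vars (measure_pmf Q) (\<lambda>_. borel) (\<lambda>(a, b) X. X $$ (a, b)) {(a, b). b < a \<and> a < n}"
    and val: "\<And>X a b. X \<in> set_pmf Q \<Longrightarrow> a < n \<Longrightarrow> b < n \<Longrightarrow> X $$ (a, b) \<in> {0, 1}"
    and mean: "\<And>a b. (a, b) \<in> pairs n \<Longrightarrow> measure_pmf.expectation Q (\<lambda>X. X $$ (a, b)) = M a b"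
    and good: "\<And>X. X \<in> set_pmf Q \<Longrightarrow> \<not> bad (edges n X) \<Longrightarrow> \<Phi> X"
  shows "1 - bprob (pairs n) (case_prod M) bad \<le> measure_pmf.prob Q {X. \<Phi> X}"
proof -
  define e where "e = (\<lambda>(a, b) (X :: real mat). X $$ (a, b))"
  have eval: "e j X \<in> {0, 1}" if "X \<in> set_pmf Q" "j \<in> pairs n" for j X
    using val[OF that(1), of "fst j" "snd j"] that(2) by (auto simp: e_def pairs_def)
  have p1: "measure_pmf.prob Q {X. e j X = 1} = case_prod M j" if j: "j \<in> pairs n" for j
  proof -
    have "case_prod M j = measure_pmf.expectation Q (e j)" using mean j by (cases j) (auto simp: e_def)
    also have "\<dots> = measure_pmf.expectation Q (indicator {X. e j X = 1})"
    proof (rule integral_cong_AE)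
      show "AE X in measure_pmf Q. e j X = indicator {X. e j X = 1} X"
        unfolding AE_measure_pmf_iff
      proof
        fix X assume "X \<in> set_pmf Q"
        then have "e j X \<in> {0, 1}" by (rule eval[OF _ j])
        then show "e j X = indicator {X. e j X = 1} X" by (auto simp: indicator_def)
      qed
    qed auto
    finally show ?thesis by simp
  qed
  have p0: "measure_pmf.prob Q {X. e j X = 0} = 1 - case_prod M j" if j: "j \<in> pairs n" for j
  proof -
    have "measure_pmf.prob Q {X. e j X = 0} = measure_pmf.prob Q (UNIV - {X. e j X = 1})"
      by (rule measure_pmf.finite_measure_eq_AE) (use eval[OF _ j] in \<open>fastforce simp: AE_measure_pmf_iff\<close>)+
    also have "\<dots> = 1 - measure_pmf.prob Q {X. e j X = 1}" using measure_pmf.prob_compl[of "{X. e j X = 1}" Q] by simp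
    finally show ?thesis using p1[OF j] by simp
  qed
  have law: "measure_pmf.prob Q {X. edges n X = A} = (\<Prod>j\<in>A. case_prod M j) * (\<Prod>j\<in>pairs n - A. 1 - case_prod M j)" if A: "A \<subseteq> pairs n" for A
  proof (cases "pairs n = {}")
    case True
    then show ?thesis using A by (simp add: edges_def)
  next
    case False
    define S where "S j = (if j \<in> A then {1} else {0 :: real})" for j :: "nat \<times> nat"
    have edges_iff: "edges n X = A \<longleftrightarrow> (\<forall>j\<in>pairs n. e j X \<in> S j)" if X: "X \<in> set_pmf Q" for X
    proof -
      have "edges n X = {j\<in>pairs n. e j X = 1}" by (auto simp: edges_def e_def)
      then have "edges n X = A \<longleftrightarrow> (\<forall>j\<in>pairs n. e j X = 1 \<longleftrightarrow> j \<in> A)" using A by blast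
      also have "\<dots> \<longleftrightarrow> (\<forall>j\<in>pairs n. e j X \<in> S j)"
      proof (rule ball_cong[OF refl])
        fix j assume "j \<in> pairs n"
        from eval[OF X this] show "(e j X = 1 \<longleftrightarrow> j \<in> A) \<longleftrightarrow> e j X \<in> S j" unfolding S_def by (cases "j \<in> A") auto
      qed
      finally show ?thesis .
    qed
    have "measure_pmf.prob Q {X. edges n X = A} = measure_pmf.prob Q (\<Inter>j\<in>pairs n. e j -` S j \<inter> space (measure_pmf Q))"
      by (rule measure_pmf.finite_measure_eq_AE) (use edges_iff False in \<open>auto simp: AE_measure_pmf_iff\<close>)
    also have "\<dots> = (\<Prod>j\<in>pairs n. measure_pmf.prob Q (e j -` S j \<inter> space (measure_pmf Q)))"
    proof (rule prob_space.indep_varsD_finite[OF measure_pmf.prob_space_axioms])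
      show "prob_space.indep_vars (measure_pmf Q) (\<lambda>_. borel) e (pairs n)" unfolding e_def pairs_def by (rule ind)
    qed (use False in \<open>auto simp: S_def\<close>)
    also have "\<dots> = (\<Prod>j\<in>pairs n. if j \<in> A then case_prod M j else 1 - case_prod M j)"
      using p0 p1 by (intro prod.cong refl) (auto simp: S_def vimage_def)
    also have "\<dots> = (\<Prod>j\<in>A. case_prod M j) * (\<Prod>j\<in>pairs n - A. 1 - case_prod M j)"
      using A by (simp add: prod.If_cases Int_absorb1 Diff_eq)
    finally show ?thesis .
  qed
  define Q' where "Q' = map_pmf (edges n) Q"
  have "measure_pmf.prob Q {X. bad (edges n X)} = measure_pmf.prob Q' {A \<in> Pow (pairs n). bad A}"
    by (simp add: Q'_def vimage_def) (rule arg_cong[where f = "measure_pmf.prob Q"], auto simp: edges_def)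
  also have "\<dots> = (\<Sum>A\<in>{A \<in> Pow (pairs n). bad A}. pmf Q' A)"
    by (rule measure_measure_pmf_finite) auto
  also have "\<dots> = (\<Sum>A\<in>{A \<in> Pow (pairs n). bad A}. (\<Prod>j\<in>A. case_prod M j) * (\<Prod>j\<in>pairs n - A. 1 - case_prod M j))"
    by (rule sum.cong) (auto simp: Q'_def pmf_map vimage_def law)
  also have "\<dots> = bprob (pairs n) (case_prod M) bad"
    unfolding bprob_def bern_def by (simp only: sum.inter_filter finite_Pow_iff finite_pairs) (rule sum.cong[OF refl], simp)
  finally have 1: "measure_pmf.prob Q {X. bad (edges n X)} = bprob (pairs n) (case_prod M) bad" .
  have "1 - measure_pmf.prob Q {X. bad (edges n X)} = measure_pmf.prob Q (UNIV - {X. bad (edges n X)})"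
    using measure_pmf.prob_compl[of "{X. bad (edges n X)}" Q] by simp
  also have "\<dots> \<le> measure_pmf.prob Q {X. \<Phi> X}"
    by (rule measure_pmf.finite_measure_mono_AE) (use good in \<open>auto simp: AE_measure_pmf_iff\<close>)
  finally show ?thesis using 1 by simp
qed

lemma adj_edges:
  assumes sym: "transpose_mat X = X" and X: "X \<in> carrier_mat n n" and diag: "\<And>a. a < n \<Longrightarrow> X $$ (a, a) = 0"
    and val: "\<And>a b. a < n \<Longrightarrow> b < n \<Longrightarrow> X $$ (a, b) \<in> {0, 1}" and ab: "a < n" "b < n"
  shows "adj (edges n X) a b = X $$ (a, b)"
proof -
  have s: "X $$ (a, b) = X $$ (b, a)" using arg_cong[OF sym, of "\<lambda>Y. Y $$ (a, b)"] X ab by simp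
  consider "a < b" | "a = b" | "b < a" by linarith
  then show ?thesis using val[OF ab] val[OF ab(2,1)] s diag[OF ab(1)] ab
    by cases (auto simp: adj_def edges_def pairs_def)
qed

section \<open>Kernels as matrices, and medoids on the rows of a feasible point\<close>

lemma mult_mat_vec_nth:
  assumes "A \<in> carrier_mat n n" "v \<in> carrier_vec n" "i < n"
  shows "(A *\<^sub>v v) $ i = (\<Sum>j<n. A $$ (i, j) * v $ j)"
  using assms by (auto simp: scalar_prod_def lessThan_atLeast0 intro!: sum.cong)

lemma quadratic_form_eq:
  fixes A :: "real mat"
  assumes A: "A \<in> carrier_mat n n" and v: "v \<in> carrier_vec n"
  shows "v \<bullet> (A *\<^sub>v v) = (\<Sum>i<n. \<Sum>j<n. v $ i * v $ j * A $$ (i, j))"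
proof -
  have "v \<bullet> (A *\<^sub>v v) = (\<Sum>i<n. v $ i * (A *\<^sub>v v) $ i)" using A by (simp add: scalar_prod_def lessThan_atLeast0)
  also have "\<dots> = (\<Sum>i<n. \<Sum>j<n. v $ i * v $ j * A $$ (i, j))"
    by (rule sum.cong[OF refl]) (simp add: mult_mat_vec_nth[OF A v] sum_distrib_left mult_ac)
  finally show ?thesis .
qed

context relaxed
begin

lemma Bst_sym: "Bst a b = Bst b a" by (simp add: Bst_def)

lemma sum_mult_Bst:
  assumes a: "a < n"
  shows "(\<Sum>b<n. f b * Bst a b) = (\<Sum>b\<in>grp (g a). f b) / size (g a)"
proof -
  have "(\<Sum>b<n. f b * Bst a b) = (\<Sum>b\<in>grp (g a). f b * (1 / size (g a)))"
    by (rule sum.mono_neutral_cong_right) (auto simp: grp_def Bst_def)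
  then show ?thesis by (simp add: sum_divide_distrib)
qed

lemma Bst_psd: "psd_on {..<n} Bst"
proof (rule psd_onI)
  fix x :: "nat \<Rightarrow> real"
  have "(\<Sum>i<n. \<Sum>j<n. x i * x j * Bst i j) = (\<Sum>i<n. x i * ((\<Sum>j\<in>grp (g i). x j) / size (g i)))"
    by (rule sum.cong[OF refl]) (simp add: sum_mult_Bst[symmetric] sum_distrib_left mult.assoc)
  also have "\<dots> = (\<Sum>k<K. \<Sum>i\<in>grp k. x i * ((\<Sum>j\<in>grp k. x j) / size k))"
    unfolding sum_by_group by (intro sum.cong refl) (auto simp: grp_def)
  also have "\<dots> = (\<Sum>k<K. (\<Sum>j\<in>grp k. x j)\<^sup>2 / size k)"
    by (rule sum.cong[OF refl]) (simp add: power2_eq_square sum_divide_distrib[symmetric] sum_distrib_right[symmetric])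
  also have "\<dots> \<ge> 0" by (intro sum_nonneg divide_nonneg_nonneg) (auto simp: size_def)
  finally show "0 \<le> (\<Sum>i<n. \<Sum>j<n. x i * x j * Bst i j)" .
qed (rule Bst_sym)

lemma Bst_bounds: assumes "a < n" shows "0 \<le> Bst a b" "Bst a b \<le> \<alpha>"
proof -
  have "1 / size (g a) \<le> 1 / m" using size_ge[OF g_less[OF assms]] m_pos by (intro divide_left_mono) auto
  then have "1 / size (g a) \<le> \<alpha>" using \<alpha>_ge by linarith
  moreover have "0 < \<alpha>" using \<alpha>_ge m_pos by (elim order_less_le_trans[rotated]) simp
  ultimately show "0 \<le> Bst a b" "Bst a b \<le> \<alpha>" by (auto simp: Bst_def size_def)
qed

lemma Bst_row: assumes "a < n" shows "(\<Sum>b<n. Bst a b) = 1"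
  using sum_mult_Bst[OF assms, of "\<lambda>_. 1"] size_pos[OF g_less[OF assms]] by (simp add: size_def)

lemma Bst_rows_apart:
  assumes ab: "a < n" "b < n" "g a \<noteq> g b"
  shows "(\<Sum>j<n. \<bar>Bst a j - Bst b j\<bar>) = 2"
proof -
  have "(\<Sum>j<n. \<bar>Bst a j - Bst b j\<bar>) = (\<Sum>j<n. Bst a j + Bst b j)"
    by (rule sum.cong[OF refl]) (use ab in \<open>auto simp: Bst_def size_def\<close>)
  then show ?thesis using Bst_row ab by (simp add: sum.distrib)
qed

text \<open>Competitor for the medoid problem: one row of B per true group, at a cost of at most
  twice the distance of B to \<open>Bst\<close>.\<close>

lemma group_medoids:
  "\<exists>r. (\<forall>k<K. r k < n \<and> g (r k) = k) \<and>
     (\<Sum>a<n. \<Sum>b<n. \<bar>B (r (g a)) b - B a b\<bar>) \<le> 2 * (\<Sum>a<n. \<Sum>b<n. \<bar>B a b - Bst a b\<bar>)"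
proof -
  have "\<forall>k\<in>{..<K}. \<exists>r. r \<in> grp k \<and> (\<Sum>i\<in>grp k. \<Sum>b<n. \<bar>B r b - B i b\<bar>) \<le> 2 * (\<Sum>i\<in>grp k. \<Sum>b<n. \<bar>B i b - Bst i b\<bar>)"
  proof
    fix k assume "k \<in> {..<K}"
    then have "0 < size k" by (intro size_pos) simp
    then have "finite (grp k)" "grp k \<noteq> {}" by (auto simp: size_def card_gt_0_iff)
    then have "\<exists>r\<in>grp k. (\<Sum>i\<in>grp k. \<Sum>b<n. \<bar>B r b - B i b\<bar>) \<le> 2 * (\<Sum>i\<in>grp k. \<Sum>b<n. \<bar>B i b - Bst i b\<bar>)"
      by (rule medoid_representative) (simp add: grp_def Bst_def)
    then show "\<exists>r. r \<in> grp k \<and> (\<Sum>i\<in>grp k. \<Sum>b<n. \<bar>B r b - B i b\<bar>) \<le> 2 * (\<Sum>i\<in>grp k. \<Sum>b<n. \<bar>B i b - Bst i b\<bar>)"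
      unfolding Bex_def .
  qed
  from bchoice[OF this] obtain r where
    r: "\<forall>k\<in>{..<K}. r k \<in> grp k \<and> (\<Sum>i\<in>grp k. \<Sum>b<n. \<bar>B (r k) b - B i b\<bar>) \<le> 2 * (\<Sum>i\<in>grp k. \<Sum>b<n. \<bar>B i b - Bst i b\<bar>)" ..
  have "(\<Sum>a<n. \<Sum>b<n. \<bar>B (r (g a)) b - B a b\<bar>) = (\<Sum>k<K. \<Sum>a\<in>grp k. \<Sum>b<n. \<bar>B (r k) b - B a b\<bar>)"
    unfolding sum_by_group[of "\<lambda>a. \<Sum>b<n. \<bar>B (r (g a)) b - B a b\<bar>"] by (intro sum.cong refl) (auto simp: grp_def)
  also have "\<dots> \<le> (\<Sum>k<K. 2 * (\<Sum>i\<in>grp k. \<Sum>b<n. \<bar>B i b - Bst i b\<bar>))" using r by (intro sum_mono) auto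
  also have "\<dots> = 2 * (\<Sum>a<n. \<Sum>b<n. \<bar>B a b - Bst a b\<bar>)"
    unfolding sum_by_group[of "\<lambda>a. \<Sum>b<n. \<bar>B a b - Bst a b\<bar>"] by (simp add: sum_distrib_left)
  finally show ?thesis using r by (intro exI[of _ r]) (auto simp: grp_def)
qed

text \<open>A row is lost if its medoid has l1 distance at least 1 from its row of
  \<open>Bst\<close>; two rows that share a medoid and are not lost have rows of \<open>Bst\<close>
  at distance below 2, so they lie in one group. The constants are 14 = 7 * 2, 15 = 14 + 1 and 105 =
  15 * 7.\<close>

lemma medoids_misclass_error_le:
  assumes h: "\<And>a. a < n \<Longrightarrow> h a < K"
    and cost: "(\<Sum>a<n. \<Sum>b<n. \<bar>\<mu> (h a) b - B a b\<bar>) \<le> 14 * (\<Sum>a<n. \<Sum>b<n. \<bar>B a b - Bst a b\<bar>)"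
    and G: "\<And>k. k < K \<Longrightarrow> G k = {a. a < n \<and> g a = k}" and H: "\<And>k. k < K \<Longrightarrow> H k = {a. a < n \<and> h a = k}"
    and small: "105 * (real n / m) * off \<le> real n * \<epsilon>" "real n * \<epsilon> < m"
  shows "misclass_error n K H G \<le> \<epsilon>"
proof -
  define I where "I = {a\<in>{..<n}. 1 \<le> (\<Sum>b<n. \<bar>\<mu> (h a) b - Bst a b\<bar>)}"
  have "real (card I) = (\<Sum>a\<in>I. 1)" by simp
  also have "\<dots> \<le> (\<Sum>a\<in>I. \<Sum>b<n. \<bar>\<mu> (h a) b - Bst a b\<bar>)" by (rule sum_mono) (auto simp: I_def)
  also have "\<dots> \<le> (\<Sum>a<n. \<Sum>b<n. \<bar>\<mu> (h a) b - Bst a b\<bar>)" by (rule sum_mono2) (auto simp: I_def intro: sum_nonneg)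
  also have "\<dots> \<le> (\<Sum>a<n. \<Sum>b<n. \<bar>\<mu> (h a) b - B a b\<bar> + \<bar>B a b - Bst a b\<bar>)" by (intro sum_mono) auto
  also have "\<dots> \<le> 15 * (\<Sum>a<n. \<Sum>b<n. \<bar>B a b - Bst a b\<bar>)" using cost by (simp add: sum.distrib)
  also have "\<dots> \<le> 15 * (7 * (real n / m) * off)" by (rule mult_left_mono[OF l1_distance_le]) simp
  finally have cI: "real (card I) \<le> real n * \<epsilon>" using small(1) by simp
  have "misclass_error n K H G \<le> real (card I) / real n"
  proof (rule misclass_error_le[OF n_pos g_less h G H])
    show "I \<subseteq> {..<n}" by (auto simp: I_def)
  next
    fix a b assume ab: "a < n" "b < n" "a \<notin> I" "b \<notin> I" "h a = h b"
    show "g a = g b"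
    proof (rule ccontr)
      assume "g a \<noteq> g b"
      from Bst_rows_apart[OF ab(1,2) this] have "2 = (\<Sum>j<n. \<bar>Bst a j - Bst b j\<bar>)" ..
      also have "\<dots> \<le> (\<Sum>j<n. \<bar>\<mu> (h a) j - Bst a j\<bar> + \<bar>\<mu> (h b) j - Bst b j\<bar>)" by (rule sum_mono) (simp add: ab(5))
      also have "\<dots> < 2" using ab(1-4) by (simp add: sum.distrib I_def)
      finally show False by simp
    qed
  next
    fix k assume k: "k < K"
    \<comment> \<open>The set I has at most n \<epsilon> < m elements and cannot contain a whole
      group.\<close>
    show "\<exists>a<n. a \<notin> I \<and> g a = k"
    proof (rule ccontr)
      assume "\<not> (\<exists>a<n. a \<notin> I \<and> g a = k)"
      then have "{a. a < n \<and> g a = k} \<subseteq> I" by auto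
      then have "card {a. a < n \<and> g a = k} \<le> card I" by (intro card_mono) (auto simp: I_def)
      then show False using m_le[OF k] cI small(2) by linarith
    qed
  qed
  also have "\<dots> \<le> \<epsilon>" using cI n_pos by (simp add: divide_le_eq mult.commute)
  finally show ?thesis .
qed

lemma Bst_in_C_set: "mat n n (case_prod Bst) \<in> C_set n K \<alpha>"
proof -
  have "pos_semidef n (mat n n (case_prod Bst))"
    unfolding pos_semidef_def
  proof
    fix v :: "real vec" assume v: "v \<in> carrier_vec n"
    have "v \<bullet> (mat n n (case_prod Bst) *\<^sub>v v) = (\<Sum>i<n. \<Sum>j<n. v $ i * v $ j * Bst i j)"
      by (subst quadratic_form_eq[OF _ v]) auto
    also have "0 \<le> \<dots>" using Bst_psd unfolding psd_on_def by blast
    finally show "0 \<le> v \<bullet> (mat n n (case_prod Bst) *\<^sub>v v)" by simp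
  qed
  moreover have "mat n n (case_prod Bst) *\<^sub>v ones_vec n = ones_vec n"
    using Bst_row by (intro eq_vecI) (simp_all add: ones_vec_def mult_mat_vec_nth[of _ n] del: index_mult_mat_vec)
  moreover have "(\<Sum>a<n. Bst a a) = real K" using sum_inv_size by (simp add: Bst_def)
  ultimately show ?thesis
    unfolding C_set_def using Bst_bounds by (auto intro!: eq_matI simp: Bst_sym)
qed

end

lemma C_set_psd_on: 
  assumes B: "B \<in> C_set n K \<alpha>"
  shows "psd_on {..<n} (\<lambda>a b. B $$ (a, b))"
proof (rule psd_onI)
  fix i j assume "i \<in> {..<n}" "j \<in> {..<n}"
  then have "transpose_mat B $$ (i, j) = B $$ (j, i)" using B by (intro index_transpose_mat(1)) (auto simp: C_set_def)
  moreover have "transpose_mat B = B" using B by (simp add: C_set_def)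
  ultimately show "B $$ (i, j) = B $$ (j, i)" by (simp only:)
next
  fix x :: "nat \<Rightarrow> real"
  have Bc: "B \<in> carrier_mat n n" and p: "0 \<le> vec n x \<bullet> (B *\<^sub>v vec n x)" using B by (auto simp: C_set_def pos_semidef_def)
  have "vec n x \<bullet> (B *\<^sub>v vec n x) = (\<Sum>i<n. \<Sum>j<n. x i * x j * B $$ (i, j))"
    by (subst quadratic_form_eq[OF Bc]) auto
  then show "0 \<le> (\<Sum>i<n. \<Sum>j<n. x i * x j * B $$ (i, j))" using p by simp
qed

lemma C_set_row_sum:
  assumes B: "B \<in> C_set n K \<alpha>" and a: "a < n"
  shows "(\<Sum>b<n. B $$ (a, b)) = 1"
proof -
  have Bc: "B \<in> carrier_mat n n" and e: "B *\<^sub>v ones_vec n = ones_vec n" using B by (auto simp: C_set_def)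
  from arg_cong[OF e, of "\<lambda>v. v $ a"] show ?thesis
    using Bc a by (simp add: ones_vec_def mult_mat_vec_nth[of _ n] del: index_mult_mat_vec)
qed

lemma mat_inner_gram:
  assumes X: "X \<in> carrier_mat n n"
  shows "mat_inner n (X * transpose_mat X) B = (\<Sum>a<n. \<Sum>b<n. B $$ (a, b) * (\<Sum>c<n. X $$ (a, c) * X $$ (b, c)))"
  unfolding mat_inner_def
  using X by (intro sum.cong refl) (auto simp: scalar_prod_def lessThan_atLeast0 mult.commute intro!: sum.cong)

lemma partition_labels:
  assumes "is_partition n K G"
  obtains g where "\<And>a. a < n \<Longrightarrow> g a < K" "\<And>k. k < K \<Longrightarrow> G k = {a. a < n \<and> g a = k}"
proof -
  have un: "(\<Union>k<K. G k) = {..<n}" and dis: "disjoint_family_on G {..<K}" using assms by (auto simp: is_partition_def)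
  have "\<forall>a\<in>{..<n}. \<exists>k. k < K \<and> a \<in> G k" using un by blast
  from bchoice[OF this] obtain g where g: "\<forall>a\<in>{..<n}. g a < K \<and> a \<in> G (g a)" ..
  show ?thesis
  proof
    show "\<And>a. a < n \<Longrightarrow> g a < K" using g by auto
    fix k assume k: "k < K"
    show "G k = {a. a < n \<and> g a = k}"
    proof (intro equalityI subsetI)
      fix a assume a: "a \<in> G k"
      then have "a \<in> {..<n}" using un k by blast
      then show "a \<in> {a. a < n \<and> g a = k}" using g a k dis by (fastforce simp: disjoint_family_on_def)
    next
      fix a assume "a \<in> {a. a < n \<and> g a = k}"
      then show "a \<in> G k" using g by auto
    qed
  qed
qed

definition label_mat :: "nat \<Rightarrow> nat \<Rightarrow> (nat \<Rightarrow> nat) \<Rightarrow> real mat" where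
  "label_mat n K h = mat n K (\<lambda>(i, k). if h i = k then 1 else 0)"

lemma membership_mats_label:
  assumes "A \<in> membership_mats n K"
  obtains h where "\<And>a. a < n \<Longrightarrow> h a < K" "A = label_mat n K h"
    "\<And>k. k < K \<Longrightarrow> derived_partition n A k = {a. a < n \<and> h a = k}"
proof -
  obtain G' where A: "A = mat n K (\<lambda>(i, k). if i \<in> G' k then 1 else 0)" and G': "is_partition n K G'"
    using assms by (auto simp: membership_mats_def)
  obtain h where h: "\<And>a. a < n \<Longrightarrow> h a < K" "\<And>k. k < K \<Longrightarrow> G' k = {a. a < n \<and> h a = k}"
    using partition_labels[OF G'] by blast
  have Ah: "A = label_mat n K h" unfolding A label_mat_def by (rule eq_matI) (auto simp: h)
  show ?thesis by (rule that[OF h(1) Ah]) (auto simp: derived_partition_def Ah label_mat_def split: if_splits)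
qed

lemma label_mat_membership:
  assumes G: "is_partition n K G" and g: "\<And>k. k < K \<Longrightarrow> G k = {a. a < n \<and> g a = k}"
  shows "label_mat n K g \<in> membership_mats n K"
proof -
  have "label_mat n K g = mat n K (\<lambda>(i, k). if i \<in> G k then 1 else 0)"
    unfolding label_mat_def by (rule eq_matI) (auto simp: g)
  then show ?thesis using G by (auto simp: membership_mats_def)
qed

lemma l1_norm_label_mat:
  assumes M: "M \<in> carrier_mat K n" and B: "B \<in> carrier_mat n n" and h: "\<And>a. a < n \<Longrightarrow> h a < K"
  shows "l1_norm (label_mat n K h * M - B) = (\<Sum>a<n. \<Sum>b<n. \<bar>M $$ (h a, b) - B $$ (a, b)\<bar>)"
proof -
  have "(label_mat n K h * M) $$ (a, b) = M $$ (h a, b)" if "a < n" "b < n" for a b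
  proof -
    have "(label_mat n K h * M) $$ (a, b) = (\<Sum>k\<in>{0..<K}. (if h a = k then 1 else 0) * M $$ (k, b))"
      using that M by (auto simp: label_mat_def scalar_prod_def intro!: sum.cong)
    also have "\<dots> = (\<Sum>k\<in>{0..<K}. if k = h a then M $$ (k, b) else 0)" by (rule sum.cong) auto
    also have "\<dots> = M $$ (h a, b)" using h[OF that(1)] by simp
    finally show ?thesis .
  qed
  moreover have "label_mat n K h * M \<in> carrier_mat n n" using M by (auto simp: label_mat_def)
  ultimately show ?thesis unfolding l1_norm_def using B by (auto intro!: sum.cong)
qed

context relaxed
begin

lemma approx_medoids_misclass_error_le:
  assumes Bm: "Bm \<in> carrier_mat n n" "\<And>a b. a < n \<Longrightarrow> b < n \<Longrightarrow> B a b = Bm $$ (a, b)"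
    and G: "is_partition n K G" "\<And>k. k < K \<Longrightarrow> G k = {a. a < n \<and> g a = k}"
    and med: "approx_medoids 7 n K Bm A R"
    and small: "105 * (real n / m) * off \<le> real n * \<epsilon>" "real n * \<epsilon> < m"
  shows "misclass_error n K (derived_partition n A) G \<le> \<epsilon>"
proof -
  have Am: "A \<in> membership_mats n K" and Ms: "R \<in> row_selections n K Bm" using med by (auto simp: approx_medoids_def)
  obtain h where h: "\<And>a. a < n \<Longrightarrow> h a < K" and Ah: "A = label_mat n K h"
    and H: "\<And>k. k < K \<Longrightarrow> derived_partition n A k = {a. a < n \<and> h a = k}"
    using membership_mats_label[OF Am] by blast
  obtain r where r: "\<And>k. k < K \<Longrightarrow> r k < n \<and> g (r k) = k"
    and rl: "(\<Sum>a<n. \<Sum>b<n. \<bar>B (r (g a)) b - B a b\<bar>) \<le> 2 * (\<Sum>a<n. \<Sum>b<n. \<bar>B a b - Bst a b\<bar>)"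
    using group_medoids by blast
  define M0 where "M0 = mat K n (\<lambda>(k, j). Bm $$ (r k, j))"
  have M0: "M0 \<in> row_selections n K Bm"
    unfolding row_selections_def M0_def using r Bm(1) by (auto intro!: exI[of _ "r _"] eq_vecI)
  have cost: "l1_norm (label_mat n K h' * M' - Bm) = (\<Sum>a<n. \<Sum>b<n. \<bar>M' $$ (h' a, b) - B a b\<bar>)"
    if "M' \<in> row_selections n K Bm" "\<And>a. a < n \<Longrightarrow> h' a < K" for M' h'
    using that Bm by (subst l1_norm_label_mat) (auto simp: row_selections_def)
  have "l1_norm (label_mat n K h * R - Bm) \<le> 7 * Min {l1_norm (A * R - Bm) | A R. A \<in> membership_mats n K \<and> R \<in> row_selections n K Bm}"
    using med by (simp add: approx_medoids_def Ah)
  also have "\<dots> \<le> 7 * l1_norm (label_mat n K g * M0 - Bm)"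
    by (intro mult_left_mono Min_le finite_medoid_costs) (use M0 label_mat_membership[OF G] in blast, simp)
  also have "l1_norm (label_mat n K g * M0 - Bm) = (\<Sum>a<n. \<Sum>b<n. \<bar>M0 $$ (g a, b) - B a b\<bar>)" by (rule cost[OF M0 g_less])
  also have "\<dots> = (\<Sum>a<n. \<Sum>b<n. \<bar>B (r (g a)) b - B a b\<bar>)"
    using g_less r Bm(2) by (intro sum.cong refl) (simp add: M0_def)
  finally have "(\<Sum>a<n. \<Sum>b<n. \<bar>R $$ (h a, b) - B a b\<bar>) \<le> 14 * (\<Sum>a<n. \<Sum>b<n. \<bar>B a b - Bst a b\<bar>)"
    using rl by (simp add: cost[OF Ms h])
  note cost' = this
  show ?thesis
    by (rule medoids_misclass_error_le[where \<mu> = "\<lambda>k b. R $$ (k, b)" and h = h and G = G]) (fact h cost' G(2) H small)+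
qed

end

section \<open>Choice of constants and conclusion\<close>

definition final_const :: real where "final_const = 8 * (3 + 4 * op_const\<^sup>2)"

text \<open>A single C serves as threshold for n in the first clause and for s2 in the
  second.\<close>

lemma final_constants_exist:
  "\<exists>C > 0. (\<forall>x. C \<le> x \<longrightarrow> 2 \<le> ln x \<and> ln x ^ 4 \<le> sqrt x \<and> ln x + 6 \<le> x) \<and>
     (\<forall>x. C \<le> x \<longrightarrow> 105 * x * final_const * exp (- (rate / 16 * x)) \<le> exp (- (rate / 32 * x)) \<and> x < exp (rate / 32 * x)) \<and>
     10 ^ 9 \<le> C \<and> 40 * op_const\<^sup>2 \<le> C"
proof -
  have c0: "0 < final_const" unfolding final_const_def by (intro mult_pos_pos add_pos_nonneg) auto
  have r0: "0 < rate" by (simp add: rate_def)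
  have logs: "2 \<le> ln x \<and> ln x ^ 4 \<le> sqrt x \<and> ln x + 6 \<le> x" if x: "exp 256 \<le> x" for x :: real
  proof -
    define y where "y = ln x"
    have x0: "0 < x" using x by (rule order_less_le_trans[OF exp_gt_zero])
    then have y: "256 \<le> y" "exp y = x" using x by (simp_all add: y_def ln_ge_iff)
    have "256 * 256 \<le> y * y" by (rule mult_mono[OF y(1) y(1)]) (use y(1) in auto)
    then have "y + 6 \<le> 1 + y + y\<^sup>2 / 2" by (simp add: power2_eq_square)
    also have "\<dots> \<le> exp y" using y(1) by (intro exp_lower_Taylor_quadratic) simp
    finally have 1: "y + 6 \<le> x" by (simp add: y(2))
    \<comment> \<open>For y \<ge> 256 one has y \<le> (y / 16)^2, so y^8 \<le> (y / 16)^16 \<le> exp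
      y = x and therefore y^4 \<le> sqrt x.\<close>
    have "1 * y \<le> (y / 256) * y" using y(1) by (intro mult_right_mono) auto
    then have "y ^ 8 \<le> ((y / 16)\<^sup>2) ^ 8" using y(1) by (intro power_mono) (auto simp: power2_eq_square)
    also have "\<dots> = (y / 16) ^ 16" by (simp only: power_mult[symmetric]) simp
    also have "\<dots> \<le> exp (y / 16) ^ 16"
    proof (rule power_mono)
      show "y / 16 \<le> exp (y / 16)" using exp_ge_add_one_self[of "y / 16"] by linarith
    qed (use y(1) in simp)
    also have "\<dots> = x" using y(2) by (simp add: exp_of_nat_mult[symmetric])
    finally have "y ^ 4 \<le> sqrt x" by (intro real_le_rsqrt) (simp add: power_mult[symmetric])
    then show ?thesis using 1 y(1) by (simp add: y_def)
  qed
  have exps: "105 * x * final_const * exp (- (rate / 16 * x)) \<le> exp (- (rate / 32 * x)) \<and> x < exp (rate / 32 * x)"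
    if x: "2048 * (105 * final_const + 2) / rate\<^sup>2 \<le> x" for x :: real
  proof -
    have "0 < 2048 * (105 * final_const + 2) / rate\<^sup>2" using c0 r0 by simp
    then have x0: "0 < x" using x by linarith
    have "2048 * (105 * final_const + 2) \<le> x * rate\<^sup>2" using x r0 by (simp add: pos_divide_le_eq)
    then have "2048 * (105 * final_const + 2) * x \<le> x * rate\<^sup>2 * x" using x0 by (intro mult_right_mono) auto
    \<comment> \<open>2048 = 2 * 32^2 lets the quadratic Taylor term of exp (rate / 32 * x) alone
      dominate the linear factor.\<close>
    then have "(105 * final_const + 2) * x \<le> (rate / 32 * x)\<^sup>2 / 2" by (simp add: power2_eq_square algebra_simps)
    moreover have "1 + rate / 32 * x + (rate / 32 * x)\<^sup>2 / 2 \<le> exp (rate / 32 * x)"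
      using r0 x0 by (intro exp_lower_Taylor_quadratic) simp
    moreover have "0 < rate / 32 * x" using r0 x0 by simp
    ultimately have key: "(105 * final_const + 2) * x \<le> exp (rate / 32 * x)" by linarith
    have cx: "0 < final_const * x" using c0 x0 by simp
    have a: "105 * x * final_const \<le> exp (rate / 32 * x)" and b: "x < exp (rate / 32 * x)"
      using key cx x0 by (simp_all add: algebra_simps)
    have "105 * x * final_const * exp (- (rate / 16 * x)) \<le> exp (rate / 32 * x) * exp (- (rate / 16 * x))"
      by (rule mult_right_mono[OF a]) simp
    also have "\<dots> = exp (- (rate / 32 * x))" by (simp add: exp_add[symmetric])
    finally show ?thesis using b by simp
  qed
  show ?thesis
    by (rule exI[of _ "max (max (exp 256) (2048 * (105 * final_const + 2) / rate\<^sup>2)) (max (10 ^ 9) (40 * op_const\<^sup>2))"])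
      (intro conjI allI impI logs exps; simp add: max.coboundedI1 max.coboundedI2 less_max_iff_disj)
qed

context block_graph_separated
begin

definition good :: "(nat \<times> nat) set \<Rightarrow> bool" where
  "good A \<longleftrightarrow> degree_regular A \<and> discrepancy_bounded A \<and> light_bounded A \<and>
     (\<Sum>a<n. lin_excess A a) \<le> D * real n * exp (- (rate / 8 * s2)) \<and>
     real (card {b\<in>{..<n}. bad A b}) \<le> real n * exp (- (rate / 8 * s2))"

lemma PP_not_good: "PP (\<lambda>A. \<not> good A) \<le> 10 / (real n)\<^sup>2"
proof -
  let ?lin = "\<lambda>A. D * real n * exp (- (rate / 8 * s2)) < (\<Sum>a<n. lin_excess A a)"
  let ?bad = "\<lambda>A. real n * exp (- (rate / 8 * s2)) < real (card {b\<in>{..<n}. bad A b})"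
  have "PP (\<lambda>A. \<not> good A) = PP (\<lambda>A. \<not> degree_regular A \<or> \<not> discrepancy_bounded A \<or> \<not> light_bounded A \<or> ?lin A \<or> ?bad A)"
    by (rule arg_cong[where f = PP]) (auto simp: good_def fun_eq_iff not_le)
  also have "\<dots> \<le> PP (\<lambda>A. \<not> degree_regular A) + (PP (\<lambda>A. \<not> discrepancy_bounded A) + (PP (\<lambda>A. \<not> light_bounded A) + (PP ?lin + PP ?bad)))"
    by (intro order_trans[OF PP_or] add_left_mono PP_or order_trans[OF PP_or add_left_mono])
  also have "\<dots> \<le> 1 / (real n)\<^sup>2 + (1 / (real n)\<^sup>2 + (2 / (real n)\<^sup>2 + (1 / (real n)\<^sup>2 + 5 / (real n)\<^sup>2)))"
    by (intro add_mono PP_not_degree_regular PP_not_discrepancy_bounded PP_not_light_bounded PP_lin_excess_large PP_many_bad_rows)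
  also have "\<dots> = 10 / (real n)\<^sup>2" by (simp add: add_divide_distrib[symmetric])
  finally show ?thesis .
qed

text \<open>The factor n / m \<le> s2 and the constants are absorbed in passing from
  \<open>rate\<close> / 16 to \<open>rate\<close> / 32.\<close>

lemma good_misclass_error_le:
  assumes C: "ln (real n) + 6 \<le> real n"
      "105 * s2 * final_const * exp (- (rate / 16 * s2)) \<le> exp (- (rate / 32 * s2))" "s2 < exp (rate / 32 * s2)"
    and big: "40 * op_const\<^sup>2 * (real n / m) \<le> s2" "real n / m \<le> s2" "2 * 10 ^ 8 \<le> s2" "s2 \<le> d"
    and \<alpha>: "1 / m \<le> \<alpha>" "\<alpha> \<le> real K ^ 3 / real n * exp (4 * d)"
    and G: "is_partition n K G" "\<And>k. k < K \<Longrightarrow> G k = {a. a < n \<and> g a = k}"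
    and X: "X \<in> carrier_mat n n" "transpose_mat X = X" "\<And>a. a < n \<Longrightarrow> X $$ (a, a) = 0"
      "\<And>a b. a < n \<Longrightarrow> b < n \<Longrightarrow> X $$ (a, b) \<in> {0, 1}"
    and good: "good (edges n X)"
    and B: "is_arg_max (mat_inner n (X * transpose_mat X)) (\<lambda>B. B \<in> C_set n K \<alpha>) B"
    and med: "approx_medoids 7 n K B A R"
  shows "misclass_error n K (derived_partition n A) G \<le> exp (- (rate / 32 * s2))"
proof -
  have BC: "B \<in> C_set n K \<alpha>" using B by (simp add: is_arg_max_def)
  then have Bc: "B \<in> carrier_mat n n" by (simp add: C_set_def)
  interpret R: relaxed n M L K g p m D "\<lambda>a b. B $$ (a, b)" \<alpha>
  proof
    show "B $$ (a, b) = B $$ (b, a)" if "a < n" "b < n" for a b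
      using psd_on_sym[OF C_set_psd_on[OF BC]] that by simp
  qed (use BC C_set_psd_on[OF BC] C_set_row_sum[OF BC] \<alpha> in \<open>auto simp: C_set_def\<close>)
  let ?g = "\<lambda>a b. \<Sum>c<n. adj (edges n X) a c * adj (edges n X) b c"
  have gram: "mat_inner n (X * transpose_mat X) Y = (\<Sum>a<n. \<Sum>b<n. Y $$ (a, b) * ?g a b)" for Y
    unfolding mat_inner_gram[OF X(1)]
    by (intro sum.cong refl arg_cong2[where f = "(*)"]) (simp_all add: adj_edges[OF X(2) X(1) X(3) X(4)])
  have "mat_inner n (X * transpose_mat X) (mat n n (case_prod R.Bst)) \<le> mat_inner n (X * transpose_mat X) B"
    using B R.Bst_in_C_set by (auto simp: is_arg_max_def not_less)
  then have opt: "(\<Sum>a<n. \<Sum>b<n. (R.Bst a b - B $$ (a, b)) * ?g a b) \<le> 0"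
    unfolding gram by (simp add: left_diff_distrib sum_subtractf)
  have off: "R.off \<le> 8 * (3 + 4 * op_const\<^sup>2) * real n * exp (- (rate / 16 * s2))"
    using good unfolding good_def
    by (intro R.off_bound[of "edges n X"] opt big C \<alpha>) (auto simp: edges_def)
  have s0: "0 < s2" using big(3) by simp
  show ?thesis
  proof (rule R.approx_medoids_misclass_error_le[OF Bc refl G med])
    have "105 * (real n / m) * R.off \<le> (105 * s2) * (8 * (3 + 4 * op_const\<^sup>2) * real n * exp (- (rate / 16 * s2)))"
      by (rule mult_mono[OF mult_left_mono[OF big(2)] off]) (use s0 R.off_nonneg in simp_all)
    also have "\<dots> = real n * (105 * s2 * final_const * exp (- (rate / 16 * s2)))" by (simp add: final_const_def)
    also have "\<dots> \<le> real n * exp (- (rate / 32 * s2))" by (intro mult_left_mono C) simp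
    finally show "105 * (real n / m) * R.off \<le> real n * exp (- (rate / 32 * s2))" .
    have "real n / m < exp (rate / 32 * s2)" using big(2) C(3) by linarith
    then have "real n < exp (rate / 32 * s2) * m" using m_pos by (simp add: pos_divide_less_eq)
    then show "real n * exp (- (rate / 32 * s2)) < m" by (simp add: exp_minus field_simps)
  qed
qed

end

text \<open>For K = 1 the separation is a minimum over the empty set; all labellings are constant,
  and the error vanishes whatever that value is.\<close>

lemma trivial_misclass_error:
  assumes G: "is_partition n 1 G" and A: "A \<in> membership_mats n 1"
  shows "misclass_error n 1 (derived_partition n A) G \<le> 0"
proof -
  obtain g where g: "\<And>a. a < n \<Longrightarrow> g a < 1" "\<And>k. k < 1 \<Longrightarrow> G k = {a. a < n \<and> g a = k}"
    using partition_labels[OF G] by blast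
  obtain h where h: "\<And>a. a < n \<Longrightarrow> h a < 1" "A = label_mat n 1 h" "\<And>k. k < 1 \<Longrightarrow> derived_partition n A k = {a. a < n \<and> h a = k}"
    by (rule membership_mats_label[OF A]) (rule that)
  have U: "(\<Union>k<1. G k) = {..<n}" using G unfolding is_partition_def by (elim conjE)
  have "G 0 \<noteq> {}" using G by (simp add: is_partition_def)
  then have n: "0 < n" using U by (cases "n = 0") auto
  have "misclass_error n 1 (derived_partition n A) G \<le> real (card ({} :: nat set)) / real n"
  proof (rule misclass_error_le[where g = g and h = h])
    show "\<exists>a<n. a \<notin> {} \<and> g a = k" if "k < 1" for k using n g(1)[OF n] that by (intro exI[of _ 0]) simp
    show "g a = g b" if "a < n" "b < n" for a b using g(1)[OF that(1)] g(1)[OF that(2)] by linarith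
  qed (fact n g h | simp)+
  then show ?thesis by simp
qed

lemma min_size_bounds:
  assumes G: "is_partition n K G" and K: "1 \<le> K"
  shows "1 \<le> min_size K G" "k < K \<Longrightarrow> min_size K G \<le> card (G k)"
proof -
  have fin: "finite (G k)" if "k < K" for k
    by (rule finite_subset[of _ "{..<n}"]) (use G that in \<open>auto simp: is_partition_def\<close>)
  have "0 < card (G k)" if "k < K" for k using fin[OF that] G that by (simp add: is_partition_def card_gt_0_iff)
  then show "1 \<le> min_size K G" unfolding min_size_def using K by (subst Min_ge_iff) (auto simp: Suc_le_eq)
  show "k < K \<Longrightarrow> min_size K G \<le> card (G k)" unfolding min_size_def by (rule Min_le) auto
qed

lemma entry_le_max_entry:
  assumes "j < K" "k < K" shows "P $$ (j, k) \<le> max_entry K P"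
  unfolding max_entry_def by (rule Max_ge) (use assms in \<open>auto intro: finite_image_set2\<close>)

lemma min_separation_sq_le:
  assumes "j < K" "k < K" "j \<noteq> k" shows "min_separation_sq K G P \<le> separation_sq K G P j k"
  unfolding min_separation_sq_def
proof (rule Min_le)
  show "finite {separation_sq K G P j k | j k. j < K \<and> k < K \<and> j \<noteq> k}"
    by (rule finite_subset[OF _ finite_image_set2[of "\<lambda>j. j < K" "\<lambda>k. k < K" "separation_sq K G P"]]) auto
qed (use assms in auto)

lemma separation_sq_eq:
  assumes g: "\<And>a. a < n \<Longrightarrow> g a < K" and G: "\<And>k. k < K \<Longrightarrow> G k = {a. a < n \<and> g a = k}"
  shows "separation_sq K G P j k = (\<Sum>b<n. (P $$ (j, g b) - P $$ (k, g b))\<^sup>2)"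
proof -
  have "(\<Sum>b<n. (P $$ (j, g b) - P $$ (k, g b))\<^sup>2) = (\<Sum>l<K. \<Sum>b\<in>{b\<in>{..<n}. g b = l}. (P $$ (j, g b) - P $$ (k, g b))\<^sup>2)"
    by (rule sum.group[symmetric]) (use g in auto)
  also have "\<dots> = (\<Sum>l<K. \<Sum>b\<in>G l. (P $$ (k, l) - P $$ (j, l))\<^sup>2)"
    by (intro sum.cong refl) (auto simp: G power2_commute)
  finally show ?thesis by (simp add: separation_sq_def)
qed

theorem theorem2:
  shows "\<exists>c c' c'' :: real. c > 0 \<and> c' > 0 \<and> c'' > 0 \<and>
    (\<forall>(n::nat) (K::nat) (G::nat \<Rightarrow> nat set) (P::real mat) (Q::real mat pmf) (L::real) (\<alpha>::real).
      let m = real (min_size K G);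
          s2 = min_separation_sq K G P / L
      in
        stochastic_block_model n K G P Q \<longrightarrow>
        max_entry K P \<le> L \<longrightarrow>
        1 / m \<le> L \<longrightarrow> L \<le> 1 / ln (real n) \<longrightarrow>
        real K / real n \<le> \<alpha> \<longrightarrow> \<alpha> \<le> 1 \<longrightarrow>
        1 / m \<le> \<alpha> \<longrightarrow> \<alpha> \<le> real K ^ 3 / real n * exp (4 * real n * L) \<longrightarrow>
        s2 \<ge> c'' * real n / m \<longrightarrow>
        measure_pmf.prob Q
          {X. \<forall>B A M.
             is_arg_max (mat_inner n (X * transpose_mat X)) (\<lambda>B. B \<in> C_set n K \<alpha>) B \<longrightarrow>
             approx_medoids 7 n K B A M \<longrightarrow>
             misclass_error n K (derived_partition n A) G \<le> exp (- c' * s2)}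
        \<ge> 1 - c / (real n)\<^sup>2)"
proof -
  obtain C where C0: "0 < C"
    and C1: "\<And>x. C \<le> x \<Longrightarrow> 2 \<le> ln x \<and> ln x ^ 4 \<le> sqrt x \<and> ln x + 6 \<le> x"
    and C2: "\<And>x. C \<le> x \<Longrightarrow> 105 * x * final_const * exp (- (rate / 16 * x)) \<le> exp (- (rate / 32 * x)) \<and> x < exp (rate / 32 * x)"
    and C3: "10 ^ 9 \<le> C" "40 * op_const\<^sup>2 \<le> C"
    using final_constants_exist by blast
  have main: "1 - 10 / (real n)\<^sup>2 \<le> measure_pmf.prob Q
          {X. \<forall>B A M.
             is_arg_max (mat_inner n (X * transpose_mat X)) (\<lambda>B. B \<in> C_set n K \<alpha>) B \<longrightarrow>
             approx_medoids 7 n K B A M \<longrightarrow>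
             misclass_error n K (derived_partition n A) G \<le> exp (- (rate / 32) * (min_separation_sq K G P / L))}"
    (is "_ \<le> measure_pmf.prob Q {X. ?\<Phi> X}")
    if sbm: "stochastic_block_model n K G P Q" and maxP: "max_entry K P \<le> L"
      and mL: "1 / real (min_size K G) \<le> L" and Ln: "L \<le> 1 / ln (real n)"
      and \<alpha>: "1 / real (min_size K G) \<le> \<alpha>" "\<alpha> \<le> real K ^ 3 / real n * exp (4 * real n * L)"
      and s2: "2 * C * real n / real (min_size K G) \<le> min_separation_sq K G P / L"
    for n K :: nat and G :: "nat \<Rightarrow> nat set" and P :: "real mat" and Q :: "real mat pmf" and L \<alpha> :: real
  proof (cases "K = 1")
    case True
    have G: "is_partition n 1 G" using sbm True by (simp add: stochastic_block_model_def)
    have "?\<Phi> X" for X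
    proof (intro allI impI)
      fix B A M assume "approx_medoids 7 n K B A M"
      then have "A \<in> membership_mats n 1" using True by (simp add: approx_medoids_def)
      from trivial_misclass_error[OF G this]
      show "misclass_error n K (derived_partition n A) G \<le> exp (- (rate / 32) * (min_separation_sq K G P / L))"
        unfolding True by (rule order_trans) simp
    qed
    then have "{X. ?\<Phi> X} = UNIV" by simp
    then show ?thesis by (simp only: measure_pmf.prob_space[simplified]) simp
  next
    case False
    define m where "m = real (min_size K G)"
    define D where "D = min_separation_sq K G P"
    have K: "2 \<le> K" and G: "is_partition n K G" and P: "P \<in> carrier_mat K K" "transpose_mat P = P"
      and P01: "\<And>j k. j < K \<Longrightarrow> k < K \<Longrightarrow> 0 \<le> P $$ (j, k) \<and> P $$ (j, k) \<le> 1"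
      and X: "\<And>X. X \<in> set_pmf Q \<Longrightarrow> X \<in> carrier_mat n n \<and> transpose_mat X = X \<and>
        (\<forall>a<n. X $$ (a, a) = 0) \<and> (\<forall>a<n. \<forall>b<n. X $$ (a, b) \<in> {0, 1})"
      and ind: "prob_space.indep_vars (measure_pmf Q) (\<lambda>_. borel) (\<lambda>(a, b) X. X $$ (a, b)) {(a, b). b < a \<and> a < n}"
      and mean: "\<And>j k a b. j < K \<Longrightarrow> k < K \<Longrightarrow> a \<in> G k \<Longrightarrow> b \<in> G j \<Longrightarrow> a \<noteq> b \<Longrightarrow>
        measure_pmf.expectation Q (\<lambda>X. X $$ (a, b)) = P $$ (j, k)"
      using sbm False unfolding stochastic_block_model_def by auto
    obtain g where g: "\<And>a. a < n \<Longrightarrow> g a < K" and Gg: "\<And>k. k < K \<Longrightarrow> G k = {a. a < n \<and> g a = k}"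
      using partition_labels[OF G] by blast
    have m1: "1 \<le> m" and m_le: "\<And>k. k < K \<Longrightarrow> m \<le> real (card (G k))"
      using min_size_bounds[OF G] K by (simp_all add: m_def)
    have L0: "0 < L" using mL m1 by (elim order_less_le_trans[rotated]) (simp add: m_def)
    have mn: "m \<le> real n"
    proof -
      have "card (G 0) \<le> card {..<n}" using K by (intro card_mono) (auto simp: Gg)
      then show ?thesis using m_le[of 0] K by simp
    qed
    have n2: "2 \<le> n"
    proof (rule ccontr)
      assume "\<not> 2 \<le> n"
      \<comment> \<open>Then ln n = 0 and 1 / 0 = 0, so the upper bound on L contradicts L >
        0.\<close>
      then have "n = 1" using mn m1 by linarith
      then show False using Ln L0 by simp
    qed
    have nm: "1 \<le> real n / m" using mn m1 by simp
    have P_sym: "P $$ (j, k) = P $$ (k, j)" if "j < K" "k < K" for j k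
    proof -
      have "transpose_mat P $$ (j, k) = P $$ (k, j)" using that P by (intro index_transpose_mat(1)) auto
      then show ?thesis by (simp only: P)
    qed
    have P_L: "P $$ (j, k) \<le> L" if "j < K" "k < K" for j k using entry_le_max_entry[OF that] maxP by (rule order_trans)
    have D_le: "D \<le> (\<Sum>b<n. (P $$ (j, g b) - P $$ (k, g b))\<^sup>2)" if "j < K" "k < K" "j \<noteq> k" for j k
      using min_separation_sq_le[OF that, of G P] separation_sq_eq[of n g K G P j k] g Gg by (simp add: D_def)
    \<comment> \<open>This is s2 \<le> d: two entries of P in [0, L] differ by at most L.\<close>
    have DL: "D / L \<le> real n * L"
    proof -
      have "D \<le> (\<Sum>b<n. (P $$ (0, g b) - P $$ (1, g b))\<^sup>2)" using K by (intro D_le) auto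
      also have "\<dots> \<le> (\<Sum>b<n. L\<^sup>2)"
      proof (rule sum_mono)
        fix b assume "b \<in> {..<n}"
        then have "\<bar>P $$ (0, g b) - P $$ (1, g b)\<bar> \<le> L"
          using P01[of 0 "g b"] P01[of 1 "g b"] P_L[of 0 "g b"] P_L[of 1 "g b"] g[of b] K by (simp add: abs_le_iff)
        then show "(P $$ (0, g b) - P $$ (1, g b))\<^sup>2 \<le> L\<^sup>2" by (rule abs_le_square_iff[THEN iffD1, OF order_trans]) simp
      qed
      finally show ?thesis using L0 by (simp add: pos_divide_le_eq power2_eq_square)
    qed
    have s2C: "2 * C * (real n / m) \<le> D / L" using s2 by (simp add: m_def D_def)
    have CD: "2 * C \<le> D / L" using s2C mult_left_mono[OF nm, of "2 * C"] C0 by simp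
    \<comment> \<open>As n \<ge> 2 gives L \<le> 2, the chain 2 C \<le> s2 \<le> n L \<le> 2 n
      bounds n from below: the assumed separation is impossible in a small graph.\<close>
    have nC: "C \<le> real n"
    proof -
      have "exp (1 / 2) \<le> real n" using exp_half_le2 n2 by linarith
      then have "1 / 2 \<le> ln (real n)" using n2 by (subst ln_ge_iff) auto
      then have "1 / ln (real n) \<le> 1 / (1 / 2)" by (intro divide_left_mono) auto
      then have "L \<le> 2" using Ln by simp
      then have "real n * L \<le> real n * 2" by (intro mult_left_mono) auto
      then show ?thesis using CD DL by linarith
    qed
    have const_nm: "c * (real n / m) \<le> D / L" if "c \<le> C" for c
      using mult_right_mono[OF that, of "real n / m"] s2C mult_nonneg_nonneg[of C "real n / m"] C0 nm by linarith
    interpret S0: block_graph n "\<lambda>a b. P $$ (g a, g b)" L K g "\<lambda>j k. P $$ (j, k)" m D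
    proof
      show "m \<le> real (card {a. a < n \<and> g a = k})" if "k < K" for k using m_le[OF that] by (simp add: Gg[OF that])
      show "1 \<le> m * L" using mL m1 by (simp add: m_def divide_le_eq mult.commute)
    qed (use n2 P01 P_L P_sym g L0 m1 D_le in auto)
    interpret S: block_graph_separated n "\<lambda>a b. P $$ (g a, g b)" L K g "\<lambda>j k. P $$ (j, k)" m D
    proof
      show "10 ^ 7 * (real n / m) \<le> S0.s2" unfolding S0.s2_def by (rule const_nm) (use C3 in simp)
    qed (use Ln C1[OF nC] in auto)
    have s2_eq: "S0.s2 = min_separation_sq K G P / L" unfolding S0.s2_def by (simp only: D_def)
    have s2_C: "C \<le> S0.s2" using CD C0 unfolding S0.s2_def by linarith
    have "1 - 10 / (real n)\<^sup>2 \<le> 1 - S0.PP (\<lambda>A. \<not> S.good A)" using S.PP_not_good by simp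
    also have "\<dots> \<le> measure_pmf.prob Q {X. ?\<Phi> X}"
    proof (rule prob_ge_bprob[OF ind])
      show "X $$ (a, b) \<in> {0, 1}" if "X \<in> set_pmf Q" "a < n" "b < n" for X a b using X[OF that(1)] that by blast
      show "measure_pmf.expectation Q (\<lambda>X. X $$ (a, b)) = P $$ (g a, g b)" if "(a, b) \<in> pairs n" for a b
      proof -
        have ab: "a < n" "b < n" "a \<noteq> b" using that by (auto simp: pairs_def)
        have "measure_pmf.expectation Q (\<lambda>X. X $$ (a, b)) = P $$ (g b, g a)"
          using ab by (intro mean g) (auto simp: Gg g)
        then show ?thesis using P_sym[of "g b" "g a"] g ab by simp
      qed
      fix Y assume Y: "Y \<in> set_pmf Q" and "\<not> \<not> S.good (edges n Y)"
      then have good: "S.good (edges n Y)" by simp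
      show "?\<Phi> Y"
      proof (intro allI impI)
        fix B A M
        assume B: "is_arg_max (mat_inner n (Y * transpose_mat Y)) (\<lambda>B. B \<in> C_set n K \<alpha>) B"
          and med: "approx_medoids 7 n K B A M"
        have "misclass_error n K (derived_partition n A) G \<le> exp (- (rate / 32 * S0.s2))"
        proof (rule S.good_misclass_error_le[OF _ _ _ _ _ _ _ _ _ G Gg _ _ _ _ good B med])
          show "40 * op_const\<^sup>2 * (real n / m) \<le> S0.s2" unfolding S0.s2_def by (rule const_nm) (rule C3)
          show "real n / m \<le> S0.s2" unfolding S0.s2_def using const_nm[of 1] C3 by simp
          show "S0.s2 \<le> S0.d" unfolding S0.s2_def S0.d_def by (rule DL)
          show "\<alpha> \<le> real K ^ 3 / real n * exp (4 * S0.d)" using \<alpha>(2) by (simp add: S0.d_def mult.assoc)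
        qed (use C1[OF nC] C2[OF s2_C] C3 s2_C \<alpha>(1) X[OF Y] in \<open>auto simp: m_def\<close>)
        then show "misclass_error n K (derived_partition n A) G \<le> exp (- (rate / 32) * (min_separation_sq K G P / L))"
          by (simp only: s2_eq mult_minus_left)
      qed
    qed
    finally show ?thesis .
  qed
  show ?thesis
    by (rule exI[of _ 10], rule exI[of _ "rate / 32"], rule exI[of _ "2 * C"], unfold Let_def, intro conjI allI impI main)
      (assumption | simp add: C0 rate_def)+
qed

end
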